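(* Assume that the $\mathcal{P}$-BDH$_1$ and DDH$_2$ assumptions hold in the bilinear groups $(\mathbb{G},\hat{\mathbb{G}},\mathbb{G}_T)$ of prime order $p$. Let $n>\log_2 p$ and $\omega=n-\log_2 p$. Let $\mathsf{HF}$ be the HIB-TDF described in the context with parameters $n,d$, $\mu=2$, $\Sigma_{\mathsf{ID}}=\{(1,x):x\in\mathbb{Z}_p^*\}$ and $\mathsf{IdSp}=\Sigma_{\mathsf{ID}}^{(\le d)}$, and let $\mathsf{LHF}$ be the sibling described in the context. Then $\mathsf{HF}$ is $(\omega,1)$-partially lossy against selective-id adversaries (with this sibling and the trivial pre-output stage $\mathcal{P}$ that always outputs $d_2=1$). Specifically, regarding condition (i) of partial lossiness, for any selective-id adversary $\mathcal{A}$ there exist algorithms $\mathcal{B}_1$ and $\mathcal{B}_2$ such that $$\mathbf{Adv}^{\mathrm{lossy}}_{\mathsf{HF},\mathsf{LHF},\omega}(\mathcal{A})\le n\cdot\Big((2d+1)\cdot\mathbf{Adv}^{\mathcal{P}\text{-}\mathrm{BDH}_1}(\mathcal{B}_1)+q\cdot\mathbf{Adv}^{\mathrm{DDH}_2}(\mathcal{B}_2)\Big),$$ where $q$ is the number of Reveal-key queries of $\mathcal{A}$ and the running times of $\mathcal{B}_1$ and $\mathcal{B}_2$ are comparable to the running time of $\mathcal{A}$.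
   Context: **Groups and assumptions.** $\mathbb{G},\hat{\mathbb{G}},\mathbb{G}_T$ are cyclic of prime order $p>2^\varrho$ ($\varrho$ the security parameter), $e:\mathbb{G}\times\hat{\mathbb{G}}\to\mathbb{G}_T$ is an efficient non-degenerate bilinear map, $g,\hat g$ generators. $\mathcal{P}$-BDH$_1$: $(g,g^b,g^{ab},g^c,\hat g,\hat g^a,\hat g^b,g^{abc})$ and $(g,g^b,g^{ab},g^c,\hat g,\hat g^a,\hat g^b,g^{z})$ are computationally indistinguishable. DDH$_2$: $(g,\hat g,\hat g^a,\hat g^b,\hat g^{ab})$ and $(g,\hat g,\hat g^a,\hat g^b,\hat g^{z})$ are computationally indistinguishable ($a,b,c,z$ uniform in $\mathbb{Z}_p$). $\mathbf{Adv}(\mathcal{B})$ denotes the distinguishing advantage of $\mathcal{B}$ for the respective pair. **HIB-TDFs, siblings.** A HIB-TDF is a tuple $(\mathsf{HF.Setup},\mathsf{HF.MKg},\mathsf{HF.Kg},\mathsf{HF.Del},\mathsf{HF.Eval},\mathsf{HF.Inv})$: setup (outputs $\mathsf{pms}$), master key generation, key generation for hierarchical identities, delegation to one more level, evaluation and inversion. A sibling $\mathsf{LHF}$ shares setup, delegation, evaluation and inversion with $\mathsf{HF}$ but has its own master key generation $\mathsf{LHF.MKg}(\mathsf{pms},aux)$ and key generation $\mathsf{LHF.Kg}$. $\lambda(f)=\log_2(|\mathrm{Dom}(f)|/|\mathrm{Im}(f)|)$. **Experiments** $\mathsf{REAL}$ ($\beta=0$), $\mathsf{LOSSY}$ ($\beta=1$),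 for selective $\mathcal{A}$. 0. Challenger runs $\mathsf{HF.Setup}$, gives $\mathsf{pms}$ to $\mathcal{A}$, who replies with a hierarchical identity $\mathsf{id}^\dagger\in\mathsf{IdSp}$. 1. Challenger runs (in both experiments) $(\mathsf{mpk}_0,\mathsf{msk}_0)\leftarrow\mathsf{HF.MKg}(\mathsf{pms})$ and $(\mathsf{mpk}_1,\mathsf{msk}_1)\leftarrow\mathsf{LHF.MKg}(\mathsf{pms},\mathsf{id}^\dagger)$, gives $\mathsf{mpk}_\beta$ to $\mathcal{A}$; $IS=QS=\emptyset$. 2. Adaptive queries: *Create-key*($\mathsf{id}$) creates $SK_{\mathsf{id}}$ with $\mathsf{HF.Kg}$ and $\mathsf{msk}_0$ if $\beta=0$, with $\mathsf{LHF.Kg}$ and $\mathsf{msk}_1$ if $\beta=1$, and adds $\mathsf{id}$ to $QS$; *Create-delegated-key*($\mathsf{id},\mathsf{id}_{\ell+1}$), $\mathsf{id}\in QS$, creates a key for $(\mathsf{id},\mathsf{id}_{\ell+1})$ with $\mathsf{HF.Del}$ and adds it to $QS$; *Reveal-key*($\mathsf{id}$), allowed only if $\mathsf{id}$ is not a prefix of $\mathsf{id}^\dagger$, returns $\perp$ if $\mathsf{id}\notin QS$, else returns $SK_{\mathsf{id}}$ and adds $\mathsf{id}$ to $IS$. 3. $\mathcal{A}$ outputs $\mathsf{id}^\star=\mathsf{id}^\dagger$ and a bit $d_{\mathcal{A}}$. Set $d_1=1$ iff $\lambda(\mathsf{HF.Eval}(\mathsf{pms},\mathsf{mpk}_1,\mathsf{id},\cdot))=0$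 for all $\mathsf{id}\in IS$ and $\lambda(\mathsf{HF.Eval}(\mathsf{pms},\mathsf{mpk}_1,\mathsf{id}^\star,\cdot))\ge\omega$. 4. $d_2$ is the output of the pre-output stage $\mathcal{P}$ (here always $1$). 5. $d^{\mathcal{A}}_{\neg abort}=d_1\wedge d_2$, $d^{\mathcal{A}}_{exp}=d_{\mathcal{A}}\wedge d^{\mathcal{A}}_{\neg abort}$. **Partial lossiness.** $\mathsf{HF}$ is $(\omega,\delta)$-partially lossy if it admits a sibling and an efficient pre-output stage $\mathcal{P}$ such that for all PPT $\mathcal{A}$ and all non-negligible $\zeta$ there are non-negligible $\epsilon_1,\epsilon_2$ with $\delta=\epsilon_1\epsilon_2$ and: (i) $\mathbf{Adv}^{\mathrm{lossy}}(\mathcal{A})=|\Pr[d^{\mathcal{A}}_{exp}=1\mid\mathsf{REAL}]-\Pr[d^{\mathcal{A}}_{exp}=1\mid\mathsf{LOSSY}]|$ is negligible; (ii) $\Pr[d^{\mathcal{A}}_{\neg abort}=1\mid\mathsf{REAL}]\ge\epsilon_1$; (iii) if $\Pr[d_{\mathcal{A}}=1\mid\mathsf{REAL}]-\frac12>\zeta$ then $\Pr[d_{\mathcal{A}}=1\mid\mathsf{REAL}\wedge d^{\mathcal{A}}_{\neg abort}=1]-\frac12>\epsilon_2\zeta$. (With the trivial $\mathcal{P}$ the experiments do not depend on $\zeta$, which is dropped from the notation.) **The construction $\mathsf{HF}$.** $d$ is a constant, $\mu,n\in\mathsf{poly}(\varrho)$; $\Delta(\cdot,\cdot)$ is the Kronecker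 delta; $\mathsf{InpSp}=\{0,1\}^n$; $\mathsf{IdSp}=\Sigma_{\mathsf{ID}}^{(\le d)}$ is the set of tuples of length between $1$ and $d$; $\mathsf{AuxSp}=\mathbb{Z}_p^{d\mu}$. Identities are $\mathsf{id}=(\mathsf{id}_1,\dots,\mathsf{id}_\ell)$, $\mathsf{id}_{i_1}=(\mathsf{id}_{i_1}[1],\dots,\mathsf{id}_{i_1}[\mu])\in\Sigma_{\mathsf{ID}}$. Indices: $1\le i_1\le d$, $1\le l_1,l_2\le n$. - $\mathsf{HF.MKg}(\mathsf{pms},\mathbf{y})$, $\mathbf{y}=[\mathbf{y}_1|\dots|\mathbf{y}_d]$, $\mathbf{y}_{i_1}\in\mathbb{Z}_p^\mu$: choose random nonzero exponents $\alpha_v$, $\boldsymbol\alpha_w\in(\mathbb{Z}_p^* )^n$, $\boldsymbol\alpha_h\in(\mathbb{Z}_p^* )^{d\times(\mu+1)\times n}$; $v=g^{\alpha_v}$, $\hat v=\hat g^{\alpha_v}$, and componentwise $\mathbf{w}=g^{\boldsymbol\alpha_w}$, $\hat{\mathbf{w}}=\hat g^{\boldsymbol\alpha_w}$, $\mathbf{h}=g^{\boldsymbol\alpha_h}$, $\hat{\mathbf{h}}=\hat g^{\boldsymbol\alpha_h}$ (entries $\mathbf{h}[i_1,i_2,l_1]$, $0\le i_2\le\mu$). Choose random $\mathbf{s}[l_2]\in\mathbb{Z}_p^*$ and set $\mathbf{J}[l_2]=v^{\mathbf{s}[l_2]}$, $\mathbf{C}_w[l_2,l_1]=\mathbf{w}[l_1]^{\mathbf{s}[l_2]}$,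 $\mathbf{C}[i_1,i_2,l_2,l_1]=\big(\mathbf{h}[i_1,0,l_1]^{\mathbf{y}_{i_1}[i_2]\Delta(l_2,l_1)}\mathbf{h}[i_1,i_2,l_1]\big)^{\mathbf{s}[l_2]}$ for $1\le i_2\le\mu$. $\mathsf{mpk}$ consists of $v,\mathbf{w},\mathbf{h},\mathbf{J},\mathbf{C}_w,\mathbf{C}$; $\mathsf{msk}=(\hat v,\hat{\mathbf{w}},\hat{\mathbf{h}})$. In injective (standard) mode $\mathbf{y}=\mathbf{y}^{(0)}=[(1,0,\dots,0)|\dots|(1,0,\dots,0)]$. - $\mathsf{HF.Kg}(\mathsf{pms},\mathsf{msk},(\mathsf{id}_1,\dots,\mathsf{id}_\ell))$: with random $\mathbf{r}_w,\mathbf{r}_{i_1}\in(\mathbb{Z}_p^* )^n$, for each $l_1$: $\mathbf{D}[l_1]=\prod_{i_1=1}^\ell\big(\prod_{i_2=1}^\mu\hat{\mathbf{h}}[i_1,i_2,l_1]^{\mathsf{id}_{i_1}[i_2]}\big)^{\mathbf{r}_{i_1}[l_1]}\hat{\mathbf{w}}[l_1]^{\mathbf{r}_w[l_1]}$, $\mathbf{D}_w[l_1]=\hat v^{\mathbf{r}_w[l_1]}$, $\mathbf{D}_{i_1}[l_1]=\hat v^{\mathbf{r}_{i_1}[l_1]}$; and, for $\ell<j\le d$, $1\le k\le\mu$, $1\le i_1\le\ell$, with fresh random exponents $\mathbf{s}[j,k,i_1,l_1],\mathbf{s}'[j,l_1],\mathbf{s}_w[j,k,l_1]$: $\mathbf{K}[j,k,l_1]=\prod_{i_1=1}^\ell\big(\prod_{i_2}\hat{\mathbf{h}}[i_1,i_2,l_1]^{\mathsf{id}_{i_1}[i_2]}\big)^{\mathbf{s}[j,k,i_1,l_1]}\hat{\mathbf{h}}[j,k,l_1]^{\mathbf{s}'[j,l_1]}\hat{\mathbf{w}}[l_1]^{\mathbf{s}_w[j,k,l_1]}$,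 $\mathbf{L}[j,l_1]=\hat v^{\mathbf{s}'[j,l_1]}$, $\mathbf{L}[j,k,i_1,l_1]=\hat v^{\mathbf{s}[j,k,i_1,l_1]}$, $\mathbf{L}_w[j,k,l_1]=\hat v^{\mathbf{s}_w[j,k,l_1]}$. - $\mathsf{HF.Del}$ to $\mathsf{id}_{\ell+1}=(x_1,\dots,x_\mu)$, separately for each $l_1$ (index suppressed): (1) raise all delegation elements $\mathbf K,\mathbf L,\mathbf L_w$ to one random power $z\in\mathbb{Z}_p^*$, writing hats. (2) $K_{\ell+1}=\prod_k\widehat K[\ell+1,k]^{x_k}$, $L_{\ell+1,\ell+1}=\widehat L[\ell+1]$, $L_{\ell+1,i_1}=\prod_k\widehat L[\ell+1,k,i_1]^{x_k}$ ($i_1\le\ell$), $L_{w,\ell+1}=\prod_k\widehat L_w[\ell+1,k]^{x_k}$. (3) New decryption part: $D'=D\,K_{\ell+1}$, $D_w'=D_wL_{w,\ell+1}$, $D_{i_1}'=D_{i_1}L_{\ell+1,i_1}$ ($i_1\le\ell$), $D_{\ell+1}'=L_{\ell+1,\ell+1}$. (4) New delegation part, for $j\ge\ell+2$ and each $k$, with random $\tau_{j,k}\in\mathbb{Z}_p^*$: $L'[j]=\widehat L[j]$, $K'[j,k]=\widehat K[j,k]K_{\ell+1}^{\tau_{j,k}}$, $L_w'[j,k]=\widehat L_w[j,k]L_{w,\ell+1}^{\tau_{j,k}}$, $L'[j,k,i_1]=\widehat L[j,k,i_1]L_{\ell+1,i_1}^{\tau_{j,k}}$ ($1\le i_1\le\ell+1$,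 with $\widehat L[j,k,\ell+1]=1$). - $\mathsf{HF.Eval}(\mathsf{pms},\mathsf{mpk},(\mathsf{id}_1,\dots,\mathsf{id}_\ell),X)$, $X=x_1\dots x_n\in\{0,1\}^n$: let $\mathbf{C}_{\mathsf{id}}[i_1,l_2,l_1]=\prod_{i_2=1}^\mu\mathbf{C}[i_1,i_2,l_2,l_1]^{\mathsf{id}_{i_1}[i_2]}$; output $C_{\mathsf{id},v}=\prod_{l_2}\mathbf{J}[l_2]^{x_{l_2}}$, $\mathbf{CT}_{\mathsf{id},w}[l_1]=\prod_{l_2}\mathbf{C}_w[l_2,l_1]^{x_{l_2}}$, $\mathbf{CT}_{\mathsf{id}}[i_1,l_1]=\prod_{l_2}\mathbf{C}_{\mathsf{id}}[i_1,l_2,l_1]^{x_{l_2}}$ for $1\le i_1\le\ell$, $1\le l_1\le n$. - $\mathsf{HF.Inv}$: for each $l_1$ set $x_{l_1}=0$ if $e(C_{\mathsf{id},v},\mathbf{D}[l_1])\,e(\mathbf{CT}_{\mathsf{id},w}[l_1],\mathbf{D}_w[l_1])^{-1}\prod_{i_1=1}^\ell e(\mathbf{CT}_{\mathsf{id}}[i_1,l_1],\mathbf{D}_{i_1}[l_1])^{-1}=1_{\mathbb{G}_T}$, and $x_{l_1}=1$ otherwise. **The sibling $\mathsf{LHF}$** (here $\mu=2$). Same algorithms, but on $aux=\mathsf{id}^\dagger=\mathsf{id}^\star=(\mathsf{id}_1^\star,\dots,\mathsf{id}_{\ell^\star}^\star)$ with $\mathsf{id}^\star_{i_1}=(1,x^\star_{i_1})$,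 master key generation runs $\mathsf{HF.MKg}$ with auxiliary input $\mathbf{y}^{(1)}=[\mathbf{y}^{(1)}_1|\dots|\mathbf{y}^{(1)}_d]\in\mathbb{Z}_p^{2d}$, where $\mathbf{y}^{(1)}_{i_1}=(-x^\star_{i_1},1)$ for $i_1\le\ell^\star$ and $\mathbf{y}^{(1)}_{i_1}=(1,0)$ for $\ell^\star<i_1\le d$. *)

theory Defs
  imports
    "HOL-Probability.Probability"
    "HOL-Algebra.Elementary_Groups"
    "HOL-Algebra.FiniteProduct"
    "HOL-Library.Sublist"
begin

section \<open>Asymptotics in the security parameter\<close>

definition negligible :: "(nat \<Rightarrow> real) \<Rightarrow> bool" where
  "negligible f \<longleftrightarrow> (\<forall>c::nat. \<forall>\<^sub>F k in sequentially. \<bar>f k\<bar> < 1 / real k ^ c)"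

definition nonnegligible :: "(nat \<Rightarrow> real) \<Rightarrow> bool" where
  "nonnegligible f \<longleftrightarrow> (\<forall>k. 0 \<le> f k) \<and> \<not> negligible f"

definition poly_bounded :: "(nat \<Rightarrow> nat) \<Rightarrow> bool" where
  "poly_bounded f \<longleftrightarrow> (\<exists>c. \<forall>k. f k \<le> k ^ c + c)"


section \<open>Bilinear groups\<close>

text \<open>
  Elements of the three groups are identified with their representations, which are machine words,
  i.e. natural numbers below \<open>2 ^ bg_w\<close>. The word length is such that products of two residues
  modulo the group order do not overflow.
\<close>

record bgroup =
  bg_p :: nat
  bg_G :: "nat monoid"
  bg_H :: "nat monoid"
  bg_T :: "nat monoid"
  bg_e :: "nat \<Rightarrow> nat \<Rightarrow> nat"
  bg_g :: nat
  bg_h :: nat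
  bg_w :: nat

definition word_group :: "nat \<Rightarrow> nat \<Rightarrow> nat monoid \<Rightarrow> bool" where
  "word_group w p G \<longleftrightarrow> group G \<and> cyclic_group G \<and> order G = p \<and> carrier G \<subseteq> {..<2 ^ w}"

definition bilinear_group :: "bgroup \<Rightarrow> bool" where
  "bilinear_group b \<longleftrightarrow>
     prime (bg_p b) \<and> bg_p b ^ 2 \<le> 2 ^ bg_w b \<and>
     word_group (bg_w b) (bg_p b) (bg_G b) \<and>
     word_group (bg_w b) (bg_p b) (bg_H b) \<and>
     word_group (bg_w b) (bg_p b) (bg_T b) \<and>
     bg_g b \<in> carrier (bg_G b) \<and> subgroup_generated (bg_G b) {bg_g b} = bg_G b \<and>
     bg_h b \<in> carrier (bg_H b) \<and> subgroup_generated (bg_H b) {bg_h b} = bg_H b \<and>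
     (\<forall>y \<in> carrier (bg_H b). (\<lambda>x. bg_e b x y) \<in> hom (bg_G b) (bg_T b)) \<and>
     (\<forall>x \<in> carrier (bg_G b). bg_e b x \<in> hom (bg_H b) (bg_T b)) \<and>
     bg_e b (bg_g b) (bg_h b) \<noteq> \<one>\<^bsub>bg_T b\<^esub>"

definition bilinear_family :: "(nat \<Rightarrow> bgroup) \<Rightarrow> bool" where
  "bilinear_family bg \<longleftrightarrow>
     (\<forall>k. bilinear_group (bg k) \<and> 2 ^ k < bg_p (bg k)) \<and> poly_bounded (\<lambda>k. bg_w (bg k))"

text \<open>Residues modulo \<open>p\<close> are represented by the natural numbers below \<open>p\<close>.\<close>

definition unif :: "nat \<Rightarrow> nat pmf" where
  "unif p = pmf_of_set {0..<p}"

definition unif_nz :: "nat \<Rightarrow> nat pmf" where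
  "unif_nz p = pmf_of_set {1..<p}"


section \<open>Algorithms and running time\<close>

text \<open>
  Algorithms are probabilistic programs over registers holding words, with unit-cost word
  arithmetic, uniform sampling and group operations; since group elements are words, their
  representations can be manipulated freely. Programs are loop-free and their running time is their
  size (all branches counted), so that a family of programs of polynomial running time is the same
  as a non-uniform probabilistic polynomial-time algorithm. Counting only the instructions on one
  execution path would be wrong: it would make decision trees of exponential size cheap.
  Program constants, registers and branching may depend on the security parameter arbitrarily.
\<close>

type_synonym reg = nat
type_synonym mem = "reg \<Rightarrow> nat"

datatype aop = Plus | Minus | Times | Divide | Modulo

datatype grp = GrpG | GrpH | GrpT

datatype instr =
    Const reg nat
  | Arith aop reg reg reg
  | Sample reg reg
  | GMul grp reg reg reg
  | GExp grp reg reg reg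
  | Pairing reg reg reg

text \<open>\<open>Ask q\<close> is an interaction with the environment; \<open>'q\<close> is the type of queries.\<close>

datatype 'q com =
    Skip
  | Instr instr
  | Seq "'q com" "'q com"
  | IfZero reg "'q com" "'q com"
  | Ask 'q

fun aop_val :: "aop \<Rightarrow> nat \<Rightarrow> nat \<Rightarrow> nat" where
  "aop_val Plus x y = x + y"
| "aop_val Minus x y = x - y"
| "aop_val Times x y = x * y"
| "aop_val Divide x y = x div y"
| "aop_val Modulo x y = x mod y"

fun the_grp :: "bgroup \<Rightarrow> grp \<Rightarrow> nat monoid" where
  "the_grp b GrpG = bg_G b"
| "the_grp b GrpH = bg_H b"
| "the_grp b GrpT = bg_T b"

text \<open>Group operations on words that do not represent group elements yield 0.\<close>

fun step :: "bgroup \<Rightarrow> instr \<Rightarrow> mem \<Rightarrow> mem pmf" where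
  "step b (Const r c) M = return_pmf (M(r := c mod 2 ^ bg_w b))"
| "step b (Arith f r x y) M = return_pmf (M(r := aop_val f (M x) (M y) mod 2 ^ bg_w b))"
| "step b (Sample r x) M =
     (if M x = 0 then return_pmf (M(r := 0)) else map_pmf (\<lambda>c. M(r := c)) (unif (M x)))"
| "step b (GMul i r x y) M = return_pmf (M(r :=
     (let G = the_grp b i in
      if M x \<in> carrier G \<and> M y \<in> carrier G then M x \<otimes>\<^bsub>G\<^esub> M y else 0)))"
| "step b (GExp i r x y) M = return_pmf (M(r :=
     (let G = the_grp b i in if M x \<in> carrier G then M x [^]\<^bsub>G\<^esub> M y else 0)))"
| "step b (Pairing r x y) M = return_pmf (M(r :=
     (if M x \<in> carrier (bg_G b) \<and> M y \<in> carrier (bg_H b) then bg_e b (M x) (M y) else 0)))"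

text \<open>The environment, with internal state \<open>'s\<close>, reads queries from and writes answers to the memory.\<close>

type_synonym ('q, 's) env = "'q \<Rightarrow> mem \<times> 's \<Rightarrow> (mem \<times> 's) pmf"

primrec exec :: "bgroup \<Rightarrow> ('q, 's) env \<Rightarrow> 'q com \<Rightarrow> mem \<times> 's \<Rightarrow> (mem \<times> 's) pmf" where
  "exec b env Skip x = return_pmf x"
| "exec b env (Instr i) x = map_pmf (\<lambda>M. (M, snd x)) (step b i (fst x))"
| "exec b env (Seq c c') x = bind_pmf (exec b env c x) (exec b env c')"
| "exec b env (IfZero r c c') x = (if fst x r = 0 then exec b env c x else exec b env c' x)"
| "exec b env (Ask q) x = env q x"

primrec cost :: "'q com \<Rightarrow> nat" where
  "cost Skip = 0"
| "cost (Instr i) = 1"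
| "cost (Seq c c') = cost c + cost c'"
| "cost (IfZero r c c') = 1 + cost c + cost c'"
| "cost (Ask q) = 1"

definition store_words :: "reg \<Rightarrow> nat list \<Rightarrow> mem \<Rightarrow> mem" where
  "store_words a ws M = (\<lambda>r. if a \<le> r \<and> r < a + length ws then ws ! (r - a) else M r)"

text \<open>Non-interactive programs: there is no environment, and \<open>Ask ()\<close> does nothing.\<close>

type_synonym algorithm = "unit com"

definition run_alg :: "bgroup \<Rightarrow> algorithm \<Rightarrow> mem \<Rightarrow> mem pmf" where
  "run_alg b B M = map_pmf fst (exec b (\<lambda>_. return_pmf) B (M, ()))"

text \<open>The output bit of a program is whether register 0 is nonzero in the end.\<close>

definition out_bit :: "mem \<Rightarrow> bool" where
  "out_bit M \<longleftrightarrow> M 0 \<noteq> 0"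

definition accept_prob :: "bgroup \<Rightarrow> algorithm \<Rightarrow> nat list pmf \<Rightarrow> real" where
  "accept_prob b B D =
     pmf (do { ws \<leftarrow> D; M \<leftarrow> run_alg b B (store_words 0 ws (\<lambda>_. 0)); return_pmf (out_bit M) }) True"


section \<open>Hardness assumptions\<close>

definition pbdh_dist :: "bgroup \<Rightarrow> bool \<Rightarrow> nat list pmf" where
  "pbdh_dist b genuine = (let p = bg_p b; g = bg_g b; h = bg_h b; G = bg_G b; H = bg_H b in do {
     x \<leftarrow> unif p; y \<leftarrow> unif p; c \<leftarrow> unif p; z \<leftarrow> unif p;
     return_pmf
       [g, g [^]\<^bsub>G\<^esub> y, g [^]\<^bsub>G\<^esub> (x * y), g [^]\<^bsub>G\<^esub> c, h, h [^]\<^bsub>H\<^esub> x, h [^]\<^bsub>H\<^esub> y,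
        (if genuine then g [^]\<^bsub>G\<^esub> (x * y * c) else g [^]\<^bsub>G\<^esub> z)] })"

definition ddh2_dist :: "bgroup \<Rightarrow> bool \<Rightarrow> nat list pmf" where
  "ddh2_dist b genuine = (let p = bg_p b; g = bg_g b; h = bg_h b; H = bg_H b in do {
     x \<leftarrow> unif p; y \<leftarrow> unif p; z \<leftarrow> unif p;
     return_pmf
       [g, h, h [^]\<^bsub>H\<^esub> x, h [^]\<^bsub>H\<^esub> y,
        (if genuine then h [^]\<^bsub>H\<^esub> (x * y) else h [^]\<^bsub>H\<^esub> z)] })"

definition pbdh_adv :: "bgroup \<Rightarrow> algorithm \<Rightarrow> real" where
  "pbdh_adv b B = \<bar>accept_prob b B (pbdh_dist b True) - accept_prob b B (pbdh_dist b False)\<bar>"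

definition ddh2_adv :: "bgroup \<Rightarrow> algorithm \<Rightarrow> real" where
  "ddh2_adv b B = \<bar>accept_prob b B (ddh2_dist b True) - accept_prob b B (ddh2_dist b False)\<bar>"

definition pbdh_assumption :: "(nat \<Rightarrow> bgroup) \<Rightarrow> bool" where
  "pbdh_assumption bg \<longleftrightarrow>
     (\<forall>B. poly_bounded (\<lambda>k. cost (B k)) \<longrightarrow> negligible (\<lambda>k. pbdh_adv (bg k) (B k)))"

definition ddh2_assumption :: "(nat \<Rightarrow> bgroup) \<Rightarrow> bool" where
  "ddh2_assumption bg \<longleftrightarrow>
     (\<forall>B. poly_bounded (\<lambda>k. cost (B k)) \<longrightarrow> negligible (\<lambda>k. ddh2_adv (bg k) (B k)))"


section \<open>Hierarchical identity-based trapdoor functions over bilinear groups\<close>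

text \<open>
  A hierarchical identity is a list of vectors of words, all of length \<open>pr_mu\<close>.
  Lists are indexed from 0, so the \<open>i\<close>-th level is \<open>id ! (i - 1)\<close>.
\<close>

type_synonym ident = "nat list list"

record params =
  pr_bg :: bgroup
  pr_n :: nat
  pr_d :: nat
  pr_mu :: nat

text \<open>
  The fields \<open>hf_mpk_words\<close> and \<open>hf_sk_words\<close> fix how master public keys and user secret keys
  (of identities of the given length) are transmitted.
\<close>

record ('mpk, 'msk, 'sk, 'x, 'y) hibtdf =
  hf_setup :: "nat \<Rightarrow> params pmf"
  hf_mkg :: "params \<Rightarrow> ('mpk \<times> 'msk) pmf"
  hf_kg :: "params \<Rightarrow> 'msk \<Rightarrow> ident \<Rightarrow> 'sk pmf"
  hf_del :: "params \<Rightarrow> 'mpk \<Rightarrow> ident \<Rightarrow> 'sk \<Rightarrow> nat list \<Rightarrow> 'sk pmf"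
  hf_eval :: "params \<Rightarrow> 'mpk \<Rightarrow> ident \<Rightarrow> 'x \<Rightarrow> 'y"
  hf_inv :: "params \<Rightarrow> 'mpk \<Rightarrow> ident \<Rightarrow> 'sk \<Rightarrow> 'y \<Rightarrow> 'x"
  hf_inp_sp :: "params \<Rightarrow> 'x set"
  hf_id_sp :: "params \<Rightarrow> ident set"
  hf_mpk_words :: "params \<Rightarrow> 'mpk \<Rightarrow> nat list"
  hf_sk_words :: "params \<Rightarrow> nat \<Rightarrow> 'sk \<Rightarrow> nat list"

text \<open>
  A sibling shares all other algorithms. Its auxiliary input is the selectively chosen identity.
\<close>

record ('mpk, 'msk, 'sk) sibling =
  lhf_mkg :: "params \<Rightarrow> ident \<Rightarrow> ('mpk \<times> 'msk) pmf"
  lhf_kg :: "params \<Rightarrow> 'msk \<Rightarrow> ident \<Rightarrow> 'sk pmf"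

definition lossiness :: "'x set \<Rightarrow> ('x \<Rightarrow> 'y) \<Rightarrow> real" where
  "lossiness D f = log 2 (real (card D) / real (card (f ` D)))"


section \<open>Selective adversaries and the experiments\<close>

text \<open>
  An identity in memory is its length followed by its components. The arguments of queries are the
  addresses of the identity, of the further component (for delegation), and of the answer (for
  key revelation).
\<close>

datatype query = Create_Key reg | Create_Delegated_Key reg reg | Reveal_Key reg reg

definition read_words :: "nat \<Rightarrow> mem \<Rightarrow> reg \<Rightarrow> nat list" where
  "read_words m M a = map M [a..<a + m]"

definition read_ident :: "nat \<Rightarrow> mem \<Rightarrow> reg \<Rightarrow> ident" where
  "read_ident m M a = map (\<lambda>i. read_words m M (a + 1 + i * m)) [0..<M a]"

text \<open>
  The first stage is run on the public parameters; afterwards the identity is read at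
  \<open>adv_target\<close>. The second stage starts in the final memory of the first one, to
  which the master public key is added at \<open>adv_mpk\<close>, and has access to the key queries.
\<close>

record adversary =
  adv_choose :: algorithm
  adv_target :: reg
  adv_mpk :: reg
  adv_attack :: "query com"

definition adv_cost :: "adversary \<Rightarrow> nat" where
  "adv_cost A = cost (adv_choose A) + cost (adv_attack A)"

text \<open>Number of query instructions occurring in a program.\<close>

primrec num_queries :: "query com \<Rightarrow> nat" where
  "num_queries Skip = 0"
| "num_queries (Instr i) = 0"
| "num_queries (Seq c c') = num_queries c + num_queries c'"
| "num_queries (IfZero r c c') = num_queries c + num_queries c'"
| "num_queries (Ask q) = 1"

text \<open>Maximal number of \<open>Reveal_Key\<close> queries on an execution path of a program.\<close>

primrec num_reveals :: "query com \<Rightarrow> nat" where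
  "num_reveals Skip = 0"
| "num_reveals (Instr i) = 0"
| "num_reveals (Seq c c') = num_reveals c + num_reveals c'"
| "num_reveals (IfZero r c c') = max (num_reveals c) (num_reveals c')"
| "num_reveals (Ask q) = (case q of Reveal_Key _ _ \<Rightarrow> 1 | _ \<Rightarrow> 0)"

text \<open>
  The group order and the generators are passed explicitly; the remaining parts of the public
  parameters are available as instructions or can be hard-wired in the program.
\<close>

definition pms_words :: "params \<Rightarrow> nat list" where
  "pms_words pms = [bg_p (pr_bg pms), bg_g (pr_bg pms), bg_h (pr_bg pms)]"

definition choose_stage :: "params \<Rightarrow> adversary \<Rightarrow> mem pmf" where
  "choose_stage pms A =
     run_alg (pr_bg pms) (adv_choose A) (store_words 0 (pms_words pms) (\<lambda>_. 0))"

definition target_ident :: "params \<Rightarrow> adversary \<Rightarrow> mem \<Rightarrow> ident" where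
  "target_ident pms A M = read_ident (pr_mu pms) M (adv_target A)"

definition selective_adversary ::
  "('mpk, 'msk, 'sk, 'x, 'y) hibtdf \<Rightarrow> nat \<Rightarrow> adversary \<Rightarrow> bool" where
  "selective_adversary HF k A \<longleftrightarrow>
     (\<forall>pms \<in> set_pmf (hf_setup HF k). \<forall>M \<in> set_pmf (choose_stage pms A).
        target_ident pms A M \<in> hf_id_sp HF pms)"

text \<open>State of the challenger: the domain of \<open>ch_keys\<close> is the set QS, \<open>ch_revealed\<close> is IS.\<close>

record 'sk challenger =
  ch_keys :: "ident \<Rightarrow> 'sk option"
  ch_revealed :: "ident set"

definition key_queries ::
  "('mpk, 'msk, 'sk, 'x, 'y) hibtdf \<Rightarrow> params \<Rightarrow> (ident \<Rightarrow> 'sk pmf) \<Rightarrow> 'mpk \<Rightarrow> ident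
    \<Rightarrow> (query, 'sk challenger) env" where
  "key_queries HF pms kg mpk target q x = (case x of (M, s) \<Rightarrow> (case q of
     Create_Key a \<Rightarrow>
       (let u = read_ident (pr_mu pms) M a in
        if u \<in> hf_id_sp HF pms
        then map_pmf (\<lambda>sk. (M, s\<lparr>ch_keys := (ch_keys s)(u \<mapsto> sk)\<rparr>)) (kg u)
        else return_pmf (M, s))
   | Create_Delegated_Key a c \<Rightarrow>
       (let u = read_ident (pr_mu pms) M a; v = read_words (pr_mu pms) M c in
        case ch_keys s u of
          None \<Rightarrow> return_pmf (M, s)
        | Some sk \<Rightarrow>
            if u @ [v] \<in> hf_id_sp HF pms
            then map_pmf (\<lambda>sk'. (M, s\<lparr>ch_keys := (ch_keys s)(u @ [v] \<mapsto> sk')\<rparr>))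
                   (hf_del HF pms mpk u sk v)
            else return_pmf (M, s))
   | Reveal_Key a r \<Rightarrow>
       (let u = read_ident (pr_mu pms) M a in
        if prefix u target then return_pmf (M(r := 0), s)
        else case ch_keys s u of
          None \<Rightarrow> return_pmf (M(r := 0), s)
        | Some sk \<Rightarrow>
            return_pmf (store_words r (1 # hf_sk_words HF pms (length u) sk) M,
                        s\<lparr>ch_revealed := insert u (ch_revealed s)\<rparr>))))"

text \<open>A pre-output stage obtains the public parameters, the set IS and the challenge identity.\<close>

type_synonym pre_output = "params \<Rightarrow> ident set \<Rightarrow> ident \<Rightarrow> bool pmf"

definition trivial_pre_output :: pre_output where
  "trivial_pre_output pms IS u = return_pmf True"

text \<open>
  The experiment REAL (for \<open>lossy = False\<close>) or LOSSY (for \<open>lossy = True\<close>); the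
  outcome consists of the bit output by the adversary and the non-abort bit \<open>d1 \<and> d2\<close>.
\<close>

definition lossy_experiment ::
  "('mpk, 'msk, 'sk, 'x, 'y) hibtdf \<Rightarrow> ('mpk, 'msk, 'sk) sibling \<Rightarrow> pre_output \<Rightarrow> real \<Rightarrow> nat
    \<Rightarrow> bool \<Rightarrow> adversary \<Rightarrow> (bool \<times> bool) pmf" where
  "lossy_experiment HF LHF P \<omega> k lossy A = do {
     pms \<leftarrow> hf_setup HF k;
     M \<leftarrow> choose_stage pms A;
     let target = target_ident pms A M;
     (mpk0, msk0) \<leftarrow> hf_mkg HF pms;
     (mpk1, msk1) \<leftarrow> lhf_mkg LHF pms target;
     let mpk = (if lossy then mpk1 else mpk0);
     let kg = (if lossy then lhf_kg LHF pms msk1 else hf_kg HF pms msk0);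
     (M', s) \<leftarrow> exec (pr_bg pms) (key_queries HF pms kg mpk target) (adv_attack A)
       (store_words (adv_mpk A) (hf_mpk_words HF pms mpk) M,
        \<lparr>ch_keys = Map.empty, ch_revealed = {}\<rparr>);
     let d1 = ((\<forall>u \<in> ch_revealed s. lossiness (hf_inp_sp HF pms) (hf_eval HF pms mpk1 u) = 0) \<and>
               lossiness (hf_inp_sp HF pms) (hf_eval HF pms mpk1 target) \<ge> \<omega>);
     d2 \<leftarrow> P pms (ch_revealed s) target;
     return_pmf (out_bit M', d1 \<and> d2)
   }"

definition lossy_adv ::
  "('mpk, 'msk, 'sk, 'x, 'y) hibtdf \<Rightarrow> ('mpk, 'msk, 'sk) sibling \<Rightarrow> pre_output \<Rightarrow> real \<Rightarrow> nat
    \<Rightarrow> adversary \<Rightarrow> real" where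
  "lossy_adv HF LHF P \<omega> k A =
     \<bar>\<P>(x in lossy_experiment HF LHF P \<omega> k False A. fst x \<and> snd x) -
      \<P>(x in lossy_experiment HF LHF P \<omega> k True A. fst x \<and> snd x)\<bar>"

text \<open>
  Partial lossiness with respect to a given sibling and a given family of pre-output stages,
  which may depend on \<open>\<zeta>\<close>.
\<close>

definition partially_lossy_with ::
  "('mpk, 'msk, 'sk, 'x, 'y) hibtdf \<Rightarrow> ('mpk, 'msk, 'sk) sibling \<Rightarrow> (real \<Rightarrow> pre_output)
    \<Rightarrow> (nat \<Rightarrow> real) \<Rightarrow> (nat \<Rightarrow> real) \<Rightarrow> bool" where
  "partially_lossy_with HF LHF P \<omega> \<delta> \<longleftrightarrow>
     (\<forall>A. (\<forall>k. selective_adversary HF k (A k)) \<longrightarrow> poly_bounded (\<lambda>k. adv_cost (A k)) \<longrightarrow>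
     (\<forall>\<zeta>. nonnegligible \<zeta> \<longrightarrow>
     (\<exists>\<epsilon>1 \<epsilon>2. nonnegligible \<epsilon>1 \<and> nonnegligible \<epsilon>2 \<and> (\<forall>k. \<delta> k = \<epsilon>1 k * \<epsilon>2 k) \<and>
        negligible (\<lambda>k. lossy_adv HF LHF (P (\<zeta> k)) (\<omega> k) k (A k)) \<and>
        (\<forall>k. let REAL = measure_pmf (lossy_experiment HF LHF (P (\<zeta> k)) (\<omega> k) k False (A k)) in
           \<P>(x in REAL. snd x) \<ge> \<epsilon>1 k \<and>
           (\<P>(x in REAL. fst x) - 1 / 2 > \<zeta> k \<longrightarrow>
            \<P>(x in REAL. fst x \<bar> snd x) - 1 / 2 > \<epsilon>2 k * \<zeta> k)))))"


section \<open>The construction\<close>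

text \<open>
  Arrays are functions on index tuples with the index ranges starting at 1 (at 0 for
  the second index of \<open>pk_h\<close> and \<open>msk_h\<close>). Values outside the ranges are irrelevant: only entries
  inside are ever used or transmitted. Hatted elements live in \<open>bg_H\<close>.
\<close>

record mpk =
  pk_v :: nat
  pk_w :: "nat \<Rightarrow> nat"
  pk_h :: "nat \<times> nat \<times> nat \<Rightarrow> nat"
  pk_J :: "nat \<Rightarrow> nat"
  pk_Cw :: "nat \<times> nat \<Rightarrow> nat"
  pk_C :: "nat \<times> nat \<times> nat \<times> nat \<Rightarrow> nat"

record msk =
  msk_v :: nat
  msk_w :: "nat \<Rightarrow> nat"
  msk_h :: "nat \<times> nat \<times> nat \<Rightarrow> nat"

text \<open>
  Decryption part \<open>D[l\<^sub>1]\<close>, \<open>D\<^sub>w[l\<^sub>1]\<close>, \<open>D\<^sub>i[l\<^sub>1]\<close> and delegation part \<open>K[j,k,l\<^sub>1]\<close>, \<open>L[j,l\<^sub>1]\<close>,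
  \<open>L[j,k,i\<^sub>1,l\<^sub>1]\<close> (here \<open>sk_Li\<close>), \<open>L\<^sub>w[j,k,l\<^sub>1]\<close>.
\<close>

record usk =
  sk_D :: "nat \<Rightarrow> nat"
  sk_Dw :: "nat \<Rightarrow> nat"
  sk_Di :: "nat \<times> nat \<Rightarrow> nat"
  sk_K :: "nat \<times> nat \<times> nat \<Rightarrow> nat"
  sk_L :: "nat \<times> nat \<Rightarrow> nat"
  sk_Li :: "nat \<times> nat \<times> nat \<times> nat \<Rightarrow> nat"
  sk_Lw :: "nat \<times> nat \<times> nat \<Rightarrow> nat"

definition rand_nz :: "nat \<Rightarrow> 'i set \<Rightarrow> ('i \<Rightarrow> nat) pmf" where
  "rand_nz p I = Pi_pmf I 0 (\<lambda>_. unif_nz p)"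

definition HF_MKg :: "params \<Rightarrow> ident \<Rightarrow> (mpk \<times> msk) pmf" where
  "HF_MKg pms y = (
     let p = bg_p (pr_bg pms); G = bg_G (pr_bg pms); H = bg_H (pr_bg pms);
         g = bg_g (pr_bg pms); gh = bg_h (pr_bg pms);
         n = pr_n pms; d = pr_d pms; m = pr_mu pms
     in do {
       av \<leftarrow> unif_nz p;
       aw \<leftarrow> rand_nz p {1..n};
       ah \<leftarrow> rand_nz p ({1..d} \<times> {0..m} \<times> {1..n});
       s \<leftarrow> rand_nz p {1..n};
       let v = g [^]\<^bsub>G\<^esub> av;
       let w = (\<lambda>l. g [^]\<^bsub>G\<^esub> aw l);
       let h = (\<lambda>x. g [^]\<^bsub>G\<^esub> ah x);
       return_pmf
         (\<lparr>pk_v = v, pk_w = w, pk_h = h,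
           pk_J = (\<lambda>l2. v [^]\<^bsub>G\<^esub> s l2),
           pk_Cw = (\<lambda>(l2, l1). w l1 [^]\<^bsub>G\<^esub> s l2),
           pk_C = (\<lambda>(i1, i2, l2, l1).
             (h (i1, 0, l1) [^]\<^bsub>G\<^esub> (y ! (i1 - 1) ! (i2 - 1) * of_bool (l2 = l1)) \<otimes>\<^bsub>G\<^esub> h (i1, i2, l1))
               [^]\<^bsub>G\<^esub> s l2)\<rparr>,
          \<lparr>msk_v = gh [^]\<^bsub>H\<^esub> av, msk_w = (\<lambda>l. gh [^]\<^bsub>H\<^esub> aw l), msk_h = (\<lambda>x. gh [^]\<^bsub>H\<^esub> ah x)\<rparr>)
     })"

definition HF_Kg :: "params \<Rightarrow> msk \<Rightarrow> ident \<Rightarrow> usk pmf" where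
  "HF_Kg pms msk u = (
     let p = bg_p (pr_bg pms); H = bg_H (pr_bg pms);
         n = pr_n pms; d = pr_d pms; m = pr_mu pms; l = length u;
         v = msk_v msk; w = msk_w msk; h = msk_h msk;
         hid = (\<lambda>i1 l1. \<Otimes>\<^bsub>H\<^esub>i2\<in>{1..m}. h (i1, i2, l1) [^]\<^bsub>H\<^esub> (u ! (i1 - 1) ! (i2 - 1)))
     in do {
       rw \<leftarrow> rand_nz p {1..n};
       r \<leftarrow> rand_nz p ({1..l} \<times> {1..n});
       s \<leftarrow> rand_nz p ({l+1..d} \<times> {1..m} \<times> {1..l} \<times> {1..n});
       s' \<leftarrow> rand_nz p ({l+1..d} \<times> {1..n});
       sw \<leftarrow> rand_nz p ({l+1..d} \<times> {1..m} \<times> {1..n});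
       return_pmf
         \<lparr>sk_D = (\<lambda>l1. (\<Otimes>\<^bsub>H\<^esub>i1\<in>{1..l}. hid i1 l1 [^]\<^bsub>H\<^esub> r (i1, l1)) \<otimes>\<^bsub>H\<^esub> w l1 [^]\<^bsub>H\<^esub> rw l1),
          sk_Dw = (\<lambda>l1. v [^]\<^bsub>H\<^esub> rw l1),
          sk_Di = (\<lambda>(i1, l1). v [^]\<^bsub>H\<^esub> r (i1, l1)),
          sk_K = (\<lambda>(j, k, l1).
            (\<Otimes>\<^bsub>H\<^esub>i1\<in>{1..l}. hid i1 l1 [^]\<^bsub>H\<^esub> s (j, k, i1, l1)) \<otimes>\<^bsub>H\<^esub>
            h (j, k, l1) [^]\<^bsub>H\<^esub> s' (j, l1) \<otimes>\<^bsub>H\<^esub> w l1 [^]\<^bsub>H\<^esub> sw (j, k, l1)),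
          sk_L = (\<lambda>(j, l1). v [^]\<^bsub>H\<^esub> s' (j, l1)),
          sk_Li = (\<lambda>(j, k, i1, l1). v [^]\<^bsub>H\<^esub> s (j, k, i1, l1)),
          sk_Lw = (\<lambda>(j, k, l1). v [^]\<^bsub>H\<^esub> sw (j, k, l1))\<rparr>
     })"

definition HF_Del :: "params \<Rightarrow> mpk \<Rightarrow> ident \<Rightarrow> usk \<Rightarrow> nat list \<Rightarrow> usk pmf" where
  "HF_Del pms mpk u sk x = (
     let p = bg_p (pr_bg pms); H = bg_H (pr_bg pms);
         n = pr_n pms; d = pr_d pms; m = pr_mu pms; l = length u
     in do {
       z \<leftarrow> rand_nz p {1..n};
       \<tau> \<leftarrow> rand_nz p ({l+2..d} \<times> {1..m} \<times> {1..n});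
       let K = (\<lambda>(j, k, l1). sk_K sk (j, k, l1) [^]\<^bsub>H\<^esub> z l1);
       let L = (\<lambda>(j, l1). sk_L sk (j, l1) [^]\<^bsub>H\<^esub> z l1);
       let Li = (\<lambda>(j, k, i1, l1). sk_Li sk (j, k, i1, l1) [^]\<^bsub>H\<^esub> z l1);
       let Lw = (\<lambda>(j, k, l1). sk_Lw sk (j, k, l1) [^]\<^bsub>H\<^esub> z l1);
       let Kn = (\<lambda>l1. \<Otimes>\<^bsub>H\<^esub>k\<in>{1..m}. K (l + 1, k, l1) [^]\<^bsub>H\<^esub> (x ! (k - 1)));
       let Ln = (\<lambda>(i1, l1). if i1 = l + 1 then L (l + 1, l1)
                   else \<Otimes>\<^bsub>H\<^esub>k\<in>{1..m}. Li (l + 1, k, i1, l1) [^]\<^bsub>H\<^esub> (x ! (k - 1)));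
       let Lwn = (\<lambda>l1. \<Otimes>\<^bsub>H\<^esub>k\<in>{1..m}. Lw (l + 1, k, l1) [^]\<^bsub>H\<^esub> (x ! (k - 1)));
       return_pmf
         \<lparr>sk_D = (\<lambda>l1. sk_D sk l1 \<otimes>\<^bsub>H\<^esub> Kn l1),
          sk_Dw = (\<lambda>l1. sk_Dw sk l1 \<otimes>\<^bsub>H\<^esub> Lwn l1),
          sk_Di = (\<lambda>(i1, l1). if i1 = l + 1 then Ln (l + 1, l1)
                     else sk_Di sk (i1, l1) \<otimes>\<^bsub>H\<^esub> Ln (i1, l1)),
          sk_K = (\<lambda>(j, k, l1). K (j, k, l1) \<otimes>\<^bsub>H\<^esub> Kn l1 [^]\<^bsub>H\<^esub> \<tau> (j, k, l1)),
          sk_L = L,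
          sk_Li = (\<lambda>(j, k, i1, l1).
            (if i1 = l + 1 then \<one>\<^bsub>H\<^esub> else Li (j, k, i1, l1)) \<otimes>\<^bsub>H\<^esub> Ln (i1, l1) [^]\<^bsub>H\<^esub> \<tau> (j, k, l1)),
          sk_Lw = (\<lambda>(j, k, l1). Lw (j, k, l1) \<otimes>\<^bsub>H\<^esub> Lwn l1 [^]\<^bsub>H\<^esub> \<tau> (j, k, l1))\<rparr>
     })"

type_synonym ctext = "nat \<times> nat list \<times> nat list list"

text \<open>The outputs: \<open>C\<^sub>v\<close>, the list of the \<open>CT\<^sub>w[l\<^sub>1]\<close>, and for each level the list of the \<open>CT[i\<^sub>1, l\<^sub>1]\<close>.\<close>

definition HF_Eval :: "params \<Rightarrow> mpk \<Rightarrow> ident \<Rightarrow> bool list \<Rightarrow> ctext" where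
  "HF_Eval pms mpk u X = (
     let G = bg_G (pr_bg pms); n = pr_n pms; m = pr_mu pms;
         x = (\<lambda>l2. of_bool (X ! (l2 - 1)) :: nat);
         Cid = (\<lambda>i1 l2 l1. \<Otimes>\<^bsub>G\<^esub>i2\<in>{1..m}. pk_C mpk (i1, i2, l2, l1) [^]\<^bsub>G\<^esub> (u ! (i1 - 1) ! (i2 - 1)))
     in (\<Otimes>\<^bsub>G\<^esub>l2\<in>{1..n}. pk_J mpk l2 [^]\<^bsub>G\<^esub> x l2,
         map (\<lambda>l1. \<Otimes>\<^bsub>G\<^esub>l2\<in>{1..n}. pk_Cw mpk (l2, l1) [^]\<^bsub>G\<^esub> x l2) [1..<n + 1],
         map (\<lambda>i1. map (\<lambda>l1. \<Otimes>\<^bsub>G\<^esub>l2\<in>{1..n}. Cid i1 l2 l1 [^]\<^bsub>G\<^esub> x l2) [1..<n + 1])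
           [1..<length u + 1]))"

definition HF_Inv :: "params \<Rightarrow> mpk \<Rightarrow> ident \<Rightarrow> usk \<Rightarrow> ctext \<Rightarrow> bool list" where
  "HF_Inv pms mpk u sk ct = (
     let T = bg_T (pr_bg pms); e = bg_e (pr_bg pms); (Cv, CTw, CT) = ct
     in map (\<lambda>l1. e Cv (sk_D sk l1) \<otimes>\<^bsub>T\<^esub> inv\<^bsub>T\<^esub> (e (CTw ! (l1 - 1)) (sk_Dw sk l1)) \<otimes>\<^bsub>T\<^esub>
               (\<Otimes>\<^bsub>T\<^esub>i1\<in>{1..length u}. inv\<^bsub>T\<^esub> (e (CT ! (i1 - 1) ! (l1 - 1)) (sk_Di sk (i1, l1))))
               \<noteq> \<one>\<^bsub>T\<^esub>)
          [1..<pr_n pms + 1])"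

definition Sigma_ID :: "params \<Rightarrow> nat list set" where
  "Sigma_ID pms = {[1, x] | x. x \<in> {1..<bg_p (pr_bg pms)}}"

definition IdSp :: "params \<Rightarrow> ident set" where
  "IdSp pms = {u. 1 \<le> length u \<and> length u \<le> pr_d pms \<and> set u \<subseteq> Sigma_ID pms}"

definition mpk_words :: "params \<Rightarrow> mpk \<Rightarrow> nat list" where
  "mpk_words pms pk = (let N = [1..<pr_n pms + 1]; I = [1..<pr_d pms + 1]; m = pr_mu pms in
     [pk_v pk] @ [pk_w pk l. l \<leftarrow> N] @
     [pk_h pk (i, k, l). i \<leftarrow> I, k \<leftarrow> [0..<m + 1], l \<leftarrow> N] @
     [pk_J pk l. l \<leftarrow> N] @
     [pk_Cw pk (l2, l1). l2 \<leftarrow> N, l1 \<leftarrow> N] @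
     [pk_C pk (i, k, l2, l1). i \<leftarrow> I, k \<leftarrow> [1..<m + 1], l2 \<leftarrow> N, l1 \<leftarrow> N])"

definition usk_words :: "params \<Rightarrow> nat \<Rightarrow> usk \<Rightarrow> nat list" where
  "usk_words pms l sk = (let N = [1..<pr_n pms + 1]; I = [1..<l + 1]; Js = [l + 1..<pr_d pms + 1];
       Ks = [1..<pr_mu pms + 1] in
     [sk_D sk l1. l1 \<leftarrow> N] @ [sk_Dw sk l1. l1 \<leftarrow> N] @ [sk_Di sk (i, l1). i \<leftarrow> I, l1 \<leftarrow> N] @
     [sk_K sk (j, k, l1). j \<leftarrow> Js, k \<leftarrow> Ks, l1 \<leftarrow> N] @
     [sk_L sk (j, l1). j \<leftarrow> Js, l1 \<leftarrow> N] @
     [sk_Li sk (j, k, i, l1). j \<leftarrow> Js, k \<leftarrow> Ks, i \<leftarrow> I, l1 \<leftarrow> N] @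
     [sk_Lw sk (j, k, l1). j \<leftarrow> Js, k \<leftarrow> Ks, l1 \<leftarrow> N])"

definition y_injective :: "params \<Rightarrow> ident" where
  "y_injective pms = replicate (pr_d pms) (1 # replicate (pr_mu pms - 1) 0)"

text \<open>The vectors \<open>(-x, 1)\<close> for the levels \<open>(1, x)\<close> of the identity, then \<open>(1, 0)\<close>.\<close>

definition y_lossy :: "params \<Rightarrow> ident \<Rightarrow> ident" where
  "y_lossy pms u = map (\<lambda>i. if i < length u then [(bg_p (pr_bg pms) - u ! i ! 1) mod bg_p (pr_bg pms), 1]
                         else [1, 0]) [0..<pr_d pms]"

definition the_params :: "(nat \<Rightarrow> bgroup) \<Rightarrow> (nat \<Rightarrow> nat) \<Rightarrow> nat \<Rightarrow> nat \<Rightarrow> params" where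
  "the_params bg n d k = \<lparr>pr_bg = bg k, pr_n = n k, pr_d = d, pr_mu = 2\<rparr>"

definition HF :: "(nat \<Rightarrow> bgroup) \<Rightarrow> (nat \<Rightarrow> nat) \<Rightarrow> nat \<Rightarrow> (mpk, msk, usk, bool list, ctext) hibtdf" where
  "HF bg n d = \<lparr>
     hf_setup = (\<lambda>k. return_pmf (the_params bg n d k)),
     hf_mkg = (\<lambda>pms. HF_MKg pms (y_injective pms)),
     hf_kg = HF_Kg,
     hf_del = HF_Del,
     hf_eval = HF_Eval,
     hf_inv = HF_Inv,
     hf_inp_sp = (\<lambda>pms. {X. length X = pr_n pms}),
     hf_id_sp = IdSp,
     hf_mpk_words = mpk_words,
     hf_sk_words = usk_words\<rparr>"

definition LHF :: "(mpk, msk, usk) sibling" where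
  "LHF = \<lparr>lhf_mkg = (\<lambda>pms u. HF_MKg pms (y_lossy pms u)), lhf_kg = HF_Kg\<rparr>"

end

theory Submission
  imports Defs "HOL-Algebra.Multiplicative_Group"
begin

text \<open>
 No experiment aborts: an identity that is not a prefix of the target has some \<open>\<langle>y\<^sub>i, id\<^sub>i\<rangle> \<noteq> 0\<close>, which makes evaluation
 injective, and for the target all of these products vanish, so the image has at most \<open>p\<close> elements. Both
 experiments are games over exponents, uniform modulo \<open>p\<close> up to an error \<open>Stat / p\<close>. First \<open>DDH\<^sub>2\<close> replaces delegated
 keys by fresh ones, level by level and column by column, in \<open>N\<close> steps, where \<open>N\<close> depends on \<open>d\<close> only. Then \<open>P-BDH\<^sub>1\<close>
 hides \<open>y\<close> one coordinate after the other, in \<open>2 n\<close> steps: keys of non-prefixes of the target can be simulated from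
 a challenge, and a random \<open>g\<^sup>z\<close> makes the entries of the master public key that depend on \<open>y\<close> uniform.
 The bound leaves a further summand \<open>n \<cdot> Adv\<close>, which absorbs \<open>Stat / p\<close>: looking up \<open>c\<close> among \<open>m\<close> powers of \<open>g\<close>
 distinguishes with advantage about \<open>m / p\<close>. The \<open>2 N\<close> \<open>DDH\<^sub>2\<close> steps are at most \<open>n q\<close> if \<open>n \<ge> 2 N\<close> and \<open>q > 0\<close>;
 if \<open>n < 2 N\<close>, then \<open>p\<close> is so small that all powers can be looked up, and if \<open>q = 0\<close> no key is ever seen.
\<close>

text \<open>Delegation has to be dealt with first: a delegated key inherits randomness from its
  parent, and the parent may be a prefix of the target, whose keys the BDH simulation cannot
  produce. Once delegated keys are fresh, each key is simulated on its own. \<open>N\<close> is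
  independent of \<open>n\<close> because one DDH tuple changes a column in all coordinates at once:
  coordinate \<open>c\<close> uses \<open>z + y * \<zeta>\<close> with its own random \<zeta>, so
  that the single unknown \<open>y\<close> is rerandomized for each coordinate. A reduction is a
  loop-free program without indirect addressing, and its whole size counts. Hence every query
  instruction of the adversary is expanded in place into straight-line code on a key table with one
  slot per query instruction, and values that depend on unknown challenge exponents are carried as
  tuples of known coefficients. Non-uniformity is essential: averaging fixes the memory after the
  first stage, the master exponents and the masks at good values, which are then hard-wired.\<close>

abbreviation (input) iff_ascii (infixr "<->" 25) where "A <-> B == A = B"

section \<open>Probability\<close>

lemma pmf_bind_diff_le:
 fixes P :: "'a pmf" and F G :: "'a=>'b pmf"
 assumes "!!x. x:set_pmf P ==> \<bar>pmf (F x) i - pmf (G x) i\<bar><=dd"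
 shows "\<bar>pmf (bind_pmf P F) i - pmf (bind_pmf P G) i\<bar><=dd"
proof -
 have int: "integrable (measure_pmf P) (%x. pmf (H x) i)" for H :: "'a=>'b pmf"
  by (rule measure_pmf.integrable_const_bound[where B = 1]) (auto simp: pmf_le_1)
 have "\<bar>pmf (bind_pmf P F) i - pmf (bind_pmf P G) i\<bar>
   = \<bar>measure_pmf.expectation P (%x. pmf (F x) i - pmf (G x) i)\<bar>"
  by (simp add: pmf_bind int)
 also have "...<=measure_pmf.expectation P (%x. \<bar>pmf (F x) i - pmf (G x) i\<bar>)"
  by (rule integral_abs_bound)
 also have "...<=measure_pmf.expectation P (%x. dd)"
  using assms by (intro integral_mono_AE) (auto simp: int AE_measure_pmf_iff)
 finally show ?thesis by simp
qed

text \<open>Averaging argument. It lets a reduction hard-wire a value that is at least as good as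
  the average instead of sampling it.\<close>

lemma pmf_bind_diff_attained:
 fixes P :: "'a pmf" and F G :: "'a=>'b pmf"
 obtains x where "x:set_pmf P"
  "\<bar>pmf (bind_pmf P F) i - pmf (bind_pmf P G) i\<bar><=\<bar>pmf (F x) i - pmf (G x) i\<bar>"
proof -
 let ?e = "\<bar>pmf (bind_pmf P F) i - pmf (bind_pmf P G) i\<bar>"
 let ?h = "%x. \<bar>pmf (F x) i - pmf (G x) i\<bar>"
 have "EX x:set_pmf P. ?e<=?h x"
 proof (rule ccontr)
  assume "\<not> ?thesis"
  hence less: "!!x. x:set_pmf P ==> ?h x < ?e" by force
  have int: "integrable (measure_pmf P) (%x. pmf (H x) i)" for H :: "'a=>'b pmf"
   by (rule measure_pmf.integrable_const_bound[where B = 1]) (auto simp: pmf_le_1)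
  have "?e = \<bar>measure_pmf.expectation P (%x. pmf (F x) i - pmf (G x) i)\<bar>"
   by (simp add: pmf_bind int)
  also have "...<=measure_pmf.expectation P ?h"
   by (rule integral_abs_bound)
  \<comment> \<open>If all differences were smaller than \<open>?e\<close>, the positive function
    \<open>?e - ?h x\<close> would have an integral of at most 0 and hence vanish on the
    support.\<close>
  finally have le: "measure_pmf.expectation P (%x. ?e - ?h x)<=0"
   by (simp add: int)
  have "AE x in measure_pmf P. 0<=?e - ?h x"
   using less by (auto simp: AE_measure_pmf_iff intro: less_imp_le)
  moreover from this have "measure_pmf.expectation P (%x. ?e - ?h x) = 0"
   using le by (intro antisym integral_nonneg_AE) auto
  ultimately have "AE x in measure_pmf P. ?e - ?h x = 0"
   by (subst (asm) integral_nonneg_eq_0_iff_AE) (auto simp: int)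
  moreover obtain x where "x:set_pmf P" using set_pmf_not_empty by fast
  ultimately show False using less[of x] by (auto simp: AE_measure_pmf_iff)
 qed
 with that show ?thesis by auto
qed

text \<open>Statistical distance in operational form: \<open>T\<close> ranges over randomized tests
  that continue from the sample. Post-processing is then just associativity of
  \<open>bind_pmf\<close>.\<close>

definition stat_dist_le :: "real=>'a pmf=>'a pmf=>bool" where
 "stat_dist_le ep P Q <->
   (ALL T :: 'a=>bool pmf. \<bar>pmf (bind_pmf P T) True - pmf (bind_pmf Q T) True\<bar><=ep)"

lemma stat_dist_le_refl: "0<=ep ==> stat_dist_le ep P P"
 by (simp add: stat_dist_le_def)

lemma stat_dist_le_trans:
 "stat_dist_le ep P Q ==> stat_dist_le dd Q R ==> stat_dist_le (ep + dd) P R"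
 unfolding stat_dist_le_def
proof
 fix T
 assume "ALL T. \<bar>pmf (P \<bind> T) True - pmf (Q \<bind> T) True\<bar><=ep"
  "ALL T. \<bar>pmf (Q \<bind> T) True - pmf (R \<bind> T) True\<bar><=dd"
 from this[THEN spec[of _ T]] show "\<bar>pmf (P \<bind> T) True - pmf (R \<bind> T) True\<bar><=ep + dd"
  by linarith
qed

lemma stat_dist_le_mono: "stat_dist_le ep P Q ==> ep<=dd ==> stat_dist_le dd P Q"
 unfolding stat_dist_le_def by (meson order_trans)

lemma stat_dist_le_sym: "stat_dist_le ep P Q ==> stat_dist_le ep Q P"
 unfolding stat_dist_le_def by (simp add: abs_minus_commute)

lemma stat_dist_le_bind2:
 assumes "0<=ep" "!!x. x:set_pmf P ==> stat_dist_le ep (F x) (G x)"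
 shows "stat_dist_le ep (bind_pmf P F) (bind_pmf P G)"
 unfolding stat_dist_le_def bind_assoc_pmf
 using assms by (intro allI pmf_bind_diff_le) (auto simp: stat_dist_le_def)

lemma stat_dist_le_bind1:
 "stat_dist_le ep P Q ==> stat_dist_le ep (bind_pmf P F) (bind_pmf Q F)"
 unfolding stat_dist_le_def bind_assoc_pmf by blast

lemma stat_dist_le_bind:
 assumes "stat_dist_le ep P Q" "0<=dd" "!!x. x:set_pmf Q ==> stat_dist_le dd (F x) (G x)"
 shows "stat_dist_le (ep + dd) (bind_pmf P F) (bind_pmf Q G)"
 using stat_dist_le_bind1[OF assms(1)] stat_dist_le_bind2[OF assms(2,3)]
 by (rule stat_dist_le_trans)

lemma stat_dist_le_map: "stat_dist_le ep P Q ==> stat_dist_le ep (map_pmf f P) (map_pmf f Q)"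
 unfolding map_pmf_def by (rule stat_dist_le_bind1)

lemma stat_dist_leD:
 "stat_dist_le ep P Q ==> \<bar>pmf P True - pmf Q True\<bar><=ep"
 unfolding stat_dist_le_def by (metis bind_return_pmf')

section \<open>Couplings\<close>

lemma rel_pmf_map_same:
 "(!!x. x:set_pmf P ==> R (f x) (g x)) ==> rel_pmf R (map_pmf f P) (map_pmf g P)"
 by (auto simp: pmf.rel_map intro!: rel_pmf_reflI)

lemma rel_pmf_eq_map:
 assumes "rel_pmf (%x y. f x = g y) P Q"
 shows "map_pmf f P = map_pmf g Q"
 using assms by (simp add: pmf.rel_map flip: pmf.rel_eq)

lemma rel_pmf_bind_same:
 "(!!x. x:set_pmf P ==> rel_pmf R (F x) (G x)) ==> rel_pmf R (bind_pmf P F) (bind_pmf P G)"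
 by (rule rel_pmf_bindI[where R = "%x y. x = y & x:set_pmf P"]) (auto intro!: rel_pmf_reflI)

text \<open>The independent coupling. It serves keys that are never revealed, which need not be
  related in any particular way.\<close>

lemma rel_pmf_all: "(!!x y. x:set_pmf P ==> y:set_pmf Q ==> R x y) ==> rel_pmf R P Q"
 by (rule rel_pmf.intros[of "pair_pmf P Q"]) (auto simp: map_fst_pair_pmf map_snd_pair_pmf)


subsection \<open>Families of independent samples\<close>

text \<open>Marginals and renaming at once: independent samples are read off a larger family at the
  injective positions \<open>e\<close>. In this way the randomness of every kind of query is taken
  from one common index set.\<close>

lemma Pi_pmf_pull:
 assumes "finite J" "inj_on e I" "e ` I<=J"
 shows "map_pmf (%rv i. if i:I then rv (e i) else d) (Pi_pmf J d (%_. D)) = Pi_pmf I d (%_. D)"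
proof -
 have "finite I" using assms finite_imageD finite_subset by blast
 thus ?thesis using assms
 proof (induction I arbitrary: J rule: finite_induct)
  case empty
  thus ?case by (simp add: map_pmf_const)
 next
  case (insert x I)
  let ?J = "J - {e x}"
  have J: "J = insert (e x) ?J" "finite ?J" "e x ~: ?J" using insert.prems by auto
  have ne: "e i~=e x" if "i:I" for i
   using insert.hyps(2) insert.prems(2) that by (metis inj_on_def insertI1 insertI2)
  have IH: "map_pmf (%rv i. if i:I then rv (e i) else d) (Pi_pmf ?J d (%_. D)) = Pi_pmf I d (%_. D)"
   using insert.prems insert.hyps by (intro insert.IH) (auto simp: ne)
  have "map_pmf (%rv i. if i:insert x I then rv (e i) else d) (Pi_pmf J d (%_. D))
    = map_pmf (%(y,f) i. if i:insert x I then (f(e x := y)) (e i) else d)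
      (pair_pmf D (Pi_pmf ?J d (%_. D)))"
   by (subst J(1), subst Pi_pmf_insert[OF J(2,3)])
     (simp add: pmf.map_comp o_def case_prod_unfold)
  also have "... = map_pmf (%(y,f). (%i. if i:I then f (e i) else d)(x := y))
      (pair_pmf D (Pi_pmf ?J d (%_. D)))"
   using ne insert.hyps by (intro map_pmf_cong refl) (auto simp: fun_eq_iff)
  also have "... = map_pmf (%(y,f). f(x := y))
    (pair_pmf D (map_pmf (%f i. if i:I then f (e i) else d) (Pi_pmf ?J d (%_. D))))"
   by (simp add: pair_map_pmf2 pmf.map_comp o_def case_prod_unfold)
  also have "... = Pi_pmf (insert x I) d (%_. D)"
   unfolding IH using insert.hyps by (simp add: Pi_pmf_insert)
  finally show ?case .
 qed
qed

text \<open>Disjoint sums of index sets turn consecutive sampling steps into a single one; the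
  algorithms of the construction are brought into this form.\<close>

lemma Pi_pmf_Plus:
 fixes A :: "'a set" and B :: "'b set"
 assumes "finite A" "finite B"
 shows "Pi_pmf (A <+> B) d (%_. D)
  = map_pmf (%(f,g). case_sum f g) (pair_pmf (Pi_pmf A d (%_. D)) (Pi_pmf B d (%_. D)))"
proof -
 let ?A = "Inl ` A :: ('a + 'b) set" and ?B = "Inr ` B :: ('a + 'b) set"
 have a: "Pi_pmf (A <+> B) d (%_. D)
   = map_pmf (%(f,g) x. if x:?A then f x else g x)
    (pair_pmf (Pi_pmf ?A d (%_. D)) (Pi_pmf ?B d (%_. D)))"
  unfolding Plus_def using assms by (intro Pi_pmf_union) auto
 have b: "Pi_pmf A d (%_. D) = map_pmf (%rv i. if i:A then rv (Inl i) else d) (Pi_pmf ?A d (%_. D))"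
  using assms by (intro Pi_pmf_pull[symmetric]) auto
 have c: "Pi_pmf B d (%_. D) = map_pmf (%rv i. if i:B then rv (Inr i) else d) (Pi_pmf ?B d (%_. D))"
  using assms by (intro Pi_pmf_pull[symmetric]) auto
 have out: "f x = d" if "f:set_pmf (Pi_pmf ?A d (%_. D))" "x ~: ?A" for f x
  using set_Pi_pmf_subset[of ?A d] assms that by auto
 have out': "f x = d" if "f:set_pmf (Pi_pmf ?B d (%_. D))" "x ~: ?B" for f x
  using set_Pi_pmf_subset[of ?B d] assms that by auto
 show ?thesis
  unfolding a b c pair_map_pmf1 pair_map_pmf2 pmf.map_comp
  by (rule map_pmf_cong[OF refl])
   (use assms in \<open>auto simp: fun_eq_iff split: sum.split dest: out[of _ "Inl _"] out'[of _ "Inl _"] out'[of _ "Inr _"]\<close>)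
qed

lemma pair_pmf_Pi_pmf:
 assumes "finite A" "finite B"
 shows "pair_pmf (Pi_pmf A d (%_. D)) (Pi_pmf B d (%_. D))
  = map_pmf (%rv. (rv o Inl,rv o Inr)) (Pi_pmf (A <+> B) d (%_. D))"
 by (subst Pi_pmf_Plus[OF assms]) (simp add: pmf.map_comp o_def case_prod_unfold)

lemma bind_Pi_pmf2:
 assumes "finite A" "finite B"
 shows "bind_pmf (Pi_pmf A d (%_. D)) (%f. bind_pmf (Pi_pmf B d (%_. D)) (%g. F f g))
  = bind_pmf (Pi_pmf (A <+> B) d (%_. D)) (%rv. F (rv o Inl) (rv o Inr))"
proof -
 have "bind_pmf (Pi_pmf A d (%_. D)) (%f. bind_pmf (Pi_pmf B d (%_. D)) (%g. F f g))
  = bind_pmf (pair_pmf (Pi_pmf A d (%_. D)) (Pi_pmf B d (%_. D))) (%(f,g). F f g)"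
  by (simp add: pair_pmf_def bind_assoc_pmf bind_return_pmf)
 thus ?thesis by (simp add: pair_pmf_Pi_pmf assms bind_map_pmf)
qed

lemma stat_dist_le_Pi_pmf:
 fixes ep :: real
 assumes "finite I" "0<=ep" "stat_dist_le ep D E"
 shows "stat_dist_le (card I * ep) (Pi_pmf I d (%_. D)) (Pi_pmf I d (%_. E))"
 using assms(1)
proof (induction I rule: finite_induct)
 case empty
 thus ?case by (simp add: stat_dist_le_refl)
next
 case (insert x I)
 have "stat_dist_le (ep + card I * ep) (Pi_pmf (insert x I) d (%_. D)) (Pi_pmf (insert x I) d (%_. E))"
  unfolding Pi_pmf_insert'[OF insert.hyps]
  by (rule stat_dist_le_bind[OF assms(3)]) (use insert assms in "auto intro!: stat_dist_le_bind1")
 thus ?case using insert by (simp add: algebra_simps)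
qed


subsection \<open>Uniform families of residues\<close>

text \<open>Residues are integers here, so that exponents can be subtracted and negated without
  truncation.\<close>

definition UI :: "nat=>'i set=>('i=>int) pmf" where
 "UI p I = Pi_pmf I 0 (%_. map_pmf int (unif p))"

lemma map_int_unif: "0 < p ==> map_pmf int (unif p) = pmf_of_set {0..<int p}"
 unfolding unif_def by (subst map_pmf_of_set_inj) (auto simp: image_int_atLeastLessThan)

lemma UI_eq_pmf_of_set:
 assumes "finite I" "0 < p"
 shows "UI p I = pmf_of_set (PiE_dflt I 0 (%_. {0..<int p}))"
 unfolding UI_def map_int_unif[OF assms(2)] using assms by (intro Pi_pmf_of_set) auto

lemma set_UI:
 assumes "finite I" "0 < p"
 shows "set_pmf (UI p I) = PiE_dflt I 0 (%_. {0..<int p})"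
 unfolding UI_eq_pmf_of_set[OF assms] using assms by (intro set_pmf_of_set) auto

lemma UI_bij:
 assumes "finite I" "0 < p"
  and "!!rv. rv:PiE_dflt I 0 (%_. {0..<int p}) ==> F rv:PiE_dflt I 0 (%_. {0..<int p})"
  and "inj_on F (PiE_dflt I 0 (%_. {0..<int p}))"
 shows "map_pmf F (UI p I) = UI p I"
proof -
 let ?S = "PiE_dflt I 0 (%_. {0..<int p})"
 have "finite ?S" "?S~={}" using assms(1,2) by auto
 moreover have "F ` ?S = ?S" using assms(3,4) \<open>finite ?S\<close> by (intro endo_inj_surj) auto
 ultimately show ?thesis
  unfolding UI_eq_pmf_of_set[OF assms(1,2)] using assms(4) by (subst map_pmf_of_set_inj) auto
qed

text \<open>A triangular change of variables is a bijection: the coordinates in \<open>J\<close> are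
  kept, the others are scaled by units and shifted by amounts that depend on \<open>J\<close> only.
  The perfect steps of the proof, such as absorbing an unknown challenge exponent into fresh
  randomness, are instances.\<close>

lemma UI_triangular:
 assumes "finite I" "0 < p" "J<=I"
  and unit: "!!i. i:I - J ==> coprime (a i) (int p)"
  and dep: "!!rv rv' i. (!!j. j:J ==> rv j = rv' j) ==> i:I - J ==> dd rv i = dd rv' i"
 shows "map_pmf (%rv i. if i:J then rv i else if i:I then (a i * rv i + dd rv i) mod int p else 0)
      (UI p I) = UI p I"
proof (rule UI_bij[OF assms(1,2)])
 let ?S = "PiE_dflt I 0 (%_. {0..<int p})"
 let ?F = "%rv i. if i:J then rv i else if i:I then (a i * rv i + dd rv i) mod int p else 0"
 show "?F rv:?S" if "rv:?S" for rv
  using that assms(2,3) by (auto simp: PiE_dflt_def)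
 show "inj_on ?F ?S"
 proof (rule inj_onI, rule ext)
  fix rv rv' i assume S: "rv:?S" "rv':?S" and eq: "?F rv = ?F rv'"
  have J: "rv j = rv' j" if "j:J" for j using fun_cong[OF eq, of j] that by simp
  show "rv i = rv' i"
  proof (cases "i:I - J")
   case True
   have "(a i * rv i + dd rv i) mod int p = (a i * rv' i + dd rv i) mod int p"
    using fun_cong[OF eq, of i] True dep[of rv rv' i] J by auto
   hence "int p dvd a i * (rv i - rv' i)"
    by (simp add: mod_eq_dvd_iff algebra_simps)
   hence "int p dvd rv i - rv' i"
    using unit[OF True] by (simp add: coprime_dvd_mult_right_iff coprime_commute)
   hence "rv i mod int p = rv' i mod int p" by (simp add: mod_eq_dvd_iff)
   thus ?thesis using S True by (auto simp: PiE_dflt_def)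
  next
   case False
   thus ?thesis using J S by (auto simp: PiE_dflt_def)
  qed
 qed
qed

lemma UI_affine:
 assumes "finite I" "0 < p" "!!i. i:I ==> coprime (a i) (int p)"
 shows "map_pmf (%rv i. if i:I then (a i * rv i + dd i) mod int p else 0) (UI p I) = UI p I"
 using UI_triangular[OF assms(1,2), of "{}" a "%_. dd"] assms(3) by simp

lemma UI_pull:
 assumes "finite J" "inj_on e I" "e ` I<=J"
 shows "map_pmf (%rv i. if i:I then rv (e i) else 0) (UI p J) = UI p I"
 unfolding UI_def by (rule Pi_pmf_pull[OF assms])

lemma UI_eq_map: "finite I ==> UI p I = map_pmf (%rv. int o rv) (Pi_pmf I 0 (%_. unif p))"
 unfolding UI_def by (subst Pi_pmf_map[where dflt = 0]) (auto simp: o_def)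

lemma stat_dist_le_unif_nz:
 assumes "1 < p"
 shows "stat_dist_le (1 / p) (unif_nz p) (unif p)"
 unfolding stat_dist_le_def
proof
 fix T :: "nat=>bool pmf"
 let ?f = "%x. pmf (T x) True"
 have eq: "{0..<p} = insert 0 {1..<p}" using assms by auto
 define S where "S = (\<Sum>x = 1..<p. ?f x)"
 have S: "0<=S" "S<=real p - 1"
  using sum_mono[of "{1..<p}" ?f "%_. 1"] assms by (auto simp: S_def pmf_le_1 sum_nonneg of_nat_diff)
 have "pmf (bind_pmf (unif p) T) True = (?f 0 + S) / p"
  using assms by (simp add: unif_def pmf_bind_pmf_of_set eq S_def)
 moreover have "pmf (bind_pmf (unif_nz p) T) True = S / (real p - 1)"
  using assms by (simp add: unif_nz_def pmf_bind_pmf_of_set S_def of_nat_diff)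
 \<comment> \<open>The difference is 1 / p times that between the average of the test over nonzero
   residues and its value at 0.\<close>
 moreover have "S / (real p - 1) - (?f 0 + S) / p = (S / (real p - 1) - ?f 0) / p"
  using assms by (simp add: field_simps)
 moreover have "\<bar>S / (real p - 1) - ?f 0\<bar><=1"
 proof -
  have "0<=S / (real p - 1)" "S / (real p - 1)<=1" using S assms by (auto simp: divide_le_eq)
  moreover have "0<=?f 0" "?f 0<=1" by (auto simp: pmf_le_1)
  ultimately show ?thesis by linarith
 qed
 ultimately show "\<bar>pmf (bind_pmf (unif_nz p) T) True - pmf (bind_pmf (unif p) T) True\<bar><=1 / real p"
  by (simp add: divide_right_mono)
qed

section \<open>Programs\<close>

primrec queries :: "'q com=>'q set" where
 "queries Skip = {}"
| "queries (Instr i) = {}"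
| "queries (Seq c c') = queries c Un queries c'"
| "queries (IfZero r c c') = queries c Un queries c'"
| "queries (Ask q) = {q}"

text \<open>The memories stay equal, hence both runs branch alike; only the states of the
  environments may differ, within \<open>R\<close>.\<close>

lemma rel_exec:
 assumes "!!q M s s'. q:queries c ==> R s s' ==> rel_pmf (rel_prod (=) R) (env q (M,s)) (env' q (M,s'))"
  and "R s s'"
 shows "rel_pmf (rel_prod (=) R) (exec b env c (M,s)) (exec b env' c (M,s'))"
 using assms
proof (induction c arbitrary: M s s')
 case (Instr i)
 thus ?case by (auto intro!: rel_pmf_map_same)
next
 case (Seq c1 c2)
 have "rel_pmf (rel_prod (=) R) (exec b env c1 (M,s)) (exec b env' c1 (M,s'))"
  using Seq.prems by (intro Seq.IH(1)) auto
 thus ?case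
  using Seq.prems Seq.IH(2)
  by (auto intro!: rel_pmf_bindI[where R = "rel_prod (=) R"])
qed auto

lemma stat_dist_le_exec:
 fixes env env' :: "(query,'s) env" and ep :: real
 assumes "0<=ep" "!!q x. stat_dist_le ep (env q x) (env' q x)"
 shows "stat_dist_le (num_queries c * ep) (exec b env c x) (exec b env' c x)"
proof (induction c arbitrary: x)
 case (Seq c1 c2)
 have "stat_dist_le (num_queries c1 * ep + num_queries c2 * ep) (exec b env (Seq c1 c2) x) (exec b env' (Seq c1 c2) x)"
  unfolding exec.simps using Seq assms by (intro stat_dist_le_bind) auto
 thus ?case by (simp add: algebra_simps)
next
 case (IfZero r c1 c2)
 have "stat_dist_le (num_queries (IfZero r c1 c2) * ep) (exec b env c1 x) (exec b env' c1 x)"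
  "stat_dist_le (num_queries (IfZero r c1 c2) * ep) (exec b env c2 x) (exec b env' c2 x)"
  using assms(1) by (auto intro!: stat_dist_le_mono[OF IfZero(1)] stat_dist_le_mono[OF IfZero(2)]
    simp: algebra_simps)
 thus ?case by simp
qed (use assms in "auto simp: stat_dist_le_refl")

lemma num_queries_le_cost: "num_queries c<=cost c"
 by (induction c) auto

lemma num_reveals_le_num_queries: "num_reveals c<=num_queries c"
 by (induction c) (auto split: query.split)

lemma num_reveals_eq_0D: "num_reveals c = 0 ==> Reveal_Key a r ~: queries c"
 by (induction c) (auto split: query.splits)

section \<open>Memories of words and the number of registers that a program changes\<close>

definition wordmem :: "bgroup=>mem=>bool" where
 "wordmem b M <-> (ALL r. M r < 2 ^ bg_w b)"

definition word_bgroup :: "bgroup=>bool" where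
 "word_bgroup b <-> (ALL i. group (the_grp b i) & carrier (the_grp b i)<={..<2 ^ bg_w b}) &
   (ALL x:carrier (bg_G b). ALL y:carrier (bg_H b). bg_e b x y:carrier (bg_T b))"

lemma wordmem_upd: "wordmem b M ==> x < 2 ^ bg_w b ==> wordmem b (M(r := x))"
 by (auto simp: wordmem_def)

lemma wordmem_step:
 assumes "word_bgroup b" "wordmem b M" "M':set_pmf (step b i M)"
 shows "wordmem b M'"
proof -
 have car: "x < 2 ^ bg_w b" if "x:carrier (the_grp b i)" for x i
  using assms(1) that by (force simp: word_bgroup_def)
 have carT: "x < 2 ^ bg_w b" if "x:carrier (bg_T b)" for x
  using car[of x GrpT] that by simp
 have grp: "group (the_grp b i)" for i using assms(1) by (auto simp: word_bgroup_def)
 show ?thesis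
 proof (cases i)
  case (Sample r x)
  thus ?thesis using assms(2,3)
   by (auto simp: unif_def split: if_splits intro!: wordmem_upd)
    (meson order_less_trans wordmem_def)
 next
  case (GMul g r x y)
  thus ?thesis using assms(2,3) grp[of g]
   by (auto simp: Let_def split: if_splits intro!: wordmem_upd intro: car[of _ g] group.is_monoid monoid.m_closed)
 next
  case (GExp g r x y)
  thus ?thesis using assms(2,3) grp[of g]
   by (auto simp: Let_def split: if_splits intro!: wordmem_upd intro: car[of _ g] group.is_monoid monoid.nat_pow_closed)
 next
  case (Pairing r x y)
  thus ?thesis using assms by (auto intro!: wordmem_upd intro: carT simp: word_bgroup_def split: if_splits)
 qed (use assms in "auto intro!: wordmem_upd")
qed

lemma wordmem_run_alg:
 assumes "word_bgroup b" "wordmem b M" "M':set_pmf (run_alg b c M)"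
 shows "wordmem b M'"
proof -
 have "wordmem b (fst y)" if "y:set_pmf (exec b (%_. return_pmf) c x)" "wordmem b (fst x)"
  for x y :: "mem \<times> unit"
  using that
  by (induction c arbitrary: x y) (auto dest: wordmem_step[OF assms(1)] split: if_splits)
 from this[of _ "(M,())"] show ?thesis using assms unfolding run_alg_def by auto
qed

lemma card_changed_step:
 assumes "M':set_pmf (step b i M)"
 shows "EX r. ALL r'. r'~=r --> M' r' = M r'"
proof -
 have "EX r x. M' = M(r := x)"
  using assms by (cases i) (auto split: if_splits)
 thus ?thesis by auto
qed

text \<open>Each instruction writes one register. For the first stage of the adversary this bounds
  the number of registers that a reduction has to hard-wire.\<close>

lemma card_changed_run_alg:
 assumes "M':set_pmf (run_alg b c M)"
 shows "finite {r. M' r~=M r} & card {r. M' r~=M r}<=cost c"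
proof -
 let ?D = "%x y. {r. fst y r~=(fst x r :: nat)}"
 have "finite (?D x y) & card (?D x y)<=cost c"
  if "y:set_pmf (exec b (%_. return_pmf) c x)" for x y :: "mem \<times> unit"
  using that
 proof (induction c arbitrary: x y)
  case (Instr i)
  hence "fst y:set_pmf (step b i (fst x))" by auto
  from card_changed_step[OF this] obtain r where "ALL r'. r'~=r --> fst y r' = fst x r'" by blast
  hence "?D x y<={r}" by auto
  from finite_subset[OF this] card_mono[OF _ this] show ?case by simp
 next
  case (Seq c1 c2)
  then obtain z where z: "z:set_pmf (exec b (%_. return_pmf) c1 x)"
   "y:set_pmf (exec b (%_. return_pmf) c2 z)" by auto
  have sub: "?D x y<=?D x z Un ?D z y" by auto
  have fin: "finite (?D x z Un ?D z y)"
   using Seq.IH(1)[OF z(1)] Seq.IH(2)[OF z(2)] finite_UnI by blast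
  have "card (?D x y)<=card (?D x z Un ?D z y)" by (rule card_mono[OF fin sub])
  hence "card (?D x y)<=cost c1 + cost c2"
   using card_Un_le[of "?D x z" "?D z y"] Seq.IH(1)[OF z(1)] Seq.IH(2)[OF z(2)] by linarith
  with finite_subset[OF sub fin] show ?case unfolding cost.simps by (rule conjI)
 next
  case (IfZero r c1 c2)
  show ?case
  proof (cases "fst x r = 0")
   case True
   thus ?thesis using IfZero.IH(1)[of y x] IfZero.prems by auto
  next
   case False
   thus ?thesis using IfZero.IH(2)[of y x] IfZero.prems by auto
  qed
 qed auto
 from this[of _ "(M,())"] show ?thesis using assms unfolding run_alg_def by auto
qed


subsection \<open>Expressions\<close>

text \<open>Constants, variables, arithmetic, group multiplication, group exponentiation, and a
  conditional on zero. The variables are abstract, so that a simulator can be written before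
  registers are allocated.\<close>

datatype 'v ex =
  EC nat
 | EV 'v
 | EA aop "'v ex" "'v ex"
 | EM grp "'v ex" "'v ex"
 | EP grp "'v ex" "'v ex"
 | EI "'v ex" "'v ex" "'v ex"

text \<open>Constants and variables are reduced to words because the compiled code reduces them when
  it copies them.\<close>

primrec eval :: "bgroup=>'v ex=>('v=>nat)=>nat" where
 "eval b (EC c) et = c mod 2 ^ bg_w b"
| "eval b (EV v) et = et v mod 2 ^ bg_w b"
| "eval b (EA f x y) et = aop_val f (eval b x et) (eval b y et) mod 2 ^ bg_w b"
| "eval b (EM i x y) et = (let G = the_grp b i in
   if eval b x et:carrier G & eval b y et:carrier G then eval b x et \<otimes>\<^bsub>G\<^esub> eval b y et else 0)"
| "eval b (EP i x y) et = (let G = the_grp b i in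
   if eval b x et:carrier G then eval b x et [^]\<^bsub>G\<^esub> eval b y et else 0)"
| "eval b (EI c x y) et = (if eval b c et = 0 then eval b x et else eval b y et)"

text \<open>The number of compiled instructions. A variable costs 2, since a register is copied by
  adding it to a zero.\<close>

primrec esize :: "'v ex=>nat" where
 "esize (EC c) = 1"
| "esize (EV v) = 2"
| "esize (EA f x y) = esize x + esize y + 1"
| "esize (EM i x y) = esize x + esize y + 1"
| "esize (EP i x y) = esize x + esize y + 1"
| "esize (EI c x y) = esize c + esize x + esize y + 1"

text \<open>Stack discipline: the result goes to register \<open>t\<close>, and everything from
  \<open>t\<close> on is scratch space.\<close>

primrec comp_ex :: "reg ex=>reg=>'q com" where
 "comp_ex (EC c) t = Instr (Const t c)"
| "comp_ex (EV r) t = Seq (Instr (Const t 0)) (Instr (Arith Plus t r t))"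
| "comp_ex (EA f x y) t = Seq (comp_ex x t) (Seq (comp_ex y (Suc t)) (Instr (Arith f t t (Suc t))))"
| "comp_ex (EM i x y) t = Seq (comp_ex x t) (Seq (comp_ex y (Suc t)) (Instr (GMul i t t (Suc t))))"
| "comp_ex (EP i x y) t = Seq (comp_ex x t) (Seq (comp_ex y (Suc t)) (Instr (GExp i t t (Suc t))))"
| "comp_ex (EI c x y) t = Seq (comp_ex c t) (IfZero t (comp_ex x t) (comp_ex y t))"

lemma cost_comp_ex: "cost (comp_ex e t) = esize e"
 by (induction e arbitrary: t) auto

lemma eval_cong: "(!!v. v:set_ex e ==> et v = et' v) ==> eval b e et = eval b e et'"
 by (induction e) (simp_all add: Let_def)

lemma eval_map_ex: "eval b (map_ex f e) et = eval b e (et o f)"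
 by (induction e) (simp_all add: Let_def)

lemma esize_map_ex [simp]: "esize (map_ex f e) = esize e"
 by (induction e) auto

lemma eval_less:
 assumes "word_bgroup b"
 shows "eval b e et < 2 ^ bg_w b"
proof -
 have car: "x < 2 ^ bg_w b" if "x:carrier (the_grp b i)" for x i
  using assms that by (force simp: word_bgroup_def)
 have grp: "group (the_grp b i)" for i using assms by (auto simp: word_bgroup_def)
 show ?thesis
 proof (induction e)
  case (EM i x y)
  thus ?case using grp[of i]
   by (auto simp: Let_def intro!: car[of _ i] intro: group.is_monoid monoid.m_closed)
 next
  case (EP i x y)
  thus ?case using grp[of i]
   by (auto simp: Let_def intro!: car[of _ i] intro: group.is_monoid monoid.nat_pow_closed)
 qed auto
qed

lemma exec_comp_ex:
 assumes "set_ex e<={..<t}"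
 shows "EX M'. exec b env (comp_ex e t) (M,s) = return_pmf (M',s) & M' t = eval b e M &
  (ALL r<t. M' r = M r)"
 using assms
proof (induction e arbitrary: t M)
 case (EC c)
 thus ?case by simp
next
 case (EV v)
 thus ?case by (auto simp: bind_return_pmf)
next
 case (EI c x y)
 have sx: "set_ex c<={..<t}" "set_ex x<={..<t}" "set_ex y<={..<t}" using EI.prems by auto
 obtain M1 where
  1: "exec b env (comp_ex c t) (M,s) = return_pmf (M1,s)" "M1 t = eval b c M" "ALL r<t. M1 r = M r"
  using EI.IH(1)[OF sx(1), of M] by blast
 have ev: "eval b x M1 = eval b x M" "eval b y M1 = eval b y M"
  using sx 1(3) by (auto intro!: eval_cong)
 obtain M2 where
  2: "exec b env (comp_ex x t) (M1,s) = return_pmf (M2,s)" "M2 t = eval b x M1" "ALL r<t. M2 r = M1 r"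
  using EI.IH(2)[OF sx(2), of M1] by blast
 obtain M3 where
  3: "exec b env (comp_ex y t) (M1,s) = return_pmf (M3,s)" "M3 t = eval b y M1" "ALL r<t. M3 r = M1 r"
  using EI.IH(3)[OF sx(3), of M1] by blast
 show ?case
 proof (cases "eval b c M = 0")
  case True
  thus ?thesis using 1 2 ev by (auto simp: bind_return_pmf)
 next
  case False
  thus ?thesis using 1 3 ev by (auto simp: bind_return_pmf)
 qed
next
 case (EA f x y)
 have sx: "set_ex x<={..<t}" "set_ex y<={..<t}" "set_ex y<={..<Suc t}" using EA.prems by auto
 obtain M1 where
  1: "exec b env (comp_ex x t) (M,s) = return_pmf (M1,s)" "M1 t = eval b x M" "ALL r<t. M1 r = M r"
  using EA.IH(1)[OF sx(1), of M] by blast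
 obtain M2 where
  2: "exec b env (comp_ex y (Suc t)) (M1,s) = return_pmf (M2,s)" "M2 (Suc t) = eval b y M1"
   "ALL r<Suc t. M2 r = M1 r"
  using EA.IH(2)[OF sx(3), of M1] by blast
 have "eval b y M1 = eval b y M" using sx 1(3) by (intro eval_cong) auto
 thus ?case using 1 2 by (auto simp: bind_return_pmf Let_def)
next
 case (EM f x y)
 have sx: "set_ex x<={..<t}" "set_ex y<={..<t}" "set_ex y<={..<Suc t}" using EM.prems by auto
 obtain M1 where
  1: "exec b env (comp_ex x t) (M,s) = return_pmf (M1,s)" "M1 t = eval b x M" "ALL r<t. M1 r = M r"
  using EM.IH(1)[OF sx(1), of M] by blast
 obtain M2 where
  2: "exec b env (comp_ex y (Suc t)) (M1,s) = return_pmf (M2,s)" "M2 (Suc t) = eval b y M1"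
   "ALL r<Suc t. M2 r = M1 r"
  using EM.IH(2)[OF sx(3), of M1] by blast
 have "eval b y M1 = eval b y M" using sx 1(3) by (intro eval_cong) auto
 thus ?case using 1 2 by (auto simp: bind_return_pmf Let_def)
next
 case (EP f x y)
 have sx: "set_ex x<={..<t}" "set_ex y<={..<t}" "set_ex y<={..<Suc t}" using EP.prems by auto
 obtain M1 where
  1: "exec b env (comp_ex x t) (M,s) = return_pmf (M1,s)" "M1 t = eval b x M" "ALL r<t. M1 r = M r"
  using EP.IH(1)[OF sx(1), of M] by blast
 obtain M2 where
  2: "exec b env (comp_ex y (Suc t)) (M1,s) = return_pmf (M2,s)" "M2 (Suc t) = eval b y M1"
   "ALL r<Suc t. M2 r = M1 r"
  using EP.IH(2)[OF sx(3), of M1] by blast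
 have "eval b y M1 = eval b y M" using sx 1(3) by (intro eval_cong) auto
 thus ?case using 1 2 by (auto simp: bind_return_pmf Let_def)
qed

subsection \<open>Parallel assignment and sampling\<close>

primrec eval_all :: "reg ex list=>reg=>'q com" where
 "eval_all [] t = Skip"
| "eval_all (e # es) t = Seq (comp_ex e t) (eval_all es (Suc t))"

primrec move_all :: "reg list=>reg=>'q com" where
 "move_all [] t = Skip"
| "move_all (r # rs) t =
   Seq (Seq (Instr (Const r 0)) (Instr (Arith Plus r t r))) (move_all rs (Suc t))"

text \<open>All right-hand sides are evaluated into scratch registers from \<open>T\<close> on
  before any target is written, so that targets may occur in right-hand sides.\<close>

definition par_assign :: "(reg \<times> reg ex) list=>reg=>'q com" where
 "par_assign xs T = Seq (eval_all (map snd xs) T) (move_all (map fst xs) T)"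

lemma cost_eval_all: "cost (eval_all es t) = (\<Sum>e\<leftarrow>es. esize e)"
 by (induction es arbitrary: t) (auto simp: cost_comp_ex)

lemma cost_move_all: "cost (move_all rs t) = 2 * length rs"
 by (induction rs arbitrary: t) auto

lemma cost_par_assign: "cost (par_assign xs T) = (\<Sum>(r,e)\<leftarrow>xs. esize e + 2)"
proof -
 have "cost (par_assign xs T) = (\<Sum>e\<leftarrow>map snd xs. esize e) + 2 * length xs"
  by (simp add: par_assign_def cost_eval_all cost_move_all)
 also have "... = (\<Sum>(r,e)\<leftarrow>xs. esize e + 2)"
  by (induction xs) auto
 finally show ?thesis .
qed

lemma exec_eval_all:
 assumes "!!e. e:set es ==> set_ex e<={..<T}" "T<=t"
 shows "EX M'. exec b env (eval_all es t) (M,s) = return_pmf (M',s) & (ALL r<t. M' r = M r) &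
  (ALL i<length es. M' (t + i) = eval b (es ! i) M)"
 using assms
proof (induction es arbitrary: t M)
 case (Cons e es)
 have "set_ex e<={..<t}" using Cons.prems by force
 from exec_comp_ex[OF this, of b env M s] obtain M1 where
  1: "exec b env (comp_ex e t) (M,s) = return_pmf (M1,s)" "M1 t = eval b e M"
  "ALL r<t. M1 r = M r" by blast
 have "!!e. e:set es ==> set_ex e<={..<T}" "T<=Suc t" using Cons.prems by auto
 from Cons.IH[OF this, of M1] obtain M2 where
  2: "exec b env (eval_all es (Suc t)) (M1,s) = return_pmf (M2,s)"
  "ALL r<Suc t. M2 r = M1 r" "ALL i<length es. M2 (Suc t + i) = eval b (es ! i) M1"
  by blast
 have ev: "eval b (es ! i) M1 = eval b (es ! i) M" if "i < length es" for i
 proof (rule eval_cong)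
  fix v assume "v:set_ex (es ! i)"
  hence "v < T" using Cons.prems(1)[of "es ! i"] that by force
  thus "M1 v = M v" using 1(3) Cons.prems(2) by auto
 qed
 have "M2 (t + i) = eval b ((e # es) ! i) M" if "i < length (e # es)" for i
  using that 1 2 ev by (cases i) auto
 moreover have "ALL r<t. M2 r = M r" using 1(3) 2(2) by simp
 moreover have "exec b env (eval_all (e # es) t) (M,s) = return_pmf (M2,s)"
  using 1(1) 2(1) by (simp add: bind_return_pmf)
 ultimately show ?case by blast
qed simp

lemma exec_move_all:
 assumes "distinct rs" "!!r. r:set rs ==> r < T" "T<=t"
  "!!i. i < length rs ==> M (t + i) < 2 ^ bg_w b"
 shows "EX M'. exec b env (move_all rs t) (M,s) = return_pmf (M',s) &
  (ALL i<length rs. M' (rs ! i) = M (t + i)) & (ALL r. r ~: set rs --> M' r = M r)"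
 using assms
proof (induction rs arbitrary: t M)
 case (Cons r rs)
 let ?M = "M(r := M t)"
 have rt: "r < t" using Cons.prems(2)[of r] Cons.prems(3) by simp
 have sm: "M t < 2 ^ bg_w b" using Cons.prems(4)[of 0] by simp
 have ex1: "exec b env (Seq (Instr (Const r 0)) (Instr (Arith Plus r t r))) (M,s) = return_pmf (?M,s)"
  using rt sm by (auto simp: bind_return_pmf fun_upd_def)
 have "?M (Suc t + i) < 2 ^ bg_w b" if "i < length rs" for i
  using Cons.prems(4)[of "Suc i"] that rt by auto
 moreover have "distinct rs" "!!r. r:set rs ==> r < T" "T<=Suc t" "r ~: set rs"
  using Cons.prems by auto
 ultimately obtain M2 where
  2: "exec b env (move_all rs (Suc t)) (?M,s) = return_pmf (M2,s)"
  "ALL i<length rs. M2 (rs ! i) = ?M (Suc t + i)" "ALL r'. r' ~: set rs --> M2 r' = ?M r'"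
  using Cons.IH[of "Suc t" ?M] by blast
 have "M2 ((r # rs) ! i) = M (t + i)" if "i < length (r # rs)" for i
  using that 2 \<open>r ~: set rs\<close> rt by (cases i) auto
 moreover have "M2 r' = M r'" if "r' ~: set (r # rs)" for r' using 2(3) that by auto
 moreover have "exec b env (move_all (r # rs) t) (M,s) = return_pmf (M2,s)"
  unfolding move_all.simps exec.simps(3)[of _ _ "Seq _ _"] ex1 bind_return_pmf 2(1) ..
 ultimately show ?case by blast
qed simp

lemma exec_par_assign:
 assumes "word_bgroup b" "distinct (map fst xs)" "!!r e. (r,e):set xs ==> r < T & set_ex e<={..<T}"
 shows "EX M'. exec b env (par_assign xs T) (M,s) = return_pmf (M',s) &
  (ALL r<T. M' r = (case map_of xs r of Some e=>eval b e M | None=>M r))"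
proof -
 have "set_ex e<={..<T}" if "e:set (map snd xs)" for e
  using that assms(3) by (metis imageE list.set_map prod.collapse)
 from exec_eval_all[where es = "map snd xs", OF this order_refl, of b env M s] obtain M1 where
  1: "exec b env (eval_all (map snd xs) T) (M,s) = return_pmf (M1,s)"
  "ALL r<T. M1 r = M r" "ALL i<length (map snd xs). M1 (T + i) = eval b (map snd xs ! i) M"
  by blast
 have "r < T" if "r:set (map fst xs)" for r
  using that assms(3) by (metis imageE list.set_map prod.collapse)
 moreover have "!!i. i < length (map fst xs) ==> M1 (T + i) < 2 ^ bg_w b"
  using 1(3) by (simp add: eval_less[OF assms(1)])
 ultimately obtain M2 where
  2: "exec b env (move_all (map fst xs) T) (M1,s) = return_pmf (M2,s)"
  "ALL i<length (map fst xs). M2 (map fst xs ! i) = M1 (T + i)"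
  "ALL r. r ~: set (map fst xs) --> M2 r = M1 r"
  using exec_move_all[OF assms(2), of T T M1 b env s] by blast
 have "M2 r = (case map_of xs r of Some e=>eval b e M | None=>M r)" if "r < T" for r
 proof (cases "map_of xs r")
  case None
  hence "r ~: set (map fst xs)" by (simp add: map_of_eq_None_iff)
  thus ?thesis using 2(3) 1(2) that None by simp
 next
  case (Some e)
  then obtain i where i: "i < length xs" "xs ! i = (r,e)"
   by (meson in_set_conv_nth map_of_SomeD)
  hence "M2 r = M1 (T + i)" using 2(2)[rule_format, of i] by simp
  moreover have "M1 (T + i) = eval b (map snd xs ! i) M" using 1(3) i by simp
  ultimately show ?thesis using Some i by simp
 qed
 moreover have "exec b env (par_assign xs T) (M,s) = return_pmf (M2,s)"
  using 1(1) 2(1) by (simp add: par_assign_def bind_return_pmf)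
 ultimately show ?thesis by blast
qed

primrec sample_all :: "nat=>reg list=>reg=>'q com" where
 "sample_all p [] T = Skip"
| "sample_all p (r # rs) T = Seq (Seq (Instr (Const T p)) (Instr (Sample r T))) (sample_all p rs T)"

lemma cost_sample_all: "cost (sample_all p rs T) = 2 * length rs"
 by (induction rs) auto

text \<open>A coupling with the family of samples; register \<open>T\<close>, which holds the
  modulus, is exempt from the frame condition.\<close>

lemma exec_sample_all:
 assumes "0 < p" "p < 2 ^ bg_w b" "distinct (map rh cs)" "!!c. c:set cs ==> rh c < T"
 shows "rel_pmf (%x rv. snd x = s & (ALL c:set cs. fst x (rh c) = rv c) &
      (ALL r. r~=T --> r ~: rh ` set cs --> fst x r = M r))
  (exec b env (sample_all p (map rh cs) T) (M,s)) (Pi_pmf (set cs) 0 (%_. unif p))"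
 using assms
proof (induction cs arbitrary: M)
 case (Cons c cs)
 let ?M = "%y. M(T := p,rh c := y)"
 let ?R = "%cs M x rv. snd x = s & (ALL c:set cs. fst x (rh c) = rv c) &
      (ALL r. r~=T --> r ~: rh ` set cs --> fst x r = M r)"
 have "exec b env (sample_all p (map rh (c # cs)) T) (M,s)
  = bind_pmf (unif p) (%y. exec b env (sample_all p (map rh cs) T) (?M y,s))"
  using Cons.prems
  by (simp add: bind_return_pmf bind_map_pmf pmf.map_comp o_def bind_assoc_pmf)
 moreover have "Pi_pmf (set (c # cs)) 0 (%_. unif p)
  = bind_pmf (unif p) (%y. map_pmf (%f. f(c := y)) (Pi_pmf (set cs) 0 (%_. unif p)))"
 proof -
  have "c ~: set cs" using Cons.prems(3) by auto
  thus ?thesis by (simp add: Pi_pmf_insert' map_pmf_def)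
 qed
 moreover have "rel_pmf (?R (c # cs) M) (exec b env (sample_all p (map rh cs) T) (?M y,s))
   (map_pmf (%f. f(c := y)) (Pi_pmf (set cs) 0 (%_. unif p)))" for y
 proof -
  have "rel_pmf (?R cs (?M y)) (exec b env (sample_all p (map rh cs) T) (?M y,s))
    (Pi_pmf (set cs) 0 (%_. unif p))"
   by (rule Cons.IH) (use Cons.prems in auto)
  thus ?thesis
   unfolding pmf.rel_map
  proof (rule pmf.rel_mono_strong)
   fix x rv assume *: "?R cs (?M y) x rv"
   have "rh c ~: rh ` set cs" "c ~: set cs" "rh c~=T"
    using Cons.prems(3) Cons.prems(4)[of c] by auto
   hence "fst x (rh c) = y" using * by simp
   thus "?R (c # cs) M x (fun_upd rv c y)" using * \<open>c ~: set cs\<close> by auto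
  qed
 qed
 ultimately show ?case by (auto intro: rel_pmf_bind_same)
qed simp

section \<open>Compiling a simulated challenger into the adversary\<close>

subsection \<open>Boolean expressions\<close>

text \<open>The value 0 stands for truth, in accordance with \<^const>\<open>EI\<close>.\<close>

definition eqx :: "'v ex=>'v ex=>'v ex" where
 "eqx x y = EA Plus (EA Minus x y) (EA Minus y x)"

definition notx :: "'v ex=>'v ex" where
 "notx x = EI x (EC 1) (EC 0)"

definition andx :: "'v ex=>'v ex=>'v ex" where
 "andx x y = EI x y (EC 1)"

definition orx :: "'v ex=>'v ex=>'v ex" where
 "orx x y = EI x (EC 0) y"

definition ltx :: "'v ex=>'v ex=>'v ex" where
 "ltx x y = notx (EA Minus y x)"

primrec allx :: "'v ex list=>'v ex" where
 "allx [] = EC 0"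
| "allx (x # xs) = andx x (allx xs)"

text \<open>Dispatch over finitely many values. The machine has no computed addresses, so whatever
  depends on the level of an identity is selected by such a chain of conditionals.\<close>

definition selx :: "'v ex=>nat list=>(nat=>'v ex)=>'v ex" where
 "selx v ls E = foldr (%l acc. EI (eqx v (EC l)) (E l) acc) ls (EC 0)"

lemma set_ex_bool [simp]:
 "set_ex (eqx x y) = set_ex x Un set_ex y" "set_ex (notx x) = set_ex x"
 "set_ex (andx x y) = set_ex x Un set_ex y" "set_ex (orx x y) = set_ex x Un set_ex y"
 "set_ex (ltx x y) = set_ex x Un set_ex y" "set_ex (allx xs) = \<Union> (set_ex ` set xs)"
 "set_ex (selx v ls E) = (if ls = [] then {} else set_ex v) Un \<Union> (set_ex ` E ` set ls)"
proof -
 show "set_ex (allx xs) = \<Union> (set_ex ` set xs)" by (induction xs) (auto simp: andx_def)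
 show "set_ex (selx v ls E) = (if ls = [] then {} else set_ex v) Un \<Union> (set_ex ` E ` set ls)"
  by (induction ls) (auto simp: selx_def eqx_def)
qed (auto simp: eqx_def notx_def andx_def orx_def ltx_def)

lemma esize_bool [simp]:
 "esize (eqx x y) = 2 * esize x + 2 * esize y + 3" "esize (notx x) = esize x + 3"
 "esize (andx x y) = esize x + esize y + 2" "esize (orx x y) = esize x + esize y + 2"
 "esize (ltx x y) = esize x + esize y + 4"
 by (auto simp: eqx_def notx_def andx_def orx_def ltx_def)

lemma esize_allx: "(!!x. x:set xs ==> esize x<=K) ==> esize (allx xs)<=length xs * (K + 2) + 1"
 by (induction xs) fastforce+

lemma esize_selx:
 "(!!l. l:set ls ==> esize (E l)<=K) ==> esize (selx v ls E)<=length ls * (2 * esize v + K + 6) + 1"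
 unfolding selx_def by (induction ls) fastforce+

lemma eval_bool:
 assumes "word_bgroup b" "0 < bg_w b"
 shows "eval b (eqx x y) et = 0 <-> eval b x et = eval b y et"
  "eval b (notx x) et = 0 <-> eval b x et~=0"
  "eval b (andx x y) et = 0 <-> eval b x et = 0 & eval b y et = 0"
  "eval b (orx x y) et = 0 <-> eval b x et = 0 \<or> eval b y et = 0"
  "eval b (ltx x y) et = 0 <-> eval b x et < eval b y et"
  "eval b (allx xs) et = 0 <-> (ALL x:set xs. eval b x et = 0)"
proof -
 let ?W = "2 ^ bg_w b :: nat"
 have W: "1 < ?W" using assms(2) by (intro one_less_power) auto
 have m: "(x - y) mod ?W = x - y" if "x < ?W" for x y :: nat using that by simp
 note less = eval_less[OF assms(1)]
 have "eval b (eqx x y) et = (eval b x et - eval b y et + (eval b y et - eval b x et)) mod ?W"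
  using less[of x et] less[of y et] by (simp add: eqx_def m)
 also have "... = eval b x et - eval b y et + (eval b y et - eval b x et)"
  using less[of x et] less[of y et] by (intro mod_less) auto
 finally show "eval b (eqx x y) et = 0 <-> eval b x et = eval b y et" by auto
 show not: "eval b (notx x) et = 0 <-> eval b x et~=0" for x :: "'a ex"
  using W assms(2) by (simp add: notx_def)
 show a: "eval b (andx x y) et = 0 <-> eval b x et = 0 & eval b y et = 0" for x y :: "'a ex"
  using W assms(2) by (simp add: andx_def)
 show "eval b (orx x y) et = 0 <-> eval b x et = 0 \<or> eval b y et = 0" by (simp add: orx_def)
 show "eval b (ltx x y) et = 0 <-> eval b x et < eval b y et"
  unfolding ltx_def not using less[of y et] by (simp add: m not_le)
 show "eval b (allx xs) et = 0 <-> (ALL x:set xs. eval b x et = 0)"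
  by (induction xs) (auto simp: a)
qed

lemma eval_selx:
 assumes "word_bgroup b" "0 < bg_w b" "eval b v et = l" "l:set ls" "!!l. l:set ls ==> l < 2 ^ bg_w b"
 shows "eval b (selx v ls E) et = eval b (E l) et"
 using assms(4,5)
proof (induction ls)
 case (Cons l' ls)
 thus ?case using assms(3) unfolding selx_def by (auto simp: eval_bool[OF assms(1,2)])
qed simp


subsection \<open>Simulated challengers\<close>

text \<open>
 A simulated challenger stores, for every created key, a payload indexed by \<open>'i\<close>. Payloads and
 revealed words are given by expressions over the identity, the delegated component, fresh
 randomness indexed by \<open>'r\<close>, the payload of the parent, and the words of the challenge.
\<close>

datatype ('i, 'r) var = VId nat nat | VX nat | VOm 'r | VPl 'i | VCh nat

definition valid_id :: "nat=>nat=>ident=>bool" where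
 "valid_id p d u <-> 1<=length u & length u<=d & set u<={[1,x] | x. x:{1..<p}}"

lemma IdSp_iff_valid_id: "u:IdSp pms <-> valid_id (bg_p (pr_bg pms)) (pr_d pms) u"
 by (auto simp: IdSp_def Sigma_ID_def valid_id_def)

fun venv :: "(nat=>nat)=>ident=>nat list=>('r=>nat)=>('i=>nat)=>('i,'r) var=>nat" where
 "venv ch u x rv pl (VId i k) = (if i < length u then u ! i ! k else 0)"
| "venv ch u x rv pl (VX k) = x ! k"
| "venv ch u x rv pl (VOm r) = rv r"
| "venv ch u x rv pl (VPl i) = pl i"
| "venv ch u x rv pl (VCh j) = ch j"

text \<open>The fields of a key record: validity flag, length and components of the identity, and
  payload.\<close>

datatype 'i fld = Ok | Ln | Idc nat nat | Py 'i

abbreviation flds :: "nat=>'i list=>'i fld set" where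
 "flds d Il \<equiv> {Ok,Ln} Un {Idc i k | i k. i < d & k < 2} Un Py ` set Il"

text \<open>Cells: registers of the adversary, challenge, randomness, slots of the key table, the key
 looked up last, the key created last, and the delegated component.\<close>

datatype ('i, 'r) cell = AR nat | Chl nat | Om 'r | Sl nat "'i fld" | Cu "'i fld" | Nw "'i fld" | Xc nat

fun vcell :: "('i,'r) var=>('i,'r) cell" where
 "vcell (VId i k) = Cu (Idc i k)"
| "vcell (VX k) = Xc k"
| "vcell (VOm r) = Om r"
| "vcell (VPl i) = Cu (Py i)"
| "vcell (VCh j) = Chl j"

definition lvars :: "'i list=>'r list=>nat=>nat=>('i,'r) var set" where
 "lvars Il Rn d nc = {VId i k | i k. i < d & k < 2} Un VOm ` set Rn Un VCh ` {..<nc}"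

text \<open>\<open>ce\<close>, \<open>de\<close> and \<open>re\<close> describe, for each level, the
  payloads of created and of delegated keys and the revealed words. The table has \<open>N\<close>
  slots; the adversary keeps its own registers, all below \<open>R\<close>; scratch space starts at
  \<open>T\<close>. By \<open>dp\<close> all levels up to \<open>d + 2\<close> fit into a
  word.\<close>

locale simulator =
 fixes b :: bgroup and d :: nat and tg :: ident and Il :: "'i list" and Rn :: "'r list"
  and ce de :: "nat=>'i=>('i,'r) var ex" and re :: "nat=>('i,'r) var ex list"
  and ch :: "nat=>nat" and nc :: nat and N R T ml :: nat
  and rh :: "('i,'r) cell=>reg"
 assumes wb: "word_bgroup b" and w0: "0 < bg_w b" and p1: "1 < bg_p b" and pw: "bg_p b < 2 ^ bg_w b"
  and dp: "d + 2 < bg_p b" and tg: "valid_id (bg_p b) d tg"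
  and dI: "distinct Il" and dR: "distinct Rn"
  and ce: "!!l i. set_ex (ce l i)<=lvars Il Rn d nc"
  and de: "!!l i. set_ex (de l i)<=lvars Il Rn d nc Un VPl ` set Il Un VX ` {..<2}"
  and re: "!!l e. e:set (re l) ==> set_ex e<={VId i k | i k. i < d & k < 2} Un VCh ` {..<nc} Un VPl ` set Il"
  and ml: "!!l. length (re l)<=ml"
  and rh_AR: "!!r. rh (AR r) = r"
  and rh_inj: "inj_on rh (AR ` {..<R} Un Chl ` {..<nc} Un Om ` set Rn Un
     (\<Union>t<N. Sl t ` flds d Il) Un
     Cu ` flds d Il Un
     Nw ` flds d Il Un Xc ` {..<2})"
  and rh_T: "!!c. c:AR ` {..<R} Un Chl ` {..<nc} Un Om ` set Rn Un
     (\<Union>t<N. Sl t ` flds d Il) Un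
     Cu ` flds d Il Un
     Nw ` flds d Il Un Xc ` {..<2} ==> rh c < T"
begin

abbreviation "p \<equiv> bg_p b"

definition flds :: "'i fld list" where
 "flds = [Ok,Ln] @ [Idc i k. i \<leftarrow> [0..<d],k \<leftarrow> [0..<2]] @ map Py Il"

abbreviation "FS \<equiv> {Ok,Ln} Un {Idc i k | i k. i < d & k < 2} Un Py ` set Il"

definition CS :: "('i,'r) cell set" where
 "CS = AR ` {..<R} Un Chl ` {..<nc} Un Om ` set Rn Un (\<Union>t<N. Sl t ` FS) Un Cu ` FS Un Nw ` FS Un Xc ` {..<2}"

lemma set_flds: "set flds = FS"
 by (auto simp: flds_def)

lemma distinct_Idc:
 fixes f :: "'i fld=>'c"
 assumes "inj f"
 shows "distinct [f (Idc i k). i \<leftarrow> [0..<d],k \<leftarrow> [0..<2]]"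
proof -
 have "distinct (concat (map (%i. map (%k. f (Idc i k)) [0..<2]) is))" if "distinct is" for "is" :: "nat list"
  using that assms by (induction "is") (auto simp: distinct_map inj_on_def dest!: injD)
 thus ?thesis by simp
qed

lemma distinct_flds: "distinct flds"
 using distinct_Idc[where f = "%x. x"] dI by (auto simp: flds_def distinct_map inj_on_def)

lemma length_flds: "length flds = 2 + 2 * d + length Il"
 by (simp add: flds_def length_concat o_def sum_list_triv)

definition pas :: "('i,'r) cell list=>(('i,'r) cell=>('i,'r) cell ex)=>'q com" where
 "pas cs g = par_assign (map (%c. (rh c,map_ex rh (g c))) cs) T"

lemma cost_pas: "(!!c. c:set cs ==> esize (g c)<=K) ==> cost (pas cs g)<=length cs * (K + 2)"
 unfolding pas_def cost_par_assign by (induction cs) fastforce+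

definition words_ok :: "mem=>bool" where
 "words_ok M <-> (ALL c:CS. M (rh c) < 2 ^ bg_w b)"

lemma exec_pas:
 assumes "distinct cs" "set cs<=CS" "!!c. c:set cs ==> set_ex (g c)<=CS" "words_ok M"
 obtains M' where "exec b env (pas cs g) (M,s) = return_pmf (M',s)" "words_ok M'"
  "!!c. c:CS ==> M' (rh c) = (if c:set cs then eval b (g c) (M o rh) else M (rh c))"
proof -
 let ?xs = "map (%c. (rh c,map_ex rh (g c))) cs"
 have inj: "inj_on rh CS" and less: "!!c. c:CS ==> rh c < T"
  using rh_inj rh_T unfolding CS_def by auto
 have d: "distinct (map fst ?xs)"
  using assms(1,2) inj by (auto simp: o_def distinct_map intro: inj_on_subset)
 have v: "r < T & set_ex e<={..<T}" if "(r,e):set ?xs" for r e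
  using that assms(2,3) less by (auto simp: ex.set_map) blast+
 obtain M' where M': "exec b env (pas cs g) (M,s) = return_pmf (M',s)"
  "ALL r<T. M' r = (case map_of ?xs r of Some e=>eval b e M | None=>M r)"
  using exec_par_assign[OF wb d v, of env M s] unfolding pas_def by blast
 have upd: "M' (rh c) = (if c:set cs then eval b (g c) (M o rh) else M (rh c))" if c: "c:CS" for c
 proof (cases "c:set cs")
  case True
  hence "map_of ?xs (rh c) = Some (map_ex rh (g c))"
   using d by (intro map_of_is_SomeI) auto
  thus ?thesis using M'(2) less[OF c] True by (simp add: eval_map_ex)
 next
  case False
  hence "rh c ~: rh ` set cs" using inj c assms(2) by (auto simp: inj_on_def)
  hence "map_of ?xs (rh c) = None" by (auto simp: map_of_eq_None_iff image_image)
  thus ?thesis using M'(2) less[OF c] False by simp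
 qed
 moreover have "words_ok M'"
  using upd assms(4) eval_less[OF wb] by (auto simp: words_ok_def)
 ultimately show ?thesis using that M'(1) by blast
qed

text \<open>The specification of the compiled handlers: the simulated challenger as an environment
  with a finite map as its state.\<close>

definition senv :: "(query,ident=>('i=>nat) option) env" where
 "senv q x = (case x of (M,s)=>(case q of
   Create_Key a =>
    (let u = read_ident 2 M a in
    if valid_id p d u
    then map_pmf (%rv. (M,s(u \<mapsto> %i. if i:set Il then eval b (ce (length u) i) (venv ch u [] rv (%_. 0)) else 0)))
      (Pi_pmf (set Rn) 0 (%_. unif p))
    else return_pmf (M,s))
  | Create_Delegated_Key a c =>
    (let u = read_ident 2 M a; v = read_words 2 M c in
    case s u of
     None=>return_pmf (M,s)
    | Some pl =>
      if valid_id p d (u @ [v])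
      then map_pmf (%rv. (M,s(u @ [v] \<mapsto> %i. if i:set Il then eval b (de (length u) i) (venv ch u v rv pl) else 0)))
      (Pi_pmf (set Rn) 0 (%_. unif p))
      else return_pmf (M,s))
  | Reveal_Key a r =>
    (let u = read_ident 2 M a in
    if prefix u tg then return_pmf (M(r := 0),s)
    else case s u of
     None=>return_pmf (M(r := 0),s)
    | Some pl =>
      return_pmf (store_words r (1 # map (%e. eval b e (venv ch u [] (%_. 0) pl)) (re (length u))) M,s))))"


subsection \<open>Handlers\<close>

definition validx :: "('i,'r) cell ex" where
 "validx = allx ([ltx (EC 0) (EV (Cu Ln)),notx (ltx (EC d) (EV (Cu Ln)))] @
   map (%i. orx (notx (ltx (EC i) (EV (Cu Ln))))
    (allx [eqx (EV (Cu (Idc i 0))) (EC 1),ltx (EC 0) (EV (Cu (Idc i 1))),ltx (EV (Cu (Idc i 1))) (EC p)])) [0..<d])"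

definition matchx :: "nat=>('i,'r) cell ex" where
 "matchx t = allx (eqx (EV (Sl t Ln)) (EV (Cu Ln)) #
   [eqx (EV (Sl t (Idc i k))) (EV (Cu (Idc i k))). i \<leftarrow> [0..<d],k \<leftarrow> [0..<2]])"

text \<open>The first matching slot wins, as in \<open>map_of\<close>. New keys enter at the front,
  so that a key created again supersedes the old one.\<close>

definition lookx :: "nat list=>'i fld=>('i,'r) cell ex" where
 "lookx ts f = foldr (%t acc. EI (andx (notx (EV (Sl t Ok))) (matchx t)) (EV (Sl t f)) acc) ts (EC 0)"

text \<open>Second components suffice, as the first component of each level of a valid identity is
  1.\<close>

definition prefx :: "('i,'r) cell ex" where
 "prefx = allx (ltx (EV (Cu Ln)) (EC (length tg + 1)) #
   map (%i. orx (notx (ltx (EC i) (EV (Cu Ln)))) (eqx (EV (Cu (Idc i 1))) (EC (tg ! i ! 1)))) [0..<length tg])"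

text \<open>Components beyond the length are padded with 0, such that identities can be compared
  field by field. Queries without a delegated component pass \<open>a\<close> for
  \<open>c\<close>.\<close>

definition load :: "nat=>nat=>'q com" where
 "load a c = pas (Cu Ln # [Cu (Idc i k). i \<leftarrow> [0..<d],k \<leftarrow> [0..<2]] @ map Xc [0..<2])
   (%z. case z of Cu Ln=>EV (AR a)
    | Cu (Idc i k)=>EI (ltx (EC i) (EV (AR a))) (EV (AR (a + 1 + i * 2 + k))) (EC 0)
    | Xc k=>EV (AR (c + k)) | _=>EC 0)"

definition find_key :: "'q com" where
 "find_key = pas (map Cu (Ok # map Py Il)) (%z. case z of Cu f=>lookx [0..<N] f | _=>EC 0)"

definition by_level :: "(nat=>('i,'r) cell ex)=>('i,'r) cell ex" where
 "by_level E = selx (EV (Cu Ln)) [1..<d + 1] E"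

definition new_key :: "'q com" where
 "new_key = pas (map Nw flds) (%z. case z of Nw Ok=>EI validx (EC 1) (EC 0)
   | Nw (Py i)=>by_level (%l. map_ex vcell (ce l i)) | Nw f=>EV (Cu f) | _=>EC 0)"

definition new_delegated_key :: "'q com" where
 "new_delegated_key = pas (map Nw flds) (%z. case z of
    Nw Ok=>EI (allx [notx (EV (Cu Ok)),ltx (EV (Cu Ln)) (EC d),eqx (EV (Xc 0)) (EC 1),
      ltx (EC 0) (EV (Xc 1)),ltx (EV (Xc 1)) (EC p)]) (EC 1) (EC 0)
   | Nw Ln=>EA Plus (EV (Cu Ln)) (EC 1)
   | Nw (Idc i k)=>EI (eqx (EV (Cu Ln)) (EC i)) (EV (Xc k)) (EV (Cu (Idc i k)))
   | Nw (Py i)=>by_level (%l. map_ex vcell (de l i)) | _=>EC 0)"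

text \<open>The table is shifted as a whole, since the number of the first free slot is known only
  at run time and could not be used as an address. The flag \<open>Nw Ok\<close> turns the shift
  into the identity for rejected keys.\<close>

definition push_key :: "'q com" where
 "push_key = pas [Sl t f. t \<leftarrow> [0..<N],f \<leftarrow> flds] (%z. case z of
   Sl t f=>EI (EV (Nw Ok)) (EV (Sl t f)) (EV (if t = 0 then Nw f else Sl (t - 1) f)) | _=>EC 0)"

definition answer :: "nat=>'q com" where
 "answer r = pas (map AR [r..<r + 1 + ml]) (%z. case z of
   AR y=>EI (andx (notx (EV (Cu Ok))) (notx prefx))
     (if y = r then EC 1 else by_level (%l. if y - r - 1 < length (re l) then map_ex vcell (re l ! (y - r - 1)) else EV (AR y)))
     (if y = r then EC 0 else EV (AR y)) | _=>EC 0)"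

definition draw :: "'q com" where
 "draw = sample_all p (map rh (map Om Rn)) T"

fun handler :: "query=>'q com" where
 "handler (Create_Key a) = Seq (load a a) (Seq draw (Seq new_key push_key))"
| "handler (Create_Delegated_Key a c) =
   Seq (load a c) (Seq find_key (Seq draw (Seq new_delegated_key push_key)))"
| "handler (Reveal_Key a r) = Seq (load a a) (Seq find_key (answer r))"

primrec sim_com :: "query com=>'q com" where
 "sim_com Skip = Skip"
| "sim_com (Instr i) = Instr i"
| "sim_com (Seq c c') = Seq (sim_com c) (sim_com c')"
| "sim_com (IfZero r c c') = IfZero r (sim_com c) (sim_com c')"
| "sim_com (Ask q) = handler q"

fun query_ok :: "query=>bool" where
 "query_ok (Create_Key a) <-> a + 3 + 2 * d<=R"
| "query_ok (Create_Delegated_Key a c) <-> a + 3 + 2 * d<=R & c + 2<=R"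
| "query_ok (Reveal_Key a r) <-> a + 3 + 2 * d<=R & r + 1 + ml<=R"

definition id_at :: "mem=>('i fld=>('i,'r) cell)=>ident=>bool" where
 "id_at M F u <-> M (rh (F Ln)) = length u &
   (ALL i<d. ALL k<2. M (rh (F (Idc i k))) = (if i < length u then u ! i ! k else 0))"

definition slots :: "mem=>(ident \<times> ('i=>nat)) list=>bool" where
 "slots M es <-> length es<=N &
   (ALL t<N. if t < length es
    then M (rh (Sl t Ok)) = 1 & id_at M (Sl t) (fst (es ! t)) & valid_id p d (fst (es ! t)) &
     (ALL i:set Il. M (rh (Sl t (Py i))) = snd (es ! t) i) & (ALL i. i ~: set Il --> snd (es ! t) i = 0)
    else M (rh (Sl t Ok)) = 0)"

text \<open>\<open>k\<close> counts query instructions passed so far. It bounds the number of stored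
  keys, so that the table never overflows.\<close>

definition simrel :: "nat=>mem=>mem \<times> (ident=>('i=>nat) option)=>bool" where
 "simrel k M x <-> words_ok M & (ALL r<R. M r = fst x r) & (ALL j<nc. M (rh (Chl j)) = ch j) &
   (EX es. slots M es & length es<=k & snd x = map_of es)"

lemma two: "k < 2 <-> k = 0 \<or> k = (1::nat)" by auto

lemma upt_two: "[0..<2] = [0,1::nat]" by (simp add: upt_rec numeral_eq_Suc)

lemma EV_cell: "words_ok M ==> c:CS ==> eval b (EV c) (M o rh) = M (rh c)"
 by (simp add: words_ok_def)

lemma EC_small: "c < 2 ^ bg_w b ==> eval b (EC c) et = c" by simp

lemma d_word: "i<=d + 2 ==> i < 2 ^ bg_w b" using dp pw by linarith

lemma read_ident_nth:
 "length (read_ident 2 M a) = M a" "i < M a ==> k < 2 ==> read_ident 2 M a ! i ! k = M (a + 1 + i * 2 + k)"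
 "x:set (read_ident 2 M a) ==> length x = 2"
 by (auto simp: read_ident_def read_words_def two upt_two)


lemma CS_simps [simp]:
 "AR r:CS <-> r < R" "Chl j:CS <-> j < nc" "Om x:CS <-> x:set Rn"
 "Sl t f:CS <-> t < N & f:FS" "Cu f:CS <-> f:FS" "Nw f:CS <-> f:FS" "Xc k:CS <-> k < 2"
 by (auto simp: CS_def)

lemma by_level_CS: "(!!l. set_ex (E l)<=CS) ==> set_ex (by_level E)<=CS"
 by (auto simp: by_level_def split: if_splits dest: subsetD)

lemma exec_load:
 assumes "words_ok M" "ALL r<R. M r = M0 r" "a + 3 + 2 * d<=R" "c + 2<=R"
 obtains M' where "exec b env (load a c) (M,s) = return_pmf (M',s)" "words_ok M'"
  "id_at M' Cu (read_ident 2 M0 a)" "!!k. k < 2 ==> M' (rh (Xc k)) = M0 (c + k)"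
  "!!z. z:CS ==> (!!f. z~=Cu f) ==> (!!k. z~=Xc k) ==> M' (rh z) = M (rh z)"
proof -
 let ?cs = "Cu Ln # [Cu (Idc i k). i \<leftarrow> [0..<d],k \<leftarrow> [0..<2]] @ map Xc [0..<2] :: ('i,'r) cell list"
 let ?g = "%z. case z of Cu Ln=>EV (AR a)
    | Cu (Idc i k)=>EI (ltx (EC i) (EV (AR a))) (EV (AR (a + 1 + i * 2 + k))) (EC 0)
    | Xc k=>EV (AR (c + k)) | _=>EC 0"
 have "distinct ?cs"
  using distinct_Idc[of "Cu :: _=>('i,'r) cell"] by (auto simp: distinct_map inj_on_def)
 moreover have "set ?cs<=CS" by auto
 moreover have "set_ex (?g z)<=CS" if "z:set ?cs" for z using that assms(3,4) by auto
 ultimately obtain M' where M': "exec b env (load a c) (M,s) = return_pmf (M',s)" "words_ok M'"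
  "!!z. z:CS ==> M' (rh z) = (if z:set ?cs then eval b (?g z) (M o rh) else M (rh z))"
  using exec_pas[of ?cs ?g M env s thesis] assms(1) unfolding load_def by blast
 have ar: "eval b (EV (AR r)) (M o rh) = M0 r" if "r < R" for r
  using that EV_cell[OF assms(1), of "AR r"] assms(2) by (simp add: rh_AR)
 have "M' (rh (Cu Ln)) = M0 a" using M'(3)[of "Cu Ln"] ar[of a] assms(3) by simp
 moreover have "M' (rh (Cu (Idc i k))) = (if i < M0 a then M0 (a + 1 + i * 2 + k) else 0)"
  if "i < d" "k < 2" for i k
 proof -
  have "M' (rh (Cu (Idc i k))) = eval b (EI (ltx (EC i) (EV (AR a))) (EV (AR (a + 1 + i * 2 + k))) (EC 0)) (M o rh)"
  proof -
   have "Cu (Idc i k):set ?cs" using that by force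
   thus ?thesis using M'(3)[of "Cu (Idc i k)"] that by (auto simp del: eval.simps)
  qed
  also have "... = (if i < M0 a then M0 (a + 1 + i * 2 + k) else 0)"
   using that assms(3) ar[of a] ar[of "a + 1 + i * 2 + k"] d_word[of i]
   unfolding eval.simps(6) eval_bool[OF wb w0] by (simp del: eval.simps(2))
  finally show ?thesis .
 qed
 ultimately have "id_at M' Cu (read_ident 2 M0 a)"
  by (auto simp: id_at_def read_ident_nth)
 moreover have "M' (rh (Xc k)) = M0 (c + k)" if "k < 2" for k
  using M'(3)[of "Xc k"] that ar[of "c + k"] assms(4) by auto
 moreover have "M' (rh z) = M (rh z)" if "z:CS" "!!f. z~=Cu f" "!!k. z~=Xc k" for z
  using M'(3)[of z] that by auto
 ultimately show ?thesis using that M'(1,2) by blast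
qed

lemma valid_id_nth:
 assumes "valid_id q e u" "i < length u"
 shows "u ! i = [1,u ! i ! 1]" "u ! i ! 0 = 1" "1<=u ! i ! 1" "u ! i ! 1 < q"
proof -
 have "u ! i:{[1,x] | x. x:{1..<q}}"
  using assms nth_mem unfolding valid_id_def by blast
 thus "u ! i = [1,u ! i ! 1]" "u ! i ! 0 = 1" "1<=u ! i ! 1" "u ! i ! 1 < q" by auto
qed

lemma ident_eqI:
 assumes "ALL x:set u. length x = 2" "ALL x:set u'. length x = 2" "length u = length u'"
  "!!i k. i < length u ==> k < 2 ==> u ! i ! k = u' ! i ! k"
 shows "u = u'"
 using assms by (auto intro!: nth_equalityI)

lemma valid_id_length2: "valid_id q e u ==> x:set u ==> length x = 2"
 by (auto simp: valid_id_def)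

lemma EV_id:
 assumes "words_ok M" "id_at M F u" "F Ln:CS" "!!i k. i < d ==> k < 2 ==> F (Idc i k):CS"
 shows "eval b (EV (F Ln)) (M o rh) = length u"
  "i < d ==> k < 2 ==> eval b (EV (F (Idc i k))) (M o rh) = (if i < length u then u ! i ! k else 0)"
 using assms EV_cell by (auto simp: id_at_def simp del: eval.simps)

text \<open>A stored identity is valid, so its length is at most \<open>d\<close> and the
  \<open>d\<close> compared levels determine it. The identity that is looked up may be
  arbitrary.\<close>

lemma eval_matchx:
 assumes M: "words_ok M" and t: "t < N" and id: "id_at M (Sl t) u'" "id_at M Cu u"
  and v: "valid_id p d u'" and u: "ALL x:set u. length x = 2"
 shows "eval b (matchx t) (M o rh) = 0 <-> u = u'"
proof -
 have 1: "eval b (EV (Sl t Ln)) (M o rh) = length u'"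
  "!!i k. i < d ==> k < 2 ==> eval b (EV (Sl t (Idc i k))) (M o rh) = (if i < length u' then u' ! i ! k else 0)"
  using EV_id[OF M id(1)] t by auto
 have 2: "eval b (EV (Cu Ln)) (M o rh) = length u"
  "!!i k. i < d ==> k < 2 ==> eval b (EV (Cu (Idc i k))) (M o rh) = (if i < length u then u ! i ! k else 0)"
  using EV_id[OF M id(2)] by auto
 have "eval b (matchx t) (M o rh) = 0 <-> length u' = length u &
   (ALL i<d. ALL k<2. eval b (EV (Sl t (Idc i k))) (M o rh) = eval b (EV (Cu (Idc i k))) (M o rh))"
  unfolding matchx_def eval_bool[OF wb w0] using 1(1) 2(1)
  by (auto simp: eval_bool[OF wb w0] simp del: eval.simps)
 also have "... <-> u = u'"
 proof
  assume *: "length u' = length u &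
   (ALL i<d. ALL k<2. eval b (EV (Sl t (Idc i k))) (M o rh) = eval b (EV (Cu (Idc i k))) (M o rh))"
  have "u ! i ! k = u' ! i ! k" if "i < length u" "k < 2" for i k
  proof -
   have "i < d" using that * v by (auto simp: valid_id_def)
   thus ?thesis using * 1(2)[of i k] 2(2)[of i k] that by auto
  qed
  thus "u = u'" using * u valid_id_length2[OF v] by (intro ident_eqI) auto
 next
  assume "u = u'"
  thus "length u' = length u &
   (ALL i<d. ALL k<2. eval b (EV (Sl t (Idc i k))) (M o rh) = eval b (EV (Cu (Idc i k))) (M o rh))"
   using 1(2) 2(2) by auto
 qed
 finally show ?thesis .
qed

text \<open>Induction from the last slot towards the front: \<open>drop j es\<close> is what remains
  to be searched, and slots behind the end of \<open>es\<close> have flag 0.\<close>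

lemma eval_lookx:
 assumes M: "words_ok M" and sl: "slots M es" and id: "id_at M Cu u" and u: "ALL x:set u. length x = 2"
  and f: "f:insert Ok (Py ` set Il)" and j: "j<=N"
 shows "eval b (lookx [j..<N] f) (M o rh) = (case map_of (drop j es) u of None=>0
  | Some pl=>(case f of Py i=>pl i | _=>1))"
 using j
proof (induction rule: inc_induct)
 case base
 have "drop N es = []" using sl by (simp add: slots_def)
 thus ?case by (simp add: lookx_def)
next
 case (step j)
 have c: "Sl j Ok:CS" "Sl j f:CS" using step f by auto
 have eq: "lookx [j..<N] f = EI (andx (notx (EV (Sl j Ok))) (matchx j)) (EV (Sl j f)) (lookx [Suc j..<N] f)"
  using step by (simp add: lookx_def upt_conv_Cons)
 have s: "if j < length es
    then M (rh (Sl j Ok)) = 1 & id_at M (Sl j) (fst (es ! j)) & valid_id p d (fst (es ! j)) &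
     (ALL i:set Il. M (rh (Sl j (Py i))) = snd (es ! j) i) & (ALL i. i ~: set Il --> snd (es ! j) i = 0)
    else M (rh (Sl j Ok)) = 0"
  using sl step(2) unfolding slots_def by blast
 show ?case
 proof (cases "j < length es")
  case True
  obtain u' pl' where e: "es ! j = (u',pl')" by fastforce
  have d: "drop j es = (u',pl') # drop (Suc j) es" using True e by (metis Cons_nth_drop_Suc)
  have "eval b (andx (notx (EV (Sl j Ok))) (matchx j)) (M o rh) = 0 <-> u = u'"
   using eval_matchx[OF M _ _ id _ u, of j u'] s True step(2) EV_cell[OF M c(1)] e
   by (simp add: eval_bool[OF wb w0] del: eval.simps)
  moreover have "eval b (EV (Sl j f)) (M o rh) = (case f of Py i=>pl' i | _=>1)"
   using EV_cell[OF M c(2)] s True f e by (auto simp del: eval.simps)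
  ultimately show ?thesis
   unfolding eq d eval.simps(6) step.IH by simp
 next
  case False
  hence "eval b (andx (notx (EV (Sl j Ok))) (matchx j)) (M o rh)~=0"
   using s EV_cell[OF M c(1)] by (simp add: eval_bool[OF wb w0] del: eval.simps)
  thus ?thesis unfolding eq eval.simps(6) step.IH using False by simp
 qed
qed

lemma id_at_frame:
 "id_at M F u ==> M' (rh (F Ln)) = M (rh (F Ln)) ==>
  (!!i k. i < d ==> k < 2 ==> M' (rh (F (Idc i k))) = M (rh (F (Idc i k)))) ==> id_at M' F u"
 by (auto simp: id_at_def)

lemma slots_frame:
 assumes "slots M es" "!!t f. t < N ==> f:FS ==> M' (rh (Sl t f)) = M (rh (Sl t f))"
 shows "slots M' es"
proof -
 have "id_at M' (Sl t) u" if "id_at M (Sl t) u" "t < N" for t u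
  using that assms(2) by (intro id_at_frame[OF that(1)]) auto
 thus ?thesis using assms unfolding slots_def by (auto split: if_splits)
qed

lemma exec_find:
 assumes M: "words_ok M" and sl: "slots M es" and id: "id_at M Cu u" and u: "ALL x:set u. length x = 2"
 obtains M' where "exec b env find_key (M,s) = return_pmf (M',s)" "words_ok M'" "id_at M' Cu u"
  "M' (rh (Cu Ok)) = of_bool (map_of es u~=None)"
  "!!pl i. map_of es u = Some pl ==> i:set Il ==> M' (rh (Cu (Py i))) = pl i"
  "!!z. z:CS ==> (!!f. z~=Cu f) ==> M' (rh z) = M (rh z)"
proof -
 let ?cs = "map Cu (Ok # map Py Il) :: ('i,'r) cell list" and ?g = "%z. case z of Cu f=>lookx [0..<N] f | _=>EC 0"
 have "distinct ?cs" using dI by (auto simp: distinct_map inj_on_def)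
 moreover have "set ?cs<=CS" by auto
 moreover have "set_ex (lookx [0..<N] f)<=CS" if "f:FS" for f
 proof -
  have "set_ex (lookx ts f)<=CS" if "set ts<={..<N}" for ts
   using that \<open>f : FS\<close> by (induction ts) (auto simp: lookx_def matchx_def)
  from this[of "[0..<N]"] show ?thesis by (simp add: lessThan_atLeast0)
 qed
 note L = this
 have "set_ex (?g z)<=CS" if "z:set ?cs" for z
 proof -
  have "EX f:FS. z = Cu f" using that by auto
  then obtain f where "z = Cu f" "f:FS" by blast
  thus ?thesis using L by simp
 qed
 ultimately obtain M' where M': "exec b env find_key (M,s) = return_pmf (M',s)" "words_ok M'"
  "!!z. z:CS ==> M' (rh z) = (if z:set ?cs then eval b (?g z) (M o rh) else M (rh z))"
  using exec_pas[of ?cs ?g M env s thesis] M unfolding find_key_def by blast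
 have fr: "M' (rh z) = M (rh z)" if "z:CS" "!!f. z~=Cu f" for z using M'(3)[of z] that by auto
 have "id_at M' Cu u" by (rule id_at_frame[OF id]) (use M'(3) in auto)
 moreover have "M' (rh (Cu Ok)) = of_bool (map_of es u~=None)"
  using M'(3)[of "Cu Ok"] eval_lookx[OF M sl id u, of Ok 0] by (auto split: option.splits)
 moreover have "M' (rh (Cu (Py i))) = pl i" if "map_of es u = Some pl" "i:set Il" for pl i
  using M'(3)[of "Cu (Py i)"] eval_lookx[OF M sl id u, of "Py i" 0] that by auto
 ultimately show ?thesis using that M'(1,2) fr by blast
qed

lemma eval_validx:
 assumes M: "words_ok M" and id: "id_at M Cu u" and u: "ALL x:set u. length x = 2"
 shows "eval b validx (M o rh) = 0 <-> valid_id p d u"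
proof -
 have 2: "eval b (EV (Cu Ln)) (M o rh) = length u"
  "!!i k. i < d ==> k < 2 ==> eval b (EV (Cu (Idc i k))) (M o rh) = (if i < length u then u ! i ! k else 0)"
  using EV_id[OF M id] by auto
 have "eval b validx (M o rh) = 0 <-> 0 < length u & \<not> d < length u &
   (ALL i<d. i < length u --> u ! i ! 0 = 1 & 0 < u ! i ! 1 & u ! i ! 1 < p)"
  unfolding validx_def using 2 d_word p1 pw
  by (auto simp: eval_bool[OF wb w0] EC_small simp del: eval.simps)
 also have "... <-> valid_id p d u"
 proof
  assume *: "0 < length u & \<not> d < length u &
   (ALL i<d. i < length u --> u ! i ! 0 = 1 & 0 < u ! i ! 1 & u ! i ! 1 < p)"
  have "x:{[1,x] | x. x:{1..<p}}" if x: "x:set u" for x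
  proof -
   obtain i where i: "i < length u" "x = u ! i" using x by (metis in_set_conv_nth)
   have "x ! 0 = 1" "0 < x ! 1" "x ! 1 < p" using * i by auto
   moreover have "x = [x ! 0,x ! 1]" using u x by (auto simp: length_Suc_conv numeral_2_eq_2)
   ultimately show ?thesis by (metis (mono_tags, lifting) atLeastLessThan_iff less_eq_Suc_le One_nat_def mem_Collect_eq)
  qed
  thus "valid_id p d u" using * by (auto simp: valid_id_def less_eq_Suc_le)
 next
  assume "valid_id p d u"
  thus "0 < length u & \<not> d < length u &
   (ALL i<d. i < length u --> u ! i ! 0 = 1 & 0 < u ! i ! 1 & u ! i ! 1 < p)"
   using valid_id_nth[OF \<open>valid_id p d u\<close>] by (force simp: valid_id_def)
 qed
 finally show ?thesis .
qed

lemma eval_prefx: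
 assumes M: "words_ok M" and id: "id_at M Cu u" and v: "valid_id p d u"
 shows "eval b prefx (M o rh) = 0 <-> prefix u tg"
proof -
 have 2: "eval b (EV (Cu Ln)) (M o rh) = length u"
  "!!i k. i < d ==> k < 2 ==> eval b (EV (Cu (Idc i k))) (M o rh) = (if i < length u then u ! i ! k else 0)"
  using EV_id[OF M id] by auto
 have lt: "length tg<=d" using tg by (simp add: valid_id_def)
 have w: "tg ! i ! 1 < 2 ^ bg_w b" if "i < length tg" for i using valid_id_nth(4)[OF tg that] pw by simp
 have "eval b prefx (M o rh) = 0 <-> length u < length tg + 1 &
   (ALL i<length tg. i < length u --> u ! i ! 1 = tg ! i ! 1)"
  unfolding prefx_def using 2 d_word w lt
  by (auto simp: eval_bool[OF wb w0] EC_small simp del: eval.simps)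
 also have "... <-> prefix u tg"
 proof
  assume *: "length u < length tg + 1 & (ALL i<length tg. i < length u --> u ! i ! 1 = tg ! i ! 1)"
  have "u = take (length u) tg"
  proof (rule nth_equalityI)
   fix i assume i: "i < length u"
   hence "u ! i ! 1 = tg ! i ! 1" "i < length tg" using * by auto
   thus "u ! i = take (length u) tg ! i"
    using valid_id_nth(1)[OF v i] valid_id_nth(1)[OF tg, of i] i by simp
  qed (use * in auto)
  thus "prefix u tg" by (metis take_is_prefix)
 qed (auto simp: prefix_def nth_append)
 finally show ?thesis .
qed

lemma eval_by_level:
 assumes M: "words_ok M" and id: "id_at M Cu u" and v: "1<=length u" "length u<=d"
 shows "eval b (by_level E) (M o rh) = eval b (E (length u)) (M o rh)"
proof -
 have "eval b (EV (Cu Ln)) (M o rh) = length u" using EV_id(1)[OF M id] by auto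
 thus ?thesis unfolding by_level_def
  using v d_word by (intro eval_selx[OF wb w0]) (auto simp del: eval.simps)
qed

lemma eval_vcell:
 assumes M: "words_ok M" and id: "id_at M Cu u" and e: "set_ex e<=V"
  and V: "!!i k. VId i k:V ==> i < d & k < 2"
  "!!k. VX k:V ==> M (rh (Xc k)) = x ! k"
  "!!r. VOm r:V ==> M (rh (Om r)) = rv r"
  "!!i. VPl i:V ==> M (rh (Cu (Py i))) = pl i"
  "!!j. VCh j:V ==> M (rh (Chl j)) = ch j"
 shows "eval b (map_ex vcell e) (M o rh) = eval b e (venv ch u x rv pl)"
 unfolding eval_map_ex
proof (rule eval_cong)
 fix v assume "v:set_ex e"
 hence "v:V" using e by auto
 thus "(M o rh o vcell) v = venv ch u x rv pl v"
  using id V by (cases v) (auto simp: id_at_def)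
qed


lemma exec_push:
 assumes M: "words_ok M" and sl: "slots M es" "length es < N"
 obtains M' where "exec b env push_key (M,s) = return_pmf (M',s)" "words_ok M'"
  "M (rh (Nw Ok)) = 0 ==> slots M' es"
  "!!u pl. M (rh (Nw Ok)) = 1 ==> id_at M Nw u ==> valid_id p d u ==>
    (!!i. i:set Il ==> M (rh (Nw (Py i))) = pl i) ==> (!!i. i ~: set Il ==> pl i = 0) ==>
    slots M' ((u,pl) # es)"
  "!!z. z:CS ==> (!!t f. z~=Sl t f) ==> M' (rh z) = M (rh z)"
proof -
 let ?cs = "[Sl t f. t \<leftarrow> [0..<N],f \<leftarrow> flds] :: ('i,'r) cell list"
 let ?g = "%z. case z of
   Sl t f=>EI (EV (Nw Ok)) (EV (Sl t f)) (EV (if t = 0 then Nw f else Sl (t - 1) f)) | _=>EC 0"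
 have set: "set ?cs = {Sl t f | t f. t < N & f:FS}" by (auto simp: set_flds)
 have "distinct (concat (map (%t. map (Sl t :: _=>('i,'r) cell) flds) ts))" if "distinct ts" for ts
  using that distinct_flds by (induction ts) (auto simp: distinct_map inj_on_def)
 hence "distinct ?cs" by simp
 moreover have "set ?cs<=CS" unfolding set by auto
 moreover have "set_ex (?g z)<=CS" if "z:set ?cs" for z
 proof -
  obtain t f where z: "z = Sl t f" "t < N" "f:FS" using \<open>z : set ?cs\<close> unfolding set by blast
  hence "t - 1 < N" by linarith
  thus ?thesis using z by (auto simp del: One_nat_def)
 qed
 ultimately obtain M' where M': "exec b env push_key (M,s) = return_pmf (M',s)" "words_ok M'"
  "!!z. z:CS ==> M' (rh z) = (if z:set ?cs then eval b (?g z) (M o rh) else M (rh z))"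
  using exec_pas[of ?cs ?g M env s thesis] M unfolding push_key_def by blast
 have ev: "M' (rh (Sl t f)) = (if M (rh (Nw Ok)) = 0 then M (rh (Sl t f))
   else if t = 0 then M (rh (Nw f)) else M (rh (Sl (t - 1) f)))" if "t < N" "f:FS" for t f
 proof -
  have "M' (rh (Sl t f)) = eval b (?g (Sl t f)) (M o rh)"
   using M'(3)[of "Sl t f"] that unfolding set by auto
  thus ?thesis
   using EV_cell[OF M, of "Nw Ok"] EV_cell[OF M, of "Sl t f"] EV_cell[OF M, of "Nw f"]
    EV_cell[OF M, of "Sl (t - 1) f"] that by (auto simp del: eval.simps(2))
 qed
 have a: "slots M' es" if "M (rh (Nw Ok)) = 0"
  by (rule slots_frame[OF sl(1)]) (use ev that in auto)
 have c: "slots M' ((u,pl) # es)"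
  if ok: "M (rh (Nw Ok)) = 1" and id: "id_at M Nw u" and v: "valid_id p d u"
   and pl: "!!i. i:set Il ==> M (rh (Nw (Py i))) = pl i" "!!i. i ~: set Il ==> pl i = 0" for u pl
 proof -
  have e0: "M' (rh (Sl 0 f)) = M (rh (Nw f))" if "f:FS" for f using ev[of 0 f] ok sl(2) that by auto
  have eS: "M' (rh (Sl (Suc t) f)) = M (rh (Sl t f))" if "Suc t < N" "f:FS" for t f
   using ev[of "Suc t" f] ok that by auto
  have "id_at M' (Sl 0) u" using id e0 by (auto simp: id_at_def)
  moreover have "id_at M' (Sl (Suc t)) u'" if "id_at M (Sl t) u'" "Suc t < N" for t u'
   using that eS by (auto simp: id_at_def)
  moreover have "t < N" if "Suc t < N" for t using that by simp
  ultimately show ?thesis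
   using sl e0 eS ok v pl unfolding slots_def
   by (auto simp: nth_Cons split: nat.split if_splits)
 qed
 have e: "M' (rh z) = M (rh z)" if "z:CS" "!!t f. z~=Sl t f" for z
  using M'(3)[of z] that unfolding set by auto
 show ?thesis by (rule that[OF M'(1,2) a c e])
qed

lemma slots_valid: "slots M es ==> map_of es u = Some pl ==> valid_id p d u & (ALL i. i ~: set Il --> pl i = 0)"
proof -
 assume sl: "slots M es" and "map_of es u = Some pl"
 then obtain t where t: "t < length es" "es ! t = (u,pl)" by (meson in_set_conv_nth map_of_SomeD)
 moreover from this have "t < N" using sl by (auto simp: slots_def)
 ultimately show ?thesis using sl unfolding slots_def by (metis fst_conv snd_conv)
qed

lemma exec_new_key:
 assumes M: "words_ok M" and id: "id_at M Cu u" and u: "ALL x:set u. length x = 2"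
  and ch: "ALL j<nc. M (rh (Chl j)) = ch j" and om: "!!r. r:set Rn ==> M (rh (Om r)) = rv r"
 obtains M' where "exec b env new_key (M,s) = return_pmf (M',s)" "words_ok M'"
  "M' (rh (Nw Ok)) = of_bool (valid_id p d u)" "id_at M' Nw u"
  "!!i. valid_id p d u ==> i:set Il ==>
    M' (rh (Nw (Py i))) = eval b (ce (length u) i) (venv ch u [] rv (%_. 0))"
  "!!z. z:CS ==> (!!f. z~=Nw f) ==> M' (rh z) = M (rh z)"
proof -
 let ?cs = "map Nw flds :: ('i,'r) cell list"
 let ?g = "%z. case z of Nw Ok=>EI validx (EC 1) (EC 0)
   | Nw (Py i)=>by_level (%l. map_ex vcell (ce l i)) | Nw f=>EV (Cu f) | _=>EC 0"
 have "distinct ?cs" using distinct_flds by (auto simp: distinct_map inj_on_def)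
 moreover have "set ?cs<=CS" by (auto simp: set_flds)
 moreover have "set_ex (map_ex vcell (ce l i))<=CS" for l i
  using ce[of l i] by (auto simp: ex.set_map lvars_def)
 hence L: "set_ex (by_level (%l. map_ex vcell (ce l i)))<=CS" for i by (rule by_level_CS)
 have "set_ex (?g z)<=CS" if "z:set ?cs" for z
  using that by (auto simp: set_flds validx_def dest: subsetD[OF L])
 ultimately obtain M' where M': "exec b env new_key (M,s) = return_pmf (M',s)" "words_ok M'"
  "!!z. z:CS ==> M' (rh z) = (if z:set ?cs then eval b (?g z) (M o rh) else M (rh z))"
  using exec_pas[of ?cs ?g M env s thesis] M unfolding new_key_def by blast
 have ev: "M' (rh (Nw f)) = eval b (?g (Nw f)) (M o rh)" if "f:FS" for f
  using M'(3)[of "Nw f"] that by (auto simp: set_flds)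
 have one: "1 mod 2 ^ bg_w b = (1::nat)" using w0 by simp
 have "M' (rh (Nw Ok)) = of_bool (valid_id p d u)"
  using ev[of Ok] eval_validx[OF M id u] one by auto
 moreover have "id_at M' Nw u"
 proof -
  have "M' (rh (Nw f)) = M (rh (Cu f))" if "f:FS" "f~=Ok" "!!i. f~=Py i" for f
   using ev[OF that(1)] EV_cell[OF M, of "Cu f"] that by (cases f) (auto simp del: eval.simps(2))
  thus ?thesis using id by (auto simp: id_at_def)
 qed
 moreover have "M' (rh (Nw (Py i))) = eval b (ce (length u) i) (venv ch u [] rv (%_. 0))"
  if "valid_id p d u" "i:set Il" for i
 proof -
  have "M' (rh (Nw (Py i))) = eval b (map_ex vcell (ce (length u) i)) (M o rh)"
   using ev[of "Py i"] that eval_by_level[OF M id] by (auto simp: valid_id_def)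
  also have "... = eval b (ce (length u) i) (venv ch u [] rv (%_. 0))"
   by (rule eval_vcell[OF M id ce]) (use ch om in "auto simp: lvars_def")
  finally show ?thesis .
 qed
 moreover have "M' (rh z) = M (rh z)" if "z:CS" "!!f. z~=Nw f" for z
  using M'(3)[of z] that by auto
 ultimately show ?thesis using that M'(1,2) by blast
qed

lemma exec_new_delegated_key:
 assumes M: "words_ok M" and id: "id_at M Cu u" and u: "ALL x:set u. length x = 2"
  and ch: "ALL j<nc. M (rh (Chl j)) = ch j" and om: "!!r. r:set Rn ==> M (rh (Om r)) = rv r"
  and x: "!!k. k < 2 ==> M (rh (Xc k)) = x ! k" "length x = 2"
  and ok: "M (rh (Cu Ok)) = of_bool (ks u~=None)" "!!pl. ks u = Some pl ==> valid_id p d u"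
  and pl: "!!pl i. ks u = Some pl ==> i:set Il ==> M (rh (Cu (Py i))) = pl i"
 obtains M' where "exec b env new_delegated_key (M,s) = return_pmf (M',s)" "words_ok M'"
  "M' (rh (Nw Ok)) = of_bool (ks u~=None & valid_id p d (u @ [x]))"
  "valid_id p d (u @ [x]) ==> id_at M' Nw (u @ [x])"
  "!!i pl. valid_id p d (u @ [x]) ==> ks u = Some pl ==> i:set Il ==>
    M' (rh (Nw (Py i))) = eval b (de (length u) i) (venv ch u x rv pl)"
  "!!z. z:CS ==> (!!f. z~=Nw f) ==> M' (rh z) = M (rh z)"
proof -
 let ?cs = "map Nw flds :: ('i,'r) cell list"
 let ?ok = "allx [notx (EV (Cu Ok)),ltx (EV (Cu Ln)) (EC d),eqx (EV (Xc 0)) (EC 1),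
      ltx (EC 0) (EV (Xc 1)),ltx (EV (Xc 1)) (EC p)]"
 let ?g = "%z. case z of
    Nw Ok=>EI ?ok (EC 1) (EC 0)
   | Nw Ln=>EA Plus (EV (Cu Ln)) (EC 1)
   | Nw (Idc i k)=>EI (eqx (EV (Cu Ln)) (EC i)) (EV (Xc k)) (EV (Cu (Idc i k)))
   | Nw (Py i)=>by_level (%l. map_ex vcell (de l i)) | _=>EC 0"
 have "distinct ?cs" using distinct_flds by (auto simp: distinct_map inj_on_def)
 moreover have "set ?cs<=CS" by (auto simp: set_flds)
 moreover have "set_ex (map_ex vcell (de l i))<=CS" for l i
  using de[of l i] by (force simp: ex.set_map lvars_def)
 hence L: "set_ex (by_level (%l. map_ex vcell (de l i)))<=CS" for i by (rule by_level_CS)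
 have "set_ex (?g z)<=CS" if "z:set ?cs" for z
  using that by (auto simp: set_flds dest: subsetD[OF L])
 ultimately obtain M' where M': "exec b env new_delegated_key (M,s) = return_pmf (M',s)" "words_ok M'"
  "!!z. z:CS ==> M' (rh z) = (if z:set ?cs then eval b (?g z) (M o rh) else M (rh z))"
  using exec_pas[of ?cs ?g M env s thesis] M unfolding new_delegated_key_def by blast
 have ev: "M' (rh (Nw f)) = eval b (?g (Nw f)) (M o rh)" if "f:FS" for f
  using M'(3)[of "Nw f"] that by (auto simp: set_flds)
 have one: "1 mod 2 ^ bg_w b = (1::nat)" using w0 by simp
 note cu = EV_id[OF M id]
 have cx: "eval b (EV (Xc k)) (M o rh) = x ! k" if "k < 2" for k
  using EV_cell[OF M, of "Xc k"] x that by (simp del: eval.simps)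
 have x2: "x = [x ! 0,x ! 1]" using x(2) by (auto simp: length_Suc_conv numeral_2_eq_2)
 have okx: "eval b ?ok (M o rh) = 0 <-> ks u~=None & valid_id p d (u @ [x])"
 proof -
  have "eval b ?ok (M o rh) = 0 <-> ks u~=None & length u < d & x ! 0 = 1 & 0 < x ! 1 & x ! 1 < p"
   using cu cx[of 0] cx[of 1] EV_cell[OF M, of "Cu Ok"] ok(1) d_word[of d] p1 pw
   by (auto simp: eval_bool[OF wb w0] EC_small simp del: eval.simps)
  also have "... <-> ks u~=None & valid_id p d (u @ [x])"
  proof (cases "ks u")
   case (Some pl)
   from ok(2)[OF Some] x2 show ?thesis
    by (subst (2) x2) (auto simp: valid_id_def less_eq_Suc_le)
  qed simp
  finally show ?thesis .
 qed
 have "M' (rh (Nw Ok)) = of_bool (ks u~=None & valid_id p d (u @ [x]))"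
  using ev[of Ok] okx one by (auto simp del: allx.simps)
 moreover have "id_at M' Nw (u @ [x])" if v: "valid_id p d (u @ [x])"
 proof -
  have l: "length u < d" using v by (auto simp: valid_id_def)
  have "M' (rh (Nw Ln)) = length u + 1"
   using ev[of Ln] cu(1) one d_word[of "length u + 1"] l by (auto simp del: eval.simps(2))
  moreover have "M' (rh (Nw (Idc i k))) = (if i < length (u @ [x]) then (u @ [x]) ! i ! k else 0)"
   if "i < d" "k < 2" for i k
  proof -
   have "M' (rh (Nw (Idc i k))) = (if length u = i then x ! k else if i < length u then u ! i ! k else 0)"
    using ev[of "Idc i k"] cu cx[of k] that d_word[of i]
    by (auto simp: eval_bool[OF wb w0] simp del: eval.simps(2))
   thus ?thesis by (auto simp: nth_append)
  qed
  ultimately show ?thesis by (auto simp: id_at_def)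
 qed
 moreover have "M' (rh (Nw (Py i))) = eval b (de (length u) i) (venv ch u x rv pl)"
  if v: "valid_id p d (u @ [x])" and k: "ks u = Some pl" and i: "i:set Il" for i pl
 proof -
  have "M' (rh (Nw (Py i))) = eval b (map_ex vcell (de (length u) i)) (M o rh)"
   using ev[of "Py i"] i ok(2)[OF k] eval_by_level[OF M id] by (auto simp: valid_id_def)
  also have "... = eval b (de (length u) i) (venv ch u x rv pl)"
   by (rule eval_vcell[OF M id de]) (use ch om x pl[OF k] in "auto simp: lvars_def")
  finally show ?thesis .
 qed
 moreover have "M' (rh z) = M (rh z)" if "z:CS" "!!f. z~=Nw f" for z
  using M'(3)[of z] that by auto
 ultimately show ?thesis using that M'(1,2) by blast
qed


end

context simulator
begin

lemma exec_answer:
 assumes M: "words_ok M" and id: "id_at M Cu u"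
  and ch: "ALL j<nc. M (rh (Chl j)) = ch j" and r: "r + 1 + ml<=R"
  and ok: "M (rh (Cu Ok)) = of_bool (ks u~=None)" "!!pl. ks u = Some pl ==> valid_id p d u"
  and pl: "!!pl i. ks u = Some pl ==> i:set Il ==> M (rh (Cu (Py i))) = pl i"
  and M0: "ALL r<R. M r = M0 r"
 obtains M' where "exec b env (answer r) (M,s) = return_pmf (M',s)" "words_ok M'"
  "!!y. y < R ==> M' y = (if prefix u tg then M0(r := 0)
    else case ks u of None=>M0(r := 0)
    | Some pl=>store_words r (1 # map (%e. eval b e (venv ch u [] (%_. 0) pl)) (re (length u))) M0) y"
  "!!z. z:CS ==> (!!y. z~=AR y) ==> M' (rh z) = M (rh z)"
proof -
 let ?cs = "map AR [r..<r + 1 + ml] :: ('i,'r) cell list"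
 let ?c = "andx (notx (EV (Cu Ok))) (notx prefx)"
 let ?E = "%y l. if y - r - 1 < length (re l) then map_ex vcell (re l ! (y - r - 1)) else EV (AR y)"
 let ?g = "%z. case z of
   AR y=>EI (andx (notx (EV (Cu Ok))) (notx prefx))
     (if y = r then EC 1 else by_level (%l. if y - r - 1 < length (re l) then map_ex vcell (re l ! (y - r - 1)) else EV (AR y)))
     (if y = r then EC 0 else EV (AR y)) | _=>EC 0"
 have lt: "length tg<=d" using tg by (simp add: valid_id_def)
 have set: "set ?cs = {AR y | y. r<=y & y < r + 1 + ml}" by auto
 have "distinct ?cs" by (auto simp: distinct_map inj_on_def)
 moreover have "set ?cs<=CS" using r unfolding set by auto
 moreover have E: "set_ex (?E y l)<=CS" if "y < R" for y l
 proof (cases "y - r - 1 < length (re l)")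
  case True
  from re[OF nth_mem[OF this]] show ?thesis using True by (force simp: ex.set_map)
 qed (use that in auto)
 have "set_ex (?g z)<=CS" if z: "z:set ?cs" for z
 proof -
  obtain y where y: "z = AR y" "y < R" using z r unfolding set by auto
  have "set_ex (by_level (?E y))<=CS" by (intro by_level_CS E y)
  from subsetD[OF this] y lt show ?thesis by (auto simp: prefx_def)
 qed
 ultimately obtain M' where M': "exec b env (answer r) (M,s) = return_pmf (M',s)" "words_ok M'"
  "!!z. z:CS ==> M' (rh z) = (if z:set ?cs then eval b (?g z) (M o rh) else M (rh z))"
  using exec_pas[of ?cs ?g M env s thesis] M unfolding answer_def by blast
 have one: "1 mod 2 ^ bg_w b = (1::nat)" using w0 by simp
 have c: "eval b ?c (M o rh) = 0 <-> ks u~=None & \<not> prefix u tg"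
  using EV_cell[OF M, of "Cu Ok"] ok eval_prefx[OF M id]
  by (auto simp: eval_bool[OF wb w0] simp del: eval.simps)
 have AR: "eval b (EV (AR y)) (M o rh) = M0 y" if "y < R" for y
  using EV_cell[OF M, of "AR y"] M0 that by (simp add: rh_AR del: eval.simps)
 have a: "M' y = (if prefix u tg then M0(r := 0)
    else case ks u of None=>M0(r := 0)
    | Some pl=>store_words r (1 # map (%e. eval b e (venv ch u [] (%_. 0) pl)) (re (length u))) M0) y"
  if y: "y < R" for y
 proof (cases "r<=y & y < r + 1 + ml")
  case False
  hence "M' y = M0 y" using M'(3)[of "AR y"] y M0 unfolding set by (auto simp: rh_AR)
  moreover have "length (re (length u))<=ml" by (rule ml)
  ultimately show ?thesis using False by (auto simp: store_words_def split: option.split)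
 next
  case True
  hence y1: "M' y = eval b (?g (AR y)) (M o rh)" using M'(3)[of "AR y"] y unfolding set by (auto simp: rh_AR)
  show ?thesis
  proof (cases "ks u~=None & \<not> prefix u tg")
   case False
   thus ?thesis using y1 c AR[OF y] True
    by (auto split: option.split simp del: eval.simps(2))
  next
   case t: True
   then obtain pl' where pl': "ks u = Some pl'" by auto
   have v: "valid_id p d u" using ok(2) pl' by auto
   show ?thesis
   proof (cases "y = r")
    case True
    thus ?thesis using y1 c t pl' one by (simp add: store_words_def)
   next
    case False
    let ?j = "y - r - 1"
    have "M' y = eval b (by_level (?E y)) (M o rh)" using y1 c t False by simp
    also have "... = eval b (?E y (length u)) (M o rh)"
     using v by (intro eval_by_level[OF M id]) (auto simp: valid_id_def)
    also have "... = (if ?j < length (re (length u)) then eval b (re (length u) ! ?j) (venv ch u [] (%_. 0) pl') else M0 y)"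
    proof (cases "?j < length (re (length u))")
     case True
     have "eval b (map_ex vcell (re (length u) ! ?j)) (M o rh) = eval b (re (length u) ! ?j) (venv ch u [] (%_. 0) pl')"
      by (rule eval_vcell[OF M id re[OF nth_mem[OF True]]]) (use ch pl[OF pl'] in auto)
     thus ?thesis using True by simp
    next
     case False
     thus ?thesis using AR[OF y] by (simp del: eval.simps(2))
    qed
    also have "... = store_words r (1 # map (%e. eval b e (venv ch u [] (%_. 0) pl')) (re (length u))) M0 y"
     using False True by (auto simp: store_words_def nth_Cons' simp flip: diff_diff_left)
    finally show ?thesis using t pl' by simp
   qed
  qed
 qed
 have e: "M' (rh z) = M (rh z)" if "z:CS" "!!y. z~=AR y" for z
  using M'(3)[of z] that unfolding set by auto
 show ?thesis by (rule that[OF M'(1,2) a e])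
qed

lemma exec_draw:
 assumes M: "words_ok M"
 shows "rel_pmf (%x rv. snd x = s & words_ok (fst x) & (ALL r:set Rn. fst x (rh (Om r)) = rv r) &
   (ALL z:CS. (ALL r. z~=Om r) --> fst x (rh z) = M (rh z)))
  (exec b env draw (M,s)) (Pi_pmf (set Rn) 0 (%_. unif p))"
proof -
 have inj: "inj_on rh CS" and less: "!!c. c:CS ==> rh c < T"
  using rh_inj rh_T unfolding CS_def by auto
 let ?rh = "%r. rh (Om r)"
 have "distinct (map ?rh Rn)"
  using dR by (auto simp: distinct_map intro!: inj_onI dest!: inj_onD[OF inj])
 hence "rel_pmf (%x rv. snd x = s & (ALL c:set Rn. fst x (?rh c) = rv c) &
      (ALL r. r~=T --> r ~: ?rh ` set Rn --> fst x r = M r))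
  (exec b env (sample_all p (map ?rh Rn) T) (M,s)) (Pi_pmf (set Rn) 0 (%_. unif p))" (is "rel_pmf ?R _ _")
  using less p1 pw by (intro exec_sample_all) auto
 hence rel: "rel_pmf ?R (exec b env draw (M,s)) (Pi_pmf (set Rn) 0 (%_. unif p))"
  by (simp add: draw_def o_def)
 show ?thesis
 proof (rule pmf.rel_mono_strong[OF rel])
  fix x rv assume R: "?R x rv" and rv: "rv:set_pmf (Pi_pmf (set Rn) 0 (%_. unif p))"
  have fr: "fst x (rh z) = M (rh z)" if "z:CS" "ALL r. z~=Om r" for z
  proof -
   have "rh z~=T" using less[OF that(1)] by simp
   moreover have "rh z ~: ?rh ` set Rn"
   proof
    assume "rh z:?rh ` set Rn"
    then obtain r where "r:set Rn" "rh z = rh (Om r)" by blast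
    thus False using inj_onD[OF inj, of z "Om r"] that by auto
   qed
   ultimately show ?thesis using R by simp
  qed
  have "rv r < p" if "r:set Rn" for r
   using rv that p1 by (auto simp: set_Pi_pmf PiE_dflt_def unif_def)
  hence om: "fst x (rh (Om r)) < 2 ^ bg_w b" if "r:set Rn" for r
   using R that pw by (metis order_less_trans)
  have "fst x (rh z) < 2 ^ bg_w b" if z: "z:CS" for z
  proof (cases "EX r. z = Om r")
   case True
   thus ?thesis using om z by auto
  next
   case False
   thus ?thesis using fr[OF z] M z by (auto simp: words_ok_def)
  qed
  hence "words_ok (fst x)" by (simp add: words_ok_def)
  thus "snd x = s & words_ok (fst x) & (ALL r:set Rn. fst x (rh (Om r)) = rv r) &
   (ALL z:CS. (ALL r. z~=Om r) --> fst x (rh z) = M (rh z))" using R fr by auto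
 qed
qed

end

context simulator
begin

lemma id_at_frame_Cu:
 "id_at M Cu u ==> (!!z. z:CS ==> ALL r. z~=Om r ==> M' (rh z) = M (rh z)) ==> id_at M' Cu u"
 by (rule id_at_frame) auto

text \<open>One step of the simulation. A handler stores at most one further key, whence
  \<open>Suc k\<close>.\<close>

lemma rel_handler:
 assumes sim: "simrel k M x" and q: "query_ok q" and k: "k < N"
 shows "rel_pmf (%y. simrel (Suc k) (fst y)) (exec b env (handler q) (M,t)) (senv q x)"
proof -
 obtain M0 s where x: "x = (M0,s)" by fastforce
 from sim x obtain es where M: "words_ok M" "ALL r<R. M r = M0 r" "ALL j<nc. M (rh (Chl j)) = ch j"
  and es: "slots M es" "length es<=k" "s = map_of es"
  unfolding simrel_def by auto
 have simI: "simrel (Suc k) M' (M0',s')"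
  if "words_ok M'" "!!r. r < R ==> M' r = M0' r" "!!j. j < nc ==> M' (rh (Chl j)) = ch j"
   "slots M' es'" "length es'<=Suc k" "s' = map_of es'" for M' M0' s' es'
  using that unfolding simrel_def by auto
 have AR: "M' r = M'' r" if "M' (rh (AR r)) = M'' (rh (AR r))" for M' M'' :: mem and r
  using that by (simp add: rh_AR)
 show ?thesis
 proof (cases q)
  case (Create_Key a)
  let ?u = "read_ident 2 M0 a"
  let ?pl = "%rv i. if i:set Il then eval b (ce (length ?u) i) (venv ch ?u [] rv (%_. 0)) else 0"
  let ?G = "%rv. (M0,if valid_id p d ?u then s(?u \<mapsto> ?pl rv) else s)"
  have R: "a + 3 + 2 * d<=R" "a + 2<=R" using q Create_Key by auto
  have u2: "ALL y:set ?u. length y = 2" using read_ident_nth(3) by blast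
  obtain M1 where 1: "exec b env (load a a) (M,t) = return_pmf (M1,t)" "words_ok M1"
   "id_at M1 Cu ?u"
   "!!z. z:CS ==> (!!f. z~=Cu f) ==> (!!k. z~=Xc k) ==> M1 (rh z) = M (rh z)"
   using exec_load[OF M(1,2) R, of env t] by metis
  have "rel_pmf (%y. simrel (Suc k) (fst y))
    (bind_pmf (exec b env draw (M1,t)) (exec b env (Seq new_key push_key)))
    (bind_pmf (Pi_pmf (set Rn) 0 (%_. unif p)) (%rv. return_pmf (?G rv)))"
  proof (rule rel_pmf_bindI[OF exec_draw[OF 1(2)]])
   fix y rv
   assume y: "snd y = t & words_ok (fst y) & (ALL r:set Rn. fst y (rh (Om r)) = rv r) &
    (ALL z:CS. (ALL r. z~=Om r) --> fst y (rh z) = M1 (rh z))"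
   obtain M2 where y2: "y = (M2,t)" using y by (cases y) auto
   have 2: "words_ok M2" "!!r. r:set Rn ==> M2 (rh (Om r)) = rv r"
    "!!z. z:CS ==> ALL r. z~=Om r ==> M2 (rh z) = M1 (rh z)"
    using y y2 by auto
   have id2: "id_at M2 Cu ?u" by (rule id_at_frame_Cu[OF 1(3)]) (use 2 in auto)
   have ch2: "ALL j<nc. M2 (rh (Chl j)) = ch j" using 2(3) 1(4) M(3) by simp
   obtain M3 where 3: "exec b env new_key (M2,t) = return_pmf (M3,t)" "words_ok M3"
    "M3 (rh (Nw Ok)) = of_bool (valid_id p d ?u)" "id_at M3 Nw ?u"
    "!!i. valid_id p d ?u ==> i:set Il ==>
      M3 (rh (Nw (Py i))) = eval b (ce (length ?u) i) (venv ch ?u [] rv (%_. 0))"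
    "!!z. z:CS ==> (!!f. z~=Nw f) ==> M3 (rh z) = M2 (rh z)"
    using exec_new_key[OF 2(1) id2 u2 ch2 2(2), where env = env and s = t] by metis
   have fr: "M3 (rh z) = M (rh z)" if "z:CS" "(EX r. z = AR r) \<or> (EX j. z = Chl j) \<or> (EX t f. z = Sl t f)" for z
    using 3(6)[of z] 2(3)[of z] 1(4)[of z] that by auto
   have sl3: "slots M3 es" by (rule slots_frame[OF es(1)]) (use fr in auto)
   have es': "length es < N" using es(2) k by simp
   obtain M4 where 4: "exec b env push_key (M3,t) = return_pmf (M4,t)" "words_ok M4"
    "M3 (rh (Nw Ok)) = 0 ==> slots M4 es"
    "!!u pl. M3 (rh (Nw Ok)) = 1 ==> id_at M3 Nw u ==> valid_id p d u ==>
      (!!i. i:set Il ==> M3 (rh (Nw (Py i))) = pl i) ==> (!!i. i ~: set Il ==> pl i = 0) ==>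
      slots M4 ((u,pl) # es)"
    "!!z. z:CS ==> (!!t f. z~=Sl t f) ==> M4 (rh z) = M3 (rh z)"
    by (rule exec_push[OF 3(2) sl3 es', where env = env and s = t])
     (rule that, assumption, assumption, blast, blast, blast)
   have "M4 r = M0 r" if "r < R" for r
    using 4(5)[of "AR r"] fr[of "AR r"] M(2) that by (auto simp: rh_AR)
   moreover have "M4 (rh (Chl j)) = ch j" if "j < nc" for j
    using 4(5)[of "Chl j"] fr[of "Chl j"] M(3) that by auto
   ultimately have "simrel (Suc k) M4 (?G rv)"
   proof (cases "valid_id p d ?u")
    case True
    have "slots M4 ((?u,?pl rv) # es)"
     by (rule 4(4)) (use 3 True in auto)
    thus ?thesis using simI[of M4 M0 "(?u,?pl rv) # es"] 4(2) es True
     \<open>!!r. r < R ==> M4 r = M0 r\<close> \<open>!!j. j < nc ==> M4 (rh (Chl j)) = ch j\<close> by auto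
   next
    case False
    hence "slots M4 es" by (intro 4(3)) (simp add: 3)
    thus ?thesis using simI[of M4 M0 es] 4(2) es False
     \<open>!!r. r < R ==> M4 r = M0 r\<close> \<open>!!j. j < nc ==> M4 (rh (Chl j)) = ch j\<close> by auto
   qed
   thus "rel_pmf (%y. simrel (Suc k) (fst y)) (exec b env (Seq new_key push_key) y) (return_pmf (?G rv))"
    unfolding y2 exec.simps(3) 3(1) bind_return_pmf 4(1) by simp
  qed
  moreover have "senv q x = bind_pmf (Pi_pmf (set Rn) 0 (%_. unif p)) (%rv. return_pmf (?G rv))"
   by (simp add: senv_def Create_Key x Let_def map_pmf_def)
  moreover have "exec b env (handler q) (M,t) =
    bind_pmf (exec b env draw (M1,t)) (exec b env (Seq new_key push_key))"
   unfolding Create_Key handler.simps exec.simps(3) 1(1) bind_return_pmf ..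
  ultimately show ?thesis by simp
 next
  case (Create_Delegated_Key a c)
  let ?u = "read_ident 2 M0 a" and ?v = "read_words 2 M0 c"
  let ?pl = "%pl rv i. if i:set Il then eval b (de (length ?u) i) (venv ch ?u ?v rv pl) else 0"
  let ?G = "%rv. (M0,case s ?u of None=>s | Some pl =>
    if valid_id p d (?u @ [?v]) then s(?u @ [?v] \<mapsto> ?pl pl rv) else s)"
  have R: "a + 3 + 2 * d<=R" "c + 2<=R" using q Create_Delegated_Key by auto
  have u2: "ALL y:set ?u. length y = 2" using read_ident_nth(3) by blast
  have v2: "length ?v = 2" "!!k. k < 2 ==> ?v ! k = M0 (c + k)" by (auto simp: read_words_def two)
  obtain M1 where 1: "exec b env (load a c) (M,t) = return_pmf (M1,t)" "words_ok M1"
   "id_at M1 Cu ?u" "!!k. k < 2 ==> M1 (rh (Xc k)) = M0 (c + k)"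
   "!!z. z:CS ==> (!!f. z~=Cu f) ==> (!!k. z~=Xc k) ==> M1 (rh z) = M (rh z)"
   using exec_load[OF M(1,2) R, of env t] by metis
  have sl1: "slots M1 es" by (rule slots_frame[OF es(1)]) (use 1(5) in auto)
  obtain M2 where 2: "exec b env find_key (M1,t) = return_pmf (M2,t)" "words_ok M2" "id_at M2 Cu ?u"
   "M2 (rh (Cu Ok)) = of_bool (map_of es ?u~=None)"
   "!!pl i. map_of es ?u = Some pl ==> i:set Il ==> M2 (rh (Cu (Py i))) = pl i"
   "!!z. z:CS ==> (!!f. z~=Cu f) ==> M2 (rh z) = M1 (rh z)"
   using exec_find[OF 1(2) sl1 1(3) u2, of env t] by metis
  have "rel_pmf (%y. simrel (Suc k) (fst y))
    (bind_pmf (exec b env draw (M2,t)) (exec b env (Seq new_delegated_key push_key)))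
    (bind_pmf (Pi_pmf (set Rn) 0 (%_. unif p)) (%rv. return_pmf (?G rv)))"
  proof (rule rel_pmf_bindI[OF exec_draw[OF 2(2)]])
   fix y rv
   assume y: "snd y = t & words_ok (fst y) & (ALL r:set Rn. fst y (rh (Om r)) = rv r) &
    (ALL z:CS. (ALL r. z~=Om r) --> fst y (rh z) = M2 (rh z))"
   obtain M3 where y3: "y = (M3,t)" using y by (cases y) auto
   have 3: "words_ok M3" "!!r. r:set Rn ==> M3 (rh (Om r)) = rv r"
    "!!z. z:CS ==> ALL r. z~=Om r ==> M3 (rh z) = M2 (rh z)"
    using y y3 by auto
   have id3: "id_at M3 Cu ?u" by (rule id_at_frame_Cu[OF 2(3)]) (use 3 in auto)
   have ch3: "ALL j<nc. M3 (rh (Chl j)) = ch j" using 3(3) 2(6) 1(5) M(3) by simp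
   have x3: "M3 (rh (Xc k)) = ?v ! k" if "k < 2" for k using 3(3) 2(6) 1(4) v2 that by simp
   have ok3: "M3 (rh (Cu Ok)) = of_bool (s ?u~=None)" using 3(3) 2(4) es(3) by simp
   have vs: "s ?u = Some pl ==> valid_id p d ?u" for pl using slots_valid[OF es(1)] es(3) by auto
   have pl3: "M3 (rh (Cu (Py i))) = pl i" if "s ?u = Some pl" "i:set Il" for pl i
    using 3(3) 2(5) that es(3) by auto
   obtain M4 where 4: "exec b env new_delegated_key (M3,t) = return_pmf (M4,t)" "words_ok M4"
    "M4 (rh (Nw Ok)) = of_bool (s ?u~=None & valid_id p d (?u @ [?v]))"
    "valid_id p d (?u @ [?v]) ==> id_at M4 Nw (?u @ [?v])"
    "!!i pl. valid_id p d (?u @ [?v]) ==> s ?u = Some pl ==> i:set Il ==>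
      M4 (rh (Nw (Py i))) = eval b (de (length ?u) i) (venv ch ?u ?v rv pl)"
    "!!z. z:CS ==> (!!f. z~=Nw f) ==> M4 (rh z) = M3 (rh z)"
    apply (rule exec_new_delegated_key[where M = M3 and u = ?u and x = ?v and rv = rv and ks = s
      and env = env and s = t])
    apply (rule 3(1))
    apply (rule id3)
    apply (rule u2)
    apply (rule ch3)
    apply (rule 3(2), assumption)
    apply (rule x3, assumption)
    apply (rule v2(1))
    apply (rule ok3)
    apply (rule vs, assumption)
    apply (rule pl3, assumption, assumption)
    by (rule that, assumption, assumption, assumption, blast, blast, blast)
   have fr: "M4 (rh z) = M (rh z)" if "z:CS" "(EX r. z = AR r) \<or> (EX j. z = Chl j) \<or> (EX t f. z = Sl t f)" for z
    using 4(6)[of z] 3(3)[of z] 2(6)[of z] 1(5)[of z] that by auto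
   have sl4: "slots M4 es" by (rule slots_frame[OF es(1)]) (use fr in auto)
   have es': "length es < N" using es(2) k by simp
   obtain M5 where 5: "exec b env push_key (M4,t) = return_pmf (M5,t)" "words_ok M5"
    "M4 (rh (Nw Ok)) = 0 ==> slots M5 es"
    "!!u pl. M4 (rh (Nw Ok)) = 1 ==> id_at M4 Nw u ==> valid_id p d u ==>
      (!!i. i:set Il ==> M4 (rh (Nw (Py i))) = pl i) ==> (!!i. i ~: set Il ==> pl i = 0) ==>
      slots M5 ((u,pl) # es)"
    "!!z. z:CS ==> (!!t f. z~=Sl t f) ==> M5 (rh z) = M4 (rh z)"
    by (rule exec_push[OF 4(2) sl4 es', where env = env and s = t])
     (rule that, assumption, assumption, blast, blast, blast)
   have A: "M5 r = M0 r" if "r < R" for r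
    using 5(5)[of "AR r"] fr[of "AR r"] M(2) that by (auto simp: rh_AR)
   have C: "M5 (rh (Chl j)) = ch j" if "j < nc" for j
    using 5(5)[of "Chl j"] fr[of "Chl j"] M(3) that by auto
   have "simrel (Suc k) M5 (?G rv)"
   proof (cases "s ?u~=None & valid_id p d (?u @ [?v])")
    case True
    then obtain pl where pl: "s ?u = Some pl" by auto
    have "slots M5 ((?u @ [?v],?pl pl rv) # es)"
     by (rule 5(4)) (use 4 True pl in auto)
    thus ?thesis using simI[of M5 M0 "(?u @ [?v],?pl pl rv) # es"] 5(2) es True pl A C by auto
   next
    case False
    hence "slots M5 es" by (intro 5(3)) (simp add: 4)
    moreover have "?G rv = (M0,s)" using False by (auto split: option.split)
    ultimately show ?thesis using simI[of M5 M0 es] 5(2) es A C by auto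
   qed
   thus "rel_pmf (%y. simrel (Suc k) (fst y)) (exec b env (Seq new_delegated_key push_key) y) (return_pmf (?G rv))"
    unfolding y3 exec.simps(3) 4(1) bind_return_pmf 5(1) by simp
  qed
  moreover have "senv q x = bind_pmf (Pi_pmf (set Rn) 0 (%_. unif p)) (%rv. return_pmf (?G rv))"
   by (simp add: senv_def Create_Delegated_Key x Let_def map_pmf_def split: option.split)
  moreover have "exec b env (handler q) (M,t) =
    bind_pmf (exec b env draw (M2,t)) (exec b env (Seq new_delegated_key push_key))"
   unfolding Create_Delegated_Key handler.simps exec.simps(3) 1(1) bind_return_pmf 2(1) ..
  ultimately show ?thesis by simp
 next
  case (Reveal_Key a r)
  let ?u = "read_ident 2 M0 a"
  have R: "a + 3 + 2 * d<=R" "a + 2<=R" "r + 1 + ml<=R" using q Reveal_Key by auto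
  have u2: "ALL y:set ?u. length y = 2" using read_ident_nth(3) by blast
  obtain M1 where 1: "exec b env (load a a) (M,t) = return_pmf (M1,t)" "words_ok M1"
   "id_at M1 Cu ?u"
   "!!z. z:CS ==> (!!f. z~=Cu f) ==> (!!k. z~=Xc k) ==> M1 (rh z) = M (rh z)"
   using exec_load[OF M(1,2) R(1,2), of env t] by metis
  have sl1: "slots M1 es" by (rule slots_frame[OF es(1)]) (use 1(4) in auto)
  obtain M2 where 2: "exec b env find_key (M1,t) = return_pmf (M2,t)" "words_ok M2" "id_at M2 Cu ?u"
   "M2 (rh (Cu Ok)) = of_bool (map_of es ?u~=None)"
   "!!pl i. map_of es ?u = Some pl ==> i:set Il ==> M2 (rh (Cu (Py i))) = pl i"
   "!!z. z:CS ==> (!!f. z~=Cu f) ==> M2 (rh z) = M1 (rh z)"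
   using exec_find[OF 1(2) sl1 1(3) u2, of env t] by metis
  have ch2: "ALL j<nc. M2 (rh (Chl j)) = ch j" using 2(6) 1(4) M(3) by simp
  have vs: "s ?u = Some pl ==> valid_id p d ?u" for pl using slots_valid[OF es(1)] es(3) by auto
  have ok2: "M2 (rh (Cu Ok)) = of_bool (s ?u~=None)" using 2(4) es(3) by simp
  have pl2: "M2 (rh (Cu (Py i))) = pl i" if "s ?u = Some pl" "i:set Il" for pl i
   using 2(5) that es(3) by auto
  have A2: "ALL r<R. M2 r = M0 r" using 2(6)[of "AR _"] 1(4)[of "AR _"] M(2) by (auto simp: rh_AR)
  let ?M0 = "if prefix ?u tg then M0(r := 0)
     else case s ?u of None=>M0(r := 0)
     | Some pl=>store_words r (1 # map (%e. eval b e (venv ch ?u [] (%_. 0) pl)) (re (length ?u))) M0"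
  obtain M3 where 3: "exec b env (answer r) (M2,t) = return_pmf (M3,t)" "words_ok M3"
   "!!y. y < R ==> M3 y = ?M0 y"
   "!!z. z:CS ==> (!!y. z~=AR y) ==> M3 (rh z) = M2 (rh z)"
   by (rule exec_answer[where M = M2 and u = ?u and ks = s and env = env and s = t], rule 2(2), rule 2(3), rule ch2,
      rule R(3), rule ok2, rule vs, assumption,
      rule pl2, assumption, assumption, rule A2)
     (rule that, assumption, assumption, blast, blast)
  have fr: "M3 (rh z) = M (rh z)" if "z:CS" "(EX j. z = Chl j) \<or> (EX t f. z = Sl t f)" for z
   using 3(4)[of z] 2(6)[of z] 1(4)[of z] that by auto
  have "slots M3 es" by (rule slots_frame[OF es(1)]) (use fr in auto)
  hence "simrel (Suc k) M3 (?M0,s)"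
   by (intro simI) (use 3 fr M es ch2 in auto)
  moreover have "senv q x = return_pmf (?M0,s)"
   by (simp add: senv_def Reveal_Key x Let_def split: option.split)
  moreover have "exec b env (handler q) (M,t) = return_pmf (M3,t)"
   unfolding Reveal_Key handler.simps exec.simps(3) 1(1) bind_return_pmf 2(1) 3(1) ..
  ultimately show ?thesis by simp
 qed
qed


section \<open>Simulation of whole programs\<close>

fun instr_regs :: "instr=>reg set" where
 "instr_regs (Const r c) = {r}"
| "instr_regs (Arith f r x y) = {r,x,y}"
| "instr_regs (Sample r x) = {r,x}"
| "instr_regs (GMul i r x y) = {r,x,y}"
| "instr_regs (GExp i r x y) = {r,x,y}"
| "instr_regs (Pairing r x y) = {r,x,y}"

primrec com_ok :: "query com=>bool" where
 "com_ok Skip <-> True"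
| "com_ok (Instr i) <-> instr_regs i<={..<R}"
| "com_ok (Seq c c') <-> com_ok c & com_ok c'"
| "com_ok (IfZero r c c') <-> r < R & com_ok c & com_ok c'"
| "com_ok (Ask q) <-> query_ok q"

text \<open>An instruction of the adversary reads and writes below \<open>R\<close>, where the
  memories agree. That both receive the same single write is what \<open>simrel_upd\<close> needs to
  preserve the key table.\<close>

lemma rel_step:
 assumes "ALL r<R. M r = M0 r" "instr_regs i<={..<R}" "ALL r<R. M r < 2 ^ bg_w b"
 shows "rel_pmf (%M' M0'. EX r<R. EX c<2 ^ bg_w b. M' = M(r := c) & M0' = M0(r := c)) (step b i M) (step b i M0)"
proof -
 have car: "x < 2 ^ bg_w b" if "x:carrier (the_grp b i)" for x i
  using wb that by (force simp: word_bgroup_def)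
 have carT: "x < 2 ^ bg_w b" if "x:carrier (bg_T b)" for x
  using car[of x GrpT] that by simp
 have grp: "group (the_grp b i)" for i using wb by (auto simp: word_bgroup_def)
 have mul: "x \<otimes>\<^bsub>the_grp b i\<^esub> y < 2 ^ bg_w b" if "x:carrier (the_grp b i)" "y:carrier (the_grp b i)" for i x y
  using that grp[of i] by (intro car[of _ i]) (meson group.is_monoid monoid.m_closed)
 have pow: "x [^]\<^bsub>the_grp b i\<^esub> (n::nat) < 2 ^ bg_w b" if "x:carrier (the_grp b i)" for i x n
  using that grp[of i] by (intro car[of _ i]) (meson group.is_monoid monoid.nat_pow_closed)
 have up: "EX ra<R. EX c<2 ^ bg_w b. M(r := v) = M(ra := c) & M0(r := v) = M0(ra := c)"
  if "r < R" "v < 2 ^ bg_w b" for r v using that by blast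
 show ?thesis
 proof (cases i)
  case (Sample r x)
  hence eq: "M x = M0 x" "r < R" "M x < 2 ^ bg_w b" using assms by auto
  show ?thesis
  proof (cases "M x = 0")
   case False
   thus ?thesis using Sample eq
    by (auto simp: unif_def intro!: rel_pmf_map_same up)
  next
   case True
   thus ?thesis using Sample eq by (auto intro!: up)
  qed
 next
  case (Pairing r x y)
  hence "M x = M0 x" "M y = M0 y" "r < R" using assms by auto
  thus ?thesis using Pairing wb carT
   by (auto simp: word_bgroup_def intro!: up)
 next
  case (GMul g r x y)
  hence "M x = M0 x" "M y = M0 y" "r < R" using assms by auto
  thus ?thesis using GMul mul by (auto simp: Let_def intro!: up)
 next
  case (GExp g r x y)
  hence "M x = M0 x" "M y = M0 y" "r < R" using assms by auto
  thus ?thesis using GExp pow by (auto simp: Let_def intro!: up)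
 qed (use assms in "auto intro!: up")
qed

lemma simrel_mono: "simrel k M x ==> k<=l ==> simrel l M x"
 unfolding simrel_def by (meson order_trans)

lemma simrel_upd:
 assumes "simrel k M x" "r < R" "c < 2 ^ bg_w b"
 shows "simrel k (M(r := c)) ((fst x)(r := c),snd x)"
proof -
 have inj: "inj_on rh CS" using rh_inj unfolding CS_def by auto
 have ne: "rh z~=r" if "z:CS" "z~=AR r" for z
  using inj_onD[OF inj, of z "AR r"] that assms(2) by (auto simp: rh_AR)
 have "words_ok (M(r := c))" using assms by (auto simp: words_ok_def simrel_def)
 moreover obtain es where es: "slots M es" "length es<=k" "snd x = map_of es"
  using assms(1) by (auto simp: simrel_def)
 have "slots (M(r := c)) es" by (rule slots_frame[OF es(1)]) (use ne in auto)
 ultimately show ?thesis using assms es ne by (auto simp: simrel_def)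
qed

lemma rel_sim_com:
 assumes "com_ok c" "simrel k M x" "k + num_queries c<=N"
 shows "rel_pmf (%y. simrel (k + num_queries c) (fst y)) (exec b env (sim_com c) (M,t)) (exec b senv c x)"
 using assms
proof (induction c arbitrary: k M x t)
 case (Instr i)
 hence "ALL r<R. M r = fst x r" "ALL r<R. M r < 2 ^ bg_w b"
  using rh_AR by (auto simp: simrel_def words_ok_def Ball_def) (metis CS_simps(1) rh_AR)
 hence "rel_pmf (%M' M0'. EX r<R. EX c<2 ^ bg_w b. M' = M(r := c) & M0' = (fst x)(r := c))
   (step b i M) (step b i (fst x))"
  using Instr.prems by (intro rel_step) auto
 thus ?case
  using simrel_upd[OF Instr.prems(2)] by (auto simp: pmf.rel_map elim!: pmf.rel_mono_strong)
next
 case (Seq c1 c2)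
 have "rel_pmf (%y. simrel (k + num_queries c1) (fst y)) (exec b env (sim_com c1) (M,t)) (exec b senv c1 x)"
  using Seq.prems by (intro Seq.IH(1)) auto
 moreover have "rel_pmf (%y. simrel (k + num_queries (Seq c1 c2)) (fst y))
   (exec b env (sim_com c2) y) (exec b senv c2 x')" if "simrel (k + num_queries c1) (fst y) x'" for y x'
  using Seq.IH(2)[of "k + num_queries c1" "fst y" x' "snd y"] Seq.prems that by (simp add: add.assoc)
 ultimately show ?case unfolding sim_com.simps exec.simps by (rule rel_pmf_bindI)
next
 case (IfZero r c1 c2)
 have "M r = fst x r" using IfZero.prems by (auto simp: simrel_def)
 moreover have "rel_pmf (%y. simrel (k + num_queries (IfZero r c1 c2)) (fst y)) (exec b env (sim_com c1) (M,t)) (exec b senv c1 x)"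
  by (rule pmf.rel_mono_strong[OF IfZero.IH(1)[of k M x t]]) (use IfZero.prems simrel_mono in auto)
 moreover have "rel_pmf (%y. simrel (k + num_queries (IfZero r c1 c2)) (fst y)) (exec b env (sim_com c2) (M,t)) (exec b senv c2 x)"
  by (rule pmf.rel_mono_strong[OF IfZero.IH(2)[of k M x t]]) (use IfZero.prems simrel_mono in auto)
 ultimately show ?case by simp
next
 case (Ask q)
 thus ?case using rel_handler[of k M x q env t] by simp
qed simp


subsection \<open>Cost of the simulation\<close>

definition handler_bound :: "nat=>nat" where
 "handler_bound K = 500 * ((K + 1) * (d + 1) ^ 2 * (N + 1) * (length Il + length Rn + ml + 1))"

lemma length_pairs: "length [f i k. i \<leftarrow> [0..<d],k \<leftarrow> [0..<2]] = 2 * d"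
 by (simp add: length_concat o_def sum_list_triv)

lemma cost_load: "cost (load a c :: 'q com)<=(2 * d + 3) * 13"
proof -
 have "cost (load a c :: 'q com)<=length (Cu Ln # [Cu (Idc i k). i \<leftarrow> [0..<d],k \<leftarrow> [0..<2]] @ map Xc [0..<2] :: ('i,'r) cell list) * (11 + 2)"
  unfolding load_def by (rule cost_pas) auto
 thus ?thesis by (simp add: length_pairs)
qed

lemma cost_find_key: "cost (find_key :: 'q com)<=(length Il + 1) * (N * (26 * d + 24) + 3)"
proof -
 have m: "esize (matchx t)<=26 * d + 14" for t
 proof -
  let ?xs = "eqx (EV (Sl t Ln)) (EV (Cu Ln)) #
   [eqx (EV (Sl t (Idc i k))) (EV (Cu (Idc i k))). i \<leftarrow> [0..<d],k \<leftarrow> [0..<2]] :: ('i,'r) cell ex list"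
  have "esize (allx ?xs)<=length ?xs * (11 + 2) + 1" by (rule esize_allx) auto
  thus ?thesis by (simp add: length_pairs matchx_def)
 qed
 have l: "esize (lookx ts f)<=length ts * (26 * d + 24) + 1" for ts f
 proof (induction ts)
  case (Cons t ts)
  thus ?case using m[of t] by (simp add: lookx_def)
 qed (simp add: lookx_def)
 have "cost (find_key :: 'q com)<=length (map Cu (Ok # map Py Il) :: ('i,'r) cell list) * (N * (26 * d + 24) + 1 + 2)"
  unfolding find_key_def by (rule cost_pas) (use l[of "[0..<N]"] in auto)
 thus ?thesis by (simp add: algebra_simps)
qed

lemma esize_by_level:
 "(!!l. esize (E l)<=K) ==> esize (by_level E)<=d * (K + 10) + 1"
 using esize_selx[of "[1..<d + 1]" E K "EV (Cu Ln)"] by (simp add: by_level_def add.commute del: upt_Suc)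

lemma cost_new_key:
 assumes "!!l i. esize (ce l i)<=K"
 shows "cost (new_key :: 'q com)<=(2 + 2 * d + length Il) * (44 * d + 93 + d * (K + 10) + 2)"
proof -
 let ?xs = "[ltx (EC 0) (EV (Cu Ln)),notx (ltx (EC d) (EV (Cu Ln)))] @
   map (%i. orx (notx (ltx (EC i) (EV (Cu Ln))))
    (allx [eqx (EV (Cu (Idc i 0))) (EC 1),ltx (EC 0) (EV (Cu (Idc i 1))),ltx (EV (Cu (Idc i 1))) (EC p)])) [0..<d]
   :: ('i,'r) cell ex list"
 have "esize (allx ?xs)<=length ?xs * (42 + 2) + 1" by (rule esize_allx) auto
 hence v: "esize validx<=44 * d + 89" by (simp add: validx_def)
 have l: "esize (by_level (%l. map_ex vcell (ce l i)))<=44 * d + 93 + d * (K + 10)" for i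
  by (rule order.trans[OF esize_by_level[where K = K]]) (simp_all add: assms)
 have "cost (new_key :: 'q com)<=length (map Nw flds :: ('i,'r) cell list) * (44 * d + 93 + d * (K + 10) + 2)"
  unfolding new_key_def by (rule cost_pas) (use v in "auto simp: set_flds intro: l")
 thus ?thesis by (simp add: length_flds)
qed

lemma cost_new_delegated_key:
 assumes "!!l i. esize (de l i)<=K"
 shows "cost (new_delegated_key :: 'q com)<=(2 + 2 * d + length Il) * (44 * d + 93 + d * (K + 10) + 2)"
proof -
 have l: "esize (by_level (%l. map_ex vcell (de l i)))<=44 * d + 93 + d * (K + 10)" for i
  by (rule order.trans[OF esize_by_level[where K = K]]) (simp_all add: assms)
 have "cost (new_delegated_key :: 'q com)<=length (map Nw flds :: ('i,'r) cell list) * (44 * d + 93 + d * (K + 10) + 2)"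
  unfolding new_delegated_key_def
  by (rule cost_pas) (auto simp: set_flds intro: l)
 thus ?thesis by (simp add: length_flds)
qed

lemma cost_push_key: "cost (push_key :: 'q com)<=N * (2 + 2 * d + length Il) * 9"
proof -
 have len: "length ([Sl t f. t \<leftarrow> [0..<N],f \<leftarrow> flds] :: ('i,'r) cell list) = N * length flds"
  by (simp add: length_concat o_def sum_list_triv)
 have "cost (push_key :: 'q com)<=length ([Sl t f. t \<leftarrow> [0..<N],f \<leftarrow> flds] :: ('i,'r) cell list) * (7 + 2)"
  unfolding push_key_def by (rule cost_pas) auto
 thus ?thesis using len by (simp add: length_flds)
qed

lemma cost_answer:
 assumes "!!l e. e:set (re l) ==> esize e<=K"
 shows "cost (answer r :: 'q com)<=(ml + 1) * (23 * d + 40 + d * (K + 12) + 2)"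
proof -
 let ?xs = "ltx (EV (Cu Ln)) (EC (length tg + 1)) #
   map (%i. orx (notx (ltx (EC i) (EV (Cu Ln)))) (eqx (EV (Cu (Idc i 1))) (EC (tg ! i ! 1)))) [0..<length tg]
   :: ('i,'r) cell ex list"
 have "esize (allx ?xs)<=length ?xs * (21 + 2) + 1" by (rule esize_allx) auto
 hence v: "esize prefx<=23 * d + 24" using tg by (simp add: prefx_def valid_id_def)
 have l: "esize (by_level (%l. if y - r - 1 < length (re l) then map_ex vcell (re l ! (y - r - 1)) else EV (AR y)))
   <=d * (K + 2 + 10) + 1" for y
  by (rule esize_by_level) (use assms[OF nth_mem] in "fastforce intro: le_SucI")
 have "cost (answer r :: 'q com)<=length (map AR [r..<r + 1 + ml] :: ('i,'r) cell list) * (23 * d + 40 + d * (K + 12) + 2)"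
  unfolding answer_def
 proof (rule cost_pas)
  fix c :: "('i,'r) cell" assume "c:set (map AR [r..<r + 1 + ml])"
  then obtain y where "c = AR y" by auto
  thus "esize (case c of
   AR y=>EI (andx (notx (EV (Cu Ok))) (notx prefx))
     (if y = r then EC 1 else by_level (%l. if y - r - 1 < length (re l) then map_ex vcell (re l ! (y - r - 1)) else EV (AR y)))
     (if y = r then EC 0 else EV (AR y)) | _=>EC 0)<=23 * d + 40 + d * (K + 12)"
   using v l[of y] by (auto simp: add.commute)
 qed
 thus ?thesis by (simp add: add.commute)
qed

text \<open>All four parameters are made at least 1, whereupon the cost of each building block is a
  constant multiple of the one monomial \<open>P\<close>.\<close>

lemma cost_handler:
 assumes "!!l i. esize (ce l i)<=K" "!!l i. esize (de l i)<=K" "!!l e. e:set (re l) ==> esize e<=K"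
 shows "cost (handler q :: 'q com)<=handler_bound K"
proof -
 define a n m k where "a = d + 1" "n = N + 1" "m = length Il + length Rn + ml + 1" "k = K + 1"
 define P where "P = k * a ^ 2 * n * m"
 have ge: "1<=a" "1<=n" "1<=m" "1<=k" by (auto simp: a_n_m_k_def)
 have mono: "x1 * x2 * x3 * x4<=y1 * y2 * y3 * y4" if "x1<=y1" "x2<=y2" "x3<=y3" "x4<=y4"
  for x1 x2 x3 x4 y1 y2 y3 y4 :: nat
  using that by (intro mult_le_mono)
 have aa: "a<=a ^ 2" using ge by (simp add: power2_eq_square)
 have P1: "a<=P" "n * a * m<=P" "m<=P" "k * a ^ 2 * m<=P"
  using mono[of 1 k a "a ^ 2" 1 n 1 m] mono[of 1 k a "a ^ 2" n n m m] mono[of 1 k 1 "a ^ 2" 1 n m m]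
   mono[of k k "a ^ 2" "a ^ 2" 1 n m m] ge aa
  unfolding P_def by (auto simp: mult_ac)
 have b1: "cost (load x c :: 'q com)<=39 * P" for x c
 proof -
  have "cost (load x c :: 'q com)<=39 * a" using cost_load[of x c, where 'q = 'q] by (simp add: a_n_m_k_def)
  thus ?thesis using P1(1) by linarith
 qed
 have b2: "cost (find_key :: 'q com)<=29 * P"
 proof -
  have "cost (find_key :: 'q com)<=m * (n * (26 * a) + 3)"
   by (rule order.trans[OF cost_find_key], intro mult_le_mono add_le_mono) (auto simp: a_n_m_k_def)
  also have "... = 26 * (n * a * m) + 3 * m" by (simp add: algebra_simps)
  finally show ?thesis using P1(2,3) by linarith
 qed
 have b3: "cost (draw :: 'q com)<=2 * P" using P1(3) by (simp add: draw_def cost_sample_all a_n_m_k_def)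
 have f: "2 + 2 * d + length Il<=3 * (a * m)"
 proof -
  have "2 + 2 * d + length Il<=2 * a + m" by (simp add: a_n_m_k_def)
  moreover have "a<=a * m" "m<=a * m" using ge by auto
  ultimately show ?thesis by linarith
 qed
 have g: "44 * d + 93 + d * (K + 10) + 2<=124 * (a * k)"
 proof -
  have "44 * d + 93 + d * (K + 10) + 2<=54 * a + 60 * a + a * k"
   by (simp add: a_n_m_k_def algebra_simps)
  moreover have "a<=a * k" using ge by auto
  ultimately show ?thesis by linarith
 qed
 have new: "(2 + 2 * d + length Il) * (44 * d + 93 + d * (K + 10) + 2)<=372 * P"
 proof -
  have "(2 + 2 * d + length Il) * (44 * d + 93 + d * (K + 10) + 2)<=3 * (a * m) * (124 * (a * k))"
   by (intro mult_le_mono f g)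
  also have "... = 372 * (k * a ^ 2 * m)" by (simp add: power2_eq_square algebra_simps)
  finally show ?thesis using P1(4) by linarith
 qed
 have b6: "cost (push_key :: 'q com)<=27 * P"
 proof -
  have "cost (push_key :: 'q com)<=n * (3 * (a * m)) * 9"
   by (rule order.trans[OF cost_push_key], intro mult_le_mono f) (auto simp: a_n_m_k_def)
  also have "... = 27 * (n * a * m)" by (simp add: algebra_simps)
  finally show ?thesis using P1(2) by linarith
 qed
 have b7: "cost (answer r :: 'q com)<=100 * P" for r
 proof -
  have "23 * d + 40 + d * (K + 12) + 2<=35 * a + 42 * a + a * k"
   by (simp add: a_n_m_k_def algebra_simps)
  moreover have "a<=a * k" using ge by auto
  ultimately have "23 * d + 40 + d * (K + 12) + 2<=78 * (a * k)" by linarith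
  hence "cost (answer r :: 'q com)<=m * (78 * (a * k))"
   by (intro order.trans[OF cost_answer[OF assms(3)]] mult_le_mono) (auto simp: a_n_m_k_def)
  also have "... = 78 * (k * a * m)" by (simp add: algebra_simps)
  also have "...<=78 * (k * a ^ 2 * m)" using aa by (intro mult_le_mono) auto
  finally show ?thesis using P1(4) by linarith
 qed
 \<comment> \<open>The most expensive handler is that of a delegation: 39 + 29 + 2 + 372 + 27 =
   469.\<close>
 have "handler_bound K = 500 * P" unfolding handler_bound_def P_def a_n_m_k_def by simp
 thus ?thesis
 proof (cases q)
  case (Create_Key x)
  thus ?thesis
   using b1[of x x] b3 b6 order.trans[OF cost_new_key[OF assms(1), where 'q = 'q] new] \<open>handler_bound K = 500 * P\<close> by simp
 next
  case (Create_Delegated_Key x c)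
  thus ?thesis
   using b1[of x c] b2 b3 b6 order.trans[OF cost_new_delegated_key[OF assms(2), where 'q = 'q] new] \<open>handler_bound K = 500 * P\<close> by simp
 next
  case (Reveal_Key x r)
  thus ?thesis using b1[of x x] b2 b7[of r] \<open>handler_bound K = 500 * P\<close> by simp
 qed
qed

lemma cost_sim_com:
 assumes "!!l i. esize (ce l i)<=K" "!!l i. esize (de l i)<=K" "!!l e. e:set (re l) ==> esize e<=K"
 shows "cost (sim_com c :: 'q com)<=cost c + num_queries c * handler_bound K"
proof (induction c)
 case (Ask q)
 have "cost (handler q :: 'q com)<=handler_bound K" by (rule cost_handler[OF assms])
 thus ?case by simp
qed (auto simp: algebra_simps)

end

section \<open>Groups of prime order\<close>

locale prime_group =
 fixes G :: "nat monoid" (structure) and p :: nat and g :: nat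
 assumes group: "group G" and cyc: "cyclic_group G" and ord_G: "order G = p" and prime_p: "prime p"
  and g: "g:carrier G" and gen: "subgroup_generated G {g} = G"
begin

abbreviation ex :: "int=>nat" where "ex k \<equiv> g [^] k"

lemma comm: "comm_group G"
 using group.cyclic_imp_abelian_group[OF group cyc] .

lemma p_gt_1: "1 < p" using prime_p prime_gt_1_nat by blast

lemma ord_g: "group.ord G g = p"
proof -
 have "group.ord G g dvd p" using group.ord_dvd_group_order[OF group g] ord_G by simp
 moreover have "group.ord G g~=1"
 proof
  assume "group.ord G g = 1"
  hence "g = \<one>" using group.ord_eq_1[OF group g] by simp
  have "carrier G = range (%k::int. g [^] k)"
   using group.carrier_subgroup_generated_by_singleton[OF group g] gen by simp
  also have "... = {\<one>}" using \<open>g = \<one>\<close> group by (auto simp: group.int_pow_one)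
  finally have "card (carrier G) = 1" by simp
  thus False using ord_G p_gt_1 by (simp add: order_def)
 qed
 ultimately show ?thesis using prime_p by (meson prime_nat_iff)
qed

lemma ex_closed [simp, intro]: "ex k:carrier G"
 using g group by (simp add: group.int_pow_closed)

lemma ex_eq_iff: "ex k = ex l <-> k mod int p = l mod int p"
 using group.int_pow_eq[OF group g, of k l] ord_g by (simp add: mod_eq_dvd_iff dvd_diff_commute)

lemma ex_mult: "ex k \<otimes> ex l = ex (k + l)"
 using group.int_pow_mult[OF group g] by simp

lemma ex_pow: "ex k [^] (n :: nat) = ex (k * int n)"
 using group.int_pow_pow[OF group g, of k "int n"] by (simp add: int_pow_int)

lemma g_pow: "g [^] (n :: nat) = ex (int n)"
 by (simp add: int_pow_int)

lemma ex_finprod: "finite A ==> (\<Otimes>i\<in>A. ex (f i)) = ex (\<Sum>i\<in>A. f i)"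
proof (induction A rule: finite_induct)
 case empty
 thus ?case using comm by (simp add: comm_group_def comm_monoid.finprod_empty)
next
 case (insert x A)
 thus ?case using comm
  by (simp add: comm_group_def comm_monoid.finprod_insert ex_mult Pi_def)
qed

end

lemma bilinear_groups:
 assumes "bilinear_group b"
 shows "prime_group (bg_G b) (bg_p b) (bg_g b)" "prime_group (bg_H b) (bg_p b) (bg_h b)"
  "word_bgroup b" "1 < bg_p b" "bg_p b < 2 ^ bg_w b" "0 < bg_w b"
proof -
 show pG: "prime_group (bg_G b) (bg_p b) (bg_g b)" and pH: "prime_group (bg_H b) (bg_p b) (bg_h b)"
  using assms by (simp_all add: bilinear_group_def word_group_def prime_group_def)
 show p1: "1 < bg_p b" using assms prime_gt_1_nat[of "bg_p b"] by (simp add: bilinear_group_def)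
 have "bg_p b < bg_p b ^ 2" using p1 by (simp add: power2_eq_square)
 also have "...<=2 ^ bg_w b" using assms by (simp add: bilinear_group_def)
 finally show pw: "bg_p b < 2 ^ bg_w b" .
 show "0 < bg_w b" using p1 pw by (cases "bg_w b") auto
 have "group (the_grp b i) & carrier (the_grp b i)<={..<2 ^ bg_w b}" for i
  using assms by (cases i) (simp_all add: bilinear_group_def word_group_def)
 moreover have "bg_e b x y:carrier (bg_T b)" if "x:carrier (bg_G b)" "y:carrier (bg_H b)" for x y
  using assms that unfolding bilinear_group_def hom_def by blast
 ultimately show "word_bgroup b" by (auto simp: word_bgroup_def)
qed


section \<open>Challengers\<close>

text \<open>The challenger with key generation \<open>K\<close>, delegation \<open>D\<close> and
  transmission \<open>W\<close> left open. The set IS is dropped; it matters for the abort bit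
  only.\<close>

definition kenv :: "nat=>nat=>ident=>(ident=>'k pmf)=>(ident=>'k=>nat list=>'k pmf) =>
  (ident=>'k=>nat list)=>(query,ident=>'k option) env" where
 "kenv p d tg K D W q x = (case x of (M,s)=>(case q of
   Create_Key a =>
    (let u = read_ident 2 M a in
    if valid_id p d u then map_pmf (%k. (M,s(u \<mapsto> k))) (K u) else return_pmf (M,s))
  | Create_Delegated_Key a c =>
    (let u = read_ident 2 M a; v = read_words 2 M c in
    case s u of
     None=>return_pmf (M,s)
    | Some k =>
      if valid_id p d (u @ [v]) then map_pmf (%k'. (M,s(u @ [v] \<mapsto> k'))) (D u k v)
      else return_pmf (M,s))
  | Reveal_Key a r =>
    (let u = read_ident 2 M a in
    if prefix u tg then return_pmf (M(r := 0),s)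
    else case s u of
     None=>return_pmf (M(r := 0),s)
    | Some k=>return_pmf (store_words r (1 # W u k) M,s))))"

text \<open>Stored keys need only be coupled. Equality is demanded of transmitted words, that is for
  identities that are no prefixes of the target, and of nothing at all if the program contains no
  reveal query.\<close>

lemma rel_kenv:
 assumes K: "!!u. valid_id p d u ==> rel_pmf (R u) (K u) (K' u)"
  and D: "!!u v k k'. valid_id p d u ==> valid_id p d (u @ [v]) ==> R u k k' ==>
    rel_pmf (R (u @ [v])) (D u k v) (D' u k' v)"
  and W: "!!u k k'. num_reveals c~=0 ==> valid_id p d u ==> \<not> prefix u tg ==> R u k k' ==> W u k = W' u k'"
 shows "map_pmf fst (exec b (kenv p d tg K D W) c (M,Map.empty)) =
  map_pmf fst (exec b (kenv p d tg K' D' W') c (M,Map.empty))"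
proof -
 let ?S = "%s s'. ALL u. rel_option (R u) (s u) (s' u) & (s u~=None --> valid_id p d u)"
 have upd: "?S (s(u \<mapsto> k)) (s'(u \<mapsto> k'))" if "?S s s'" "valid_id p d u" "R u k k'" for s s' u k k'
  using that by auto
 have "rel_pmf (rel_prod (=) ?S) (exec b (kenv p d tg K D W) c (M,Map.empty))
  (exec b (kenv p d tg K' D' W') c (M,Map.empty))"
 proof (rule rel_exec)
  fix q M s s'
  assume q: "q:queries c" and S: "?S s s'"
  show "rel_pmf (rel_prod (=) ?S) (kenv p d tg K D W q (M,s)) (kenv p d tg K' D' W' q (M,s'))"
  proof (cases q)
   case (Create_Key a)
   show ?thesis
   proof (cases "valid_id p d (read_ident 2 M a)")
    case True
    have "rel_pmf (rel_prod (=) ?S)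
      (map_pmf (%k. (M,s(read_ident 2 M a \<mapsto> k))) (K (read_ident 2 M a)))
      (map_pmf (%k. (M,s'(read_ident 2 M a \<mapsto> k))) (K' (read_ident 2 M a)))"
     unfolding pmf.rel_map
     by (rule pmf.rel_mono_strong[OF K[OF True]]) (use upd[OF S True] in auto)
    thus ?thesis using Create_Key True by (simp add: kenv_def Let_def)
   qed (use Create_Key S in "simp add: kenv_def Let_def")
  next
   case (Create_Delegated_Key a c')
   let ?u = "read_ident 2 M a" and ?v = "read_words 2 M c'"
   have Su: "rel_option (R ?u) (s ?u) (s' ?u)" using S by blast
   show ?thesis
   proof (cases "s ?u")
    case None
    hence "s' ?u = None" using Su by simp
    thus ?thesis using Create_Delegated_Key None S by (simp add: kenv_def Let_def)
   next
    case (Some k)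
    then obtain k' where k': "s' ?u = Some k'" "R ?u k k'" using Su by (auto simp: option_rel_Some1)
    have v: "valid_id p d ?u" using S Some by auto
    show ?thesis
    proof (cases "valid_id p d (?u @ [?v])")
     case True
     have "rel_pmf (rel_prod (=) ?S)
      (map_pmf (%k. (M,s(?u @ [?v] \<mapsto> k))) (D ?u k ?v))
      (map_pmf (%k. (M,s'(?u @ [?v] \<mapsto> k))) (D' ?u k' ?v))"
      unfolding pmf.rel_map
      by (rule pmf.rel_mono_strong[OF D[OF v True k'(2)]]) (use upd[OF S True] in auto)
     thus ?thesis using Create_Delegated_Key True Some k' by (simp add: kenv_def Let_def)
    qed (use Create_Delegated_Key S Some k' in "simp add: kenv_def Let_def")
   qed
  next
   case (Reveal_Key a r)
   hence nr: "num_reveals c~=0" using q num_reveals_eq_0D by blast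
   let ?u = "read_ident 2 M a"
   have Su: "rel_option (R ?u) (s ?u) (s' ?u)" using S by blast
   show ?thesis
   proof (cases "s ?u")
    case None
    hence "s' ?u = None" using Su by simp
    thus ?thesis using Reveal_Key None S by (simp add: kenv_def Let_def)
   next
    case (Some k)
    then obtain k' where k': "s' ?u = Some k'" "R ?u k k'" using Su by (auto simp: option_rel_Some1)
    have v: "valid_id p d ?u" using S Some by auto
    show ?thesis using Reveal_Key Some k' S W[OF nr v _ k'(2)] by (simp add: kenv_def Let_def)
   qed
  qed
 qed simp
 hence "rel_pmf (%x y. fst x = fst y) (exec b (kenv p d tg K D W) c (M,Map.empty))
  (exec b (kenv p d tg K' D' W') c (M,Map.empty))"
  by (rule pmf.rel_mono_strong) auto
 thus ?thesis by (rule rel_pmf_eq_map)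
qed

lemma (in simulator) senv_eq_kenv:
 "senv = kenv p d tg
   (%u. map_pmf (%rv i. if i:set Il then eval b (ce (length u) i) (venv ch u [] rv (%_. 0)) else 0)
    (Pi_pmf (set Rn) 0 (%_. unif p)))
   (%u pl v. map_pmf (%rv i. if i:set Il then eval b (de (length u) i) (venv ch u v rv pl) else 0)
    (Pi_pmf (set Rn) 0 (%_. unif p)))
   (%u pl. map (%e. eval b e (venv ch u [] (%_. 0) pl)) (re (length u)))"
 by (intro ext) (simp add: senv_def kenv_def Let_def pmf.map_comp o_def split: prod.split query.split option.split)


abbreviation the_pms :: "bgroup=>nat=>nat=>params" where
 "the_pms b d n \<equiv> \<lparr>pr_bg = b,pr_n = n,pr_d = d,pr_mu = 2\<rparr>"

section \<open>Keys as families of exponents\<close>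

text \<open>
 \<open>Coef j k i c\<close> is the exponent of level \<open>i\<close> in the row of \<open>K[j,k,c]\<close>, with \<open>i = 0\<close> standing for
 \<open>w\<close> and \<open>(j,k) = (0,0)\<close> for the row of the decryption part \<open>D[c]\<close>; \<open>Extra j c\<close> is \<open>s'[j,c]\<close>.
\<close>

datatype kx = Coef nat nat nat nat | Extra nat nat

definition rows :: "nat=>nat=>(nat \<times> nat) set" where
 "rows d l = insert (0,0) ({l + 1..d} \<times> {1..2})"

definition KI :: "nat=>nat=>nat=>kx set" where
 "KI d n l = {Coef j k i c | j k i c. (j,k):rows d l & i<=l & c:{1..n}} Un
   {Extra j c | j c. j:{l + 1..d} & c:{1..n}}"

text \<open>A transmitted word is either a row, that is \<open>D\<close> or \<open>K\<close>, or the
  power of v in the second group with a single coefficient as exponent.\<close>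

datatype witem = WRow nat nat nat | WL kx

definition items :: "nat=>nat=>nat=>witem list" where
 "items d n l = (let N = [1..<n + 1]; I = [1..<l + 1]; Js = [l + 1..<d + 1]; Ks = [1..<2 + 1] in
   [WRow 0 0 c. c \<leftarrow> N] @ [WL (Coef 0 0 0 c). c \<leftarrow> N] @ [WL (Coef 0 0 i c). i \<leftarrow> I,c \<leftarrow> N] @
   [WRow j k c. j \<leftarrow> Js,k \<leftarrow> Ks,c \<leftarrow> N] @
   [WL (Extra j c). j \<leftarrow> Js,c \<leftarrow> N] @
   [WL (Coef j k i c). j \<leftarrow> Js,k \<leftarrow> Ks,i \<leftarrow> I,c \<leftarrow> N] @
   [WL (Coef j k 0 c). j \<leftarrow> Js,k \<leftarrow> Ks,c \<leftarrow> N])"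

type_synonym secret = "int \<times> (nat=>int) \<times> (nat \<times> nat \<times> nat=>int)"

fun hid :: "(nat \<times> nat \<times> nat=>int)=>ident=>nat=>nat=>int" where
 "hid ah u i c = ah (i,1,c) * int (u ! (i - 1) ! 0) + ah (i,2,c) * int (u ! (i - 1) ! 1)"

text \<open>Exponents of transmitted words relative to the generator of the second group. They are
  linear in the key \<open>ka\<close>, with the master exponents as coefficients; both simulations
  rest on this.\<close>

fun wexp :: "secret=>ident=>(kx=>int)=>witem=>int" where
 "wexp (av,aw,ah) u ka (WRow j k c) =
   (\<Sum>i = 1..length u. hid ah u i c * ka (Coef j k i c)) + aw c * ka (Coef j k 0 c) +
   (if j = 0 then 0 else ah (j,k,c) * ka (Extra j c))"
| "wexp (av,aw,ah) u ka (WL x) = av * ka x"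

fun usk_rel :: "bgroup=>nat=>nat=>secret=>ident=>(kx=>int)=>usk=>bool" where
 "usk_rel b d n sec u ka sk <-> (let P = (%w. bg_h b [^]\<^bsub>bg_H b\<^esub> wexp sec u ka w); l = length u in
   ALL c:{1..n}. sk_D sk c = P (WRow 0 0 c) & sk_Dw sk c = P (WL (Coef 0 0 0 c)) &
    (ALL i:{1..l}. sk_Di sk (i,c) = P (WL (Coef 0 0 i c))) &
    (ALL j:{l + 1..d}. sk_L sk (j,c) = P (WL (Extra j c)) &
     (ALL k:{1..2}. sk_K sk (j,k,c) = P (WRow j k c) & sk_Lw sk (j,k,c) = P (WL (Coef j k 0 c)) &
      (ALL i:{1..l}. sk_Li sk (j,k,i,c) = P (WL (Coef j k i c))))))"

definition key_words :: "bgroup=>nat=>nat=>secret=>ident=>(kx=>int)=>nat list" where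
 "key_words b d n sec u ka = map (%w. bg_h b [^]\<^bsub>bg_H b\<^esub> wexp sec u ka w) (items d n (length u))"

lemma usk_words_eq:
 assumes "usk_rel b d n sec u ka sk"
 shows "usk_words (the_pms b d n) (length u) sk = key_words b d n sec u ka"
proof -
 define P where "P w = bg_h b [^]\<^bsub>bg_H b\<^esub> wexp sec u ka w" for w
 define N I Js Ks where "N = [1..<n + 1]" "I = [1..<length u + 1]" "Js = [length u + 1..<d + 1]" "Ks = [1..<2 + 1::nat]"
 have sets: "c:set N ==> c:{1..n}" "i:set I ==> i:{1..length u}"
  "j:set Js ==> j:{length u + 1..d}" "k:set Ks ==> k:{1..2}" for c i j k
  by (auto simp: N_I_Js_Ks_def)
 note a = bspec[OF assms[unfolded usk_rel.simps Let_def, folded P_def], OF sets(1)]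
 have r: "sk_D sk c = P (WRow 0 0 c)" "sk_Dw sk c = P (WL (Coef 0 0 0 c))" if "c:set N" for c
  using a[OF that] by blast+
 have r': "sk_Di sk (i,c) = P (WL (Coef 0 0 i c))" if "c:set N" "i:set I" for i c
  using a[OF that(1)] sets(2)[OF that(2)] by blast
 have r'': "sk_L sk (j,c) = P (WL (Extra j c))" if "c:set N" "j:set Js" for j c
  using a[OF that(1)] sets(3)[OF that(2)] by blast
 have r3: "sk_K sk (j,k,c) = P (WRow j k c)" "sk_Lw sk (j,k,c) = P (WL (Coef j k 0 c))"
  if "c:set N" "j:set Js" "k:set Ks" for j k c
  using a[OF that(1)] sets(3)[OF that(2)] sets(4)[OF that(3)] by blast+
 have r4: "sk_Li sk (j,k,i,c) = P (WL (Coef j k i c))"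
  if "c:set N" "j:set Js" "k:set Ks" "i:set I" for i j k c
  using a[OF that(1)] sets(3)[OF that(2)] sets(4)[OF that(3)] sets(2)[OF that(4)] by blast
 have e: "concat (map (%i. map (%c. f i c) N) xs) = concat (map (%i. map (%c. g i c) N) xs)"
  if "!!i c. i:set xs ==> c:set N ==> f i c = g i c" for xs :: "nat list" and f g :: "nat=>nat=>nat"
  by (intro arg_cong[where f = concat] map_cong refl that)
 have e': "concat (map (%j. concat (map (f j) Ks)) Js) = concat (map (%j. concat (map (g j) Ks)) Js)"
  if "!!j k. j:set Js ==> k:set Ks ==> f j k = g j k" for f g :: "nat=>nat=>nat list"
  by (intro arg_cong[where f = concat] map_cong refl that)
 have 1: "map (sk_D sk) N = map (%c. P (WRow 0 0 c)) N" "map (sk_Dw sk) N = map (%c. P (WL (Coef 0 0 0 c))) N"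
  by (intro map_cong refl r, assumption)+
 have 2: "concat (map (%i. map (%c. sk_Di sk (i,c)) N) I) = concat (map (%i. map (%c. P (WL (Coef 0 0 i c))) N) I)"
  "concat (map (%j. map (%c. sk_L sk (j,c)) N) Js) = concat (map (%j. map (%c. P (WL (Extra j c))) N) Js)"
  by (rule e, rule r', assumption, assumption, rule e, rule r'', assumption, assumption)
 have 3: "concat (map (%j. concat (map (%k. map (%c. sk_K sk (j,k,c)) N) Ks)) Js) =
   concat (map (%j. concat (map (%k. map (%c. P (WRow j k c)) N) Ks)) Js)"
  "concat (map (%j. concat (map (%k. map (%c. sk_Lw sk (j,k,c)) N) Ks)) Js) =
   concat (map (%j. concat (map (%k. map (%c. P (WL (Coef j k 0 c))) N) Ks)) Js)"
  by (intro e' map_cong refl r3, assumption, assumption, assumption)+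
 have 4: "concat (map (%j. concat (map (%k. concat (map (%i. map (%c. sk_Li sk (j,k,i,c)) N) I)) Ks)) Js) =
   concat (map (%j. concat (map (%k. concat (map (%i. map (%c. P (WL (Coef j k i c))) N) I)) Ks)) Js)"
  by (intro e' e r4, assumption, assumption, assumption, assumption)
 show ?thesis
  unfolding usk_words_def key_words_def items_def Let_def params.simps P_def[symmetric] N_I_Js_Ks_def[symmetric]
   map_append map_concat list.map_comp o_def 1 2 3 4 ..
qed

lemma finite_KI [simp]: "finite (KI d n l)"
proof -
 have "KI d n l<=(%((j,k),i,c). Coef j k i c) ` (rows d l \<times> {..l} \<times> {1..n}) Un
   (%(j,c). Extra j c) ` ({l + 1..d} \<times> {1..n})"
 proof
  fix x assume "x:KI d n l"
  then consider j k i c where "x = Coef j k i c" "(j,k):rows d l" "i<=l" "c:{1..n}"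
   | j c where "x = Extra j c" "j:{l + 1..d}" "c:{1..n}"
   unfolding KI_def by blast
  thus "x:(%((j,k),i,c). Coef j k i c) ` (rows d l \<times> {..l} \<times> {1..n}) Un
    (%(j,c). Extra j c) ` ({l + 1..d} \<times> {1..n})"
  proof cases
   case (1 j k i c)
   thus ?thesis by (intro UnI1 image_eqI[of _ _ "((j,k),i,c)"]) simp_all
  next
   case (2 j c)
   thus ?thesis by (intro UnI2 image_eqI[of _ _ "(j,c)"]) simp_all
  qed
 qed
 moreover have "finite (rows d l)" by (simp add: rows_def)
 ultimately show ?thesis by (auto intro: finite_subset)
qed

lemma in_KI [simp]:
 "Coef j k i c:KI d n l <-> (j,k):rows d l & i<=l & c:{1..n}"
 "Extra j c:KI d n l <-> j:{l + 1..d} & c:{1..n}"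
 by (auto simp: KI_def)

lemma wexp_cong:
 assumes "!!x. x:KI d n (length u) ==> ka x mod P = ka' x mod P"
  and "w:{WRow j k c | j k c. (j,k):rows d (length u) & c:{1..n}} Un WL ` KI d n (length u)"
 shows "wexp sec u ka w mod P = wexp sec u ka' w mod P"
proof -
 obtain av aw ah where sec: "sec = (av,aw,ah)" by (cases sec)
 consider (R) j k c where "w = WRow j k c" "(j,k):rows d (length u)" "c:{1..n}"
  | (L) x where "w = WL x" "x:KI d n (length u)" using assms(2) by auto
 thus ?thesis
 proof cases
  case R
  have "hid ah u i c * ka (Coef j k i c) mod P = hid ah u i c * ka' (Coef j k i c) mod P"
   if "i:{1..length u}" for i
   by (rule mod_mult_cong[OF refl], rule assms(1)) (use R that in auto)
  hence "(\<Sum>i = 1..length u. hid ah u i c * ka (Coef j k i c) mod P)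
    = (\<Sum>i = 1..length u. hid ah u i c * ka' (Coef j k i c) mod P)"
   by (rule sum.cong[OF refl])
  hence 1: "(\<Sum>i = 1..length u. hid ah u i c * ka (Coef j k i c)) mod P
    = (\<Sum>i = 1..length u. hid ah u i c * ka' (Coef j k i c)) mod P"
   by (subst (1 2) mod_sum_eq[symmetric]) simp
  have 2: "aw c * ka (Coef j k 0 c) mod P = aw c * ka' (Coef j k 0 c) mod P"
   by (rule mod_mult_cong[OF refl], rule assms(1)) (use R in auto)
  have 3: "(if j = 0 then 0 else ah (j,k,c) * ka (Extra j c)) mod P =
    (if j = 0 then 0 else ah (j,k,c) * ka' (Extra j c)) mod P"
  proof (cases "j = 0")
   case False
   thus ?thesis using R by (simp, intro mod_mult_cong[OF refl] assms(1)) (auto simp: rows_def)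
  qed simp
  show ?thesis unfolding R sec wexp.simps by (intro mod_add_cong 1 2 3)
 next
  case L
  thus ?thesis unfolding sec by (simp, intro mod_mult_cong[OF refl] assms(1))
 qed
qed

lemma set_items:
 assumes "w:set (items d n l)"
 shows "w:{WRow j k c | j k c. (j,k):rows d l & c:{1..n}} Un WL ` KI d n l"
proof -
 have upt: "set [a..<b + 1] = {a..b}" for a b :: nat by auto
 show ?thesis
  using assms unfolding items_def Let_def set_append set_concat set_map upt Un_iff
  by (elim disjE) (auto simp: rows_def simp del: upt_Suc)
qed


lemma usk_rel_cong:
 assumes "bilinear_group b" "!!x. x:KI d n (length u) ==> ka x mod int (bg_p b) = ka' x mod int (bg_p b)"
  and "usk_rel b d n sec u ka sk"
 shows "usk_rel b d n sec u ka' sk"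
proof -
 interpret H: prime_group "bg_H b" "bg_p b" "bg_h b" by (rule bilinear_groups(2)[OF assms(1)])
 have eq: "H.ex (wexp sec u ka' w) = H.ex (wexp sec u ka w)"
  if "w:{WRow j k c | j k c. (j,k):rows d (length u) & c:{1..n}} Un WL ` KI d n (length u)" for w
  unfolding H.ex_eq_iff by (rule wexp_cong[OF _ that, symmetric]) (rule assms(2))
 show ?thesis
  unfolding usk_rel.simps Let_def
 proof (intro ballI conjI)
 qed (use assms(3) in "simp_all add: Let_def eq rows_def")
qed

text \<open>The randomness of one query: \<open>RZ\<close> and \<open>RT\<close> are the exponents z
  and \<tau> of a delegation, \<open>RN\<close> is a fresh key, and \<open>RM\<close> a second one,
  which supplies the part of a simulated key that is multiplied by an unknown challenge exponent.
  One index set covers all levels and all kinds of queries.\<close>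

datatype rx = RZ nat | RT nat nat nat | RN kx | RM kx

definition KA :: "nat=>nat=>kx set" where
 "KA d n = (\<Union>l\<in>{..d}. KI d n l)"

definition RS :: "nat=>nat=>rx set" where
 "RS d n = RZ ` {1..n} Un {RT j k c | j k c. j:{1..d} & k:{1..2} & c:{1..n}} Un RN ` KA d n Un RM ` KA d n"

lemma finite_KA [simp]: "finite (KA d n)" by (simp add: KA_def)

lemma finite_RS [simp]: "finite (RS d n)"
proof -
 have "{RT j k c | j k c. j:{1..d} & k:{1..2} & c:{1..n}} =
   (%(j,k,c). RT j k c) ` ({1..d} \<times> {1..2} \<times> {1..n})" by (auto simp: image_iff)
 thus ?thesis by (simp add: RS_def)
qed

lemma in_RS [simp]:
 "RZ c:RS d n <-> c:{1..n}" "RT j k c:RS d n <-> j:{1..d} & k:{1..2} & c:{1..n}"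
 "RN x:RS d n <-> x:KA d n" "RM x:RS d n <-> x:KA d n"
 by (auto simp: RS_def)

lemma KI_KA: "x:KI d n l ==> l<=d ==> x:KA d n" by (auto simp: KA_def)

text \<open>Values outside the index range are set to 0, such that keys can be compared as
  functions.\<close>

definition onKI :: "nat=>nat=>nat=>(kx=>int)=>kx=>int" where
 "onKI d n l F = (%x. if x:KI d n l then F x else 0)"

definition fresh :: "nat=>nat=>nat=>(rx=>int)=>kx=>int" where
 "fresh d n l rv = onKI d n l (%x. rv (RN x))"

text \<open>The exponent of level \<open>i\<close> in the row that delegation multiplies into
  \<open>D\<close> and, with exponent \<tau>, into the remaining rows. The new level itself enters
  through the shared exponent s'.\<close>

definition newx :: "nat=>nat list=>(kx=>int)=>nat=>nat=>int" where
 "newx l v V i c = (if i = l + 1 then V (Extra (l + 1) c)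
   else V (Coef (l + 1) 1 i c) * int (v ! 0) + V (Coef (l + 1) 2 i c) * int (v ! 1))"

text \<open>Delegation: \<open>ka\<close> is the key of the parent, of level \<open>l\<close>, and \<open>V\<close> its randomization by \<open>z\<close>.\<close>

fun cmb :: "nat=>nat list=>(nat=>nat=>nat=>int)=>(kx=>int)=>(kx=>int)=>kx=>int" where
 "cmb l v \<tau> ka V (Coef j k i c) =
   (if i = l + 1 then 0 else if j = 0 then ka (Coef 0 0 i c) else V (Coef j k i c)) +
   (if j = 0 then 1 else \<tau> j k c) * newx l v V i c"
| "cmb l v \<tau> ka V (Extra j c) = V (Extra j c)"

primrec coord :: "kx=>nat" where
 "coord (Coef j k i c) = c"
| "coord (Extra j c) = c"

definition deleg :: "nat=>nat=>nat=>nat=>nat list=>(kx=>int)=>(rx=>int)=>kx=>int" where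
 "deleg p d n l v ka rv = onKI d n (l + 1)
   (%x. cmb l v (%j k c. rv (RT j k c)) ka (%x. rv (RZ (coord x)) * ka x) x mod int p)"

lemma bind_Pi_pmf5:
 assumes "finite A" "finite B" "finite C" "finite E" "finite I"
 shows "bind_pmf (Pi_pmf A d (%_. D)) (%f1. bind_pmf (Pi_pmf B d (%_. D)) (%f2.
   bind_pmf (Pi_pmf C d (%_. D)) (%f3. bind_pmf (Pi_pmf E d (%_. D)) (%f4.
   bind_pmf (Pi_pmf I d (%_. D)) (%f5. return_pmf (F f1 f2 f3 f4 f5))))))
  = map_pmf (%rv. F (%x. rv (Inl x)) (%x. rv (Inr (Inl x))) (%x. rv (Inr (Inr (Inl x))))
    (%x. rv (Inr (Inr (Inr (Inl x))))) (%x. rv (Inr (Inr (Inr (Inr x))))))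
    (Pi_pmf (A <+> (B <+> (C <+> (E <+> I)))) d (%_. D))"
 using assms by (simp add: bind_Pi_pmf2 finite_Plus map_pmf_def o_def)

definition msk_rel :: "bgroup=>secret=>msk=>bool" where
 "msk_rel b sec msk <-> (case sec of (av,aw,ah) =>
   msk_v msk = bg_h b [^]\<^bsub>bg_H b\<^esub> av & (ALL c. msk_w msk c = bg_h b [^]\<^bsub>bg_H b\<^esub> aw c) &
   (ALL x. msk_h msk x = bg_h b [^]\<^bsub>bg_H b\<^esub> ah x))"

lemma sum_12: "(\<Sum>k\<in>{1..2::nat}. f k) = f 1 + (f 2 :: 'a :: comm_monoid_add)"
 by (simp add: numeral_2_eq_2)

text \<open>The exponents drawn by key generation are exactly the coefficients of a key; only their
  names have to be matched.\<close>

lemma rel_HF_Kg: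
 assumes b: "bilinear_group b" and msk: "msk_rel b sec msk" and l: "length u<=d"
 shows "rel_pmf (usk_rel b d n sec u)
  (map_pmf (%rv. fresh d n (length u) (%x. int (rv x))) (Pi_pmf (RS d n) 0 (%_. unif_nz (bg_p b))))
  (HF_Kg (the_pms b d n) msk u)"
proof -
 interpret H: prime_group "bg_H b" "bg_p b" "bg_h b" by (rule bilinear_groups(2)[OF b])
 obtain av aw ah where sec: "sec = (av,aw,ah)" by (cases sec)
 have m: "msk_v msk = H.ex av" "!!c. msk_w msk c = H.ex (aw c)" "!!x. msk_h msk x = H.ex (ah x)"
  using msk by (auto simp: msk_rel_def sec)
 define l where "l = length u"
 define A where "A = Sum_Type.Plus {1..n} (Sum_Type.Plus ({1..l} \<times> {1..n})
   (Sum_Type.Plus ({l+1..d} \<times> {1..2::nat} \<times> {1..l} \<times> {1..n})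
   (Sum_Type.Plus ({l+1..d} \<times> {1..n}) ({l+1..d} \<times> {1..2::nat} \<times> {1..n}))))"
 \<comment> \<open>The five families \<open>rw\<close>, \<open>r\<close>, \<open>s\<close>,
   \<open>s'\<close> and \<open>sw\<close> under their names as key coefficients.\<close>
 define e where "e = case_sum (%c. RN (Coef 0 0 0 c)) (case_sum (%(i,c). RN (Coef 0 0 i c))
   (case_sum (%(j,k,i,c). RN (Coef j k i c)) (case_sum (%(j,c). RN (Extra j c)) (%(j,k,c). RN (Coef j k 0 c)))))"
 have eA: "e ` A<=RS d n"
  using l by (auto simp: A_def e_def l_def KA_def rows_def Plus_def intro!: bexI[of _ "length u"])
 have ei: "inj_on e A"
  unfolding inj_on_def A_def e_def Plus_def by auto
 have pull: "Pi_pmf A 0 (%_. unif_nz (bg_p b)) =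
   map_pmf (%rv i. if i:A then rv (e i) else 0) (Pi_pmf (RS d n) 0 (%_. unif_nz (bg_p b)))"
  by (rule Pi_pmf_pull[symmetric]) (use eA ei in auto)
 show ?thesis
  unfolding HF_Kg_def Let_def params.simps rand_nz_def l_def[symmetric]
  apply (subst bind_Pi_pmf5)
     apply simp_all[5]
  unfolding A_def[symmetric] pull pmf.map_comp o_def
  apply (rule rel_pmf_map_same)
  subgoal for rv
  proof -
  have A: "Inl c:A <-> c:{1..n}" "Inr (Inl (i,c)):A <-> i:{1..l} & c:{1..n}"
   "Inr (Inr (Inl (j,k,i,c))):A <-> j:{l+1..d} & k:{1..2} & i:{1..l} & c:{1..n}"
   "Inr (Inr (Inr (Inl (j,c)))):A <-> j:{l+1..d} & c:{1..n}"
   "Inr (Inr (Inr (Inr (j,k,c)))):A <-> j:{l+1..d} & k:{1..2} & c:{1..n}" for i j k c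
   by (auto simp: A_def)
  have e: "e (Inl c) = RN (Coef 0 0 0 c)" "e (Inr (Inl (i,c))) = RN (Coef 0 0 i c)"
   "e (Inr (Inr (Inl (j,k,i,c)))) = RN (Coef j k i c)" "e (Inr (Inr (Inr (Inl (j,c))))) = RN (Extra j c)"
   "e (Inr (Inr (Inr (Inr (j,k,c))))) = RN (Coef j k 0 c)" for i j k c
   by (auto simp: e_def)
  have x: "(\<Sum>i = 1..l. f i * int (if i:{1..l} & P then a i else 0)) = (\<Sum>i = 1..l. f i * int (if P then a i else 0))"
   "(\<Sum>i = 1..l. f i * (if i<=l & P then b i else 0)) = (\<Sum>i = 1..l. f i * (if P then b i else 0))"
   for f :: "nat=>int" and a :: "nat=>nat" and b :: "nat=>int" and P
   by (auto intro!: sum.cong)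
  show ?thesis
   unfolding usk_rel.simps Let_def l_def[symmetric] usk.simps prod.case sec wexp.simps hid.simps m A e
    H.ex_pow fresh_def onKI_def in_KI
   by (simp only: H.ex_finprod finite_atLeastAtMost sum_12 H.ex_mult H.ex_pow cong: ball_cong)
    (intro ballI conjI; simp add: rows_def ac_simps)
  qed
  done
qed

lemma (in prime_group) finprod_12:
 assumes "F 1 = ex x" "F 2 = ex y"
 shows "(\<Otimes>k\<in>{1..2::nat}. F k) = ex (x + y)"
proof -
 interpret comm_group G by (rule comm)
 have "{1..2::nat} = {1,2}" by auto
 thus ?thesis using assms by (simp add: finprod_insert Pi_def ex_mult)
qed

lemma wexp_scale: "wexp sec u (%x. z (coord x) * ka x) (WRow j k c) = z c * wexp sec u ka (WRow j k c)"
 "wexp sec u (%x. z (coord x) * ka x) (WL x) = z (coord x) * wexp sec u ka (WL x)"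
 by (cases sec; simp add: algebra_simps sum_distrib_left)+

text \<open>Correctness of delegation in the exponent. The terms with s' in the two rows of level
  \<open>l + 1\<close>, weighted by the components of \<open>v\<close>, add up to the summand of the
  new level in the extended identity.\<close>

lemma wexp_cmb:
 assumes "l = length u" "j = 0 & k = 0 \<or> l + 2<=j"
 shows "wexp sec (u @ [v]) (cmb l v \<tau> ka V) (WRow j k c) =
  wexp sec u (if j = 0 then ka else V) (WRow j k c) + (if j = 0 then 1 else \<tau> j k c) *
   (wexp sec u V (WRow (l + 1) 1 c) * int (v ! 0) + wexp sec u V (WRow (l + 1) 2 c) * int (v ! 1))"
proof -
 obtain av aw ah where sec: "sec = (av,aw,ah)" by (cases sec)
 let ?t = "if j = 0 then 1 else \<tau> j k c"
 let ?b = "if j = 0 then ka else V"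
 have hid: "hid ah (u @ [v]) i c = hid ah u i c" if "i:{1..l}" for i
  using that assms(1) by (auto simp: nth_append)
 have "(\<Sum>i = 1..l. hid ah (u @ [v]) i c * cmb l v \<tau> ka V (Coef j k i c)) =
   (\<Sum>i = 1..l. hid ah u i c * ?b (Coef j k i c) + ?t * (hid ah u i c * V (Coef (l + 1) 1 i c) * int (v ! 0) +
    hid ah u i c * V (Coef (l + 1) 2 i c) * int (v ! 1)))"
  by (intro sum.cong refl) (use assms in "auto simp add: hid newx_def algebra_simps simp del: hid.simps")
 also have "... = (\<Sum>i = 1..l. hid ah u i c * ?b (Coef j k i c)) +
   ?t * ((\<Sum>i = 1..l. hid ah u i c * V (Coef (l + 1) 1 i c)) * int (v ! 0) +
    (\<Sum>i = 1..l. hid ah u i c * V (Coef (l + 1) 2 i c)) * int (v ! 1))"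
  by (simp add: sum.distrib sum_distrib_left sum_distrib_right algebra_simps del: hid.simps)
 finally have s: "(\<Sum>i = 1..l. hid ah (u @ [v]) i c * cmb l v \<tau> ka V (Coef j k i c)) = ..." .
 have "wexp sec (u @ [v]) (cmb l v \<tau> ka V) (WRow j k c) =
   (\<Sum>i = 1..l. hid ah (u @ [v]) i c * cmb l v \<tau> ka V (Coef j k i c)) +
   hid ah (u @ [v]) (l + 1) c * cmb l v \<tau> ka V (Coef j k (l + 1) c) +
   aw c * cmb l v \<tau> ka V (Coef j k 0 c) + (if j = 0 then 0 else ah (j,k,c) * V (Extra j c))"
  using assms(1) by (simp add: sec del: hid.simps cmb.simps) simp
 also have "hid ah (u @ [v]) (l + 1) c = ah (l + 1,1,c) * int (v ! 0) + ah (l + 1,2,c) * int (v ! 1)"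
  using assms(1) by simp
 finally show ?thesis
  unfolding s unfolding sec wexp.simps assms(1)[symmetric]
  using assms(2) by (auto simp: newx_def algebra_simps simp del: hid.simps)
qed

lemma rel_HF_Del:
 assumes b: "bilinear_group b" and sk: "usk_rel b d n sec u ka sk" and d: "length u < d"
 shows "rel_pmf (usk_rel b d n sec (u @ [v]))
  (map_pmf (%rv. deleg (bg_p b) d n (length u) v ka (%x. int (rv x))) (Pi_pmf (RS d n) 0 (%_. unif_nz (bg_p b))))
  (HF_Del (the_pms b d n) mpk u sk v)"
proof -
 interpret H: prime_group "bg_H b" "bg_p b" "bg_h b" by (rule bilinear_groups(2)[OF b])
 define l where "l = length u"
 define A where "A = Sum_Type.Plus {1..n} ({l+2..d} \<times> {1..2::nat} \<times> {1..n})"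
 define e where "e = case_sum (%c. RZ c) (%(j,k,c). RT j k c)"
 have eA: "e ` A<=RS d n" by (auto simp: A_def e_def Plus_def)
 have ei: "inj_on e A" unfolding inj_on_def A_def e_def Plus_def by auto
 have pull: "Pi_pmf A 0 (%_. unif_nz (bg_p b)) =
   map_pmf (%rv i. if i:A then rv (e i) else 0) (Pi_pmf (RS d n) 0 (%_. unif_nz (bg_p b)))"
  by (rule Pi_pmf_pull[symmetric]) (use eA ei in auto)
 define P where "P w = H.ex (wexp sec u ka w)" for w
 note a = bspec[OF sk[unfolded usk_rel.simps Let_def, folded P_def l_def]]
 have r: "sk_D sk c = H.ex (wexp sec u ka (WRow 0 0 c))" "sk_Dw sk c = H.ex (wexp sec u ka (WL (Coef 0 0 0 c)))"
  if "c:{1..n}" for c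
  using a[OF that] unfolding P_def by blast+
 have r': "sk_Di sk (i,c) = H.ex (wexp sec u ka (WL (Coef 0 0 i c)))" if "c:{1..n}" "i:{1..l}" for i c
  using a[OF that(1)] that(2) unfolding P_def by blast
 have r2: "sk_L sk (j,c) = H.ex (wexp sec u ka (WL (Extra j c)))" if "c:{1..n}" "j:{l + 1..d}" for j c
  using a[OF that(1)] that(2) unfolding P_def by blast
 have r3: "sk_K sk (j,k,c) = H.ex (wexp sec u ka (WRow j k c))" "sk_Lw sk (j,k,c) = H.ex (wexp sec u ka (WL (Coef j k 0 c)))"
  if "c:{1..n}" "j:{l + 1..d}" "k:{1..2}" for j k c
  using a[OF that(1)] that(2,3) unfolding P_def by blast+
 have r4: "sk_Li sk (j,k,i,c) = H.ex (wexp sec u ka (WL (Coef j k i c)))"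
  if "c:{1..n}" "j:{l + 1..d}" "k:{1..2}" "i:{1..l}" for i j k c
  using a[OF that(1)] that(2-4) unfolding P_def by blast
 show ?thesis
  unfolding HF_Del_def Let_def params.simps rand_nz_def l_def[symmetric]
  apply (subst bind_Pi_pmf2)
   apply simp_all[2]
  unfolding A_def[symmetric] pull o_def map_pmf_def[symmetric] pmf.map_comp prod.case
  apply (rule rel_pmf_map_same)
  subgoal for rv
  proof -
  have A: "Inl c:A <-> c:{1..n}" "Inr (j,k,c):A <-> j:{l+2..d} & k:{1..2} & c:{1..n}" for j k c
   by (auto simp: A_def)
  have e: "e (Inl c) = RZ c" "e (Inr (j,k,c)) = RT j k c" for j k c
   by (auto simp: e_def)
  have l1: "l + 1:{l + 1..d}" "1:{1..2::nat}" "2:{1..2::nat}" using d l_def by auto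
  let ?V = "%x. int (rv (RZ (coord x))) * ka x"
  let ?k = "cmb l v (%j k c. int (rv (RT j k c))) ka ?V"
  have sc: "wexp sec u ?V (WRow j k c) = wexp sec u ka (WRow j k c) * int (rv (RZ c))"
   "wexp sec u ?V (WL x) = wexp sec u ka (WL x) * int (rv (RZ (coord x)))" for j k c x
   using wexp_scale[where z = "%c. int (rv (RZ c))" and ka = ka and u = u and sec = sec]
   by (simp_all add: mult.commute del: wexp.simps)
  have Kn: "(\<Otimes>\<^bsub>bg_H b\<^esub>k\<in>{1..2}. (sk_K sk (l + 1,k,c) [^]\<^bsub>bg_H b\<^esub> rv (RZ c)) [^]\<^bsub>bg_H b\<^esub> (v ! (k - 1)))
    = H.ex (wexp sec u ?V (WRow (l + 1) 1 c) * int (v ! 0) + wexp sec u ?V (WRow (l + 1) 2 c) * int (v ! 1))"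
   if "c:{1..n}" for c
   by (rule H.finprod_12) (simp_all add: r3[OF that l1(1) l1(2)] r3[OF that l1(1) l1(3)] H.ex_pow sc del: wexp.simps One_nat_def flip: One_nat_def)
  have Lwn: "(\<Otimes>\<^bsub>bg_H b\<^esub>k\<in>{1..2}. (sk_Lw sk (l + 1,k,c) [^]\<^bsub>bg_H b\<^esub> rv (RZ c)) [^]\<^bsub>bg_H b\<^esub> (v ! (k - 1)))
    = H.ex (wexp sec u ?V (WL (Coef (l + 1) 1 0 c)) * int (v ! 0) + wexp sec u ?V (WL (Coef (l + 1) 2 0 c)) * int (v ! 1))"
   if "c:{1..n}" for c
   by (rule H.finprod_12) (simp_all add: r3[OF that l1(1) l1(2)] r3[OF that l1(1) l1(3)] H.ex_pow sc del: wexp.simps One_nat_def flip: One_nat_def)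
  have Ln: "(\<Otimes>\<^bsub>bg_H b\<^esub>k\<in>{1..2}. (sk_Li sk (l + 1,k,i,c) [^]\<^bsub>bg_H b\<^esub> rv (RZ c)) [^]\<^bsub>bg_H b\<^esub> (v ! (k - 1)))
    = H.ex (wexp sec u ?V (WL (Coef (l + 1) 1 i c)) * int (v ! 0) + wexp sec u ?V (WL (Coef (l + 1) 2 i c)) * int (v ! 1))"
   if "c:{1..n}" "i:{1..l}" for c i
   by (rule H.finprod_12) (simp_all add: r4[OF that(1) l1(1) l1(2) that(2)] r4[OF that(1) l1(1) l1(3) that(2)] H.ex_pow sc del: wexp.simps One_nat_def flip: One_nat_def)
  have W: "wexp sec (u @ [v]) ?k (WRow 0 0 c) = wexp sec u ka (WRow 0 0 c) +
    (wexp sec u ?V (WRow (l + 1) 1 c) * int (v ! 0) + wexp sec u ?V (WRow (l + 1) 2 c) * int (v ! 1))"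
   "l + 2<=j ==> wexp sec (u @ [v]) ?k (WRow j k c) = wexp sec u ?V (WRow j k c) + int (rv (RT j k c)) *
    (wexp sec u ?V (WRow (l + 1) 1 c) * int (v ! 0) + wexp sec u ?V (WRow (l + 1) 2 c) * int (v ! 1))" for j k c
   using wexp_cmb[OF l_def, of 0 0 sec v "%j k c. int (rv (RT j k c))" ka ?V]
    wexp_cmb[OF l_def, of j k sec v "%j k c. int (rv (RT j k c))" ka ?V]
   by (simp_all del: wexp.simps cmb.simps One_nat_def)
  obtain av aw ah where sec: "sec = (av,aw,ah)" by (cases sec)
  have wl: "wexp sec y k (WL x) = av * k x" for y k x by (simp add: sec)
  have l2: "length (u @ [v]) = l + 1" by (simp add: l_def)
  have up: "j:{l + 2..d}" "j:{l + 1..d}" "l + 2<=j" "j~=0" if "j:{l + 1 + 1..d}" for j using that by auto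
  have one: "\<one>\<^bsub>bg_H b\<^esub> \<otimes>\<^bsub>bg_H b\<^esub> H.ex x = H.ex x" for x using H.ex_mult[of 0 x] by simp
  have lt: "i:{1..l + 1} ==> i~=l + 1 ==> i:{1..l}" for i by auto
  show ?thesis
   \<comment> \<open>\<open>deleg\<close> is \<open>?k\<close> reduced modulo p on the index range,
     which powers of the generator do not notice.\<close>
   apply (rule usk_rel_cong[OF b, where ka = ?k])
    apply (simp add: deleg_def onKI_def l_def)
   unfolding usk_rel.simps Let_def usk.simps prod.case l2
   apply (intro ballI conjI)
   subgoal for c by (simp add: A e r Kn W H.ex_mult del: wexp.simps cmb.simps One_nat_def)
   subgoal for c by (simp add: A e r Lwn wl newx_def H.ex_mult del: wexp.simps One_nat_def; simp add: algebra_simps)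
   subgoal for c i
    apply (cases "i = l + 1")
    subgoal by (simp add: A e r2[OF _ l1(1)] wl newx_def H.ex_pow del: wexp.simps One_nat_def; simp add: algebra_simps)
    subgoal by (frule (1) lt) (simp add: A e r' Ln wl newx_def H.ex_mult del: wexp.simps One_nat_def; simp add: algebra_simps)
    done
   subgoal for c j by (frule up(2)) (simp add: A e r2 wl H.ex_mult H.ex_pow del: wexp.simps One_nat_def; simp add: algebra_simps)
   subgoal for c j k using up[of j]
    by (simp add: A e r3 Kn W wl sc H.ex_mult H.ex_pow del: wexp.simps One_nat_def; simp add: algebra_simps)
   subgoal for c j k using up[of j]
    by (simp add: A e r3 Lwn wl newx_def H.ex_mult H.ex_pow del: wexp.simps One_nat_def; simp add: algebra_simps)
   subgoal for c j k i using up[of j]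
    apply (cases "i = l + 1")
    subgoal by (simp add: A e r2[OF _ l1(1)] wl newx_def one H.ex_mult H.ex_pow del: wexp.simps One_nat_def; simp add: algebra_simps)
    subgoal by (frule (1) lt) (simp add: A e r4 Ln wl newx_def H.ex_mult H.ex_pow del: wexp.simps One_nat_def; simp add: algebra_simps)
    done
   done
  qed
  done
qed

section \<open>Master keys\<close>

text \<open>The master exponents \<alpha>_v, \<alpha>_w, \<alpha>_h and s, in this order.\<close>

datatype sx = SV | SW nat | SH nat nat nat | SS nat

definition SI :: "nat=>nat=>sx set" where
 "SI d n = {SV} Un SW ` {1..n} Un {SH i k l | i k l. i:{1..d} & k:{0..2} & l:{1..n}} Un SS ` {1..n}"

lemma finite_SI [simp]: "finite (SI d n)"
proof -
 have "{SH i k l | i k l. i:{1..d} & k:{0..2} & l:{1..n}} =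
   (%(i,k,l). SH i k l) ` ({1..d} \<times> {0..2} \<times> {1..n})" by (auto simp: image_iff)
 thus ?thesis by (simp add: SI_def)
qed

lemma in_SI [simp]:
 "SV:SI d n" "SW l:SI d n <-> l:{1..n}" "SS l:SI d n <-> l:{1..n}"
 "SH i k l:SI d n <-> i:{1..d} & k:{0..2} & l:{1..n}"
 by (auto simp: SI_def)

datatype mi = MV | MW nat | MH nat nat nat | MJ nat | MCw nat nat | MC nat nat nat nat

definition mitems :: "nat=>nat=>mi list" where
 "mitems d n = (let N = [1..<n + 1]; I = [1..<d + 1] in
   [MV] @ [MW l. l \<leftarrow> N] @ [MH i k l. i \<leftarrow> I,k \<leftarrow> [0..<2 + 1],l \<leftarrow> N] @ [MJ l. l \<leftarrow> N] @
   [MCw l2 l1. l2 \<leftarrow> N,l1 \<leftarrow> N] @ [MC i k l2 l1. i \<leftarrow> I,k \<leftarrow> [1..<2 + 1],l2 \<leftarrow> N,l1 \<leftarrow> N])"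

definition sec_of :: "(sx=>int)=>secret" where
 "sec_of th = (th SV,%l. th (SW l),%(i,k,l). th (SH i k l))"

text \<open>\<open>Y l i k\<close> is the entry \<open>y\<^sub>i[k]\<close> of the auxiliary input used for coordinate \<open>l\<close>.\<close>

fun mexp :: "(nat=>nat=>nat=>int)=>(sx=>int)=>mi=>int" where
 "mexp Y th MV = th SV"
| "mexp Y th (MW l) = th (SW l)"
| "mexp Y th (MH i k l) = th (SH i k l)"
| "mexp Y th (MJ l) = th SV * th (SS l)"
| "mexp Y th (MCw l2 l1) = th (SW l1) * th (SS l2)"
| "mexp Y th (MC i k l2 l1) = (th (SH i 0 l1) * (if l2 = l1 then Y l1 i k else 0) + th (SH i k l1)) * th (SS l2)"

definition mwords :: "bgroup=>nat=>nat=>(mi=>int)=>nat list" where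
 "mwords b d n E = map (%m. bg_g b [^]\<^bsub>bg_G b\<^esub> E m) (mitems d n)"

definition mpk_rel :: "bgroup=>nat=>nat=>(mi=>int)=>mpk=>bool" where
 "mpk_rel b d n E pk <-> (let P = (%m. bg_g b [^]\<^bsub>bg_G b\<^esub> E m) in pk_v pk = P MV &
   (ALL l:{1..n}. pk_w pk l = P (MW l) & pk_J pk l = P (MJ l) & (ALL l1:{1..n}. pk_Cw pk (l,l1) = P (MCw l l1)) &
    (ALL i:{1..d}. (ALL k:{0..2}. pk_h pk (i,k,l) = P (MH i k l)) &
     (ALL k:{1..2}. ALL l1:{1..n}. pk_C pk (i,k,l,l1) = P (MC i k l l1)))))"

lemma mpk_words_eq:
 assumes "mpk_rel b d n E pk"
 shows "mpk_words (the_pms b d n) pk = mwords b d n E"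
proof -
 define P where "P m = bg_g b [^]\<^bsub>bg_G b\<^esub> E m" for m
 define N I K0 K1 where "N = [1..<n + 1]" "I = [1..<d + 1]" "K0 = [0..<2 + 1::nat]" "K1 = [1..<2 + 1::nat]"
 have sets: "c:set N ==> c:{1..n}" "i:set I ==> i:{1..d}"
  "k:set K0 ==> k:{0..2}" "k:set K1 ==> k:{1..2}" for c i k
  by (auto simp: N_I_K0_K1_def)
 note v = conjunct1[OF assms[unfolded mpk_rel_def Let_def, folded P_def]]
 note a = bspec[OF conjunct2[OF assms[unfolded mpk_rel_def Let_def, folded P_def]], OF sets(1)]
 have r: "pk_w pk l = P (MW l)" "pk_J pk l = P (MJ l)" if "l:set N" for l
  using a[OF that] by blast+
 have r': "pk_Cw pk (l,l1) = P (MCw l l1)" if "l:set N" "l1:set N" for l l1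
  using a[OF that(1)] sets(1)[OF that(2)] by blast
 have r'': "pk_h pk (i,k,l) = P (MH i k l)" if "l:set N" "i:set I" "k:set K0" for l i k
  using a[OF that(1)] sets(2)[OF that(2)] sets(3)[OF that(3)] by blast
 have r3: "pk_C pk (i,k,l,l1) = P (MC i k l l1)" if "l:set N" "i:set I" "k:set K1" "l1:set N" for l i k l1
  using a[OF that(1)] sets(2)[OF that(2)] sets(4)[OF that(3)] sets(1)[OF that(4)] by blast
 have e: "concat (map f xs) = concat (map g xs)" if "!!i. i:set xs ==> f i = g i" for xs :: "nat list" and f g :: "nat=>nat list"
  by (intro arg_cong[where f = concat] map_cong refl that)
 have 1: "map (pk_w pk) N = map (%c. P (MW c)) N" "map (pk_J pk) N = map (%c. P (MJ c)) N"
  by (intro map_cong refl r, assumption)+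
 have 2: "concat (map (%l. map (%c. pk_Cw pk (l,c)) N) N) = concat (map (%l. map (%c. P (MCw l c)) N) N)"
  by (intro e map_cong refl r', assumption, assumption)
 have 3: "concat (map (%i. concat (map (%k. map (%l. pk_h pk (i,k,l)) N) K0)) I) =
   concat (map (%i. concat (map (%k. map (%l. P (MH i k l)) N) K0)) I)"
  by (intro e map_cong refl r'', assumption, assumption, assumption)
 have 4: "concat (map (%i. concat (map (%k. concat (map (%l. map (%l1. pk_C pk (i,k,l,l1)) N) N)) K1)) I) =
   concat (map (%i. concat (map (%k. concat (map (%l. map (%l1. P (MC i k l l1)) N) N)) K1)) I)"
  by (intro e map_cong refl r3, assumption, assumption, assumption, assumption)
 show ?thesis
  unfolding mpk_words_def mwords_def mitems_def Let_def params.simps P_def[symmetric] N_I_K0_K1_def[symmetric]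
   map_append map_concat list.map_comp o_def 1 2 3 4 v by simp
qed

text \<open>The construction uses the same vector in all coordinates. The hybrids mix two vectors,
  which is why the auxiliary input takes the coordinate as an argument.\<close>

definition yvec :: "ident=>nat=>nat=>nat=>int" where
 "yvec y l i k = int (y ! (i - 1) ! (k - 1))"

lemma rel_HF_MKg:
 assumes b: "bilinear_group b"
 shows "rel_pmf (%th (pk,msk). mpk_rel b d n (mexp (yvec y) (%x. int (th x))) pk & msk_rel b (sec_of (%x. int (th x))) msk)
  (Pi_pmf (SI d n) 0 (%_. unif_nz (bg_p b))) (HF_MKg (the_pms b d n) y)"
proof -
 interpret G: prime_group "bg_G b" "bg_p b" "bg_g b" by (rule bilinear_groups(1)[OF b])
 interpret H: prime_group "bg_H b" "bg_p b" "bg_h b" by (rule bilinear_groups(2)[OF b])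
 let ?U = "unif_nz (bg_p b)"
 define A where "A = Sum_Type.Plus {()} (Sum_Type.Plus {1..n} (Sum_Type.Plus ({1..d} \<times> {0..2::nat} \<times> {1..n}) {1..n}))"
 define e where "e = case_sum (%_::unit. SV) (case_sum SW (case_sum (%(i,k,l). SH i k l) SS))"
 have eA: "e ` A<=SI d n" by (auto simp: A_def e_def Plus_def)
 have ei: "inj_on e A" unfolding inj_on_def A_def e_def Plus_def by auto
 have pull: "Pi_pmf A 0 (%_. ?U) = map_pmf (%rv i. if i:A then rv (e i) else 0) (Pi_pmf (SI d n) 0 (%_. ?U))"
  by (rule Pi_pmf_pull[symmetric]) (use eA ei in auto)
 have u: "?U = map_pmf (%f. f ()) (Pi_pmf {()} 0 (%_. ?U))"
  by (simp add: Pi_pmf_singleton pmf.map_comp o_def)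
 have 4: "bind_pmf ?U (%a. bind_pmf (Pi_pmf {1..n} 0 (%_. ?U)) (%w.
   bind_pmf (Pi_pmf ({1..d} \<times> {0..2::nat} \<times> {1..n}) 0 (%_. ?U)) (%h. bind_pmf (Pi_pmf {1..n} 0 (%_. ?U)) (%s.
   return_pmf (F a w h s))))) =
   map_pmf (%rv. F (rv (Inl ())) (%x. rv (Inr (Inl x))) (%x. rv (Inr (Inr (Inl x)))) (%x. rv (Inr (Inr (Inr x)))))
    (Pi_pmf A 0 (%_. ?U))" for F :: "_=>_=>_=>_=>mpk \<times> msk"
  by (subst u) (simp add: bind_map_pmf bind_assoc_pmf bind_return_pmf bind_Pi_pmf2 finite_Plus A_def map_pmf_def o_def)
 have A: "Inl ():A" "Inr (Inl l):A <-> l:{1..n}" "Inr (Inr (Inr l)):A <-> l:{1..n}"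
  "Inr (Inr (Inl (i,k,l))):A <-> i:{1..d} & k:{0..2} & l:{1..n}" for i k l
  by (auto simp: A_def)
 have e: "e (Inl ()) = SV" "e (Inr (Inl l)) = SW l" "e (Inr (Inr (Inr l))) = SS l" "e (Inr (Inr (Inl (i,k,l)))) = SH i k l"
  for i k l by (auto simp: e_def)
 have out: "th x = 0" if "th:set_pmf (Pi_pmf (SI d n) 0 (%_. ?U))" "x ~: SI d n" for th x
  using that set_Pi_pmf_subset[of "SI d n" 0 "%_. ?U"] by auto
 have pulled: "(if Inr (Inl l):A then th (e (Inr (Inl l))) else 0) = th (SW l)"
  "(if Inr (Inr (Inr l)):A then th (e (Inr (Inr (Inr l)))) else 0) = th (SS l)"
  "(if Inr (Inr (Inl x)):A then th (e (Inr (Inr (Inl x)))) else 0) = (case x of (i,k,l)=>th (SH i k l))"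
  if "th:set_pmf (Pi_pmf (SI d n) 0 (%_. ?U))" for th l x
  using out[OF that] by (cases x; auto simp: A e)+
 show ?thesis
  unfolding HF_MKg_def Let_def params.simps rand_nz_def
  apply (subst 4)
  unfolding pull pmf.map_comp o_def
  apply (subst pmf.map_id[symmetric, of "Pi_pmf (SI d n) 0 (%_. unif_nz (bg_p b))"], unfold id_def)
  apply (rule rel_pmf_map_same)
  subgoal for th
   by (simp add: pulled A(1) e(1) mpk_rel_def msk_rel_def sec_of_def G.g_pow H.g_pow G.ex_pow G.ex_mult yvec_def
     algebra_simps Let_def split: prod.split)
  done
qed

section \<open>Injectivity and lossiness\<close>

text \<open>The inner product of y_i and id_i at coordinate \<open>l\<close>. It decides between
  injectivity and lossiness.\<close>

definition Bx :: "(nat=>nat=>nat=>int)=>ident=>nat=>nat=>int" where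
 "Bx Y u l i = Y l i 1 * int (u ! (i - 1) ! 0) + Y l i 2 * int (u ! (i - 1) ! 1)"

lemma valid_idD:
 assumes "valid_id p d u" "i:{1..length u}"
 shows "u ! (i - 1) ! 0 = 1" "1<=u ! (i - 1) ! 1" "u ! (i - 1) ! 1 < p" "u ! (i - 1) = [1,u ! (i - 1) ! 1]"
proof -
 have "u ! (i - 1):set u" using assms(2) by (intro nth_mem) auto
 then obtain x where "u ! (i - 1) = [1,x]" "x:{1..<p}" using assms(1) by (auto simp: valid_id_def)
 thus "u ! (i - 1) ! 0 = 1" "1<=u ! (i - 1) ! 1" "u ! (i - 1) ! 1 < p" "u ! (i - 1) = [1,u ! (i - 1) ! 1]"
  by auto
qed

lemma Bx_injective:
 assumes "valid_id p d u" "i:{1..length u}"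
 shows "Bx (yvec (y_injective (the_pms b d n))) u l i = 1"
proof -
 have "i - 1 < d" using assms by (auto simp: valid_id_def)
 thus ?thesis using valid_idD[OF assms] by (simp add: Bx_def yvec_def y_injective_def)
qed

lemma Bx_lossy:
 assumes "valid_id (bg_p b) d tg" "valid_id (bg_p b) d u" "i:{1..length u}"
 shows "Bx (yvec (y_lossy (the_pms b d n) tg)) u l i =
  (if i<=length tg then int (bg_p b) - int (tg ! (i - 1) ! 1) + int (u ! (i - 1) ! 1) else 1)"
proof -
 have i: "i - 1 < d" "1<=i" using assms by (auto simp: valid_id_def)
 show ?thesis
 proof (cases "i<=length tg")
  case True
  hence "i:{1..length tg}" using i by auto
  note t = valid_idD[OF assms(1) this]
  have "(bg_p b - tg ! (i - 1) ! 1) mod bg_p b = bg_p b - tg ! (i - 1) ! 1"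
   using t by (intro mod_less) linarith
  moreover have "i - 1 < length tg" using True i by auto
  ultimately show ?thesis using True t valid_idD[OF assms(2,3)] i
   by (simp add: Bx_def yvec_def y_lossy_def of_nat_diff)
 next
  case False
  hence "\<not> i - 1 < length tg" by auto
  thus ?thesis using False valid_idD[OF assms(2,3)] i by (simp add: Bx_def yvec_def y_lossy_def)
 qed
qed

lemma prefix_iff_nth: "prefix u v <-> length u<=length v & (ALL i<length u. u ! i = v ! i)"
proof
 assume "length u<=length v & (ALL i<length u. u ! i = v ! i)"
 hence "u = take (length u) v" by (intro nth_equalityI) auto
 thus "prefix u v" by (metis take_is_prefix)
qed (auto simp: prefix_def nth_append)

lemma Bx_lossy_prefix:
 assumes "valid_id (bg_p b) d tg" "valid_id (bg_p b) d u" "prefix u tg" "i:{1..length u}"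
 shows "Bx (yvec (y_lossy (the_pms b d n) tg)) u l i mod int (bg_p b) = 0"
proof -
 have "i - 1 < length u" "i<=length tg" using assms(3,4) by (auto simp: prefix_iff_nth)
 thus ?thesis using assms(3) by (simp add: Bx_lossy[OF assms(1,2,4)] prefix_iff_nth)
qed

text \<open>An identity longer than the target has a level at which the product is 1. Otherwise it
  differs from the target at some level, and there the product is the difference of two distinct
  residues.\<close>

lemma Bx_lossy_not_prefix:
 assumes "valid_id (bg_p b) d tg" "valid_id (bg_p b) d u" "\<not> prefix u tg"
 shows "EX i:{1..length u}. Bx (yvec (y_lossy (the_pms b d n) tg)) u l i mod int (bg_p b)~=0"
proof (cases "length u<=length tg")
 case False
 have "bg_p b > 1" using valid_idD[OF assms(2), of 1] assms(2) by (auto simp: valid_id_def)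
 thus ?thesis using False Bx_lossy[OF assms(1,2), of "length u"] by (intro bexI[of _ "length u"]) auto
next
 case True
 then obtain j where j: "j < length u" "u ! j~=tg ! j" using assms(3) by (auto simp: prefix_iff_nth)
 hence i: "j + 1:{1..length u}" "j + 1:{1..length tg}" using True by auto
 note t = valid_idD[OF assms(1) i(2), unfolded add_diff_cancel_right'] and v = valid_idD[OF assms(2) i(1), unfolded add_diff_cancel_right']
 have ne: "tg ! j ! 1~=u ! j ! 1" using j(2) t(4) v(4) by metis
 have "\<not> int (bg_p b) dvd int (u ! j ! 1) - int (tg ! j ! 1)"
 proof
  assume "int (bg_p b) dvd int (u ! j ! 1) - int (tg ! j ! 1)"
  hence "int (u ! j ! 1) mod int (bg_p b) = int (tg ! j ! 1) mod int (bg_p b)" by (simp add: mod_eq_dvd_iff)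
  thus False using t v ne by simp
 qed
 moreover have "Bx (yvec (y_lossy (the_pms b d n) tg)) u l (j + 1) mod int (bg_p b) =
   (int (u ! j ! 1) - int (tg ! j ! 1)) mod int (bg_p b)"
 proof -
  have "j + 1<=length tg" using i by auto
  hence "Bx (yvec (y_lossy (the_pms b d n) tg)) u l (j + 1) =
   int (u ! j ! 1) - int (tg ! j ! 1) + int (bg_p b)"
   using Bx_lossy[OF assms(1,2) i(1)] by simp
  thus ?thesis by simp
 qed
 ultimately show ?thesis using i(1) by (intro bexI[of _ "j + 1"]) (auto simp: dvd_eq_mod_eq_0)
qed

definition xb :: "bool list=>nat=>int" where "xb X l = of_bool (X ! (l - 1))"

definition Sx :: "nat=>(sx=>int)=>bool list=>int" where
 "Sx n th X = (\<Sum>l = 1..n. th (SS l) * xb X l)"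

text \<open>The vector y occurs in the diagonal entries \<open>l2 = l1\<close> only. Hence each
  output word depends on the sum \<open>S\<close> of the selected exponents s and, through the
  diagonal, on the single bit \<open>xb X l\<close>.\<close>

lemma HF_Eval_eq:
 assumes b: "bilinear_group b" and pk: "mpk_rel b d n (mexp Y th) pk" and d: "length u<=d"
 shows "HF_Eval (the_pms b d n) pk u X = (let P = (%x. bg_g b [^]\<^bsub>bg_G b\<^esub> x); S = Sx n th X in
  (P (th SV * S),map (%l. P (th (SW l) * S)) [1..<n + 1],
   map (%i. map (%l. P (th (SH i 0 l) * Bx Y u l i * th (SS l) * xb X l +
    (th (SH i 1 l) * int (u ! (i - 1) ! 0) + th (SH i 2 l) * int (u ! (i - 1) ! 1)) * S)) [1..<n + 1]) [1..<length u + 1]))"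
proof -
 interpret G: prime_group "bg_G b" "bg_p b" "bg_g b" by (rule bilinear_groups(1)[OF b])
 define S where "S = Sx n th X"
 define P where "P m = G.ex (mexp Y th m)" for m
 note a = bspec[OF conjunct2[OF pk[unfolded mpk_rel_def Let_def, folded P_def]]]
 have r: "pk_J pk l = G.ex (th SV * th (SS l))" if "l:{1..n}" for l
  using a[OF that] unfolding P_def by simp
 have r': "pk_Cw pk (l,l1) = G.ex (th (SW l1) * th (SS l))" if "l:{1..n}" "l1:{1..n}" for l l1
  using a[OF that(1)] that(2) unfolding P_def mexp.simps by blast
 have r3: "pk_C pk (i,k,l,l1) = G.ex (mexp Y th (MC i k l l1))" if "l:{1..n}" "i:{1..d}" "k:{1..2}" "l1:{1..n}" for l i k l1
  using a[OF that(1)] that(2-4) unfolding P_def by blast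
 have fp: "(\<Otimes>\<^bsub>bg_G b\<^esub>l\<in>{1..n}. F l [^]\<^bsub>bg_G b\<^esub> (of_bool (X ! (l - 1)) :: nat)) = G.ex (\<Sum>l = 1..n. f l * xb X l)"
  if "!!l. l:{1..n} ==> F l = G.ex (f l)" for F f
 proof -
  interpret comm_group "bg_G b" by (rule G.comm)
  have "(\<Otimes>\<^bsub>bg_G b\<^esub>l\<in>{1..n}. F l [^]\<^bsub>bg_G b\<^esub> (of_bool (X ! (l - 1)) :: nat)) = (\<Otimes>\<^bsub>bg_G b\<^esub>l\<in>{1..n}. G.ex (f l * xb X l))"
   by (rule finprod_cong') (auto simp: that G.ex_pow xb_def)
  thus ?thesis by (simp add: G.ex_finprod)
 qed
 have 1: "(\<Otimes>\<^bsub>bg_G b\<^esub>l2\<in>{1..n}. pk_J pk l2 [^]\<^bsub>bg_G b\<^esub> (of_bool (X ! (l2 - 1)) :: nat)) = G.ex (th SV * S)"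
  by (subst fp[OF r], assumption) (simp add: S_def Sx_def sum_distrib_left mult.assoc)
 have 2: "(\<Otimes>\<^bsub>bg_G b\<^esub>l2\<in>{1..n}. pk_Cw pk (l2,l) [^]\<^bsub>bg_G b\<^esub> (of_bool (X ! (l2 - 1)) :: nat)) = G.ex (th (SW l) * S)"
  if "l:{1..n}" for l
  by (subst fp[OF r'[OF _ that]], assumption) (simp add: S_def Sx_def sum_distrib_left mult.assoc)
 have 3: "(\<Otimes>\<^bsub>bg_G b\<^esub>l2\<in>{1..n}. (\<Otimes>\<^bsub>bg_G b\<^esub>k\<in>{1..2}. pk_C pk (i,k,l2,l) [^]\<^bsub>bg_G b\<^esub> (u ! (i - 1) ! (k - 1)))
    [^]\<^bsub>bg_G b\<^esub> (of_bool (X ! (l2 - 1)) :: nat)) =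
   G.ex (th (SH i 0 l) * Bx Y u l i * th (SS l) * xb X l +
    (th (SH i 1 l) * int (u ! (i - 1) ! 0) + th (SH i 2 l) * int (u ! (i - 1) ! 1)) * S)"
  if l: "l:{1..n}" and i: "i:{1..length u}" for l i
 proof -
  have i': "i:{1..d}" using i d by auto
  let ?H = "th (SH i 1 l) * int (u ! (i - 1) ! 0) + th (SH i 2 l) * int (u ! (i - 1) ! 1)"
  let ?f = "%l2. mexp Y th (MC i 1 l2 l) * int (u ! (i - 1) ! 0) + mexp Y th (MC i 2 l2 l) * int (u ! (i - 1) ! 1)"
  have "(\<Sum>l2 = 1..n. ?f l2 * xb X l2) =
    (\<Sum>l2 = 1..n. (if l2 = l then th (SH i 0 l) * Bx Y u l i * th (SS l) * xb X l else 0) + ?H * (th (SS l2) * xb X l2))"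
   by (intro sum.cong refl) (simp add: Bx_def algebra_simps)
  also have "... = th (SH i 0 l) * Bx Y u l i * th (SS l) * xb X l + ?H * S"
   using l by (simp add: sum.distrib S_def Sx_def sum_distrib_left sum.delta')
  finally have s: "(\<Sum>l2 = 1..n. ?f l2 * xb X l2) = ..." .
  show ?thesis
  proof (subst fp[where f = ?f])
   show "(\<Otimes>\<^bsub>bg_G b\<^esub>k\<in>{1..2}. pk_C pk (i,k,l2,l) [^]\<^bsub>bg_G b\<^esub> (u ! (i - 1) ! (k - 1))) = G.ex (?f l2)"
    if "l2:{1..n}" for l2
    by (rule G.finprod_12) (simp_all add: r3[OF that i' _ l] G.ex_pow del: mexp.simps)
  qed (simp only: s)
 qed
 have upt: "set [1..<m + 1] = {1..m}" for m by auto
 show ?thesis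
  unfolding HF_Eval_def Let_def params.simps S_def[symmetric] prod.inject
  by (intro conjI 1 map_cong refl 2 3) (simp_all only: upt)
qed

lemma HF_Eval_inj:
 assumes b: "bilinear_group b" and pk: "mpk_rel b d n (mexp Y th) pk" and u: "length u<=d"
  and nz: "!!x. x:SI d n ==> \<not> int (bg_p b) dvd th x"
  and B: "!!l. EX i:{1..length u}. Bx Y u l i mod int (bg_p b)~=0"
 shows "inj_on (HF_Eval (the_pms b d n) pk u) {X. length X = n}"
proof (rule inj_onI, clarify)
 interpret G: prime_group "bg_G b" "bg_p b" "bg_g b" by (rule bilinear_groups(1)[OF b])
 let ?p = "int (bg_p b)"
 have pr: "prime ?p" using G.prime_p by simp
 fix X X' :: "bool list"
 assume len: "n = length X" "length X' = length X"
  and eq: "HF_Eval \<lparr>pr_bg = b,pr_n = length X,pr_d = d,pr_mu = 2\<rparr> pk u X = HF_Eval \<lparr>pr_bg = b,pr_n = length X,pr_d = d,pr_mu = 2\<rparr> pk u X'"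
 let ?S = "Sx n th X" and ?S' = "Sx n th X'"
 note eq' = eq[folded len(1), unfolded HF_Eval_eq[OF b pk u] Let_def prod.inject G.ex_eq_iff]
 \<comment> \<open>The first output word fixes \<open>S\<close> modulo p, since \<open>th SV\<close>
   is a unit. The terms with \<open>S\<close> then cancel in all other words and leave the bits
   times units.\<close>
 have "?p dvd th SV * (?S - ?S')" using eq' by (simp add: mod_eq_dvd_iff algebra_simps)
 hence S: "?p dvd ?S - ?S'" using nz[of SV] pr by (simp add: prime_dvd_mult_iff)
 have xb: "xb X l = xb X' l" if l: "l:{1..n}" for l
 proof -
  obtain i where i: "i:{1..length u}" "Bx Y u l i mod ?p~=0" using B by blast
  let ?H = "th (SH i 1 l) * int (u ! (i - 1) ! 0) + th (SH i 2 l) * int (u ! (i - 1) ! 1)"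
  let ?c = "th (SH i 0 l) * Bx Y u l i * th (SS l)"
  have "G.ex (?c * xb X l + ?H * ?S) = G.ex (?c * xb X' l + ?H * ?S')"
  proof -
   have "i:set [1..<length u + 1]" "l:set [1..<n + 1]" using i l by auto
   from bspec[OF bspec[OF eq'[THEN conjunct2, THEN conjunct2, unfolded map_eq_conv] this(1), unfolded map_eq_conv] this(2)]
   show ?thesis .
  qed
  hence "?p dvd (?c * xb X l + ?H * ?S) - (?c * xb X' l + ?H * ?S')" by (simp add: G.ex_eq_iff mod_eq_dvd_iff)
  moreover have "?p dvd ?H * (?S - ?S')" using S by simp
  ultimately have "?p dvd ((?c * xb X l + ?H * ?S) - (?c * xb X' l + ?H * ?S')) - ?H * (?S - ?S')" by (rule dvd_diff)
  hence "?p dvd ?c * (xb X l - xb X' l)" by (simp add: algebra_simps)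
  moreover have "\<not> ?p dvd ?c"
  proof -
   have "\<not> ?p dvd th (SH i 0 l)" "\<not> ?p dvd th (SS l)" using i l u by (auto intro!: nz)
   moreover have "\<not> ?p dvd Bx Y u l i" using i(2) by (metis dvd_imp_mod_0)
   ultimately show ?thesis by (simp add: prime_dvd_mult_iff[OF pr])
  qed
  ultimately have d: "?p dvd xb X l - xb X' l" by (simp add: prime_dvd_mult_iff[OF pr])
  hence "xb X l mod ?p = xb X' l mod ?p" by (simp only: mod_eq_dvd_iff)
  thus ?thesis using G.p_gt_1 by (auto simp: xb_def split: if_splits)
 qed
 have xs: "xb X (Suc j) = xb X' (Suc j)" if "j < n" for j using that by (intro xb) auto
 have "X ! j = X' ! j" if "j < n" for j using xs[OF that] by (simp add: xb_def of_bool_eq_iff)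
 thus "X = X'" using len by (intro nth_equalityI) auto
qed

text \<open>When the terms with \<open>Bx\<close> vanish, the output is a function of
  \<open>Sx\<close> modulo p alone.\<close>

lemma HF_Eval_lossy:
 assumes b: "bilinear_group b" and pk: "mpk_rel b d n (mexp Y th) pk" and u: "length u<=d"
  and B: "!!l i. i:{1..length u} ==> Bx Y u l i mod int (bg_p b) = 0"
 shows "card (HF_Eval (the_pms b d n) pk u ` {X. length X = n})<=bg_p b"
proof -
 interpret G: prime_group "bg_G b" "bg_p b" "bg_g b" by (rule bilinear_groups(1)[OF b])
 let ?p = "int (bg_p b)"
 let ?F = "%S. (G.ex (th SV * S),map (%l. G.ex (th (SW l) * S)) [1..<n + 1],
   map (%i. map (%l. G.ex ((th (SH i 1 l) * int (u ! (i - 1) ! 0) + th (SH i 2 l) * int (u ! (i - 1) ! 1)) * S)) [1..<n + 1]) [1..<length u + 1])"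
 have "HF_Eval (the_pms b d n) pk u X = ?F (Sx n th X mod ?p)" for X
 proof -
  have m: "G.ex (c * (S mod ?p)) = G.ex (c * S)" for c S by (simp add: G.ex_eq_iff mod_mult_right_eq)
  have k: "G.ex (th (SH i 0 l) * Bx Y u l i * th (SS l) * xb X l + T) = G.ex T" if "i:{1..length u}" for i l T
  proof -
   have "?p dvd th (SH i 0 l) * Bx Y u l i * th (SS l) * xb X l" proof -
    have "?p dvd Bx Y u l i" using B[OF that, of l] by (rule mod_0_imp_dvd)
    thus ?thesis by (rule dvd_mult2[OF dvd_mult2[OF dvd_mult]])
   qed
   thus ?thesis by (simp add: G.ex_eq_iff mod_eq_dvd_iff)
  qed
  have upt: "set [1..<m + 1] = {1..m}" for m by auto
  show ?thesis unfolding HF_Eval_eq[OF b pk u] Let_def m prod.inject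
   by (intro conjI refl map_cong k) (simp only: upt)
 qed
 hence "HF_Eval (the_pms b d n) pk u ` {X. length X = n}<=?F ` {0..<?p}"
  using G.p_gt_1 by auto
 hence "card (HF_Eval (the_pms b d n) pk u ` {X. length X = n})<=card (?F ` {0..<?p})"
  by (intro card_mono) auto
 also have "...<=bg_p b" using card_image_le[of "{0..<?p}" ?F] by simp
 finally show ?thesis .
qed

section \<open>The experiments as games over exponents\<close>

definition kgame :: "bgroup=>nat=>ident=>query com=>mem=>reg=>nat list=>(ident=>'k pmf) =>
  (ident=>'k=>nat list=>'k pmf)=>(ident=>'k=>nat list)=>bool pmf" where
 "kgame b d tg c M a ws K D W =
   map_pmf (%x. out_bit (fst x)) (exec b (kenv (bg_p b) d tg K D W) c (store_words a ws M,Map.empty))"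

text \<open>\<open>Q\<close> is the distribution of a single exponent: nonzero residues in the
  experiments, all residues in the hybrids.\<close>

definition genK :: "nat pmf=>nat=>nat=>ident=>(kx=>int) pmf" where
 "genK Q d n u = map_pmf (%rv. fresh d n (length u) (%x. int (rv x))) (Pi_pmf (RS d n) 0 (%_. Q))"

definition genD :: "nat pmf=>nat=>nat=>nat=>ident=>(kx=>int)=>nat list=>(kx=>int) pmf" where
 "genD Q p d n u ka v = map_pmf (%rv. deleg p d n (length u) v ka (%x. int (rv x))) (Pi_pmf (RS d n) 0 (%_. Q))"

text \<open>Of the set IS only the invariant survives that its members are valid and no prefixes of
  the target. This is all that the abort bit will need.\<close>

lemma rel_key_queries:
 fixes nn :: "nat=>nat"
 assumes b: "bilinear_group b" and msk: "msk_rel b sec msk"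
 shows "rel_pmf (%x y. fst x = fst y & (ALL u:ch_revealed (snd y). valid_id (bg_p b) d u & \<not> prefix u tg))
  (exec b (kenv (bg_p b) d tg (genK (unif_nz (bg_p b)) d n) (genD (unif_nz (bg_p b)) (bg_p b) d n) (key_words b d n sec)) c (M,Map.empty))
  (exec b (key_queries (HF bg nn d) (the_pms b d n) (HF_Kg (the_pms b d n) msk) mpk tg) c
   (M,\<lparr>ch_keys = Map.empty,ch_revealed = {}\<rparr>))"
proof -
 let ?K = "genK (unif_nz (bg_p b)) d n" and ?D = "genD (unif_nz (bg_p b)) (bg_p b) d n"
 let ?e = "kenv (bg_p b) d tg ?K ?D (key_words b d n sec)"
 let ?e' = "key_queries (HF bg nn d) (the_pms b d n) (HF_Kg (the_pms b d n) msk) mpk tg"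
 define U where "U u = usk_rel b d n sec u" for u
 let ?S = "%s s' :: usk challenger. (ALL u. rel_option (U u) (s u) (ch_keys s' u) & (s u~=None --> valid_id (bg_p b) d u)) &
   (ALL u:ch_revealed s'. valid_id (bg_p b) d u & \<not> prefix u tg)"
 have K: "rel_pmf (U u) (?K u) (HF_Kg (the_pms b d n) msk u)" if "valid_id (bg_p b) d u" for u
  unfolding genK_def U_def using that by (intro rel_HF_Kg[OF b msk]) (simp add: valid_id_def)
 have D: "rel_pmf (U (u @ [v])) (?D u k v) (HF_Del (the_pms b d n) mpk u sk v)"
  if "valid_id (bg_p b) d (u @ [v])" "U u k sk" for u k v sk
  unfolding genD_def U_def using that by (intro rel_HF_Del[OF b]) (auto simp: valid_id_def U_def)
 have upd: "?S (s(u \<mapsto> k)) (s'\<lparr>ch_keys := (ch_keys s')(u \<mapsto> k')\<rparr>)" if "?S s s'" "valid_id (bg_p b) d u" "U u k k'" for s s' u k k'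
  using that by auto
 have id: "u:hf_id_sp (HF bg nn d) (the_pms b d n) <-> valid_id (bg_p b) d u" for u
  by (simp add: HF_def IdSp_iff_valid_id)
 have hf: "hf_del (HF bg nn d) = HF_Del" "hf_sk_words (HF bg nn d) = usk_words" by (simp_all add: HF_def)
 have "rel_pmf (rel_prod (=) ?S) (exec b ?e c (M,Map.empty)) (exec b ?e' c (M,\<lparr>ch_keys = Map.empty,ch_revealed = {}\<rparr>))"
 proof (rule rel_exec)
  fix q M s s'
  assume q: "q:queries c" and S: "?S s s'"
  show "rel_pmf (rel_prod (=) ?S) (?e q (M,s)) (?e' q (M,s'))"
  proof (cases q)
   case (Create_Key a)
   let ?u = "read_ident 2 M a"
   show ?thesis
   proof (cases "valid_id (bg_p b) d ?u")
    case True
    have "rel_pmf (rel_prod (=) ?S) (map_pmf (%k. (M,s(?u \<mapsto> k))) (?K ?u))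
      (map_pmf (%sk. (M,s'\<lparr>ch_keys := (ch_keys s')(?u \<mapsto> sk)\<rparr>)) (HF_Kg (the_pms b d n) msk ?u))"
     unfolding pmf.rel_map
     by (rule pmf.rel_mono_strong[OF K[OF True]]) (use upd[OF S True] in auto)
    thus ?thesis using Create_Key True by (simp add: kenv_def key_queries_def Let_def id)
   qed (use Create_Key S in "simp add: kenv_def key_queries_def Let_def id")
  next
   case (Create_Delegated_Key a c')
   let ?u = "read_ident 2 M a" and ?v = "read_words 2 M c'"
   have Su: "rel_option (U ?u) (s ?u) (ch_keys s' ?u)" using S by blast
   show ?thesis
   proof (cases "s ?u")
    case None
    hence "ch_keys s' ?u = None" using Su by simp
    thus ?thesis using Create_Delegated_Key None S by (simp add: kenv_def key_queries_def Let_def)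
   next
    case (Some k)
    then obtain k' where k': "ch_keys s' ?u = Some k'" "U ?u k k'" using Su by (auto simp: option_rel_Some1)
    show ?thesis
    proof (cases "valid_id (bg_p b) d (?u @ [?v])")
     case True
     have "rel_pmf (rel_prod (=) ?S)
      (map_pmf (%k. (M,s(?u @ [?v] \<mapsto> k))) (?D ?u k ?v))
      (map_pmf (%sk. (M,s'\<lparr>ch_keys := (ch_keys s')(?u @ [?v] \<mapsto> sk)\<rparr>)) (HF_Del (the_pms b d n) mpk ?u k' ?v))"
      unfolding pmf.rel_map
      by (rule pmf.rel_mono_strong[OF D[OF True k'(2)]]) (use upd[OF S True] in auto)
     thus ?thesis using Create_Delegated_Key True Some k' by (simp add: kenv_def key_queries_def Let_def id hf)
    qed (use Create_Delegated_Key S Some k' in "simp add: kenv_def key_queries_def Let_def id")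
   qed
  next
   case (Reveal_Key a r)
   let ?u = "read_ident 2 M a"
   have Su: "rel_option (U ?u) (s ?u) (ch_keys s' ?u)" using S by blast
   show ?thesis
   proof (cases "s ?u")
    case None
    hence "ch_keys s' ?u = None" using Su by simp
    thus ?thesis using Reveal_Key None S by (simp add: kenv_def key_queries_def Let_def)
   next
    case (Some k)
    then obtain k' where k': "ch_keys s' ?u = Some k'" "U ?u k k'" using Su by (auto simp: option_rel_Some1)
    have v: "valid_id (bg_p b) d ?u" using S Some by auto
    have w: "usk_words (the_pms b d n) (length ?u) k' = key_words b d n sec ?u k"
     by (rule usk_words_eq) (use k' in "simp add: U_def")
    show ?thesis
    proof (cases "prefix ?u tg")
     case True
     thus ?thesis using Reveal_Key Some k' S by (simp add: kenv_def key_queries_def Let_def)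
    next
     case False
     thus ?thesis using Reveal_Key Some k' S v by (simp add: kenv_def key_queries_def Let_def hf w)
    qed
   qed
  qed
 qed simp
 thus ?thesis by (rule pmf.rel_mono_strong) auto
qed

lemma unif_nz_not_dvd:
 assumes "1 < p" "finite I" "th:set_pmf (Pi_pmf I 0 (%_. unif_nz p))" "x:I"
 shows "\<not> int p dvd int (th x)"
proof -
 have "th x:{1..<p}"
  using assms by (auto simp: set_Pi_pmf PiE_dflt_def unif_nz_def set_pmf_of_set)
 thus ?thesis by (auto dest: zdvd_imp_le)
qed

definition real_Y :: "bgroup=>nat=>nat=>nat=>nat=>nat=>int" where
 "real_Y b d n = yvec (y_injective (the_pms b d n))"

definition lossy_Y :: "bgroup=>nat=>nat=>ident=>nat=>nat=>nat=>int" where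
 "lossy_Y b d n tg = yvec (y_lossy (the_pms b d n) tg)"

definition xgame :: "nat pmf=>bgroup=>nat=>nat=>ident=>query com=>mem=>reg=>(nat=>nat=>nat=>int)=>bool pmf" where
 "xgame Q b d n tg c M a Y = bind_pmf (Pi_pmf (SI d n) 0 (%_. Q)) (%th.
   kgame b d tg c M a (mwords b d n (mexp Y (%x. int (th x)))) (genK Q d n) (genD Q (bg_p b) d n)
    (key_words b d n (sec_of (%x. int (th x)))))"

text \<open>Both key pairs are coupled with exponents: the transmitted one determines the game, and
  the lossy one, from which the abort bit is computed in either experiment, shows that this bit is
  always \<open>True\<close>.\<close>

lemma experiment_eq:
 assumes b: "bilinear_group (bg k)" and sel: "selective_adversary (HF bg n d) k A"
  and rv: "rv = real (n k) - log 2 (real (bg_p (bg k)))"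
 shows "lossy_experiment (HF bg n d) LHF trivial_pre_output rv k lossy A =
  map_pmf (%x. (x,True)) (bind_pmf (choose_stage (the_pms (bg k) d (n k)) A) (%M.
   let tg = target_ident (the_pms (bg k) d (n k)) A M in
   xgame (unif_nz (bg_p (bg k))) (bg k) d (n k) tg (adv_attack A) M (adv_mpk A)
    (if lossy then lossy_Y (bg k) d (n k) tg else real_Y (bg k) d (n k))))"
proof -
 let ?b = "bg k" and ?n = "n k" and ?Q = "unif_nz (bg_p (bg k))"
 let ?pms = "the_pms ?b d ?n"
 interpret G: prime_group "bg_G ?b" "bg_p ?b" "bg_g ?b" by (rule bilinear_groups(1)[OF b])
 let ?I = "Pi_pmf (SI d ?n) 0 (%_. ?Q)"
 let ?kg = "%tg M Y th. kgame ?b d tg (adv_attack A) M (adv_mpk A) (mwords ?b d ?n (mexp Y (%x. int (th x)))) (genK ?Q d ?n) (genD ?Q (bg_p ?b) d ?n)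
    (key_words ?b d ?n (sec_of (%x. int (th x))))"
 have pms: "the_params bg n d k = ?pms" by (simp add: the_params_def)
 have main: "bind_pmf (HF_MKg ?pms (y_injective ?pms)) (%(mpk0,msk0). bind_pmf (HF_MKg ?pms (y_lossy ?pms tg)) (%(mpk1,msk1).
   bind_pmf (exec ?b (key_queries (HF bg n d) ?pms (if lossy then HF_Kg ?pms msk1 else HF_Kg ?pms msk0) (if lossy then mpk1 else mpk0) tg)
     (adv_attack A) (store_words (adv_mpk A) (mpk_words ?pms (if lossy then mpk1 else mpk0)) M,\<lparr>ch_keys = Map.empty,ch_revealed = {}\<rparr>))
    (%(M',s). return_pmf (out_bit M',((ALL u:ch_revealed s. lossiness {X. length X = ?n} (HF_Eval ?pms mpk1 u) = 0) &
      lossiness {X. length X = ?n} (HF_Eval ?pms mpk1 tg) \<ge> rv) & True)))) =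
   map_pmf (%x. (x,True)) (xgame ?Q ?b d ?n tg (adv_attack A) M (adv_mpk A) (if lossy then lossy_Y ?b d ?n tg else real_Y ?b d ?n))"
  (is "?L = ?R") if tg: "valid_id (bg_p ?b) d tg" for tg M
 proof -
  have R: "?R = bind_pmf ?I (%th0. bind_pmf ?I (%th1. map_pmf (%x. (x,True))
    (?kg tg M (if lossy then lossy_Y ?b d ?n tg else real_Y ?b d ?n) (if lossy then th1 else th0))))"
   by (cases lossy) (simp_all add: xgame_def map_bind_pmf)
  have "rel_pmf (=) ?R ?L"
   unfolding R
  proof (rule rel_pmf_bindI[OF pmf.rel_mono_strong[OF rel_HF_MKg[OF b, of d ?n "y_injective ?pms"]]])
   fix th0 pm0 assume *: "th0:set_pmf ?I"
    "case pm0 of (pk,msk)=>mpk_rel ?b d ?n (mexp (yvec (y_injective ?pms)) (%x. int (th0 x))) pk & msk_rel ?b (sec_of (%x. int (th0 x))) msk"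
   thus "th0:set_pmf ?I & (case pm0 of (pk,msk)=>mpk_rel ?b d ?n (mexp (real_Y ?b d ?n) (%x. int (th0 x))) pk &
    msk_rel ?b (sec_of (%x. int (th0 x))) msk)" by (simp add: real_Y_def)
  next
   fix th0 pm0 assume 0: "th0:set_pmf ?I & (case pm0 of (pk,msk)=>mpk_rel ?b d ?n (mexp (real_Y ?b d ?n) (%x. int (th0 x))) pk &
    msk_rel ?b (sec_of (%x. int (th0 x))) msk)"
   obtain pk0 mk0 where pm0: "pm0 = (pk0,mk0)" by (cases pm0)
   show "rel_pmf (=) (bind_pmf ?I (%th1. map_pmf (%x. (x,True))
    (?kg tg M (if lossy then lossy_Y ?b d ?n tg else real_Y ?b d ?n) (if lossy then th1 else th0))))
    (case pm0 of (mpk0,msk0)=>bind_pmf (HF_MKg ?pms (y_lossy ?pms tg)) (%(mpk1,msk1).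
   bind_pmf (exec ?b (key_queries (HF bg n d) ?pms (if lossy then HF_Kg ?pms msk1 else HF_Kg ?pms msk0) (if lossy then mpk1 else mpk0) tg)
     (adv_attack A) (store_words (adv_mpk A) (mpk_words ?pms (if lossy then mpk1 else mpk0)) M,\<lparr>ch_keys = Map.empty,ch_revealed = {}\<rparr>))
    (%(M',s). return_pmf (out_bit M',((ALL u:ch_revealed s. lossiness {X. length X = ?n} (HF_Eval ?pms mpk1 u) = 0) &
      lossiness {X. length X = ?n} (HF_Eval ?pms mpk1 tg) \<ge> rv) & True))))"
    unfolding pm0 prod.case
   proof (rule rel_pmf_bindI[OF pmf.rel_mono_strong[OF rel_HF_MKg[OF b, of d ?n "y_lossy ?pms tg"]]])
    fix th1 pm1 assume "th1:set_pmf ?I"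
     "case pm1 of (pk,msk)=>mpk_rel ?b d ?n (mexp (yvec (y_lossy ?pms tg)) (%x. int (th1 x))) pk & msk_rel ?b (sec_of (%x. int (th1 x))) msk"
    thus "th1:set_pmf ?I & (case pm1 of (pk,msk)=>mpk_rel ?b d ?n (mexp (lossy_Y ?b d ?n tg) (%x. int (th1 x))) pk &
     msk_rel ?b (sec_of (%x. int (th1 x))) msk)" by (simp add: lossy_Y_def)
   next
    fix th1 pm1 assume 1: "th1:set_pmf ?I & (case pm1 of (pk,msk)=>mpk_rel ?b d ?n (mexp (lossy_Y ?b d ?n tg) (%x. int (th1 x))) pk &
     msk_rel ?b (sec_of (%x. int (th1 x))) msk)"
    obtain pk1 mk1 where pm1: "pm1 = (pk1,mk1)" by (cases pm1)
    have rel1: "mpk_rel ?b d ?n (mexp (lossy_Y ?b d ?n tg) (%x. int (th1 x))) pk1" using 1 pm1 by simp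
    define th where "th = (if lossy then th1 else th0)"
    define pk where "pk = (if lossy then pk1 else pk0)"
    define mk where "mk = (if lossy then mk1 else mk0)"
    define Y where "Y = (if lossy then lossy_Y ?b d ?n tg else real_Y ?b d ?n)"
    have mk: "msk_rel ?b (sec_of (%x. int (th x))) mk" and pk: "mpk_rel ?b d ?n (mexp Y (%x. int (th x))) pk"
     using 0 1 pm0 pm1 by (auto simp: th_def pk_def mk_def Y_def)
    have kg: "(if lossy then HF_Kg ?pms mk1 else HF_Kg ?pms mk0) = HF_Kg ?pms mk" by (simp add: mk_def)
    have card: "card {X :: bool list. length X = ?n} = 2 ^ ?n"
     using card_lists_length_eq[of "UNIV :: bool set" ?n] by simp
    have inj: "lossiness {X. length X = ?n} (HF_Eval ?pms pk1 u) = 0" if "valid_id (bg_p ?b) d u" "\<not> prefix u tg" for u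
    proof -
     have "inj_on (HF_Eval ?pms pk1 u) {X. length X = ?n}"
     proof (rule HF_Eval_inj[OF b rel1])
      show "length u<=d" using that by (simp add: valid_id_def)
      show "\<not> int (bg_p ?b) dvd int (th1 x)" if "x:SI d ?n" for x
      using 1 that by (intro unif_nz_not_dvd[OF G.p_gt_1 finite_SI]) auto
      show "EX i:{1..length u}. Bx (lossy_Y ?b d ?n tg) u l i mod int (bg_p ?b)~=0" for l
      unfolding lossy_Y_def by (rule Bx_lossy_not_prefix[OF tg that])
     qed
     thus ?thesis by (simp add: lossiness_def card_image card)
    qed
    have lossy: "rv<=lossiness {X. length X = ?n} (HF_Eval ?pms pk1 tg)"
    proof -
     let ?c = "card (HF_Eval ?pms pk1 tg ` {X. length X = ?n})"
     have le: "?c<=bg_p ?b"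
      by (rule HF_Eval_lossy[OF b rel1]) (use tg Bx_lossy_prefix[OF tg tg] in "auto simp: valid_id_def lossy_Y_def")
     have "finite {X :: bool list. length X = ?n}" using card card_gt_0_iff by fastforce
     moreover have "{X :: bool list. length X = ?n}~={}" using Ex_list_of_length by auto
     ultimately have "0 < ?c" by (simp add: card_gt_0_iff)
     hence "log 2 (real ?c)<=log 2 (real (bg_p ?b))" using le by simp
     thus ?thesis using \<open>0 < ?c\<close> by (simp add: lossiness_def card rv log_divide)
    qed
    have "rel_pmf (%x y. x = y)
      (bind_pmf (exec ?b (kenv (bg_p ?b) d tg (genK ?Q d ?n) (genD ?Q (bg_p ?b) d ?n) (key_words ?b d ?n (sec_of (%x. int (th x))))) (adv_attack A)
      (store_words (adv_mpk A) (mpk_words ?pms pk) M,Map.empty)) (%x. return_pmf (out_bit (fst x),True)))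
      (bind_pmf (exec ?b (key_queries (HF bg n d) ?pms (HF_Kg ?pms mk) pk tg)
     (adv_attack A) (store_words (adv_mpk A) (mpk_words ?pms pk) M,\<lparr>ch_keys = Map.empty,ch_revealed = {}\<rparr>))
    (%(M',s). return_pmf (out_bit M',((ALL u:ch_revealed s. lossiness {X. length X = ?n} (HF_Eval ?pms pk1 u) = 0) &
      lossiness {X. length X = ?n} (HF_Eval ?pms pk1 tg) \<ge> rv) & True)))"
     by (rule rel_pmf_bindI[OF rel_key_queries[OF b mk]]) (auto simp: inj lossy)
    thus "rel_pmf (=) (map_pmf (%x. (x,True)) (?kg tg M (if lossy then lossy_Y ?b d ?n tg else real_Y ?b d ?n) (if lossy then th1 else th0)))
    (case pm1 of (mpk1,msk1)=>bind_pmf (exec ?b (key_queries (HF bg n d) ?pms (if lossy then HF_Kg ?pms msk1 else HF_Kg ?pms mk0) (if lossy then mpk1 else pk0) tg)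
     (adv_attack A) (store_words (adv_mpk A) (mpk_words ?pms (if lossy then mpk1 else pk0)) M,\<lparr>ch_keys = Map.empty,ch_revealed = {}\<rparr>))
    (%(M',s). return_pmf (out_bit M',((ALL u:ch_revealed s. lossiness {X. length X = ?n} (HF_Eval ?pms mpk1 u) = 0) &
      lossiness {X. length X = ?n} (HF_Eval ?pms mpk1 tg) \<ge> rv) & True)))"
     unfolding pm1 prod.case th_def[symmetric] pk_def[symmetric] Y_def[symmetric] kg mpk_words_eq[OF pk]
     by (simp add: kgame_def map_pmf_def bind_assoc_pmf bind_return_pmf)
   qed
  qed
  thus ?thesis by (simp add: pmf.rel_eq)
 qed
 have hf: "hf_setup (HF bg n d) = (%k. return_pmf (the_params bg n d k))" "hf_mkg (HF bg n d) = (%pms. HF_MKg pms (y_injective pms))"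
  "hf_kg (HF bg n d) = HF_Kg" "lhf_kg LHF = HF_Kg" "lhf_mkg LHF = (%pms u. HF_MKg pms (y_lossy pms u))"
  "hf_eval (HF bg n d) = HF_Eval" "hf_mpk_words (HF bg n d) = mpk_words" "hf_inp_sp (HF bg n d) = (%pms. {X. length X = pr_n pms})"
  by (simp_all add: HF_def LHF_def)
 show ?thesis
  unfolding lossy_experiment_def hf bind_return_pmf pms trivial_pre_output_def Let_def map_bind_pmf params.simps
 proof (rule bind_pmf_cong[OF refl])
  fix M assume "M:set_pmf (choose_stage ?pms A)"
  hence "valid_id (bg_p ?b) d (target_ident ?pms A M)"
   using sel by (auto simp: selective_adversary_def HF_def IdSp_iff_valid_id pms)
  from main[OF this, of M]
  show "HF_MKg ?pms (y_injective ?pms) \<bind> (%(mpk0,msk0). HF_MKg ?pms (y_lossy ?pms (target_ident ?pms A M)) \<bind> (%(mpk1,msk1).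
   exec ?b (key_queries (HF bg n d) ?pms (if lossy then HF_Kg ?pms msk1 else HF_Kg ?pms msk0) (if lossy then mpk1 else mpk0) (target_ident ?pms A M))
     (adv_attack A) (store_words (adv_mpk A) (mpk_words ?pms (if lossy then mpk1 else mpk0)) M,\<lparr>ch_keys = Map.empty,ch_revealed = {}\<rparr>) \<bind>
    (%(M',s). return_pmf (out_bit M',((ALL u:ch_revealed s. lossiness {X. length X = ?n} (HF_Eval ?pms mpk1 u) = 0) &
      rv<=lossiness {X. length X = ?n} (HF_Eval ?pms mpk1 (target_ident ?pms A M))) & True)))) =
   map_pmf (%x. (x,True)) (xgame ?Q ?b d ?n (target_ident ?pms A M) (adv_attack A) M (adv_mpk A)
    (if lossy then lossy_Y ?b d ?n (target_ident ?pms A M) else real_Y ?b d ?n))" .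
 qed
qed

section \<open>Challengers given by polynomials\<close>

datatype 'v px = PC int | PV 'v | PA "'v px" "'v px" | PM "'v px" "'v px"

primrec pev :: "'v px=>('v=>int)=>int" where
 "pev (PC c) et = c"
| "pev (PV v) et = et v"
| "pev (PA x y) et = pev x et + pev y et"
| "pev (PM x y) et = pev x et * pev y et"

primrec psize :: "'v px=>nat" where
 "psize (PC c) = 1"
| "psize (PV v) = 2"
| "psize (PA x y) = psize x + psize y + 3"
| "psize (PM x y) = psize x + psize y + 3"

primrec pcomp :: "nat=>'v px=>'v ex" where
 "pcomp p (PC c) = EC (nat (c mod int p))"
| "pcomp p (PV v) = EV v"
| "pcomp p (PA x y) = EA Modulo (EA Plus (pcomp p x) (pcomp p y)) (EC p)"
| "pcomp p (PM x y) = EA Modulo (EA Times (pcomp p x) (pcomp p y)) (EC p)"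

lemma esize_pcomp: "esize (pcomp p e) = psize e" by (induction e) auto

lemma set_ex_pcomp: "set_ex (pcomp p e) = set_px e" by (induction e) auto

text \<open>Every intermediate result is reduced, so that products stay below p^2, which fits into a
  word in a bilinear group.\<close>

lemma eval_pcomp:
 assumes "1 < p" "p ^ 2<=2 ^ bg_w b" "!!v. v:set_px e ==> et v < p"
 shows "int (eval b (pcomp p e) et) = pev e (%v. int (et v)) mod int p"
 using assms(3)
proof (induction e)
 have pp: "p < p * p" using assms(1) by simp
 hence pw: "p < 2 ^ bg_w b" using assms(2) unfolding power2_eq_square by (rule less_le_trans)
 {
  case (PC c)
  have "nat (c mod int p) < p" using assms(1) by (simp add: nat_less_iff)
  hence "nat (c mod int p) < 2 ^ bg_w b" using pw by linarith
  thus ?case using assms(1) by simp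
 next
  case (PV v)
  hence "et v < p" by simp
  thus ?case using pw by simp
 next
  case (PA x y)
  let ?x = "eval b (pcomp p x) et" and ?y = "eval b (pcomp p y) et"
  have IH: "int ?x = pev x (%v. int (et v)) mod int p" "int ?y = pev y (%v. int (et v)) mod int p" using PA by auto
  have "int ?x < int p" "int ?y < int p" unfolding IH using assms(1) by auto
  hence "?x + ?y < 2 * p" by simp
  also have "2 * p<=p * p" using assms(1) by simp
  also have "...<=2 ^ bg_w b" using assms(2) by (simp add: power2_eq_square)
  finally have "?x + ?y < 2 ^ bg_w b" .
  moreover have "(?x + ?y) mod p < 2 ^ bg_w b" using assms(1) pw by (meson less_trans mod_less_divisor zero_less_one)
  ultimately have "eval b (pcomp p (PA x y)) et = (?x + ?y) mod p" using pw by simp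
  thus ?case by (simp add: zmod_int IH mod_add_eq)
 next
  case (PM x y)
  let ?x = "eval b (pcomp p x) et" and ?y = "eval b (pcomp p y) et"
  have IH: "int ?x = pev x (%v. int (et v)) mod int p" "int ?y = pev y (%v. int (et v)) mod int p" using PM by auto
  have "int ?x < int p" "int ?y < int p" unfolding IH using assms(1) by auto
  hence "?x < p" "?y < p" by simp_all
  hence "?x * ?y < p * p" using mult_strict_mono[of ?x p ?y p] by simp
  hence "?x * ?y < 2 ^ bg_w b" using assms(2) by (simp add: power2_eq_square)
  moreover have "(?x * ?y) mod p < 2 ^ bg_w b" using assms(1) pw by (meson less_trans mod_less_divisor zero_less_one)
  ultimately have "eval b (pcomp p (PM x y)) et = (?x * ?y) mod p" using pw by simp
  thus ?case by (simp add: zmod_int IH mod_mult_eq)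
 }
qed

text \<open>A product of challenge words with polynomials as exponents. This is how a word is
  computed whose discrete logarithm is unknown to the program.\<close>

primrec wordx :: "bgroup=>grp=>(nat=>'v)=>(nat \<times> 'v px) list=>'v ex" where
 "wordx b G f [] = EC (\<one>\<^bsub>the_grp b G\<^esub>)"
| "wordx b G f (jq # qs) = EM G (EP G (EV (f (fst jq))) (pcomp (bg_p b) (snd jq))) (wordx b G f qs)"

lemma eval_wordx:
 assumes pg: "prime_group (the_grp b G) (bg_p b) g" and wb: "word_bgroup b" and p: "1 < bg_p b" "bg_p b ^ 2<=2 ^ bg_w b"
  and v: "!!j q v. (j,q):set qs ==> v:set_px q ==> et v < bg_p b"
  and f: "!!j q. (j,q):set qs ==> et (f j) = g [^]\<^bsub>the_grp b G\<^esub> (e j :: int)"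
 shows "eval b (wordx b G f qs) et = g [^]\<^bsub>the_grp b G\<^esub> (\<Sum>(j,q)\<leftarrow>qs. e j * pev q (%v. int (et v)))"
 using v f
proof (induction qs)
 interpret prime_group "the_grp b G" "bg_p b" g by (rule pg)
 have car: "x < 2 ^ bg_w b" if "x:carrier (the_grp b G)" for x
  using wb that by (force simp: word_bgroup_def)
 {
  case Nil
  have "\<one>\<^bsub>the_grp b G\<^esub>:carrier (the_grp b G)" using ex_closed[of 0] by simp
  thus ?case using car by simp
 next
  case (Cons jq qs)
  obtain j q where jq: "jq = (j,q)" by (cases jq)
  have IH: "eval b (wordx b G f qs) et = ex (\<Sum>(j,q)\<leftarrow>qs. e j * pev q (%v. int (et v)))"
  proof (rule Cons.IH)
   fix j q v assume "(j,q):set qs"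
   hence *: "(j,q):set (jq # qs)" by simp
   show "et (f j) = ex (e j)" by (rule Cons.prems(2)[OF *])
   show "v:set_px q ==> et v < bg_p b" by (rule Cons.prems(1)[OF *])
  qed
  have q: "int (eval b (pcomp (bg_p b) q) et) = pev q (%v. int (et v)) mod int (bg_p b)"
   by (rule eval_pcomp[OF p]) (use Cons.prems jq in auto)
  have j: "et (f j) = ex (e j)" using Cons.prems(2)[of j q] jq by simp
  hence "et (f j) < 2 ^ bg_w b" using car by simp
  hence "eval b (EP G (EV (f j)) (pcomp (bg_p b) q)) et = ex (e j * int (eval b (pcomp (bg_p b) q) et))"
   using j by (simp add: ex_pow)
  also have "... = ex (e j * pev q (%v. int (et v)))"
   unfolding q by (simp add: ex_eq_iff mod_mult_right_eq)
  finally show ?case using IH jq by (simp add: ex_mult)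
 }
qed

lemma esize_wordx: "(!!j q. (j,q):set qs ==> psize q<=K) ==> esize (wordx b G f qs)<=length qs * (K + 4) + 1"
 by (induction qs) (force simp: esize_pcomp)+

lemma set_ex_wordx: "set_ex (wordx b G f qs)<=(\<Union>(j,q)\<in>set qs. {f j} Un set_px q)"
 by (induction qs) (auto simp: set_ex_pcomp)

fun iregs :: "instr=>reg set" where
 "iregs (Const r c) = {r}"
| "iregs (Arith f r x y) = {r,x,y}"
| "iregs (Sample r x) = {r,x}"
| "iregs (GMul i r x y) = {r,x,y}"
| "iregs (GExp i r x y) = {r,x,y}"
| "iregs (Pairing r x y) = {r,x,y}"

lemma (in simulator) instr_regs_eq: "instr_regs i = iregs i" by (cases i) auto

primrec regs_ok :: "nat=>nat=>nat=>query com=>bool" where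
 "regs_ok d ml R Skip <-> True"
| "regs_ok d ml R (Instr i) <-> iregs i<={..<R}"
| "regs_ok d ml R (Seq c c') <-> regs_ok d ml R c & regs_ok d ml R c'"
| "regs_ok d ml R (IfZero r c c') <-> r < R & regs_ok d ml R c & regs_ok d ml R c'"
| "regs_ok d ml R (Ask q) <-> (case q of Create_Key a=>a + 3 + 2 * d<=R
   | Create_Delegated_Key a c=>a + 3 + 2 * d<=R & c + 2<=R
   | Reveal_Key a r=>a + 3 + 2 * d<=R & r + 1 + ml<=R)"

lemma finite_iregs: "finite (iregs i)" by (cases i) auto

lemma regs_ok_mono: "regs_ok d ml R c ==> R<=R' ==> regs_ok d ml R' c"
 by (induction c) (auto split: query.splits)

lemma regs_ok_ex: "EX R. regs_ok d ml R c"
proof (induction c)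
 case (Instr i)
 obtain R where "ALL r:iregs i. r < R" using finite_nat_set_iff_bounded[of "iregs i"] finite_iregs[of i] by auto
 thus ?case by (intro exI[of _ R]) auto
next
 case (Seq c c')
 then obtain R R' where "regs_ok d ml R c" "regs_ok d ml R' c'" by auto
 thus ?case by (intro exI[of _ "max R R'"]) (auto intro: regs_ok_mono)
next
 case (IfZero r c c')
 then obtain R R' where "regs_ok d ml R c" "regs_ok d ml R' c'" by auto
 thus ?case by (intro exI[of _ "max (Suc r) (max R R')"]) (auto intro: regs_ok_mono)
next
 case (Ask q)
 show ?case
 proof (cases q)
  case (Create_Key a)
  thus ?thesis by (intro exI[of _ "a + 3 + 2 * d"]) simp
 next
  case (Create_Delegated_Key a c)
  thus ?thesis by (intro exI[of _ "a + 3 + 2 * d + c + 2"]) simp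
 next
  case (Reveal_Key a r)
  thus ?thesis by (intro exI[of _ "a + 3 + 2 * d + r + 1 + ml"]) simp
 qed
qed simp

lemma (in simulator) com_ok: "regs_ok d ml R c ==> com_ok c"
 by (induction c) (auto simp: instr_regs_eq split: query.splits)

text \<open>Challenge words do not occur in polynomials.\<close>

fun penv :: "ident=>nat list=>('r=>int)=>('i=>int)=>('i,'r) var=>int" where
 "penv u x rv pl (VId i k) = (if i < length u then int (u ! i ! k) else 0)"
| "penv u x rv pl (VX k) = int (x ! k)"
| "penv u x rv pl (VOm r) = rv r"
| "penv u x rv pl (VPl i) = pl i"
| "penv u x rv pl (VCh j) = 0"

definition polyK :: "nat=>'i set=>'r set=>(nat=>'i=>('i,'r) var px)=>ident=>('i=>int) pmf" where
 "polyK p IS R cp u = map_pmf (%rv i. if i:IS then pev (cp (length u) i) (penv u [] rv (%_. 0)) mod int p else 0) (UI p R)"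

definition polyD :: "nat=>'i set=>'r set=>(nat=>'i=>('i,'r) var px)=>ident=>('i=>int)=>nat list=>('i=>int) pmf" where
 "polyD p IS R dp u pl v = map_pmf (%rv i. if i:IS then pev (dp (length u) i) (penv u v rv pl) mod int p else 0) (UI p R)"

text \<open>\<open>e j\<close> is the discrete logarithm of challenge word \<open>j\<close>. It
  occurs in the analysis only; the program handles the word itself.\<close>

definition polyW :: "bgroup=>(nat=>int)=>(nat=>(nat \<times> ('i,'r) var px) list list)=>ident=>('i=>int)=>nat list" where
 "polyW b e rp u pl = map (%qs. bg_h b [^]\<^bsub>bg_H b\<^esub> (\<Sum>(j,q)\<leftarrow>qs. e j * pev q (penv u [] (%_. 0) pl))) (rp (length u))"

definition hardwire :: "mem=>reg list=>'q com" where
 "hardwire M rs = foldr (%r. Seq (Instr (Const r (M r)))) rs Skip"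

lemma cost_hardwire: "cost (hardwire M rs) = length rs"
 by (induction rs) (auto simp: hardwire_def)

lemma exec_hardwire:
 assumes "!!r. M r < 2 ^ bg_w b"
 shows "exec b env (hardwire M rs) (M',s) = return_pmf (%r. if r:set rs then M r else M' r,s)"
proof (induction rs arbitrary: M')
 case (Cons r rs)
 have "(%x. if x:set rs then M x else (M'(r := M r)) x) = (%x. if x:set (r # rs) then M x else M' x)" by auto
 thus ?case using Cons assms by (simp add: hardwire_def bind_return_pmf)
qed (simp add: hardwire_def)

abbreviation idvars :: "nat=>('i,'r) var set" where
 "idvars d \<equiv> {VId i k | i k. i < d & k < 2}"

lemma valid_id_entry_less:
 assumes "valid_id p d u" "i < length u" "k < 2" "1 < p"
 shows "u ! i ! k < p"
proof -
 have "i + 1:{1..length u}" using assms by auto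
 from valid_idD[OF assms(1) this] have "u ! i ! 0 = 1" "u ! i ! 1 < p" by simp_all
 moreover have "k = 0 \<or> k = 1" using assms(3) by linarith
 ultimately show ?thesis using assms(4) by (elim disjE) simp_all
qed

lemma pev_cong: "(!!v. v:set_px e ==> et v = et' v) ==> pev e et = pev e et'"
 by (induction e) auto

lemma less_if_eq_mod: "int a = x mod int p ==> 0 < p ==> a < p"
proof -
 assume "int a = x mod int p" "0 < p"
 hence "int a < int p" using pos_mod_bound[of "int p" x] by linarith
 thus "a < p" by simp
qed

lemma venv_penv:
 assumes "valid_id p d u" "1 < p" "!!r. rv r < p" "!!i. pl i < p"
  and "!!j. v~=VCh j" "!!i k. v = VId i k ==> k < 2" "!!k. v = VX k ==> x ! k < p"
 shows "venv ch u x rv pl v < p" "int (venv ch u x rv pl v) = penv u x (%r. int (rv r)) (%i. int (pl i)) v"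
proof -
 have "venv ch u x rv pl v < p & int (venv ch u x rv pl v) = penv u x (%r. int (rv r)) (%i. int (pl i)) v"
 proof (cases v)
  case (VId i k)
  hence k: "k < 2" using assms(6) by simp
  thus ?thesis using VId assms(2) valid_id_entry_less[OF assms(1) _ k assms(2), of i] by simp
 next
  case (VX k)
  thus ?thesis using assms(7) by simp
 qed (use assms(3-5) in simp_all)
 thus "venv ch u x rv pl v < p" "int (venv ch u x rv pl v) = penv u x (%r. int (rv r)) (%i. int (pl i)) v"
  by simp_all
qed

text \<open>The machine stores words and the games compute with integers; the invariant is that
  payloads are the same numbers, all below p.\<close>

lemma rel_poly:
 fixes cp dp :: "nat=>'i=>('i,'r) var px" and rp :: "nat=>(nat \<times> ('i,'r) var px) list list"
 assumes b: "bilinear_group b" and R: "finite Rs"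
  and cpv: "!!l i. set_px (cp l i)<=idvars d Un VOm ` Rs"
  and dpv: "!!l i. set_px (dp l i)<=idvars d Un VOm ` Rs Un VPl ` Is Un VX ` {..<2}"
  and rpv: "!!l qs j q. qs:set (rp l) ==> (j,q):set qs ==> set_px q<=idvars d Un VPl ` Is"
  and ch: "!!l qs j q. qs:set (rp l) ==> (j,q):set qs ==> ch j = bg_h b [^]\<^bsub>bg_H b\<^esub> (e j :: int)"
 shows "map_pmf fst (exec b (kenv (bg_p b) d tg
   (%u. map_pmf (%rv i. if i:Is then eval b (pcomp (bg_p b) (cp (length u) i)) (venv ch u [] rv (%_. 0)) else 0)
    (Pi_pmf Rs 0 (%_. unif (bg_p b))))
   (%u pl v. map_pmf (%rv i. if i:Is then eval b (pcomp (bg_p b) (dp (length u) i)) (venv ch u v rv pl) else 0)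
    (Pi_pmf Rs 0 (%_. unif (bg_p b))))
   (%u pl. map (%x. eval b x (venv ch u [] (%_. 0) pl)) (map (wordx b GrpH VCh) (rp (length u))))) c (M,Map.empty)) =
  map_pmf fst (exec b (kenv (bg_p b) d tg (polyK (bg_p b) Is Rs cp) (polyD (bg_p b) Is Rs dp) (polyW b e rp)) c (M,Map.empty))"
proof (rule rel_kenv[where R = "%u (k :: 'i=>nat) (k' :: 'i=>int). (ALL i. k i < bg_p b) & k' = (%i. int (k i))"])
 let ?p = "bg_p b"
 note bg = bilinear_groups[OF b]
 note p = bg(4)
 have pp: "?p ^ 2<=2 ^ bg_w b" using b by (simp add: bilinear_group_def)
 have om: "rv r < ?p" if "rv:set_pmf (Pi_pmf Rs 0 (%_. unif ?p))" for rv r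
 proof -
  have "set_pmf (unif ?p) = {0..<?p}" unfolding unif_def by (rule set_pmf_of_set) (use p in simp_all)
  hence "rv:PiE_dflt Rs 0 (%_. {0..<?p})" using that by (simp add: set_Pi_pmf R o_def)
  thus ?thesis using p by (cases "r:Rs") (simp_all add: PiE_dflt_def)
 qed
 {
  fix u assume u: "valid_id ?p d u"
  show "rel_pmf (%k k'. (ALL i. k i < ?p) & k' = (%i. int (k i)))
   (map_pmf (%rv i. if i:Is then eval b (pcomp ?p (cp (length u) i)) (venv ch u [] rv (%_. 0)) else 0)
    (Pi_pmf Rs 0 (%_. unif ?p))) (polyK ?p Is Rs cp u)"
   unfolding polyK_def UI_eq_map[OF R] pmf.map_comp o_def
  proof (rule rel_pmf_map_same)
   fix rv assume rv: "rv:set_pmf (Pi_pmf Rs 0 (%_. unif ?p))"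
   have v: "venv ch u [] rv (%_. 0) v < ?p" "int (venv ch u [] rv (%_. 0) v) = penv u [] (%x. int (rv x)) (%_. 0) v"
    if "v:idvars d Un VOm ` Rs" for v
    using venv_penv[OF u p om[OF rv], of "%_. 0" v "[]" ch] that p by auto
   have ev: "int (eval b (pcomp ?p (cp (length u) i)) (venv ch u [] rv (%_. 0))) =
     pev (cp (length u) i) (penv u [] (%x. int (rv x)) (%_. 0)) mod int ?p" for i
   proof (subst eval_pcomp[OF p pp])
    show "venv ch u [] rv (%_. 0) v < ?p" if "v:set_px (cp (length u) i)" for v by (rule v(1)[OF subsetD[OF cpv that]])
    have "pev (cp (length u) i) (%v. int (venv ch u [] rv (%_. 0) v)) = pev (cp (length u) i) (penv u [] (%x. int (rv x)) (%_. 0))"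
     by (rule pev_cong, rule v(2), rule subsetD[OF cpv])
    thus "pev (cp (length u) i) (%v. int (venv ch u [] rv (%_. 0) v)) mod int ?p =
     pev (cp (length u) i) (penv u [] (%x. int (rv x)) (%_. 0)) mod int ?p" by simp
   qed
   have lt: "eval b (pcomp ?p (cp (length u) i)) (venv ch u [] rv (%_. 0)) < ?p" for i
    by (rule less_if_eq_mod[OF ev[of i]]) (use p in simp)
   show "(ALL i. (if i:Is then eval b (pcomp ?p (cp (length u) i)) (venv ch u [] rv (%_. 0)) else 0) < ?p) &
    (%i. if i:Is then pev (cp (length u) i) (penv u [] (%x. int (rv x)) (%_. 0)) mod int ?p else 0) =
    (%i. int (if i:Is then eval b (pcomp ?p (cp (length u) i)) (venv ch u [] rv (%_. 0)) else 0))"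
    using p by (simp add: lt ev fun_eq_iff)
  qed
 }
 {
  fix u v and pl :: "'i=>nat" and pl' :: "'i=>int"
  assume u: "valid_id ?p d u" and uv: "valid_id ?p d (u @ [v])" and pl: "(ALL i. pl i < ?p) & pl' = (%i. int (pl i))"
  have vx: "v ! k < ?p" if "k < 2" for k
   using valid_id_entry_less[OF uv _ that p, of "length u"] by simp
  show "rel_pmf (%k k'. (ALL i. k i < ?p) & k' = (%i. int (k i)))
   (map_pmf (%rv i. if i:Is then eval b (pcomp ?p (dp (length u) i)) (venv ch u v rv pl) else 0)
    (Pi_pmf Rs 0 (%_. unif ?p))) (polyD ?p Is Rs dp u pl' v)"
   unfolding polyD_def UI_eq_map[OF R] pmf.map_comp o_def
  proof (rule rel_pmf_map_same)
   fix rv assume rv: "rv:set_pmf (Pi_pmf Rs 0 (%_. unif ?p))"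
   have w: "venv ch u v rv pl x < ?p" "int (venv ch u v rv pl x) = penv u v (%x. int (rv x)) pl' x"
    if "x:idvars d Un VOm ` Rs Un VPl ` Is Un VX ` {..<2}" for x
    using venv_penv[OF u p om[OF rv], of pl x v ch] that pl vx by auto
   have ev: "int (eval b (pcomp ?p (dp (length u) i)) (venv ch u v rv pl)) =
     pev (dp (length u) i) (penv u v (%x. int (rv x)) pl') mod int ?p" for i
   proof (subst eval_pcomp[OF p pp])
    show "venv ch u v rv pl x < ?p" if "x:set_px (dp (length u) i)" for x by (rule w(1)[OF subsetD[OF dpv that]])
    have "pev (dp (length u) i) (%x. int (venv ch u v rv pl x)) = pev (dp (length u) i) (penv u v (%x. int (rv x)) pl')"
     by (rule pev_cong, rule w(2), rule subsetD[OF dpv])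
    thus "pev (dp (length u) i) (%x. int (venv ch u v rv pl x)) mod int ?p =
     pev (dp (length u) i) (penv u v (%x. int (rv x)) pl') mod int ?p" by simp
   qed
   have lt: "eval b (pcomp ?p (dp (length u) i)) (venv ch u v rv pl) < ?p" for i
    by (rule less_if_eq_mod[OF ev[of i]]) (use p in simp)
   show "(ALL i. (if i:Is then eval b (pcomp ?p (dp (length u) i)) (venv ch u v rv pl) else 0) < ?p) &
    (%i. if i:Is then pev (dp (length u) i) (penv u v (%x. int (rv x)) pl') mod int ?p else 0) =
    (%i. int (if i:Is then eval b (pcomp ?p (dp (length u) i)) (venv ch u v rv pl) else 0))"
    using p by (simp add: lt ev fun_eq_iff)
  qed
 }
 {
  fix u and pl :: "'i=>nat" and pl' :: "'i=>int"
  assume u: "valid_id ?p d u" and pl: "(ALL i. pl i < ?p) & pl' = (%i. int (pl i))"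
  have w: "venv ch u [] (%_. 0) pl x < ?p" "int (venv ch u [] (%_. 0) pl x) = penv u [] (%_. 0) pl' x"
   if "x:idvars d Un VPl ` Is" for x
   using venv_penv[OF u p, of "%_. 0" pl x "[]" ch] that pl p by auto
  have pg: "prime_group (the_grp b GrpH) ?p (bg_h b)" using bg(2) by simp
  have "eval b (wordx b GrpH VCh qs) (venv ch u [] (%_. 0) pl) =
    bg_h b [^]\<^bsub>bg_H b\<^esub> (\<Sum>(j,q)\<leftarrow>qs. e j * pev q (penv u [] (%_. 0) pl'))" if qs: "qs:set (rp (length u))" for qs
  proof -
   have "eval b (wordx b GrpH VCh qs) (venv ch u [] (%_. 0) pl) =
    bg_h b [^]\<^bsub>the_grp b GrpH\<^esub> (\<Sum>(j,q)\<leftarrow>qs. e j * pev q (%x. int (venv ch u [] (%_. 0) pl x)))"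
   proof (rule eval_wordx[OF pg bg(3) p pp])
    show "venv ch u [] (%_. 0) pl x < ?p" if "(j,q):set qs" "x:set_px q" for j q x
     by (rule w(1)[OF subsetD[OF rpv[OF qs that(1)] that(2)]])
    show "venv ch u [] (%_. 0) pl (VCh j) = bg_h b [^]\<^bsub>the_grp b GrpH\<^esub> e j" if "(j,q):set qs" for j q
     using ch[OF qs that] by simp
   qed
   also have "(\<Sum>(j,q)\<leftarrow>qs. e j * pev q (%x. int (venv ch u [] (%_. 0) pl x))) =
     (\<Sum>(j,q)\<leftarrow>qs. e j * pev q (penv u [] (%_. 0) pl'))"
   proof (intro arg_cong[where f = sum_list] map_cong refl)
    fix z assume z: "z:set qs"
    obtain j q where jq: "z = (j,q)" by (cases z)
    have "pev (snd z) (%x. int (venv ch u [] (%_. 0) pl x)) = pev (snd z) (penv u [] (%_. 0) pl')"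
     unfolding jq snd_conv by (rule pev_cong, rule w(2), rule subsetD[OF rpv[OF qs z[unfolded jq]]])
    thus "(case z of (j,q)=>e j * pev q (%x. int (venv ch u [] (%_. 0) pl x))) =
     (case z of (j,q)=>e j * pev q (penv u [] (%_. 0) pl'))" by (cases z) simp
   qed
   finally show ?thesis by simp
  qed
  thus "map (%x. eval b x (venv ch u [] (%_. 0) pl)) (map (wordx b GrpH VCh) (rp (length u))) = polyW b e rp u pl'"
   by (simp add: polyW_def)
 }
qed

section \<open>From challengers given by polynomials to programs\<close>

definition sim_bound :: "nat=>nat=>nat=>nat=>nat" where
 "sim_bound d Q m K = Q * (500 * ((K + 1) * (d + 1) ^ 2 * (Q + 1) * (m + 1)))"

text \<open>The compiler used by both reductions. \<open>B\<close> is chosen before the challenge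
  words \<open>ws\<close> and their exponents \<open>e\<close>, so that one program works for
  genuine and random challenges alike. The expressions \<open>mes\<close> compute the master public
  key from the challenge.\<close>

lemma simulate:
 fixes cp dp :: "nat=>'i=>('i,'r) var px" and rp :: "nat=>(nat \<times> ('i,'r) var px) list list"
  and mes :: "nat ex list"
 assumes b: "bilinear_group b" and d: "d + 2 < bg_p b" and tg: "valid_id (bg_p b) d tg"
  and dI: "distinct Il" and dR: "distinct Rl"
  and cpv: "!!l i. set_px (cp l i)<=idvars d Un VOm ` set Rl"
  and dpv: "!!l i. set_px (dp l i)<=idvars d Un VOm ` set Rl Un VPl ` set Il Un VX ` {..<2}"
  and rpv: "!!l qs j q. qs:set (rp l) ==> (j,q):set qs ==> j < lc & set_px q<=idvars d Un VPl ` set Il"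
  and ml: "!!l. length (rp l)<=ml"
  and M0: "!!r. M0 r < 2 ^ bg_w b" "finite {r. M0 r~=0}"
  and mes: "!!x. x:set mes ==> set_ex x<={..<lc}"
  and K: "!!l i. psize (cp l i)<=K" "!!l i. psize (dp l i)<=K"
   "!!l qs. qs:set (rp l) ==> esize (wordx b GrpH VCh qs :: ('i,'r) var ex)<=K" "!!x. x:set mes ==> esize x<=K"
 shows "EX B :: algorithm. cost B<=cost c + sim_bound d (num_queries c) (length Il + length Rl + ml) K +
   card {r. M0 r~=0} + lc + (lc + length mes) * (K + 4) &
  (ALL ws e. length ws = lc --> (ALL j<lc. ws ! j < 2 ^ bg_w b) -->
   (ALL l qs j q. qs:set (rp l) --> (j,q):set qs --> ws ! j = bg_h b [^]\<^bsub>bg_H b\<^esub> (e j :: int)) -->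
   map_pmf out_bit (run_alg b B (store_words 0 ws (%_. 0))) =
   kgame b d tg c M0 a (map (%x. eval b x (%j. ws ! j)) mes) (polyK (bg_p b) (set Il) (set Rl) cp)
    (polyD (bg_p b) (set Il) (set Rl) dp) (polyW b e rp))"
proof -
 let ?p = "bg_p b"
 note bg = bilinear_groups[OF b]
 define N where "N = num_queries c"
 define ce where "ce l i = pcomp ?p (cp l i)" for l i
 define de where "de l i = pcomp ?p (dp l i)" for l i
 define re where "re l = map (wordx b GrpH VCh :: _=>('i,'r) var ex) (rp l)" for l
 obtain R0 where R0: "regs_ok d ml R0 c" using regs_ok_ex by blast
 obtain R1 where R1: "!!r. M0 r~=0 ==> r < R1" using M0(2) finite_nat_set_iff_bounded[of "{r. M0 r~=0}"] by auto
 \<comment> \<open>Below \<open>R\<close> lie all registers of the adversary, the hard-wired memory,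
   the arriving challenge and the public key; \<open>+ 1\<close> makes sure that the output register
   0 is among them.\<close>
 define R where "R = R0 + R1 + lc + a + length mes + 1"
 have R: "regs_ok d ml R c" "lc<=R" "0 < R" "a + length mes<=R"
  using regs_ok_mono[OF R0, of R] by (simp_all add: R_def)
 have RM: "r < R" if "M0 r~=0" for r using R1[OF that] by (simp add: R_def)
 define FS where "FS = ({Ok,Ln} Un {Idc i k | i k. i < d & k < 2} Un Py ` set Il :: 'i fld set)"
 define CF where "CF = Chl ` {..<lc} Un Om ` set Rl Un (\<Union>t<N. Sl t ` FS) Un Cu ` FS Un Nw ` FS Un (Xc ` {..<2} :: ('i,'r) cell set)"
 have "{Idc i k | i k. i < d & k < 2} = (%(i,k). Idc i k :: 'i fld) ` ({..<d} \<times> {..<2})" by auto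
 hence "finite FS" by (simp add: FS_def)
 hence fin: "finite CF" by (simp add: CF_def)
 then obtain f :: "('i,'r) cell=>nat" and m where f: "f ` CF = {i. i < m}" "inj_on f CF"
  using finite_imp_inj_to_nat_seg[OF fin] by blast
 define rh where "rh z = (case z of AR r=>r | _=>R + f z)" for z :: "('i,'r) cell"
 have rh_AR: "rh (AR r) = r" for r by (simp add: rh_def)
 have rh_CF: "rh z = R + f z" if "z:CF" for z using that by (auto simp: rh_def CF_def)
 define T where "T = R + m"
 have sim: "simulator b d tg Il Rl ce de re lc N R T ml rh"
 proof
  show "word_bgroup b" "0 < bg_w b" "1 < ?p" "?p < 2 ^ bg_w b" "d + 2 < ?p" "valid_id ?p d tg" "distinct Il" "distinct Rl"
   using bg d tg dI dR by simp_all
  show "set_ex (ce l i)<=lvars Il Rl d lc" for l i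
   using cpv[of l i] unfolding ce_def set_ex_pcomp lvars_def by (rule order_trans) auto
  show "set_ex (de l i)<=lvars Il Rl d lc Un VPl ` set Il Un VX ` {..<2}" for l i
   using dpv[of l i] unfolding de_def set_ex_pcomp lvars_def by (rule order_trans) auto
  show "set_ex x<=idvars d Un VCh ` {..<lc} Un VPl ` set Il" if x: "x:set (re l)" for l x
  proof -
   obtain qs where qs: "qs:set (rp l)" "x = wordx b GrpH VCh qs" using x by (auto simp: re_def)
   have "{VCh j} Un set_px q<=idvars d Un VCh ` {..<lc} Un VPl ` set Il" if "(j,q):set qs" for j q
    using rpv[OF qs(1) that] by auto
   hence "(\<Union>(j,q)\<in>set qs. {VCh j} Un set_px q)<=idvars d Un VCh ` {..<lc} Un VPl ` set Il"
    by (intro UN_least) (simp only: split: prod.split, intro allI impI, simp)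
   thus ?thesis unfolding qs(2) by (rule order_trans[OF set_ex_wordx])
  qed
  show "length (re l)<=ml" for l using ml by (simp add: re_def)
  show "rh (AR r) = r" for r by (rule rh_AR)
  have eq: "AR ` {..<R} Un Chl ` {..<lc} Un Om ` set Rl Un
     (\<Union>t<N. Sl t ` flds d Il) Un
     Cu ` flds d Il Un
     Nw ` flds d Il Un Xc ` {..<2} = AR ` {..<R} Un CF"
   by (simp only: CF_def FS_def Un_assoc)
  have "inj_on rh (AR ` {..<R} Un CF)"
  proof (rule inj_onI)
   fix z z' assume zz: "z:AR ` {..<R} Un CF" "z':AR ` {..<R} Un CF" "rh z = rh z'"
   show "z = z'"
   proof (cases "z:CF")
    case True
    show ?thesis
    proof (cases "z':CF")
     case T': True
     hence "f z = f z'" using zz(3) True rh_CF by simp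
     thus ?thesis using f(2) True T' by (simp add: inj_on_eq_iff)
    next
     case False
     then obtain r where "z' = AR r" "r < R" using zz(2) by auto
     thus ?thesis using zz(3) rh_CF[OF True] rh_AR by simp
    qed
   next
    case False
    then obtain r where z: "z = AR r" "r < R" using zz(1) by auto
    show ?thesis
    proof (cases "z':CF")
     case True
     thus ?thesis using zz(3) rh_CF[OF True] rh_AR z by simp
    next
     case False
     then obtain r' where "z' = AR r'" using zz(2) by auto
     thus ?thesis using zz(3) z rh_AR by simp
    qed
   qed
  qed
  thus "inj_on rh (AR ` {..<R} Un Chl ` {..<lc} Un Om ` set Rl Un
     (\<Union>t<N. Sl t ` flds d Il) Un
     Cu ` flds d Il Un
     Nw ` flds d Il Un Xc ` {..<2})" unfolding eq .
  show "rh z < T" if "z:AR ` {..<R} Un Chl ` {..<lc} Un Om ` set Rl Un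
     (\<Union>t<N. Sl t ` flds d Il) Un
     Cu ` flds d Il Un
     Nw ` flds d Il Un Xc ` {..<2}" for z
  proof -
   have "z:AR ` {..<R} \<or> z:CF" using that unfolding eq by blast
   thus ?thesis
   proof
    assume "z:CF"
    hence "f z < m" using f(1) by blast
    thus ?thesis using rh_CF[OF \<open>z : CF\<close>] by (simp add: T_def)
   qed (auto simp: rh_AR T_def)
  qed
 qed
 \<comment> \<open>The challenge is saved and the public key is written in one parallel assignment,
   because the public key may overlap the registers in which the challenge arrives.\<close>
 define cs :: "('i,'r) cell list" where "cs = map Chl [0..<lc] @ map AR [a..<a + length mes]"
 define g :: "('i,'r) cell=>('i,'r) cell ex" where "g z = (case z of Chl j=>EV (AR j) | AR r=>map_ex AR (mes ! (r - a)) | _=>EC 0)" for z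
 \<comment> \<open>The registers below \<open>lc\<close> still contain the challenge and must show
   \<open>M0\<close> to the adversary, even where \<open>M0\<close> is 0. The public key is left
   alone.\<close>
 define rs where "rs = sorted_list_of_set (({..<lc} Un {r. M0 r~=0}) - {a..<a + length mes})"
 define prep :: algorithm where "prep = simulator.pas T rh cs g"
 define sc :: algorithm where "sc = simulator.sim_com b d tg Il Rl ce de re N T ml rh c"
 define B where "B = Seq prep (Seq (hardwire M0 rs) sc)"
 interpret S0: simulator b d tg Il Rl ce de re "%_. 0" lc N R T ml rh by (rule sim)
 have scs: "set cs = Chl ` {..<lc} Un AR ` {a..<a + length mes}" by (auto simp: cs_def)
 have fr: "finite (({..<lc} Un {r. M0 r~=0}) - {a..<a + length mes})" using M0(2) by simp
 have "length rs = card (({..<lc} Un {r. M0 r~=0}) - {a..<a + length mes})" by (simp add: rs_def)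
 also have "...<=card ({..<lc} Un {r. M0 r~=0})" using M0(2) by (intro card_mono) auto
 also have "...<=lc + card {r. M0 r~=0}" using card_Un_le[of "{..<lc}" "{r. M0 r~=0}"] by simp
 finally have lrs: "length rs<=lc + card {r. M0 r~=0}" .
 have mnth: "mes ! (r - a):set mes" if "r:{a..<a + length mes}" for r
  using that by (intro nth_mem) auto
 have "esize (g z)<=K + 2" if z: "z:set cs" for z
 proof -
  consider j where "z = Chl j" | r where "z = AR r" "r:{a..<a + length mes}" using z scs by auto
  thus ?thesis
  proof cases
   case 2
   thus ?thesis using K(4)[OF mnth[OF 2(2)]] by (simp add: g_def)
  qed (simp add: g_def)
 qed
 hence "cost prep<=length cs * (K + 2 + 2)" unfolding prep_def by (rule S0.cost_pas)
 hence c1: "cost prep<=(lc + length mes) * (K + 4)" by (simp add: cs_def algebra_simps)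
 have "cost sc<=cost c + num_queries c * S0.handler_bound K"
  unfolding sc_def
 proof (rule S0.cost_sim_com)
  show "esize (ce l i)<=K" "esize (de l i)<=K" for l i using K by (simp_all add: ce_def de_def esize_pcomp)
  show "esize x<=K" if "x:set (re l)" for l x using that K(3) by (auto simp: re_def)
 qed
 hence c2: "cost sc<=cost c + sim_bound d (num_queries c) (length Il + length Rl + ml) K"
  unfolding S0.handler_bound_def sim_bound_def N_def[symmetric] .
 have costB: "cost B<=cost c + sim_bound d (num_queries c) (length Il + length Rl + ml) K +
   card {r. M0 r~=0} + lc + (lc + length mes) * (K + 4)"
  using c1 c2 lrs by (simp add: B_def cost_hardwire)
 show ?thesis
 proof (intro exI[of _ B] conjI costB allI impI)
  fix ws and e :: "nat=>int"
  assume ws: "length ws = lc" "ALL j<lc. ws ! j < 2 ^ bg_w b"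
   and e: "ALL l qs j q. qs:set (rp l) --> (j,q):set qs --> ws ! j = bg_h b [^]\<^bsub>bg_H b\<^esub> e j"
  interpret S: simulator b d tg Il Rl ce de re "%j. ws ! j" lc N R T ml rh by (rule sim)
  define Ms where "Ms = store_words 0 ws (%_. 0)"
  define mw where "mw = map (%x. eval b x (%j. ws ! j)) mes"
  have Ms: "Ms r = (if r < lc then ws ! r else 0)" for r by (simp add: Ms_def store_words_def ws)
  have wMs: "S.words_ok Ms" using ws by (simp add: S.words_ok_def Ms)
  have "AR r:S.CS" if "r:{a..<a + length mes}" for r using that R(4) by (auto simp: S.CS_simps)
  hence csCS: "set cs<=S.CS" unfolding scs by auto
  have gCS: "set_ex (g z)<=S.CS" if z: "z:set cs" for z
  proof -
   consider j where "z = Chl j" "j < lc" | r where "z = AR r" "r:{a..<a + length mes}" using z scs by auto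
   thus ?thesis
   proof cases
    case 1
    thus ?thesis using R(2) by (simp add: g_def)
   next
    case 2
    have "set_ex (mes ! (r - a))<={..<R}" using mes[OF mnth[OF 2(2)]] R(2) by auto
    thus ?thesis using 2 by (auto simp: g_def ex.set_map)
   qed
  qed
  have dcs: "distinct cs" by (auto simp: cs_def distinct_map inj_on_def)
  obtain M1 where M1: "exec b (%_. return_pmf) (S.pas cs g :: algorithm) (Ms,()) = return_pmf (M1,())" "S.words_ok M1"
   "!!z. z:S.CS ==> M1 (rh z) = (if z:set cs then eval b (g z) (Ms o rh) else Ms (rh z))"
   by (rule S.exec_pas[OF dcs csCS gCS wMs, where env = "%_ :: unit. return_pmf" and s = "()"], assumption)
    (rule that, assumption, assumption, blast)
  define M2 where "M2 r = (if r:set rs then M0 r else M1 r)" for r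
  have M2: "exec b (%_. return_pmf) (hardwire M0 rs :: algorithm) (M1,()) = return_pmf (M2,())"
   unfolding M2_def by (rule exec_hardwire[OF M0(1)])
  have srs: "set rs = ({..<lc} Un {r. M0 r~=0}) - {a..<a + length mes}" using fr by (simp add: rs_def)
  have rsR: "r < R" if "r:set rs" for r using that R(2) RM[of r] by (auto simp: srs)
  have ge: "rh z ~: set rs" "lc<=rh z" if "z:CF" for z
   using rh_CF[OF that] rsR[of "rh z"] R(2) by auto
  have CS: "S.CS = AR ` {..<R} Un CF" by (simp only: S.CS_def CF_def FS_def Un_assoc)
  have "M2 r = store_words a mw M0 r" if r: "r < R" for r
  proof (cases "r:{a..<a + length mes}")
   case True
   have "M1 r = eval b (map_ex AR (mes ! (r - a))) (Ms o rh)"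
    using M1(3)[of "AR r"] True r scs by (simp add: rh_AR g_def)
   also have "... = eval b (mes ! (r - a)) (%j. ws ! j)"
    unfolding eval_map_ex
   proof (rule eval_cong)
    fix j assume "j:set_ex (mes ! (r - a))"
    hence "j < lc" using mes[OF mnth[OF True]] by auto
    thus "(Ms o rh o AR) j = ws ! j" by (simp add: rh_AR Ms)
   qed
   finally have "M1 r = ..." .
   moreover have "r - a < length mes" using True by auto
   ultimately show ?thesis using True by (simp add: M2_def srs store_words_def mw_def)
  next
   case False
   have "M1 r = Ms r" using M1(3)[of "AR r"] False r scs by (auto simp: rh_AR)
   thus ?thesis using False by (auto simp: M2_def srs store_words_def mw_def Ms)
  qed
  moreover have "M2 (rh (Chl j)) = ws ! j" if j: "j < lc" for j
  proof -
   have "Chl j:CF" using j by (simp add: CF_def)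
   hence "M2 (rh (Chl j)) = M1 (rh (Chl j))" using ge(1)[OF \<open>Chl j : CF\<close>] by (simp add: M2_def)
   also have "... = eval b (EV (AR j)) (Ms o rh)" using M1(3)[of "Chl j"] j scs by (simp add: g_def)
   also have "... = ws ! j" using j ws(2) by (simp add: rh_AR Ms)
   finally show ?thesis .
  qed
  moreover have "S.slots M2 []"
  proof -
   have "M2 (rh (Sl t Ok)) = 0" if t: "t < N" for t
   proof -
    have c: "Sl t Ok:CF" using t by (auto simp: CF_def FS_def)
    have "Sl t Ok:S.CS" "Sl t Ok ~: set cs" using c CS scs by auto
    hence "M1 (rh (Sl t Ok)) = 0" using M1(3)[of "Sl t Ok"] ge(2)[OF c] by (simp add: Ms)
    thus ?thesis using ge(1)[OF c] by (simp add: M2_def)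
   qed
   thus ?thesis by (simp add: S.slots_def)
  qed
  moreover have "S.words_ok M2" using M1(2) M0(1) by (simp add: S.words_ok_def M2_def)
  ultimately have rel: "S.simrel 0 M2 (store_words a mw M0,Map.empty)"
   by (auto simp: S.simrel_def)
  have q0: "0 + num_queries c<=N" by (simp add: N_def)
  note rc = S.rel_sim_com[OF S.com_ok[OF R(1)] rel q0, where env = "%_ :: unit. return_pmf" and t = "()"]
  have "map_pmf (%y. out_bit (fst y)) (exec b (%_. return_pmf) (S.sim_com c :: algorithm) (M2,())) =
    map_pmf (%x. out_bit (fst x)) (exec b S.senv c (store_words a mw M0,Map.empty))"
  proof (rule rel_pmf_eq_map, rule pmf.rel_mono_strong[OF rc])
   fix y x assume "S.simrel (0 + num_queries c) (fst y) x"
   hence "fst y 0 = fst x 0" using R(3) by (simp add: S.simrel_def)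
   thus "out_bit (fst y) = out_bit (fst x)" by (simp add: out_bit_def)
  qed
  moreover have "exec b (%_. return_pmf) B (Ms,()) = exec b (%_. return_pmf) (S.sim_com c :: algorithm) (M2,())"
   by (simp add: B_def prep_def sc_def M1(1) M2 bind_return_pmf)
  moreover have "map_pmf (%x. out_bit (fst x)) (exec b S.senv c (store_words a mw M0,Map.empty)) =
    kgame b d tg c M0 a mw (polyK ?p (set Il) (set Rl) cp) (polyD ?p (set Il) (set Rl) dp) (polyW b e rp)"
  proof -
   have "map_pmf fst (exec b S.senv c (store_words a mw M0,Map.empty)) =
    map_pmf fst (exec b (kenv ?p d tg (polyK ?p (set Il) (set Rl) cp) (polyD ?p (set Il) (set Rl) dp) (polyW b e rp)) c (store_words a mw M0,Map.empty))"
    unfolding S.senv_eq_kenv ce_def de_def re_def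
    by (rule rel_poly[OF b _ cpv dpv conjunct2[OF rpv]]) (use e in auto)
   hence "map_pmf out_bit (map_pmf fst (exec b S.senv c (store_words a mw M0,Map.empty))) =
    map_pmf out_bit (map_pmf fst (exec b (kenv ?p d tg (polyK ?p (set Il) (set Rl) cp) (polyD ?p (set Il) (set Rl) dp) (polyW b e rp)) c (store_words a mw M0,Map.empty)))"
    by (rule arg_cong)
   thus ?thesis by (simp add: pmf.map_comp o_def kgame_def)
  qed
  ultimately show "map_pmf out_bit (run_alg b B (store_words 0 ws (%_. 0))) =
   kgame b d tg c M0 a (map (%x. eval b x (%j. ws ! j)) mes) (polyK ?p (set Il) (set Rl) cp)
    (polyD ?p (set Il) (set Rl) dp) (polyW b e rp)"
   by (simp add: run_alg_def pmf.map_comp o_def Ms_def mw_def)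
 qed
qed

section \<open>Hybrid challengers\<close>

lemma mod_mult_left_congI: "a mod P = b mod P ==> (c * a) mod P = (c * b) mod (P :: int)"
 by (metis mod_mult_right_eq)

lemma newx_cong:
 assumes "l < d" "i<=l + 1" "c:{1..n}" "!!x. x:KI d n l ==> V x mod P = V' x mod P"
 shows "newx l v V i c mod P = newx l v V' i c mod P"
proof (cases "i = l + 1")
 case True
 have "Extra (l + 1) c:KI d n l" using assms by simp
 thus ?thesis using True assms(4) by (simp add: newx_def)
next
 case False
 have "Coef (l + 1) 1 i c:KI d n l" "Coef (l + 1) 2 i c:KI d n l" using False assms by (auto simp: rows_def)
 note m = assms(4)[OF this(1)] assms(4)[OF this(2)]
 show ?thesis using False unfolding newx_def by (simp del: One_nat_def) (intro mod_add_cong mod_mult_cong m refl)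
qed

lemma cmb_cong:
 assumes l: "l < d" and x: "x:KI d n (l + 1)"
  and ka: "!!x. x:KI d n l ==> ka x mod P = ka' x mod P" and V: "!!x. x:KI d n l ==> V x mod P = V' x mod P"
  and \<tau>: "!!j k c. j:{l + 2..d} ==> k:{1..2} ==> c:{1..n} ==> \<tau> j k c = \<tau>' j k c"
 shows "cmb l v \<tau> ka V x mod P = cmb l v \<tau>' ka' V' x mod P"
proof (cases x)
 case (Coef j k i c)
 hence jk: "(j,k):rows d (l + 1)" and i: "i<=l + 1" and c: "c:{1..n}" using x by auto
 note nx = newx_cong[OF l i c V]
 have 1: "(if i = l + 1 then 0 else if j = 0 then ka (Coef 0 0 i c) else V (Coef j k i c)) mod P =
   (if i = l + 1 then 0 else if j = 0 then ka' (Coef 0 0 i c) else V' (Coef j k i c)) mod P"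
 proof (cases "i = l + 1")
  case False
  hence "Coef 0 0 i c:KI d n l" "j~=0 ==> Coef j k i c:KI d n l" using jk i c by (auto simp: rows_def)
  thus ?thesis using ka[of "Coef 0 0 i c"] V[of "Coef j k i c"] False by (cases "j = 0") simp_all
 qed simp
 have 2: "(if j = 0 then 1 else \<tau> j k c) = (if j = 0 then 1 else \<tau>' j k c)"
  using \<tau>[of j k c] jk c by (auto simp: rows_def)
 show ?thesis unfolding Coef cmb.simps 2 by (intro mod_add_cong 1 mod_mult_cong refl nx)
next
 case (Extra j c)
 hence "Extra j c:KI d n l" using x by auto
 thus ?thesis using V Extra by simp
qed

text \<open>\<open>deleg\<close> with a modified randomized parent: entries selected by
  \<open>f\<close> lose their genuine value, and \<open>tt\<close> times fresh randomness is
  added.\<close>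

definition delegx :: "nat=>nat=>nat=>nat=>nat list=>(kx=>bool)=>(kx=>int)=>(kx=>int)=>(rx=>int)=>kx=>int" where
 "delegx p d n l v f tt ka rv = onKI d n (l + 1) (%x. cmb l v (%j k c. rv (RT j k c)) ka
   (%x. (if f x then 0 else rv (RZ (coord x)) * ka x) + tt x * rv (RN x)) x mod int p)"

lemma delegx_cong:
 assumes "l < d"
  and "!!x. x:KI d n l ==> ((if f x then 0 else rv (RZ (coord x)) * ka x) + tt x * rv (RN x)) mod int p =
    ((if f' x then 0 else rv' (RZ (coord x)) * ka x) + tt' x * rv' (RN x)) mod int p"
  and "!!j k c. j:{l + 2..d} ==> k:{1..2} ==> c:{1..n} ==> rv (RT j k c) = rv' (RT j k c)"
 shows "delegx p d n l v f tt ka rv = delegx p d n l v f' tt' ka rv'"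
 unfolding delegx_def onKI_def
proof (rule ext)
 fix x
 show "(if x:KI d n (l + 1) then cmb l v (%j k c. rv (RT j k c)) ka
   (%x. (if f x then 0 else rv (RZ (coord x)) * ka x) + tt x * rv (RN x)) x mod int p else 0) =
  (if x:KI d n (l + 1) then cmb l v (%j k c. rv' (RT j k c)) ka
   (%x. (if f' x then 0 else rv' (RZ (coord x)) * ka x) + tt' x * rv' (RN x)) x mod int p else 0)"
 proof (cases "x:KI d n (l + 1)")
  case True
  show ?thesis unfolding if_P[OF True] by (rule cmb_cong[OF assms(1) True refl assms(2,3)])
 qed simp
qed

text \<open>A column consists of the entries that agree up to the coordinate. The number of columns
  depends on \<open>d\<close> only.\<close>

primrec strip :: "kx=>kx" where
 "strip (Coef j k i c) = Coef j k i 0"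
| "strip (Extra j c) = Extra j 0"

definition freshK :: "nat=>nat=>nat=>ident=>(kx=>int) pmf" where
 "freshK p d n u = map_pmf (fresh d n (length u)) (UI p (RS d n))"

lemma fresh_UI: "l<=d ==> map_pmf (fresh d n l) (UI p (RS d n)) = UI p (KI d n l)"
proof -
 assume l: "l<=d"
 have "map_pmf (%rv x. if x:KI d n l then rv (RN x) else 0) (UI p (RS d n)) = UI p (KI d n l)"
  by (rule UI_pull) (use l in "auto simp: inj_on_def intro: KI_KA")
 thus ?thesis by (simp add: fresh_def[abs_def] onKI_def)
qed

text \<open>
 Below level \<open>L\<close> delegation yields fresh keys. At level \<open>L\<close> the columns in \<open>S\<close> of the randomized
 parent key are replaced by independent randomness, and the column \<open>col\<close> is perturbed by a multiple
 of \<open>t\<close> of such randomness.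
\<close>

definition hybD :: "nat=>nat=>nat=>nat=>kx set=>kx=>int=>ident=>(kx=>int)=>nat list=>(kx=>int) pmf" where
 "hybD p d n L S col t u ka v = map_pmf (%rv. if length u < L then fresh d n (length u + 1) rv
   else delegx p d n (length u) v (%x. length u = L & strip x:S)
    (%x. if length u = L then (if strip x:S then 1 else if strip x = col then t else 0) else 0) ka rv) (UI p (RS d n))"

lemma set_UI_out:
 assumes "finite I" "0 < p" "rv:set_pmf (UI p I)" "x ~: I"
 shows "rv x = 0"
 using assms(3,4) unfolding set_UI[OF assms(1,2)] by (simp add: PiE_dflt_def)

lemma set_UI_range:
 assumes "finite I" "0 < p" "rv:set_pmf (UI p I)"
 shows "0<=rv x & rv x < int p"
 using assms(3,2) unfolding set_UI[OF assms(1,2)] by (cases "x:I") (auto simp: PiE_dflt_def)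

lemma hybD_t0: "hybD p d n L S col 0 u ka v = hybD p d n L S col' 0 u ka v"
 by (simp add: hybD_def cong: if_cong)

text \<open>For a unit \<open>t\<close>, the multiple of \<open>t\<close> of a uniform entry hides
  the genuine value to which it is added.\<close>

lemma hybD_unit:
 assumes p: "0 < p" and t: "coprime t (int p)" and col: "col ~: S" and d: "length u < d"
 shows "hybD p d n L S col t u ka v = hybD p d n L (insert col S) col' 0 u ka v"
proof (cases "length u = L")
 case True
 let ?J = "RS d n - RN ` {x:KI d n L. strip x = col}"
 let ?dd = "%rv i. case i of RN x=>rv (RZ (coord x)) * ka x | _=>0"
 let ?h = "%rv i. if i:?J then rv i else if i:RS d n then (t * rv i + ?dd rv i) mod int p else 0"
 have UIh: "map_pmf ?h (UI p (RS d n)) = UI p (RS d n)"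
 proof (rule UI_triangular[OF finite_RS p])
  fix rv rv' :: "rx=>int" and i assume eq: "!!j. j:?J ==> rv j = rv' j" and i: "i:RS d n - ?J"
  then obtain x where x: "i = RN x" "x:KI d n L" by auto
  have "coord x:{1..n}" using x(2) by (cases x) auto
  hence "RZ (coord x):?J" by auto
  hence "rv (RZ (coord x)) = rv' (RZ (coord x))" by (rule eq)
  thus "?dd rv i = ?dd rv' i" by (simp add: x)
 qed (use t in auto)
 let ?F = "delegx p d n L v (%x. strip x:insert col S) (%x. if strip x:insert col S then 1 else 0) ka"
 have "delegx p d n L v (%x. strip x:S) (%x. if strip x:S then 1 else if strip x = col then t else 0) ka rv = ?F (?h rv)"
  if rv: "rv:set_pmf (UI p (RS d n))" for rv
 proof (rule delegx_cong)
  note out = set_UI_out[OF finite_RS p rv]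
  have z: "?h rv (RZ c) = rv (RZ c)" and r: "?h rv (RT j k c) = rv (RT j k c)" for c j k
   using out by auto
  show "rv (RT j k c) = ?h rv (RT j k c)" for j k c by (rule r[symmetric])
  show "L < d" using d True by simp
  fix x assume x: "x:KI d n L"
  have R: "RN x:RS d n" using x d True by (auto intro: KI_KA)
  show "((if strip x:S then 0 else rv (RZ (coord x)) * ka x) + (if strip x:S then 1 else if strip x = col then t else 0) * rv (RN x)) mod int p =
   ((if strip x:insert col S then 0 else ?h rv (RZ (coord x)) * ka x) + (if strip x:insert col S then 1 else 0) * ?h rv (RN x)) mod int p"
  proof (cases "strip x = col")
   case True
   have "?h rv (RN x) = (t * rv (RN x) + rv (RZ (coord x)) * ka x) mod int p" using R x True by auto
   thus ?thesis using True col by (simp add: add.commute)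
  next
   case False
   have "?h rv (RN x) = rv (RN x)" using R False by auto
   thus ?thesis using False z by simp
  qed
 qed
 hence "map_pmf (delegx p d n L v (%x. strip x:S) (%x. if strip x:S then 1 else if strip x = col then t else 0) ka) (UI p (RS d n))
   = map_pmf (%rv. ?F (?h rv)) (UI p (RS d n))"
  by (intro map_pmf_cong refl)
 also have "... = map_pmf ?F (map_pmf ?h (UI p (RS d n)))" by (simp only: pmf.map_comp o_def)
 also have "... = map_pmf ?F (UI p (RS d n))" by (simp only: UIh)
 finally show ?thesis unfolding hybD_def using True by (simp cong: if_cong)
next
 case False
 hence e: "(length u = L) = False" by simp
 show ?thesis unfolding hybD_def e simp_thms if_False ..
qed

lemma hybD_next:
 assumes "length u~=L"
 shows "hybD p d n L S col 0 u ka v = hybD p d n (L + 1) {} col' 0 u ka v"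
proof -
 have a: "delegx p d n (length u) v (%x. length u = L & strip x:S)
   (%x. if length u = L then (if strip x:S then 1 else if strip x = col then 0 else 0) else 0) ka rv =
  delegx p d n (length u) v (%x. length u = L + 1 & strip x:{})
   (%x. if length u = L + 1 then (if strip x:{} then 1 else if strip x = col' then 0 else 0) else 0) ka rv" for rv
  using assms by (simp add: delegx_def cong: if_cong)
 have b: "length u < L <-> length u < L + 1" using assms by auto
 show ?thesis unfolding hybD_def a b ..
qed

lemma genD_eq_hybD:
 assumes "1<=length u" "0 < p"
 shows "genD (unif p) p d n u ka v = hybD p d n 1 {} col 0 u ka v"
proof -
 have a: "deleg p d n (length u) v ka = delegx p d n (length u) v (%x. length u = 1 & strip x:{})
   (%x. if length u = 1 then (if strip x:{} then 1 else if strip x = col then 0 else 0) else 0) ka"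
  by (simp add: fun_eq_iff delegx_def deleg_def cong: if_cong)
 have b: "(length u < 1) = False" using assms by auto
 show ?thesis unfolding genD_def hybD_def a UI_eq_map[OF finite_RS] pmf.map_comp o_def b if_False ..
qed

lemma stat_dist_le_kenv_valid:
 fixes ep :: real and K K' :: "ident=>'a pmf"
 assumes "0<=ep" "!!u. valid_id p d u ==> stat_dist_le ep (K u) (K' u)"
  "!!u k v. valid_id p d (u @ [v]) ==> stat_dist_le ep (D u k v) (D' u k v)"
 shows "stat_dist_le (num_queries c * ep) (exec b (kenv p d tg K D W) c x) (exec b (kenv p d tg K' D' W) c x)"
proof (rule stat_dist_le_exec[OF assms(1)])
 fix q :: query and x :: "mem \<times> (ident=>'a option)"
 show "stat_dist_le ep (kenv p d tg K D W q x) (kenv p d tg K' D' W q x)"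
  using assms by (auto simp: kenv_def Let_def split: prod.split query.split option.split
    intro!: stat_dist_le_map stat_dist_le_refl)
qed

lemma UI_split:
 assumes "finite A" "finite B" "A \<inter> B = {}"
 shows "UI p (A Un B) = bind_pmf (UI p A) (%f. map_pmf (%g x. if x:A then f x else g x) (UI p B))"
 unfolding UI_def Pi_pmf_union[OF assms] pair_pmf_def map_pmf_def by (simp add: bind_assoc_pmf bind_return_pmf)

text \<open>It suffices to compare the continuations on nonzero residues; moving there and back
  costs \<open>card I / p\<close> each way.\<close>

lemma bind_nz_stat:
 fixes F G :: "('i=>int)=>'b pmf"
 assumes I: "finite I" and p: "1 < p" and FG: "!!rv. (!!i. i:I ==> 1<=rv i & rv i < int p) ==> F rv = G rv"
 shows "stat_dist_le (2 * card I / p) (bind_pmf (UI p I) F) (bind_pmf (UI p I) G)"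
proof -
 let ?N = "Pi_pmf I 0 (%_. map_pmf int (unif_nz p))"
 have "stat_dist_le (1 / p) (map_pmf int (unif_nz p)) (map_pmf int (unif p))"
  by (rule stat_dist_le_map[OF stat_dist_le_unif_nz[OF p]])
 hence s: "stat_dist_le (card I * (1 / p)) ?N (UI p I)"
  unfolding UI_def by (rule stat_dist_le_Pi_pmf[OF I, rotated]) simp
 have eq: "bind_pmf ?N F = bind_pmf ?N G"
 proof (rule bind_pmf_cong[OF refl])
  fix rv assume rv: "rv:set_pmf ?N"
  have un: "set_pmf (unif_nz p) = {1..<p}" unfolding unif_nz_def by (rule set_pmf_of_set) (use p in simp_all)
  have "rv:PiE_dflt I 0 (%_. int ` {1..<p})" using rv by (simp add: set_Pi_pmf[OF I] o_def un)
  hence "rv i:int ` {1..<p}" if "i:I" for i using that by (simp add: PiE_dflt_def)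
  thus "F rv = G rv" by (intro FG) force
 qed
 have "stat_dist_le (card I * (1 / p) + card I * (1 / p)) (bind_pmf (UI p I) F) (bind_pmf (UI p I) G)"
  using stat_dist_le_trans[OF stat_dist_le_sym[OF stat_dist_le_bind1[OF s, of F]] stat_dist_le_bind1[OF s, of G, folded eq]]
  by (simp add: eq)
 thus ?thesis by simp
qed

text \<open>The randomized parent is now a fresh key. The entry of the new level in a remaining row
  is \<tau> times s', which is uniform for nonzero s'; every other entry gets fresh randomness of
  its own. The exponents s' equal to 0 cause the error.\<close>

lemma hybD_all:
 assumes pr: "prime p" and d: "length u < d" and v: "v ! 0 = 1"
  and all: "!!x. x:KI d n (length u) ==> strip x:S"
 shows "stat_dist_le (2 * n / p) (hybD p d n (length u) S col 0 u ka v) (hybD p d n (length u + 1) S' col' 0 u ka v)"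
proof -
 define l where "l = length u"
 have p: "1 < p" "0 < p" using pr prime_gt_1_nat[of p] by auto
 define E where "E = (%c. RN (Extra (l + 1) c)) ` {1..n}"
 define Rr where "Rr = RS d n - E"
 have E: "E<=RS d n" using d by (auto simp: E_def l_def intro!: KI_KA[of _ _ _ l])
 have RSeq: "RS d n = E Un Rr" "finite E" "finite Rr" "E \<inter> Rr = {}" using E by (auto simp: Rr_def E_def)
 have cE: "card E = n" unfolding E_def by (subst card_image) (auto simp: inj_on_def)
 \<comment> \<open>For each entry of the delegated key, the variable that makes it uniform. For the
   row of \<open>D\<close> this is the entry of \<open>k = 1\<close>, whose coefficient
   \<open>v ! 0\<close> is 1.\<close>
 define src where "src x = (case x of Coef j k i c =>
   (if j = 0 then (if i = l + 1 then RN (Extra (l + 1) c) else RN (Coef (l + 1) 1 i c))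
    else if i = l + 1 then RT j k c else RN x) | Extra j c=>RN x)" for x
 have src_in: "src x:RS d n" if "x:KI d n (l + 1)" for x
  using that d by (cases x) (auto simp: src_def rows_def KA_def l_def intro: bexI[of _ "length u"] bexI[of _ "length u + 1"])
 have src_inj: "inj_on src (KI d n (l + 1))"
 proof (rule inj_onI)
  fix x y assume "x:KI d n (l + 1)" "y:KI d n (l + 1)" "src x = src y"
  thus "x = y" by (cases x; cases y) (auto simp: src_def rows_def split: if_splits)
 qed
 let ?pull = "%rv x. if x:KI d n (l + 1) then rv (src x) else 0"
 have pull: "map_pmf ?pull (UI p (RS d n)) = UI p (KI d n (l + 1))"
  by (rule UI_pull) (use src_in src_inj in auto)
 let ?F = "delegx p d n l v (%x. strip x:S) (%x. if strip x:S then 1 else 0) ka"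
 let ?m = "%ep rv x. if x:E then ep x else rv x"
 have main: "map_pmf (%rv. ?F (?m ep rv)) (UI p Rr) = map_pmf (%rv. ?pull (?m ep rv)) (UI p Rr)"
  if ep: "!!i. i:E ==> 1<=ep i & ep i < int p" for ep
 proof -
  let ?e = "%c. ep (RN (Extra (l + 1) c))"
  let ?nx = "%rv i c. rv (RN (Coef (l + 1) 1 i c)) + rv (RN (Coef (l + 1) 2 i c)) * int (v ! 1)"
  \<comment> \<open>Two triangular substitutions. On \<open>A\<close>, the old levels of the
    remaining rows absorb the \<tau> multiple of the new row. Then, on \<open>B\<close>, each \<tau>
    is scaled by s' and the entries of \<open>k = 1\<close> are turned into the row of
    \<open>D\<close>. The shifts on \<open>A\<close> refer to the variables in \<open>B\<close>
    before their substitution, hence this order.\<close>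
  define A where "A = {RN (Coef j k i c) | j k i c. j:{l + 2..d} & k:{1..2} & i<=l & c:{1..n}}"
  define B where "B = {RT j k c | j k c. j:{l + 2..d} & k:{1..2} & c:{1..n}} Un
    {RN (Coef (l + 1) 1 i c) | i c. i<=l & c:{1..n}}"
  have inR: "A<=Rr" "B<=Rr"
   using d by (auto simp: A_def B_def Rr_def E_def l_def KA_def rows_def intro!: bexI[of _ "length u"])
  let ?dd1 = "%rv r. case r of RN (Coef j k i c)=>rv (RT j k c) * ?nx rv i c | _=>0"
  let ?h1 = "%rv r. if r:Rr - A then rv r else if r:Rr then (1 * rv r + ?dd1 rv r) mod int p else 0"
  let ?a2 = "%r. case r of RT j k c=>?e c | _=>1"
  let ?dd2 = "%rv r. case r of RN (Coef j k i c)=>rv (RN (Coef (l + 1) 2 i c)) * int (v ! 1) + ka (Coef 0 0 i c) | _=>0"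
  let ?h2 = "%rv r. if r:Rr - B then rv r else if r:Rr then (?a2 r * rv r + ?dd2 rv r) mod int p else 0"
  have i2: "RN (Coef (l + 1) k i c):Rr - A" if "k:{1..2}" "i<=l" "c:{1..n}" for k i c
   using that d by (auto simp: A_def Rr_def E_def l_def KA_def rows_def intro!: bexI[of _ "length u"])
  have i3: "RN (Coef (l + 1) 2 i c):Rr - B" if "i<=l" "c:{1..n}" for i c
   using that d by (auto simp: B_def Rr_def E_def l_def KA_def rows_def intro!: bexI[of _ "length u"])
  have i4: "RT j k c:Rr - A" if "j:{l + 2..d}" "k:{1..2}" "c:{1..n}" for j k c
   using that by (auto simp: A_def Rr_def E_def)
  have h1: "map_pmf ?h1 (UI p Rr) = UI p Rr"
  proof (rule UI_triangular[OF RSeq(3) p(2)])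
   fix rv rv' :: "rx=>int" and r assume eq: "!!j. j:Rr - A ==> rv j = rv' j" and r: "r:Rr - (Rr - A)"
   then obtain j k i c where r: "r = RN (Coef j k i c)" "j:{l + 2..d}" "k:{1..2}" "i<=l" "c:{1..n}"
    by (auto simp: A_def)
   thus "?dd1 rv r = ?dd1 rv' r" using eq[OF i4, of j k c] eq[OF i2, of 1 i c] eq[OF i2, of 2 i c] by simp
  qed auto
  have h2: "map_pmf ?h2 (UI p Rr) = UI p Rr"
  proof (rule UI_triangular[OF RSeq(3) p(2)])
   fix r assume "r:Rr - (Rr - B)"
   then consider j k c where "r = RT j k c" "c:{1..n}" | x where "r = RN x" by (auto simp: B_def)
   thus "coprime (?a2 r) (int p)"
   proof cases
    case 1
    have "RN (Extra (l + 1) c):E" using 1 by (auto simp: E_def)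
    hence "1<=?e c & ?e c < int p" by (rule ep)
    hence "\<not> int p dvd ?e c" by (auto dest: zdvd_imp_le)
    hence "coprime (int p) (?e c)" using pr by (intro prime_imp_coprime) simp_all
    thus ?thesis using 1 by (simp add: coprime_commute)
   qed simp
  next
   fix rv rv' :: "rx=>int" and r assume eq: "!!j. j:Rr - B ==> rv j = rv' j" and "r:Rr - (Rr - B)"
   then consider j k c where "r = RT j k c" | i c where "r = RN (Coef (l + 1) 1 i c)" "i<=l" "c:{1..n}" by (auto simp: B_def)
   thus "?dd2 rv r = ?dd2 rv' r" by cases (use eq[OF i3] in simp_all)
  qed auto
  have "?F (?m ep rv) = ?pull (?m ep (?h2 (?h1 rv)))" if rv: "rv:set_pmf (UI p Rr)" for rv
  proof
   fix x
   let ?w = "?m ep rv"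
   define w1 where "w1 = ?h1 rv"
   note out = set_UI_out[OF RSeq(3) p(2) rv] and rng = set_UI_range[OF RSeq(3) p(2) rv]
   have V: "((if strip y:S then 0 else ?w (RZ (coord y)) * ka y) + (if strip y:S then 1 else 0) * ?w (RN y)) mod int p = ?w (RN y) mod int p"
    if "y:KI d n l" for y using all[OF that[unfolded l_def]] by simp
   show "?F ?w x = ?pull (?m ep (?h2 (?h1 rv))) x"
   proof (cases "x:KI d n (l + 1)")
    case x: True
    have "?F ?w x = cmb l v (%j k c. ?w (RT j k c)) ka (%y. ?w (RN y)) x mod int p"
     unfolding delegx_def onKI_def if_P[OF x] by (rule cmb_cong[OF _ x refl V refl]) (use d l_def in simp_all)
    also have "... = ?m ep (?h2 w1) (src x)"
    proof (cases x)
     case (Coef j k i c)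
     hence jk: "(j,k):rows d (l + 1)" and i: "i<=l + 1" and c: "c:{1..n}" using x by auto
     have jk': "j:{l + 2..d} & k:{1..2}" if "j~=0" using jk that by (auto simp: rows_def)
     have j0: "k = 0" if "j = 0" using jk that by (auto simp: rows_def)
     have wE: "?w (RN (Extra (l + 1) c)) = ?e c" using c by (auto simp: E_def)
     have wN: "?w (RN (Coef j k i c)) = rv (RN (Coef j k i c))" "?w (RT j k c) = rv (RT j k c)" for j k i c
      by (auto simp: E_def)
     have nx: "newx l v (%y. ?w (RN y)) i c = (if i = l + 1 then ?e c else ?nx rv i c)"
      by (simp only: newx_def wE wN v of_nat_1 mult_1_right)
     have eb: "?e c mod int p = ?e c" using ep[of "RN (Extra (l + 1) c)"] c by (auto simp: E_def)
     consider "j = 0" "i = l + 1" | "j = 0" "i<=l" | "j~=0" "i = l + 1" | "j~=0" "i<=l" using i by linarith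
     thus ?thesis
     proof cases
      case 1
      thus ?thesis using Coef nx eb c by (simp add: src_def E_def)
     next
      case 2
      have m: "RN (Coef (l + 1) 1 i c):B" "RN (Coef (l + 1) 1 i c) ~: E" "RN (Coef (l + 1) 1 i c) ~: A"
      using 2 c by (auto simp: B_def E_def A_def)
      have m': "RN (Coef (l + 1) 1 i c):Rr" using m(1) inR(2) by (rule subsetD[rotated])
      have q: "w1 (RN (Coef (l + 1) k i c)) = rv (RN (Coef (l + 1) k i c))" if "k:{1..2}" for k
      using i2[OF that 2(2) c] by (simp add: w1_def)
      have "?m ep (?h2 (w1)) (src x) = ?h2 (w1) (RN (Coef (l + 1) 1 i c))"
      using 2 Coef m(2) by (simp add: src_def)
      also have "... = (1 * w1 (RN (Coef (l + 1) 1 i c)) + (w1 (RN (Coef (l + 1) 2 i c)) * int (v ! 1) + ka (Coef 0 0 i c))) mod int p"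
      using m(1) m' by simp
      also have "... = (ka (Coef 0 0 i c) + ?nx rv i c) mod int p"
      using q[of 1] q[of 2] by (simp add: algebra_simps)
      finally show ?thesis using 2 Coef j0 nx by simp
     next
      case 3
      have m: "RT j k c:B" "RT j k c ~: E" using jk' 3 c by (auto simp: B_def E_def)
      have m': "RT j k c:Rr" using m(1) inR(2) by (rule subsetD[rotated])
      have q: "w1 (RT j k c) = rv (RT j k c)" using i4[of j k c] jk' 3 c by (simp add: w1_def)
      have "?m ep (?h2 (w1)) (src x) = ?h2 (w1) (RT j k c)"
      using 3 Coef m(2) by (simp add: src_def)
      also have "... = (?e c * w1 (RT j k c) + 0) mod int p" using m(1) m' by simp
      also have "... = (rv (RT j k c) * ?e c) mod int p" unfolding q by (simp add: mult.commute)
      finally show ?thesis using 3 Coef nx wN(2)[of j k c] by simp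
     next
      case 4
      have m: "RN x:A" "RN x ~: E" "RN x ~: B" using jk' 4 c Coef by (auto simp: B_def E_def A_def)
      have m': "RN x:Rr" using m(1) inR(1) by (rule subsetD[rotated])
      have "?m ep (?h2 (w1)) (src x) = ?h2 (w1) (RN x)" using 4 Coef m(2) by (simp add: src_def)
      also have "... = w1 (RN x)" using m(3) m' by simp
      also have "... = (rv (RN x) + rv (RT j k c) * ?nx rv i c) mod int p" using m(1) m' Coef by (simp add: w1_def)
      finally show ?thesis using 4 Coef nx wN[of j k c] wN(1)[of j k i c] by simp
     qed
    next
     case (Extra j c)
     hence j: "j:{l + 2..d}" "c:{1..n}" using x by auto
     have m: "RN x ~: E" "RN x ~: A" "RN x ~: B" using j Extra by (auto simp: E_def A_def B_def)
     have "x:KI d n l" using j Extra by auto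
     hence "RN x:RS d n" using d by (auto simp: l_def intro: KI_KA)
     hence m': "RN x:Rr" using m(1) by (simp add: Rr_def)
     have "?m ep (?h2 w1) (src x) = ?h2 w1 (RN x)" using Extra m(1) by (simp add: src_def)
     also have "... = rv (RN x)" using m m' by (simp add: w1_def)
     finally show ?thesis using Extra m(1) rng[of "RN x"] by simp
    qed
    finally show ?thesis using x unfolding w1_def by simp
   qed (simp add: delegx_def onKI_def)
  qed
  hence "map_pmf (%rv. ?F (?m ep rv)) (UI p Rr) = map_pmf (%rv. ?pull (?m ep (?h2 (?h1 rv)))) (UI p Rr)"
   by (intro map_pmf_cong refl)
  also have "... = map_pmf (%rv. ?pull (?m ep rv)) (map_pmf ?h2 (map_pmf ?h1 (UI p Rr)))" by (simp only: pmf.map_comp o_def)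
  also have "... = map_pmf (%rv. ?pull (?m ep rv)) (UI p Rr)" by (simp only: h1 h2)
  finally show ?thesis .
 qed
 have "stat_dist_le (2 * card E / p) (bind_pmf (UI p E) (%ep. map_pmf (%rv. ?F (?m ep rv)) (UI p Rr)))
   (bind_pmf (UI p E) (%ep. map_pmf (%rv. ?pull (?m ep rv)) (UI p Rr)))"
  by (rule bind_nz_stat[OF RSeq(2) p(1)]) (rule main)
 moreover have join: "bind_pmf (UI p E) (%ep. map_pmf (%rv. G (?m ep rv)) (UI p Rr)) = map_pmf G (UI p (RS d n))"
  for G :: "(rx=>int)=>kx=>int"
  unfolding RSeq(1) UI_split[OF RSeq(2-4)] map_bind_pmf pmf.map_comp o_def ..
 ultimately have "stat_dist_le (2 * n / p) (map_pmf ?F (UI p (RS d n))) (UI p (KI d n (l + 1)))"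
  unfolding join[of ?F] join[of ?pull] pull cE by blast
 moreover have "hybD p d n (length u) S col 0 u ka v = map_pmf ?F (UI p (RS d n))"
  by (simp add: hybD_def l_def cong: if_cong)
 moreover have "hybD p d n (length u + 1) S' col' 0 u ka v = UI p (KI d n (l + 1))"
  using fresh_UI[of "l + 1" d n p] d by (simp add: hybD_def l_def)
 ultimately show ?thesis by simp
qed

section \<open>Simulation from DDH tuples\<close>

primrec setc :: "nat=>kx=>kx" where
 "setc c (Coef j k i c') = Coef j k i c"
| "setc c (Extra j c') = Extra j c"

lemma setc_strip: "strip x = col ==> setc (coord x) col = x"
 by (cases x) auto

definition psum :: "'v px list=>'v px" where
 "psum xs = foldr PA xs (PC 0)"

lemma pev_psum: "pev (psum xs) et = (\<Sum>x\<leftarrow>xs. pev x et)"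
 by (induction xs) (auto simp: psum_def)

lemma set_px_psum: "set_px (psum xs) = (\<Union>x\<in>set xs. set_px x)"
 by (induction xs) (auto simp: psum_def)

lemma psize_psum: "(!!x. x:set xs ==> psize x<=K) ==> psize (psum xs)<=length xs * (K + 3) + 1"
 by (induction xs) (force simp: psum_def)+

type_synonym fvar = "(nat \<times> kx,rx) var"

fun wexpx :: "secret=>nat=>nat=>witem=>fvar px" where
 "wexpx (av,aw,ah) l m (WRow j k c) =
   PA (psum (map (%i. PM (PA (PM (PC (ah (i,1,c))) (PV (VId (i - 1) 0))) (PM (PC (ah (i,2,c))) (PV (VId (i - 1) 1))))
      (PV (VPl (m,Coef j k i c)))) [1..<l + 1]))
    (PA (PM (PC (aw c)) (PV (VPl (m,Coef j k 0 c))))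
     (if j = 0 then PC 0 else PM (PC (ah (j,k,c))) (PV (VPl (m,Extra j c)))))"
| "wexpx (av,aw,ah) l m (WL x) = PM (PC av) (PV (VPl (m,x)))"

lemma pev_wexpx: "pev (wexpx sec (length u) m w) (penv u v rv pl) = wexp sec u (%x. pl (m,x)) w"
proof -
 obtain av aw ah where sec: "sec = (av,aw,ah)" by (cases sec)
 show ?thesis
 proof (cases w)
  case (WRow j k c)
  have "(\<Sum>i\<leftarrow>[1..<length u + 1]. pev (PM (PA (PM (PC (ah (i,1,c))) (PV (VId (i - 1) 0))) (PM (PC (ah (i,2,c))) (PV (VId (i - 1) 1))))
      (PV (VPl (m,Coef j k i c)))) (penv u v rv pl)) = (\<Sum>i\<leftarrow>[1..<length u + 1]. hid ah u i c * pl (m,Coef j k i c))"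
   by (intro arg_cong[where f = sum_list] map_cong refl) auto
  also have "... = (\<Sum>i = 1..length u. hid ah u i c * pl (m,Coef j k i c))"
   by (subst interv_sum_list_conv_sum_set_nat) (auto intro!: sum.cong simp del: hid.simps)
  finally show ?thesis by (simp add: WRow sec pev_psum o_def del: hid.simps)
 qed (simp add: sec)
qed

lemma set_px_wexpx:
 assumes w: "w:set (items d n l)" and l: "l<=d"
 shows "set_px (wexpx sec l m w)<=idvars d Un VPl ` ({m} \<times> KA d n)"
proof -
 obtain av aw ah where sec: "sec = (av,aw,ah)" by (cases sec)
 consider j k c where "w = WRow j k c" "(j,k):rows d l" "c:{1..n}" | x where "w = WL x" "x:KI d n l"
  using set_items[OF w] by auto
 thus ?thesis
 proof cases
  case 1
  have i: "Coef j k i c:KA d n" if "i<=l" for i using 1 that l by (intro KI_KA[of _ d n l]) auto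
  have e: "Extra j c:KA d n" if "j~=0" using 1 that l by (intro KI_KA[of _ d n l]) (auto simp: rows_def)
  show ?thesis unfolding 1(1) sec using i e l by (auto simp: set_px_psum split: if_splits)
 next
  case 2
  hence "x:KA d n" using l by (intro KI_KA)
  thus ?thesis unfolding 2(1) sec by auto
 qed
qed

lemma psize_wexpx: "l<=d ==> psize (wexpx sec l m w)<=23 * d + 20"
proof -
 assume l: "l<=d"
 obtain av aw ah where sec: "sec = (av,aw,ah)" by (cases sec)
 show ?thesis
 proof (cases w)
  case (WRow j k c)
  define T :: "fvar px" where "T = psum (map (%i. PM (PA (PM (PC (ah (i,1,c))) (PV (VId (i - 1) 0))) (PM (PC (ah (i,2,c))) (PV (VId (i - 1) 1))))
      (PV (VPl (m,Coef j k i c)))) [1..<l + 1])"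
  have "psize T<=length [1..<l + 1] * (20 + 3) + 1"
   unfolding T_def by (rule order_trans[OF psize_psum[where K = 20]]) (auto simp del: upt_Suc)
  hence "psize T<=23 * l + 1" by (simp del: upt_Suc)
  thus ?thesis using l unfolding WRow sec wexpx.simps T_def[symmetric] by simp
 qed (simp add: sec)
qed

definition newxx :: "nat=>(kx=>fvar px)=>nat=>nat=>fvar px" where
 "newxx l V i c = (if i = l + 1 then V (Extra (l + 1) c)
   else PA (PM (V (Coef (l + 1) 1 i c)) (PV (VX 0))) (PM (V (Coef (l + 1) 2 i c)) (PV (VX 1))))"

fun cmbx :: "nat=>(kx=>fvar px)=>(kx=>fvar px)=>kx=>fvar px" where
 "cmbx l K V (Coef j k i c) = PA (if i = l + 1 then PC 0 else if j = 0 then K (Coef 0 0 i c) else V (Coef j k i c))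
   (PM (if j = 0 then PC 1 else PV (VOm (RT j k c))) (newxx l V i c))"
| "cmbx l K V (Extra j c) = V (Extra j c)"

lemma pev_cmbx: "pev (cmbx l K V x) (penv u v rv pl) = cmb l v (%j k c. rv (RT j k c))
  (%x. pev (K x) (penv u v rv pl)) (%x. pev (V x) (penv u v rv pl)) x"
 by (cases x) (auto simp: newxx_def newx_def)

lemma set_px_cmbx:
 assumes x: "x:KI d n (l + 1)" and l: "l < d"
  and K: "!!y. y:KI d n l ==> set_px (K y)<=A" and V: "!!y. y:KI d n l ==> set_px (V y)<=A"
  and A: "VX 0:A" "VX 1:A" "!!r. r:RS d n ==> VOm r:A"
 shows "set_px (cmbx l K V x)<=A"
proof (cases x)
 case (Coef j k i c)
 hence jk: "(j,k):rows d (l + 1)" and i: "i<=l + 1" and c: "c:{1..n}" using x by auto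
 have 1: "set_px (newxx l V i c)<=A"
 proof (cases "i = l + 1")
  case True
  have "Extra (l + 1) c:KI d n l" using l c by simp
  thus ?thesis using True V by (simp add: newxx_def)
 next
  case False
  have m: "Coef (l + 1) 1 i c:KI d n l" "Coef (l + 1) 2 i c:KI d n l" using False i l c by (auto simp: rows_def)
  show ?thesis using False V[OF m(1)] V[OF m(2)] A by (simp add: newxx_def)
 qed
 have 2: "VOm (RT j k c):A" if "j~=0" using that jk c by (intro A(3)) (auto simp: rows_def)
 have 3: "set_px (K (Coef 0 0 i c))<=A" if "i~=l + 1" using that i c by (intro K) (auto simp: rows_def)
 have 4: "set_px (V (Coef j k i c))<=A" if "i~=l + 1" "j~=0" using that i c jk by (intro V) (auto simp: rows_def)
 show ?thesis unfolding Coef using 1 2 3 4 by auto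
next
 case (Extra j c)
 hence "Extra j c:KI d n l" using x by auto
 thus ?thesis unfolding Extra using V by simp
qed

lemma psize_cmbx:
 assumes "!!y. psize (K y)<=7" "!!y. psize (V y)<=7"
 shows "psize (cmbx l K V x)<=50"
proof (cases x)
 case (Coef j k i c)
 have "psize (newxx l V i c)<=27"
  using assms(2)[of "Extra (l + 1) c"] assms(2)[of "Coef (l + 1) 1 i c"] assms(2)[of "Coef (l + 1) 2 i c"]
  by (simp add: newxx_def)
 thus ?thesis using Coef assms(1)[of "Coef 0 0 i c"] assms(2)[of "Coef j k i c"] by auto
next
 case (Extra j c)
 thus ?thesis using assms(2)[of "Extra j c"] by simp
qed

text \<open>A key of the DDH simulation has four known parts, combined with the discrete logarithms
  1, x, y and x y + t of the challenge words.\<close>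

definition lin4 :: "(nat=>int)=>(nat=>int)=>int" where
 "lin4 e f = e 0 * f 0 + e 1 * f 1 + e 2 * f 2 + e 3 * f 3"

lemma wexp_lin4: "wexp sec u (%x. lin4 e (%m. f m x)) w = lin4 e (%m. wexp sec u (f m) w)"
 by (cases sec; cases w) (auto simp: lin4_def sum.distrib sum_distrib_left algebra_simps)

lemma cmb_lin4: "cmb l v \<tau> (%x. lin4 e (%m. ka m x)) (%x. lin4 e (%m. V m x)) z = lin4 e (%m. cmb l v \<tau> (ka m) (V m) z)"
 by (cases z) (auto simp: lin4_def newx_def algebra_simps)

lemma lin4_mod_cong: "(!!m. m < 4 ==> f m mod P = g m mod P) ==> lin4 e f mod P = lin4 e g mod P"
 unfolding lin4_def by (intro mod_add_cong mod_mult_cong refl) auto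

definition freshx :: "nat=>kx=>nat=>nat=>kx=>fvar px" where
 "freshx L col l m x = (if m = 0 then PV (VOm (RN x)) else if m = 1 & l = L & strip x = col then PC 1 else PC 0)"

text \<open>At level \<open>L\<close> the exponent z becomes \<open>z + y * \<zeta>\<close>, and
  entries of column \<open>col\<close> have the form \<open>\<sigma> + x\<close>. Expanding the
  product gives \<open>z * \<sigma>\<close>, \<open>z\<close>, \<open>\<zeta> * \<sigma>\<close> and
  \<open>\<zeta>\<close> as coefficients of 1, x, y and x y. Since \<zeta> is the \<open>RN\<close>
  entry of that column, a challenge with x y + t adds exactly the perturbation of
  \<open>hybD\<close>.\<close>

definition randx :: "nat=>kx set=>kx=>nat=>nat=>kx=>fvar px" where
 "randx L S col l m i = (let z = PV (VOm (RZ (coord i))); \<sigma> = PV (VPl (0,i)); \<zeta> = PV (VOm (RN (setc (coord i) col))) in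
   if l = L then
    (if strip i:S then (if m = 0 then PV (VOm (RN i)) else PC 0)
    else if m = 0 then PM z \<sigma> else if m = 2 then PM \<zeta> \<sigma>
    else if strip i = col then (if m = 1 then z else \<zeta>) else PC 0)
   else PM z (PV (VPl (m,i))))"

definition ddh_ce :: "nat=>nat=>nat=>kx=>nat=>nat \<times> kx=>fvar px" where
 "ddh_ce d n L col l mx = (case mx of (m,x)=>if x:KI d n l & l<=d then freshx L col l m x else PC 0)"

definition ddh_de :: "nat=>nat=>nat=>kx set=>kx=>nat=>nat \<times> kx=>fvar px" where
 "ddh_de d n L S col l mx = (case mx of (m,x)=>if x:KI d n (l + 1) & l < d & m < 4 then
   (if l < L then freshx L col (l + 1) m x else cmbx l (%y. PV (VPl (m,y))) (randx L S col l m) x) else PC 0)"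

definition ddh_re :: "nat=>nat=>secret=>nat=>(nat \<times> fvar px) list list" where
 "ddh_re d n sec l = (if l<=d then map (%w. map (%m. (m + 1,wexpx sec l m w)) [0..<4]) (items d n l) else [])"

text \<open>At level \<open>L\<close> the key will be multiplied by \<open>y\<close> once more, so
  that nothing unknown may occur there except \<open>x\<close> in column \<open>col\<close>. Deeper
  keys are randomized with known exponents and may have arbitrary parts.\<close>

definition ddh_rel :: "nat=>nat=>nat=>nat=>kx=>(nat=>int)=>nat=>(nat \<times> kx=>int)=>(kx=>int)=>bool" where
 "ddh_rel p d n L col e l pl ka <-> (ALL x:KI d n l. lin4 e (%m. pl (m,x)) mod int p = ka x mod int p &
   (l = L --> pl (1,x) = (if strip x = col then 1 else 0) & pl (2,x) = 0 & pl (3,x) = 0))"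

text \<open>Adding the unknown \<open>x\<close> to uniform entries of one column does not change
  their distribution; \<open>?h\<close> undoes the shift.\<close>

lemma ddh_fresh_rel:
 assumes p: "1 < p" and l: "l<=d" and e: "e 0 = 1" and P: "!!m x. m < 4 ==> x:KI d n l ==> F (m,x) = freshx L col l m x"
 shows "rel_pmf (ddh_rel p d n L col e l)
  (map_pmf (%rv i. if i:{..<4} \<times> KA d n then pev (F i) (penv u v rv pl) mod int p else 0) (UI p (RS d n)))
  (map_pmf (fresh d n l) (UI p (RS d n)))"
proof -
 let ?J = "RS d n - RN ` {x:KI d n l. l = L & strip x = col}"
 let ?h = "%rv i. if i:?J then rv i else if i:RS d n then (1 * rv i + e 1) mod int p else 0"
 have h: "map_pmf ?h (UI p (RS d n)) = UI p (RS d n)"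
  by (rule UI_triangular[OF finite_RS]) (use p in auto)
 have "rel_pmf (ddh_rel p d n L col e l)
  (map_pmf (%rv i. if i:{..<4} \<times> KA d n then pev (F i) (penv u v rv pl) mod int p else 0) (UI p (RS d n)))
  (map_pmf (%rv. fresh d n l (?h rv)) (UI p (RS d n)))"
 proof (rule rel_pmf_map_same)
  fix rv :: "rx=>int"
  define Q where "Q i = (if i:{..<4} \<times> KA d n then pev (F i) (penv u v rv pl) mod int p else 0)" for i
  have "ddh_rel p d n L col e l Q (fresh d n l (?h rv))"
   unfolding ddh_rel_def
  proof
   fix x assume x: "x:KI d n l"
   have xA: "x:KA d n" using x l by (rule KI_KA)
   hence R: "RN x:RS d n" by simp
   have F: "Q (m,x) = (if m = 0 then rv (RN x) mod int p else if m = 1 & l = L & strip x = col then 1 else 0)" if "m < 4" for m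
    using that xA p P[OF that x] by (simp add: freshx_def Q_def)
   have k: "fresh d n l (?h rv) x = (if l = L & strip x = col then (rv (RN x) + e 1) mod int p else rv (RN x))"
    using x R by (auto simp: fresh_def onKI_def)
   show "lin4 e (%m. Q (m,x)) mod int p = fresh d n l (?h rv) x mod int p &
    (l = L --> Q (1,x) = (if strip x = col then 1 else 0) & Q (2,x) = 0 & Q (3,x) = 0)"
    unfolding k lin4_def by (simp add: F e mod_add_left_eq)
  qed
  thus "ddh_rel p d n L col e l (%i. if i:{..<4} \<times> KA d n then pev (F i) (penv u v rv pl) mod int p else 0) (fresh d n l (?h rv))"
   by (simp only: Q_def[abs_def])
 qed
 also have "map_pmf (%rv. fresh d n l (?h rv)) (UI p (RS d n)) = map_pmf (fresh d n l) (map_pmf ?h (UI p (RS d n)))"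
  by (simp only: pmf.map_comp o_def)
 finally show ?thesis by (simp only: h)
qed


lemma hybD_simp:
 "length u < L ==> hybD p d n L S col t u ka v = map_pmf (fresh d n (length u + 1)) (UI p (RS d n))"
 "L < length u ==> hybD p d n L S col t u ka v = map_pmf (delegx p d n (length u) v (%_. False) (%_. 0) ka) (UI p (RS d n))"
 "length u = L ==> hybD p d n L S col t u ka v = map_pmf (delegx p d n L v (%x. strip x:S)
   (%x. if strip x:S then 1 else if strip x = col then t else 0) ka) (UI p (RS d n))"
 by (simp_all add: hybD_def)

text \<open>A uniform z hides the shift by \<open>y * \<zeta>\<close>, which \<open>?h\<close>
  performs. Afterwards both keys agree by expanding the product, and linearity of delegation carries
  this to the new key.\<close>

lemma ddh_deleg_rel:
 assumes p: "1 < p" and l: "l < d" "L<=l" and e: "e 0 = 1" "e 3 mod int p = (e 1 * e 2 + t) mod int p" and col: "col:strip ` KI d n L" "col ~: S"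
  and R: "ddh_rel p d n L col e l pl ka" and len: "length u = l"
 shows "rel_pmf (ddh_rel p d n L col e (l + 1)) (polyD p ({..<4} \<times> KA d n) (RS d n) (ddh_de d n L S col) u pl v)
  (hybD p d n L S col t u ka v)"
proof -
 let ?J = "RS d n - (if l = L then RZ ` {1..n} else {})"
 let ?z = "%c. RN (setc c col)"
 let ?dd = "%rv r. case r of RZ c=>e 2 * rv (?z c) | _=>0"
 let ?h = "%rv i. if i:?J then rv i else if i:RS d n then (1 * rv i + ?dd rv i) mod int p else 0"
 have colK: "setc c col:KI d n L" if "c:{1..n}" for c
 proof -
  obtain x where "x:KI d n L" "col = strip x" using col(1) by auto
  thus ?thesis using that by (cases x) auto
 qed
 have colA: "?z c:RS d n" if "c:{1..n}" for c
  using KI_KA[OF colK[OF that]] l by simp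
 have h: "map_pmf ?h (UI p (RS d n)) = UI p (RS d n)"
 proof (rule UI_triangular[OF finite_RS])
  fix rv rv' :: "rx=>int" and r assume eq: "!!j. j:?J ==> rv j = rv' j" and r: "r:RS d n - ?J"
  then obtain c where c: "r = RZ c" "c:{1..n}" by (auto split: if_splits)
  have "?z c:?J" using colA[OF c(2)] by auto
  thus "?dd rv r = ?dd rv' r" using eq c by simp
 qed (use p in auto)
 define f where "f x = (l = L & strip x:S)" for x
 define tt where "tt x = (if l = L then (if strip x:S then 1 else if strip x = col then t else 0) else 0)" for x
 have hyb: "hybD p d n L S col t u ka v = map_pmf (%rv. delegx p d n l v f tt ka (?h rv)) (UI p (RS d n))"
 proof -
  have "hybD p d n L S col t u ka v = map_pmf (delegx p d n l v f tt ka) (UI p (RS d n))"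
   using l len by (cases "l = L") (simp_all add: hybD_simp f_def[abs_def] tt_def[abs_def])
  also have "... = map_pmf (delegx p d n l v f tt ka) (map_pmf ?h (UI p (RS d n)))" by (simp only: h)
  finally show ?thesis by (simp only: pmf.map_comp o_def)
 qed
 show ?thesis
  unfolding hyb polyD_def
 proof (rule rel_pmf_map_same)
  fix rv assume rv: "rv:set_pmf (UI p (RS d n))"
  note out = set_UI_out[OF finite_RS _ rv]
  define w1 where "w1 = ?h rv"
  let ?en = "penv u v rv pl"
  define Q where "Q i = (if i:{..<4} \<times> KA d n then pev (ddh_de d n L S col (length u) i) ?en mod int p else 0)" for i
  define Vm where "Vm m y = pev (randx L S col l m y) ?en" for m y
  define V where "V x = (if f x then 0 else w1 (RZ (coord x)) * ka x) + tt x * w1 (RN x)" for x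
  have V: "lin4 e (%m. Vm m y) mod int p = V y mod int p" if y: "y:KI d n l" for y
  proof -
   have c: "coord y:{1..n}" using y by (cases y) auto
   note Ry = R[unfolded ddh_rel_def, THEN bspec, OF y]
   have RN: "w1 (RN x) = rv (RN x)" for x using out p by (auto simp: w1_def)
   show ?thesis
   proof (cases "l = L")
    case False
    have z: "w1 (RZ (coord y)) = rv (RZ (coord y))" using out p False by (auto simp: w1_def)
    have "lin4 e (%m. Vm m y) = rv (RZ (coord y)) * lin4 e (%m. pl (m,y))"
     using False by (simp add: Vm_def randx_def Let_def lin4_def algebra_simps)
    moreover have "rv (RZ (coord y)) * lin4 e (%m. pl (m,y)) mod int p = rv (RZ (coord y)) * ka y mod int p"
     by (rule mod_mult_left_congI[OF conjunct1[OF Ry]])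
    ultimately have "lin4 e (%m. Vm m y) mod int p = rv (RZ (coord y)) * ka y mod int p" by simp
    thus ?thesis using False z by (simp add: V_def f_def tt_def)
   next
    case True
    have pl: "pl (1,y) = (if strip y = col then 1 else 0)" "pl (2,y) = 0" "pl (3,y) = 0" using Ry True by auto
    have k: "ka y mod int p = (pl (0,y) + e 1 * (if strip y = col then 1 else 0)) mod int p"
     using conjunct1[OF Ry] unfolding lin4_def pl e by simp
    have z: "w1 (RZ (coord y)) = (rv (RZ (coord y)) + e 2 * rv (?z (coord y))) mod int p" using True c by (simp add: w1_def)
    show ?thesis
    proof (cases "strip y:S")
     case S: True
     hence "strip y~=col" using col(2) by auto
     thus ?thesis using S True RN by (simp add: V_def f_def tt_def Vm_def lin4_def randx_def Let_def e)
    next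
     case S: False
     let ?a = "rv (RZ (coord y))" and ?g = "rv (?z (coord y))" and ?s = "pl (0,y)"
     have V1: "V y mod int p = ((?a + e 2 * ?g) * (?s + e 1 * (if strip y = col then 1 else 0)) + (if strip y = col then t else 0) * rv (RN y)) mod int p"
     proof -
      have v1: "V y = (?a + e 2 * ?g) mod int p * ka y + (if strip y = col then t else 0) * rv (RN y)"
      unfolding V_def z RN using S True by (simp add: f_def tt_def)
      have v2: "(?a + e 2 * ?g) mod int p * ka y mod int p = (?a + e 2 * ?g) * (?s + e 1 * (if strip y = col then 1 else 0)) mod int p"
      by (rule mod_mult_cong[OF _ k]) simp
      show ?thesis unfolding v1 by (rule mod_add_cong[OF v2 refl])
     qed
     have L1: "lin4 e (%m. Vm m y) = (?a + e 2 * ?g) * ?s + (if strip y = col then ?a * e 1 + e 3 * ?g else 0)"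
      using S True by (simp add: Vm_def lin4_def randx_def Let_def e algebra_simps)
     have M: "((?a + e 2 * ?g) * ?s + (?a * e 1 + e 3 * ?g)) mod int p = ((?a + e 2 * ?g) * ?s + (?a * e 1 + (e 1 * e 2 + t) * ?g)) mod int p"
      by (intro mod_add_cong mod_mult_cong refl e(2))
     show ?thesis
     proof (cases "strip y = col")
      case True
      have g: "?z (coord y) = RN y" using setc_strip[OF True] by simp
      have "(?a + e 2 * ?g) * (?s + e 1 * 1) + t * ?g = (?a + e 2 * ?g) * ?s + (?a * e 1 + (e 1 * e 2 + t) * ?g)"
      by (simp add: algebra_simps)
      thus ?thesis unfolding V1 L1 if_P[OF True] unfolding M unfolding g by simp
     next
      case False
      thus ?thesis unfolding V1 L1 by simp
     qed
    qed
   qed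
  qed
  have "ddh_rel p d n L col e (l + 1) Q (delegx p d n l v f tt ka w1)"
   unfolding ddh_rel_def
  proof
   fix x assume x: "x:KI d n (l + 1)"
   have "x:KA d n" using x l by (intro KI_KA[of _ _ _ "l + 1"]) auto
   hence Q: "Q (m,x) = cmb l v (%j k c. rv (RT j k c)) (%y. pl (m,y)) (Vm m) x mod int p" if "m < 4" for m
    using that x l len by (simp add: Q_def ddh_de_def pev_cmbx Vm_def[abs_def])
   have "lin4 e (%m. Q (m,x)) mod int p = lin4 e (%m. cmb l v (%j k c. rv (RT j k c)) (%y. pl (m,y)) (Vm m) x) mod int p"
    by (rule lin4_mod_cong) (simp add: Q)
   also have "... = cmb l v (%j k c. rv (RT j k c)) (%y. lin4 e (%m. pl (m,y))) (%y. lin4 e (%m. Vm m y)) x mod int p"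
    by (simp only: cmb_lin4)
   also have "... = cmb l v (%j k c. w1 (RT j k c)) ka V x mod int p"
   proof (rule cmb_cong[OF l(1) x])
    show "lin4 e (%m. pl (m,y)) mod int p = ka y mod int p" if "y:KI d n l" for y
     using R that by (simp add: ddh_rel_def)
    show "rv (RT j k c) = w1 (RT j k c)" for j k c using out p by (auto simp: w1_def)
   qed (rule V)
   also have "... = delegx p d n l v f tt ka w1 x mod int p"
    using x by (simp add: delegx_def onKI_def V_def[abs_def])
   finally show "lin4 e (%m. Q (m,x)) mod int p = delegx p d n l v f tt ka w1 x mod int p &
    (l + 1 = L --> Q (1,x) = (if strip x = col then 1 else 0) & Q (2,x) = 0 & Q (3,x) = 0)" using l by simp
  qed
  thus "ddh_rel p d n L col e (l + 1) (%i. if i:{..<4} \<times> KA d n then pev (ddh_de d n L S col (length u) i) ?en mod int p else 0)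
    (delegx p d n l v f tt ka (?h rv))" by (simp only: Q_def[abs_def] w1_def)
 qed
qed

lemma ddh_words:
 assumes b: "bilinear_group b" and R: "ddh_rel (bg_p b) d n L col e (length u) pl ka" and l: "length u<=d"
 shows "polyW b (%j. e (j - 1)) (ddh_re d n sec) u pl = key_words b d n sec u ka"
proof -
 interpret H: prime_group "bg_H b" "bg_p b" "bg_h b" by (rule bilinear_groups(2)[OF b])
 have "H.ex (\<Sum>(j,q)\<leftarrow>map (%m. (m + 1,wexpx sec (length u) m w)) [0..<4]. e (j - 1) * pev q (penv u [] (%_. 0) pl)) = H.ex (wexp sec u ka w)"
  if w: "w:set (items d n (length u))" for w
 proof -
  have u4: "[0..<4] = [0,1,2,3 :: nat]" by (simp add: upt_rec)
  have "(\<Sum>(j,q)\<leftarrow>map (%m. (m + 1,wexpx sec (length u) m w)) [0..<4]. e (j - 1) * pev q (penv u [] (%_. 0) pl)) =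
    wexp sec u (%x. lin4 e (%m. pl (m,x))) w"
   unfolding u4 wexp_lin4 by (simp add: pev_wexpx lin4_def)
  moreover have "wexp sec u (%x. lin4 e (%m. pl (m,x))) w mod int (bg_p b) = wexp sec u ka w mod int (bg_p b)"
   by (rule wexp_cong[OF _ set_items[OF w]]) (use R in "simp add: ddh_rel_def")
  ultimately show ?thesis by (simp only: H.ex_eq_iff)
 qed
 thus ?thesis using l by (simp add: polyW_def key_words_def ddh_re_def o_def)
qed

text \<open>Telescoping. Of the reductions of the single steps, one with the largest advantage
  serves for all.\<close>

lemma chain:
 fixes G :: "nat=>real" and adv :: "'b=>real"
 assumes "B0:Z" and w: "0<=w"
  and step: "!!i. i < m ==> EX B:Z. \<bar>G i - G (Suc i)\<bar><=w * adv B + e"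
 shows "EX B:Z. \<bar>G 0 - G m\<bar><=real m * (w * adv B + e)"
 using step
proof (induction m)
 case 0
 thus ?case using assms(1) by auto
next
 case (Suc m)
 then obtain B where B: "B:Z" "\<bar>G 0 - G m\<bar><=real m * (w * adv B + e)" by (meson less_Suc_eq)
 obtain B' where B': "B':Z" "\<bar>G m - G (Suc m)\<bar><=w * adv B' + e" using Suc.prems[of m] by auto
 define B2 where "B2 = (if adv B<=adv B' then B' else B)"
 have "w * adv B<=w * adv B2" "w * adv B'<=w * adv B2" using w by (auto simp: B2_def intro: mult_left_mono)
 hence "real m * (w * adv B + e)<=real m * (w * adv B2 + e)" "w * adv B' + e<=w * adv B2 + e"
  by (auto intro: mult_left_mono)
 hence "\<bar>G 0 - G (Suc m)\<bar><=real m * (w * adv B2 + e) + (w * adv B2 + e)" using B(2) B'(2) by linarith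
 thus ?case using B(1) B'(1) by (intro bexI[of _ B2]) (auto simp: B2_def algebra_simps)
qed

lemma unif_shift:
 assumes "0 < p"
 shows "map_pmf (%z. (int z + c) mod int p) (unif p) = map_pmf int (unif p)"
proof -
 let ?f = "%z. (z + c) mod int p"
 have inj: "inj_on ?f {0..<int p}"
 proof (rule inj_onI)
  fix x y assume "x:{0..<int p}" "y:{0..<int p}" "?f x = ?f y"
  hence "int p dvd (x + c) - (y + c)" by (simp only: mod_eq_dvd_iff)
  hence "int p dvd x - y" by simp
  hence "x mod int p = y mod int p" by (simp only: mod_eq_dvd_iff)
  moreover have "x mod int p = x" "y mod int p = y"
   using \<open>x : _\<close> \<open>y : _\<close> by (auto intro: mod_pos_pos_trivial)
  ultimately show "x = y" by (simp only:)
 qed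
 have "?f ` {0..<int p} = {0..<int p}" using assms by (intro endo_inj_surj inj) auto
 hence "map_pmf ?f (pmf_of_set {0..<int p}) = pmf_of_set {0..<int p}"
  using assms by (subst map_pmf_of_set_inj[OF inj]) auto
 thus ?thesis unfolding map_int_unif[OF assms, symmetric] by (simp add: pmf.map_comp o_def)
qed

lemma kgame_cong:
 assumes "!!u. valid_id (bg_p b) d u ==> K u = K' u" "!!u k v. valid_id (bg_p b) d u ==> valid_id (bg_p b) d (u @ [v]) ==> D u k v = D' u k v"
 shows "kgame b d tg c M a ws K D W = kgame b d tg c M a ws K' D' W"
proof -
 have "map_pmf fst (exec b (kenv (bg_p b) d tg K D W) c (store_words a ws M,Map.empty)) =
  map_pmf fst (exec b (kenv (bg_p b) d tg K' D' W) c (store_words a ws M,Map.empty))"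
  by (rule rel_kenv[where R = "%_. (=)"]) (use assms in "auto simp: pmf.rel_refl")
 hence "map_pmf out_bit (map_pmf fst (exec b (kenv (bg_p b) d tg K D W) c (store_words a ws M,Map.empty))) =
  map_pmf out_bit (map_pmf fst (exec b (kenv (bg_p b) d tg K' D' W) c (store_words a ws M,Map.empty)))" by (rule arg_cong)
 thus ?thesis by (simp add: kgame_def pmf.map_comp o_def)
qed

lemma kgame_rel:
 assumes "!!u. valid_id (bg_p b) d u ==> rel_pmf (R u) (K u) (K' u)"
  and "!!u v k k'. valid_id (bg_p b) d u ==> valid_id (bg_p b) d (u @ [v]) ==> R u k k' ==>
    rel_pmf (R (u @ [v])) (D u k v) (D' u k' v)"
  and "!!u k k'. num_reveals c~=0 ==> valid_id (bg_p b) d u ==> \<not> prefix u tg ==> R u k k' ==> W u k = W' u k'"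
 shows "kgame b d tg c M a ws K D W = kgame b d tg c M a ws K' D' W'"
proof -
 have "map_pmf out_bit (map_pmf fst (exec b (kenv (bg_p b) d tg K D W) c (store_words a ws M,Map.empty))) =
  map_pmf out_bit (map_pmf fst (exec b (kenv (bg_p b) d tg K' D' W') c (store_words a ws M,Map.empty)))"
  by (rule arg_cong[OF rel_kenv[where R = R, OF assms]])
 thus ?thesis by (simp add: kgame_def pmf.map_comp o_def)
qed

section \<open>Sizes of index sets and of the reductions\<close>

lemma card_KA: "card (KA d n)<=4 * (d + 1) ^ 2 * n" and card_strip: "L<=d ==> card (strip ` KI d n L)<=4 * (d + 1) ^ 2"
proof -
 have sub: "KI d n l<=(%(j,k,i,c). Coef j k i c) ` ({0..d} \<times> {0..2} \<times> {0..d} \<times> {1..n}) Un (%(j,c). Extra j c) ` ({0..d} \<times> {1..n})"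
  if "l<=d" for l
 proof
  fix x assume x: "x:KI d n l"
  show "x:(%(j,k,i,c). Coef j k i c) ` ({0..d} \<times> {0..2} \<times> {0..d} \<times> {1..n}) Un (%(j,c). Extra j c) ` ({0..d} \<times> {1..n})"
  proof (cases x)
   case (Coef j k i c)
   thus ?thesis using x that by (intro UnI1 image_eqI[of _ _ "(j,k,i,c)"]) (auto simp: rows_def)
  next
   case (Extra j c)
   thus ?thesis using x that by (intro UnI2 image_eqI[of _ _ "(j,c)"]) auto
  qed
 qed
 have "KA d n<=(%(j,k,i,c). Coef j k i c) ` ({0..d} \<times> {0..2} \<times> {0..d} \<times> {1..n}) Un (%(j,c). Extra j c) ` ({0..d} \<times> {1..n})"
  unfolding KA_def by (intro UN_least sub) simp
 hence "card (KA d n)<=card ((%(j,k,i,c). Coef j k i c) ` ({0..d} \<times> {0..2::nat} \<times> {0..d} \<times> {1..n}) Un (%(j,c). Extra j c) ` ({0..d} \<times> {1..n}))"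
  by (intro card_mono) auto
 also have "...<=card ({0..d} \<times> {0..2::nat} \<times> {0..d} \<times> {1..n}) + card ({0..d} \<times> {1..n})"
  by (intro order_trans[OF card_Un_le] add_mono card_image_le) auto
 also have "...<=4 * (d + 1) ^ 2 * n" by (simp add: card_cartesian_product power2_eq_square algebra_simps)
 finally show "card (KA d n)<=4 * (d + 1) ^ 2 * n" .
 show "card (strip ` KI d n L)<=4 * (d + 1) ^ 2" if L: "L<=d"
 proof -
  have "strip ` KI d n L<=(%(j,k,i). Coef j k i 0) ` ({0..d} \<times> {0..2} \<times> {0..d}) Un (%j. Extra j 0) ` {0..d}"
  proof
   fix y assume "y:strip ` KI d n L"
   then obtain x where x: "x:KI d n L" "y = strip x" by auto
   show "y:(%(j,k,i). Coef j k i 0) ` ({0..d} \<times> {0..2} \<times> {0..d}) Un (%j. Extra j 0) ` {0..d}"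
   proof (cases x)
    case (Coef j k i c)
    thus ?thesis using x L by (intro UnI1 image_eqI[of _ _ "(j,k,i)"]) (auto simp: rows_def)
   next
    case (Extra j c)
    thus ?thesis using x L by (intro UnI2 image_eqI[of _ _ j]) auto
   qed
  qed
  hence "card (strip ` KI d n L)<=card ((%(j,k,i). Coef j k i 0) ` ({0..d} \<times> {0..2::nat} \<times> {0..d}) Un (%j. Extra j 0) ` {0..d})"
   by (intro card_mono) auto
  also have "...<=card ({0..d} \<times> {0..2::nat} \<times> {0..d}) + card {0..d}"
   by (intro order_trans[OF card_Un_le] add_mono card_image_le) auto
  also have "...<=4 * (d + 1) ^ 2" by (simp add: card_cartesian_product power2_eq_square algebra_simps)
  finally show ?thesis .
 qed
qed

lemma card_RS: "card (RS d n)<=11 * (d + 1) ^ 2 * n"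
proof -
 have eq: "{RT j k c | j k c. j:{1..d} & k:{1..2} & c:{1..n}} =
   (%(j,k,c). RT j k c) ` ({1..d} \<times> {1..2} \<times> {1..n})" by (auto simp: image_iff)
 have "card (RS d n)<=card (RZ ` {1..n}) + card ((%(j,k,c). RT j k c) ` ({1..d} \<times> {1..2::nat} \<times> {1..n})) + card (RN ` KA d n) + card (RM ` KA d n)"
  unfolding RS_def eq by (intro order_trans[OF card_Un_le] add_mono order_refl)
 also have "...<=card {1..n} + card ({1..d} \<times> {1..2::nat} \<times> {1..n}) + card (KA d n) + card (KA d n)"
  by (intro add_mono card_image_le) auto
 also have "... = n + 2 * d * n + 2 * card (KA d n)" by (simp add: card_cartesian_product)
 also have "...<=n + 2 * d * n + 2 * (4 * (d + 1) ^ 2 * n)" by (intro add_mono mult_left_mono card_KA order_refl) simp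
 also have "...<=11 * (d + 1) ^ 2 * n" by (simp add: power2_eq_square algebra_simps)
 finally show ?thesis .
qed

lemma length_items: "l<=d ==> length (items d n l)<=9 * (d + 1) ^ 2 * n"
proof -
 assume l: "l<=d"
 have u: "[1..<2 + 1::nat] = [1,2]" by (simp add: upt_rec)
 have "length (items d n l) = 2 * n + l * n + (d - l) * (2 * n) + (d - l) * n + (d - l) * (2 * (l * n)) + (d - l) * (2 * n)"
  unfolding items_def Let_def u by (simp add: length_concat o_def sum_list_triv algebra_simps del: upt_Suc)
 also have "...<=2 * n + d * n + d * (2 * n) + d * n + d * (2 * (d * n)) + d * (2 * n)"
  using l by (intro add_mono mult_mono) auto
 also have "...<=9 * (d + 1) ^ 2 * n" by (simp add: power2_eq_square algebra_simps)
 finally show ?thesis .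
qed

lemma length_mitems: "length (mitems d n)<=9 * (d + 1) ^ 2 * (n + 1) ^ 2"
proof -
 have u: "[1..<2 + 1::nat] = [1,2]" "[0..<2 + 1::nat] = [0,1,2]" by (simp_all add: upt_rec)
 have "length (mitems d n) = 1 + n + d * (3 * n) + n + n * n + d * (2 * (n * n))"
  unfolding mitems_def Let_def u by (simp add: length_concat o_def sum_list_triv algebra_simps del: upt_Suc)
 also have "...<=9 * (d + 1) ^ 2 * (n + 1) ^ 2" by (simp add: power2_eq_square algebra_simps)
 finally show ?thesis .
qed

text \<open>Dominates both the sum of the numbers of payload entries, random values and revealed
  words, and the number of words of the master public key.\<close>

definition size_bound :: "nat=>nat=>nat" where
 "size_bound d n = 40 * (d + 1) ^ 2 * (n + 1) ^ 2"

text \<open>A challenge has at most 8 words, and \<open>300 * (d + 1)\<close> bounds the size of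
  each expression in either simulation.\<close>

definition red_bound :: "nat=>nat=>nat=>nat" where
 "red_bound d n Q = sim_bound d Q (size_bound d n) (300 * (d + 1)) + 8 + (8 + size_bound d n) * (300 * (d + 1) + 4)"

lemma size_bound_sum: "4 * card (KA d n) + card (RS d n) + 9 * (d + 1) ^ 2 * n<=size_bound d n"
proof -
 have "4 * card (KA d n) + card (RS d n) + 9 * (d + 1) ^ 2 * n<=4 * (4 * (d + 1) ^ 2 * n) + 11 * (d + 1) ^ 2 * n + 9 * (d + 1) ^ 2 * n"
  by (intro add_mono mult_left_mono card_KA card_RS) auto
 also have "... = 36 * (d + 1) ^ 2 * n" by simp
 also have "...<=40 * (d + 1) ^ 2 * (n + 1) ^ 2"
  by (intro mult_mono) (auto simp: power2_eq_square)
 finally show ?thesis by (simp add: size_bound_def)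
qed

lemma sim_bound_mono: "m<=m' ==> sim_bound d Q m K<=sim_bound d Q m' K"
 unfolding sim_bound_def by (intro mult_left_mono) auto

lemma simulate_bound:
 assumes "m<=size_bound d n" "lm<=size_bound d n" "lc<=8"
  and "cost B<=C + sim_bound d Q m (300 * (d + 1)) + z + lc + (lc + lm) * (300 * (d + 1) + 4)"
 shows "cost B<=C + z + red_bound d n Q"
proof -
 have "(lc + lm) * (300 * (d + 1) + 4)<=(8 + size_bound d n) * (300 * (d + 1) + 4)"
  using assms(2,3) by (intro mult_right_mono) auto
 thus ?thesis using assms(3,4) sim_bound_mono[OF assms(1), of d Q "300 * (d + 1)"] unfolding red_bound_def by linarith
qed

lemma finite_distinct_list_ex: "finite A ==> EX xs. set xs = A & distinct xs & length xs = card A"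
 using finite_distinct_list distinct_card by metis

lemma accept_prob_eq:
 "accept_prob b B D = pmf (bind_pmf D (%ws. map_pmf out_bit (run_alg b B (store_words 0 ws (%_. 0))))) True"
 by (simp add: accept_prob_def map_pmf_def)

text \<open>On a DDH tuple the reduction plays the current hybrid. On a random tuple it plays with a
  uniform perturbation \<open>t\<close>, which for nonzero \<open>t\<close> is the next hybrid;
  \<open>t = 0\<close> costs 1 / p.\<close>

lemma ddh_hop:
 fixes c :: "query com" and a :: reg and sec :: secret
 assumes b: "bilinear_group b" and d: "d + 2 < bg_p b" and tg: "valid_id (bg_p b) d tg" and L: "L < d"
  and col: "col:strip ` KI d n L" "col ~: S"
  and M0: "!!r. M0 r < 2 ^ bg_w b" "finite {r. M0 r~=0}"
  and wm: "!!x. x:set wm ==> x < 2 ^ bg_w b" "length wm<=size_bound d n"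
 defines "G \<equiv> %S. kgame b d tg c M0 a wm (freshK (bg_p b) d n) (hybD (bg_p b) d n L S (Extra 0 0) 0) (key_words b d n sec)"
 shows "EX B. cost B<=cost c + card {r. M0 r~=0} + red_bound d n (num_queries c) &
  \<bar>pmf (G S) True - pmf (G (insert col S)) True\<bar><=ddh2_adv b B + 1 / bg_p b"
proof -
 let ?p = "bg_p b"
 note bg = bilinear_groups[OF b]
 interpret H: prime_group "bg_H b" ?p "bg_h b" by (rule bg(2))
 have p0: "0 < ?p" using bg(4) by simp
 obtain Il where Il: "set Il = {..<4::nat} \<times> KA d n" "distinct Il" "length Il = card ({..<4::nat} \<times> KA d n)"
  using finite_distinct_list_ex[of "{..<4::nat} \<times> KA d n"] by auto
 obtain Rl where Rl: "set Rl = RS d n" "distinct Rl" "length Rl = card (RS d n)"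
  using finite_distinct_list_ex[of "RS d n"] by auto
 have colA: "setc cc col:KA d n" if "cc:{1..n}" for cc
 proof -
  obtain x where "x:KI d n L" "col = strip x" using col(1) by auto
  hence "setc cc col:KI d n L" using that by (cases x) auto
  thus ?thesis using L by (intro KI_KA[of _ d n L]) auto
 qed
 have randv: "set_px (randx L S col l m y)<=VOm ` RS d n Un VPl ` ({..<4} \<times> KA d n)" if y: "y:KI d n l" "l<=d" "m < 4" for l m y
 proof -
  have "coord y:{1..n}" using y by (cases y) auto
  thus ?thesis using y colA KI_KA[OF y(1,2)] by (auto simp: randx_def Let_def)
 qed
 have "EX B. cost B<=cost c + sim_bound d (num_queries c) (length Il + length Rl + 9 * (d + 1) ^ 2 * n) (300 * (d + 1)) +
   card {r. M0 r~=0} + 5 + (5 + length (map EC wm :: nat ex list)) * (300 * (d + 1) + 4) &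
  (ALL ws e. length ws = 5 --> (ALL j<5. ws ! j < 2 ^ bg_w b) -->
   (ALL l qs j q. qs:set (ddh_re d n sec l) --> (j,q):set qs --> ws ! j = H.ex (e j)) -->
   map_pmf out_bit (run_alg b B (store_words 0 ws (%_. 0))) =
   kgame b d tg c M0 a (map (%x. eval b x (%j. ws ! j)) (map EC wm)) (polyK ?p (set Il) (set Rl) (ddh_ce d n L col))
    (polyD ?p (set Il) (set Rl) (ddh_de d n L S col)) (polyW b e (ddh_re d n sec)))"
 proof (rule simulate[OF b d tg Il(2) Rl(2)])
  show "set_px (ddh_ce d n L col l i)<=idvars d Un VOm ` set Rl" for l i
   unfolding Rl ddh_ce_def freshx_def by (auto split: prod.splits intro!: imageI intro: KI_KA)
  show "set_px (ddh_de d n L S col l i)<=idvars d Un VOm ` set Rl Un VPl ` set Il Un VX ` {..<2}" for l i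
  proof (cases i)
   case (Pair m x)
   show ?thesis
   proof (cases "x:KI d n (l + 1) & l < d & m < 4")
    case True
    hence x: "x:KI d n (l + 1)" "l < d" "m < 4" by auto
    have xA: "x:KA d n" using x by (intro KI_KA[of _ d n "l + 1"]) auto
    have "set_px (cmbx l (%y. PV (VPl (m,y))) (randx L S col l m) x)<=idvars d Un VOm ` set Rl Un VPl ` set Il Un VX ` {..<2}"
    proof (rule set_px_cmbx[OF x(1,2)])
     show "set_px (PV (VPl (m,y)) :: fvar px)<=idvars d Un VOm ` set Rl Un VPl ` set Il Un VX ` {..<2}" if "y:KI d n l" for y
      using that x KI_KA[OF that] by (auto simp: Il)
     show "set_px (randx L S col l m y)<=idvars d Un VOm ` set Rl Un VPl ` set Il Un VX ` {..<2}" if "y:KI d n l" for y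
      using randv[OF that _ x(3)] x(2) by (auto simp: Il Rl)
    qed (auto simp: Rl)
    moreover have "set_px (freshx L col (l + 1) m x)<=VOm ` set Rl" using xA by (auto simp: freshx_def Rl)
    ultimately show ?thesis using True Pair by (auto simp: ddh_de_def)
   next
    case False
    thus ?thesis unfolding Pair ddh_de_def prod.case if_not_P[OF False] by simp
   qed
  qed
  show "j < 5 & set_px q<=idvars d Un VPl ` set Il" if h: "qs:set (ddh_re d n sec l)" "(j,q):set qs" for l qs j q
  proof -
   obtain w m where w: "l<=d" "w:set (items d n l)" "m < 4" "j = m + 1" "q = wexpx sec l m w"
    using h by (auto simp: ddh_re_def split: if_splits)
   show ?thesis using set_px_wexpx[OF w(2,1), of sec m] w(3-5) by (auto simp: Il)
  qed
  show "length (ddh_re d n sec l)<=9 * (d + 1) ^ 2 * n" for l using length_items[of l d n] by (simp add: ddh_re_def)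
  show "psize (ddh_ce d n L col l i)<=300 * (d + 1)" for l i by (simp add: ddh_ce_def freshx_def split: prod.splits)
  show "psize (ddh_de d n L S col l i)<=300 * (d + 1)" for l i
  proof (cases i)
   case (Pair m x)
   have "psize (cmbx l (%y. PV (VPl (m,y))) (randx L S col l m) x)<=50"
    by (rule psize_cmbx) (auto simp: randx_def Let_def)
   thus ?thesis by (simp add: ddh_de_def freshx_def Pair)
  qed
  show "esize (wordx b GrpH VCh qs :: fvar ex)<=300 * (d + 1)" if h: "qs:set (ddh_re d n sec l)" for l qs
  proof -
   obtain w where w: "l<=d" "qs = map (%m. (m + 1,wexpx sec l m w)) [0..<4]"
    using h by (auto simp: ddh_re_def split: if_splits)
   have "esize (wordx b GrpH VCh qs :: fvar ex)<=length qs * (23 * d + 20 + 4) + 1"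
    by (rule esize_wordx) (auto simp: w(2) intro!: psize_wexpx[OF w(1)])
   thus ?thesis using w(2) by simp
  qed
 qed (use M0 in auto)
 then obtain B where cB: "cost B<=cost c + sim_bound d (num_queries c) (length Il + length Rl + 9 * (d + 1) ^ 2 * n) (300 * (d + 1)) +
   card {r. M0 r~=0} + 5 + (5 + length (map EC wm :: nat ex list)) * (300 * (d + 1) + 4)"
  and B: "!!ws e. length ws = 5 ==> (ALL j<5. ws ! j < 2 ^ bg_w b) ==>
   (ALL l qs j q. qs:set (ddh_re d n sec l) --> (j,q):set qs --> ws ! j = H.ex (e j)) ==>
   map_pmf out_bit (run_alg b B (store_words 0 ws (%_. 0))) =
   kgame b d tg c M0 a (map (%x. eval b x (%j. ws ! j)) (map EC wm)) (polyK ?p (set Il) (set Rl) (ddh_ce d n L col))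
    (polyD ?p (set Il) (set Rl) (ddh_de d n L S col)) (polyW b e (ddh_re d n sec))"
  by blast
 have cost: "cost B<=cost c + card {r. M0 r~=0} + red_bound d n (num_queries c)"
  by (rule simulate_bound[OF _ wm(2) _ cB[unfolded length_map]]) (use size_bound_sum[of d n] in "simp_all add: Il Rl card_cartesian_product")
 \<comment> \<open>The game played on a challenge whose last exponent is x y + t.\<close>
 define Gt where "Gt t = kgame b d tg c M0 a wm (freshK ?p d n) (hybD ?p d n L S col t) (key_words b d n sec)" for t
 have sim: "map_pmf out_bit (run_alg b B (store_words 0 [bg_g b,bg_h b,H.ex (int x),H.ex (int y),H.ex (int z)] (%_. 0))) = Gt t"
  if z: "int z mod int ?p = (int x * int y + t) mod int ?p" for x y z t
 proof -
  define e :: "nat=>int" where "e = (%m. if m = 0 then 1 else if m = 1 then int x else if m = 2 then int y else int z)"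
  let ?ws = "[bg_g b,bg_h b,H.ex (int x),H.ex (int y),H.ex (int z)]"
  have carG: "bg_g b < 2 ^ bg_w b" and carH: "w < 2 ^ bg_w b" if "w:carrier (bg_H b)" for w
   using b that by (auto simp: bilinear_group_def word_group_def)
  have "ALL j<5. ?ws ! j < 2 ^ bg_w b"
   using carG[OF H.g] carH[OF H.g] carH[OF H.ex_closed] by (auto simp: less_Suc_eq numeral_eq_Suc)
  \<comment> \<open>Word 0 of the challenge is the generator of the first group; the exponents
    \<open>e 0\<close> to \<open>e 3\<close> belong to the words 1 to 4, whence the offset.\<close>
  moreover have "ALL l qs j q. qs:set (ddh_re d n sec l) --> (j,q):set qs --> ?ws ! j = H.ex (e (j - 1))"
  proof (intro allI impI)
   fix l qs j q assume "qs:set (ddh_re d n sec l)" "(j,q):set qs"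
   then obtain m where m: "m < 4" "j = m + 1" by (auto simp: ddh_re_def split: if_splits)
   hence "m = 0 \<or> m = 1 \<or> m = 2 \<or> m = 3" by linarith
   moreover have "bg_h b = H.ex 1" using H.g H.group by (simp add: group.int_pow_1)
   ultimately show "?ws ! j = H.ex (e (j - 1))" using m(2) by (elim disjE) (simp_all add: e_def)
  qed
  ultimately have "map_pmf out_bit (run_alg b B (store_words 0 ?ws (%_. 0))) =
   kgame b d tg c M0 a (map (%x. eval b x (%j. ?ws ! j)) (map EC wm)) (polyK ?p (set Il) (set Rl) (ddh_ce d n L col))
    (polyD ?p (set Il) (set Rl) (ddh_de d n L S col)) (polyW b (%j. e (j - 1)) (ddh_re d n sec))"
   by (intro B) simp_all
  also have "map (%x. eval b x (%j. ?ws ! j)) (map EC wm) = wm" using wm(1) by (auto intro!: map_idI)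
  also have "kgame b d tg c M0 a wm (polyK ?p (set Il) (set Rl) (ddh_ce d n L col))
    (polyD ?p (set Il) (set Rl) (ddh_de d n L S col)) (polyW b (%j. e (j - 1)) (ddh_re d n sec)) = Gt t"
   unfolding Gt_def
  proof (rule kgame_rel[where R = "%u. ddh_rel ?p d n L col e (length u)"])
   fix u assume u: "valid_id ?p d u"
   show "rel_pmf (ddh_rel ?p d n L col e (length u)) (polyK ?p (set Il) (set Rl) (ddh_ce d n L col) u) (freshK ?p d n u)"
    unfolding polyK_def freshK_def Il Rl
    by (rule ddh_fresh_rel[OF bg(4)]) (use u in "auto simp: valid_id_def e_def ddh_ce_def")
  next
   fix u v pl ka assume u: "valid_id ?p d u" "valid_id ?p d (u @ [v])" and R: "ddh_rel ?p d n L col e (length u) pl ka"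
   have l: "length u < d" using u(2) by (simp add: valid_id_def)
   show "rel_pmf (ddh_rel ?p d n L col e (length (u @ [v]))) (polyD ?p (set Il) (set Rl) (ddh_de d n L S col) u pl v) (hybD ?p d n L S col t u ka v)"
   proof (cases "length u < L")
    case True
    show ?thesis
     unfolding polyD_def hybD_simp(1)[OF True] Il Rl length_append_singleton Suc_eq_plus1
     by (rule ddh_fresh_rel[OF bg(4)]) (use l True in "auto simp: e_def ddh_de_def")
   next
    case False
    hence "L<=length u" by simp
    moreover have "e 0 = 1" "e 3 mod int ?p = (e 1 * e 2 + t) mod int ?p" using z by (simp_all add: e_def)
    ultimately show ?thesis
     unfolding Il Rl length_append_singleton Suc_eq_plus1 by (intro ddh_deleg_rel[OF bg(4) l _ _ _ col R refl])
   qed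
  next
   fix u pl ka assume "valid_id ?p d u" "ddh_rel ?p d n L col e (length u) pl ka"
   thus "polyW b (%j. e (j - 1)) (ddh_re d n sec) u pl = key_words b d n sec u ka"
    by (intro ddh_words[OF b]) (auto simp: valid_id_def)
  qed
  finally show ?thesis .
 qed
 have real: "accept_prob b B (ddh2_dist b True) = pmf (G S) True"
 proof -
  have "bind_pmf (ddh2_dist b True) (%ws. map_pmf out_bit (run_alg b B (store_words 0 ws (%_. 0)))) =
   bind_pmf (unif ?p) (%x. bind_pmf (unif ?p) (%y. bind_pmf (unif ?p) (%z. Gt 0)))"
   unfolding ddh2_dist_def Let_def bind_assoc_pmf bind_return_pmf H.g_pow if_True
   by (intro bind_pmf_cong refl sim) simp
  moreover have "hybD ?p d n L S col 0 = hybD ?p d n L S (Extra 0 0) 0" by (intro ext hybD_t0)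
  ultimately show ?thesis unfolding accept_prob_eq by (simp add: Gt_def G_def)
 qed
 have rand: "accept_prob b B (ddh2_dist b False) = pmf (bind_pmf (unif ?p) (%t. Gt (int t))) True"
 proof -
  have "bind_pmf (ddh2_dist b False) (%ws. map_pmf out_bit (run_alg b B (store_words 0 ws (%_. 0)))) =
   bind_pmf (unif ?p) (%x. bind_pmf (unif ?p) (%y. bind_pmf (unif ?p) (%z. Gt ((int z + - (int x * int y)) mod int ?p))))"
   unfolding ddh2_dist_def Let_def bind_assoc_pmf bind_return_pmf H.g_pow if_False
   by (intro bind_pmf_cong refl sim) (simp add: mod_add_right_eq)
  also have "... = bind_pmf (unif ?p) (%x. bind_pmf (unif ?p) (%y. bind_pmf (map_pmf (%z. (int z + - (int x * int y)) mod int ?p) (unif ?p)) Gt))"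
   by (simp add: bind_map_pmf)
  also have "... = bind_pmf (unif ?p) (%t. Gt (int t))" unfolding unif_shift[OF p0] by (simp add: bind_map_pmf)
  finally show ?thesis unfolding accept_prob_eq by simp
 qed
 have "bind_pmf (unif_nz ?p) (%t. Gt (int t)) = bind_pmf (unif_nz ?p) (%_. G (insert col S))"
 proof (rule bind_pmf_cong[OF refl])
  fix t assume "t:set_pmf (unif_nz ?p)"
  moreover have "set_pmf (unif_nz ?p) = {1..<?p}" unfolding unif_nz_def by (rule set_pmf_of_set) (use bg(4) in simp_all)
  ultimately have t: "1<=t" "t < ?p" by auto
  have "\<not> ?p dvd t" using t by (auto dest: dvd_imp_le)
  hence cop: "coprime (int t) (int ?p)" using prime_imp_coprime[OF H.prime_p] by (simp add: coprime_commute)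
  show "Gt (int t) = G (insert col S)"
   unfolding Gt_def G_def by (rule kgame_cong[OF refl hybD_unit[OF p0 cop col(2)]]) (simp add: valid_id_def)
 qed
 hence "stat_dist_le (1 / ?p) (G (insert col S)) (bind_pmf (unif ?p) (%t. Gt (int t)))"
  using stat_dist_le_bind1[OF stat_dist_le_unif_nz[OF bg(4)], of "%t. Gt (int t)"] by simp
 from stat_dist_leD[OF this] show ?thesis
  using cost by (intro exI[of _ B] conjI) (auto simp: ddh2_adv_def real rand)
qed

section \<open>The sequence of DDH hops\<close>

definition freshD :: "nat=>nat=>nat=>ident=>(kx=>int)=>nat list=>(kx=>int) pmf" where
 "freshD p d n u ka v = map_pmf (fresh d n (length u + 1)) (UI p (RS d n))"

text \<open>The two ends of the sequence: no identity is shorter than 1, and no identity of length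
  \<open>d\<close> can be delegated.\<close>

lemma kgame_fresh:
 assumes "0 < bg_p b"
 shows "kgame b d tg c M a ws (genK (unif (bg_p b)) d n) (genD (unif (bg_p b)) (bg_p b) d n) W =
   kgame b d tg c M a ws (freshK (bg_p b) d n) (hybD (bg_p b) d n 1 {} (Extra 0 0) 0) W"
  and "kgame b d tg c M a ws (freshK (bg_p b) d n) (freshD (bg_p b) d n) W =
   kgame b d tg c M a ws (freshK (bg_p b) d n) (hybD (bg_p b) d n d {} (Extra 0 0) 0) W"
proof -
 show "kgame b d tg c M a ws (genK (unif (bg_p b)) d n) (genD (unif (bg_p b)) (bg_p b) d n) W =
   kgame b d tg c M a ws (freshK (bg_p b) d n) (hybD (bg_p b) d n 1 {} (Extra 0 0) 0) W"
 proof (rule kgame_cong)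
  show "genK (unif (bg_p b)) d n u = freshK (bg_p b) d n u" for u
   unfolding genK_def freshK_def UI_eq_map[OF finite_RS] pmf.map_comp o_def ..
  show "genD (unif (bg_p b)) (bg_p b) d n u k v = hybD (bg_p b) d n 1 {} (Extra 0 0) 0 u k v"
   if "valid_id (bg_p b) d u" for u k v
   by (rule genD_eq_hybD) (use that assms in "simp_all add: valid_id_def")
 qed
 show "kgame b d tg c M a ws (freshK (bg_p b) d n) (freshD (bg_p b) d n) W =
   kgame b d tg c M a ws (freshK (bg_p b) d n) (hybD (bg_p b) d n d {} (Extra 0 0) 0) W"
  by (rule kgame_cong) (simp_all add: freshD_def hybD_simp valid_id_def)
qed

lemma kgame_no_reveals:
 assumes "num_reveals c = 0"
 shows "kgame b d tg c M a ws K D W = kgame b d tg c M a ws K' D' W'"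
 by (rule kgame_rel[where R = "%_ _ _. True"]) (use assms in "auto intro: rel_pmf_all")

lemma ddh2_adv_nonneg: "0<=ddh2_adv b B" by (simp add: ddh2_adv_def)

text \<open>For each of the levels 1 to \<open>d - 1\<close>, all columns are replaced one by one,
  and then the level counts as fresh by \<open>hybD_all\<close>, whose error arises once per
  query.\<close>

lemma ddh_part:
 fixes c :: "query com" and a :: reg and sec :: secret
 assumes b: "bilinear_group b" and d: "d + 2 < bg_p b" "1<=d" and tg: "valid_id (bg_p b) d tg"
  and M0: "!!r. M0 r < 2 ^ bg_w b" "finite {r. M0 r~=0}"
  and wm: "!!x. x:set wm ==> x < 2 ^ bg_w b" "length wm<=size_bound d n"
 shows "EX B. cost B<=cost c + card {r. M0 r~=0} + red_bound d n (num_queries c) &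
  \<bar>pmf (kgame b d tg c M0 a wm (genK (unif (bg_p b)) d n) (genD (unif (bg_p b)) (bg_p b) d n) (key_words b d n sec)) True -
   pmf (kgame b d tg c M0 a wm (freshK (bg_p b) d n) (freshD (bg_p b) d n) (key_words b d n sec)) True\<bar>
  <=d * (4 * (d + 1) ^ 2 * ddh2_adv b B + (4 * (d + 1) ^ 2 + 2 * n * num_queries c) / bg_p b)"
proof -
 let ?p = "bg_p b" and ?Q = "num_queries c" and ?N = "4 * (real d + 1) ^ 2"
 note bg = bilinear_groups[OF b]
 have pr: "prime ?p" and p0: "0 < ?p" using b bg(4) by (auto simp: bilinear_group_def)
 define G where "G L S = pmf (kgame b d tg c M0 a wm (freshK ?p d n) (hybD ?p d n L S (Extra 0 0) 0) (key_words b d n sec)) True" for L S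
 define Z where "Z = {B :: algorithm. cost B<=cost c + card {r. M0 r~=0} + red_bound d n ?Q}"
 have Z0: "Skip:Z" by (simp add: Z_def)
 have level: "EX B:Z. \<bar>G (Suc i) {} - G (Suc (Suc i)) {}\<bar><=?N * ddh2_adv b B + (?N + 2 * n * ?Q) / ?p" if i: "i < d - 1" for i
 proof -
  define L where "L = Suc i"
  have L: "L < d" using i by (simp add: L_def)
  obtain xs where xs: "set xs = strip ` KI d n L" "distinct xs" "length xs = card (strip ` KI d n L)"
   using finite_distinct_list_ex[of "strip ` KI d n L"] by auto
  have "EX B:Z. \<bar>G L (set (take 0 xs)) - G L (set (take (length xs) xs))\<bar><=real (length xs) * (1 * ddh2_adv b B + 1 / ?p)"
  proof (rule chain[OF Z0])
   fix j assume j: "j < length xs"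
   hence "xs ! j:strip ` KI d n L" using xs(1) nth_mem by metis
   moreover have "xs ! j ~: set (take j xs)" using xs(2) j by (auto simp: in_set_conv_nth nth_eq_iff_index_eq)
   ultimately obtain B where "B:Z" "\<bar>G L (set (take j xs)) - G L (insert (xs ! j) (set (take j xs)))\<bar><=ddh2_adv b B + 1 / ?p"
    using ddh_hop[OF b d(1) tg L _ _ M0 wm, of "xs ! j" "set (take j xs)" c a sec] unfolding G_def Z_def by blast
   moreover have "set (take (Suc j) xs) = insert (xs ! j) (set (take j xs))" using j by (simp add: take_Suc_conv_app_nth)
   ultimately show "EX B:Z. \<bar>G L (set (take j xs)) - G L (set (take (Suc j) xs))\<bar><=1 * ddh2_adv b B + 1 / ?p" by auto
  qed simp
  then obtain B where B: "B:Z" "\<bar>G L {} - G L (set xs)\<bar><=real (length xs) * (ddh2_adv b B + 1 / ?p)" by auto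
  have "real (length xs)<=real (4 * (d + 1) ^ 2)" unfolding xs(3) using card_strip[of L d n] L by (intro of_nat_mono) simp
  hence "real (length xs)<=?N" by (simp add: add.commute)
  hence "real (length xs) * (ddh2_adv b B + 1 / ?p)<=?N * (ddh2_adv b B + 1 / ?p)"
   using ddh2_adv_nonneg by (intro mult_right_mono) auto
  hence 1: "\<bar>G L {} - G L (set xs)\<bar><=?N * ddh2_adv b B + ?N / ?p" using B(2) by (simp add: algebra_simps)
  have "stat_dist_le (?Q * (2 * n / ?p))
    (exec b (kenv ?p d tg (freshK ?p d n) (hybD ?p d n L (set xs) (Extra 0 0) 0) (key_words b d n sec)) c (store_words a wm M0,Map.empty))
    (exec b (kenv ?p d tg (freshK ?p d n) (hybD ?p d n (L + 1) {} (Extra 0 0) 0) (key_words b d n sec)) c (store_words a wm M0,Map.empty))"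
  proof (rule stat_dist_le_kenv_valid)
   fix u v ka assume v: "valid_id ?p d (u @ [v])"
   show "stat_dist_le (2 * n / ?p) (hybD ?p d n L (set xs) (Extra 0 0) 0 u ka v) (hybD ?p d n (L + 1) {} (Extra 0 0) 0 u ka v)"
   proof (cases "length u = L")
    case True
    have "v ! 0 = 1" using v by (auto simp: valid_id_def)
    have "stat_dist_le (2 * real n / real ?p) (hybD ?p d n (length u) (set xs) (Extra 0 0) 0 u ka v) (hybD ?p d n (length u + 1) {} (Extra 0 0) 0 u ka v)"
    proof (rule hybD_all[OF pr])
     show "length u < d" using True L by simp
     show "v ! 0 = 1" by fact
     show "strip x:set xs" if "x:KI d n (length u)" for x using that xs(1) True by auto
    qed
    thus ?thesis using True by simp
   next
    case False
    thus ?thesis unfolding hybD_next[OF False, of ?p d n "set xs" "Extra 0 0" ka v "Extra 0 0"] by (intro stat_dist_le_refl) simp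
   qed
  qed (auto intro: stat_dist_le_refl)
  from stat_dist_leD[OF stat_dist_le_map[OF this, of "%x. out_bit (fst x)"]]
  have 2: "\<bar>G L (set xs) - G (L + 1) {}\<bar><=?Q * (2 * n / ?p)" by (simp add: G_def kgame_def)
  have "\<bar>G L {} - G (L + 1) {}\<bar><=?N * ddh2_adv b B + ?N / ?p + ?Q * (2 * n / ?p)" using 1 2 by linarith
  also have "... = ?N * ddh2_adv b B + (?N + 2 * n * ?Q) / ?p" by (simp add: add_divide_distrib)
  finally show ?thesis using B(1) by (intro bexI[of _ B]) (simp_all add: L_def)
 qed
 obtain B where B: "B:Z" "\<bar>G (Suc 0) {} - G (Suc (d - 1)) {}\<bar><=real (d - 1) * (?N * ddh2_adv b B + (?N + 2 * n * ?Q) / ?p)"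
  using chain[where G = "%i. G (Suc i) {}" and adv = "ddh2_adv b" and w = ?N and e = "(?N + 2 * n * ?Q) / ?p" and m = "d - 1", OF Z0 _ level] by auto
 have "0<=?N * ddh2_adv b B + (?N + 2 * n * ?Q) / ?p" using ddh2_adv_nonneg[of b B] by (intro add_nonneg_nonneg) auto
 hence "real (d - 1) * (?N * ddh2_adv b B + (?N + 2 * n * ?Q) / ?p)<=d * (?N * ddh2_adv b B + (?N + 2 * n * ?Q) / ?p)"
  by (intro mult_right_mono) auto
 hence "\<bar>G 1 {} - G d {}\<bar><=d * (?N * ddh2_adv b B + (?N + 2 * n * ?Q) / ?p)" using B(2) d(2) by simp
 thus ?thesis
  using B(1) unfolding kgame_fresh[OF p0] by (intro exI[of _ B] conjI) (simp_all add: Z_def G_def add.commute)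
qed

section \<open>Simulation from BDH tuples\<close>

text \<open>\<open>ak i k\<close> is the coefficient of a b in the exponent of h[i,k] at the
  attacked coordinate. These random masks will hide y.\<close>

definition Ax :: "(nat=>nat=>int)=>ident=>nat=>int" where
 "Ax ak u i = ak i 1 * int (u ! (i - 1) ! 0) + ak i 2 * int (u ! (i - 1) ! 1)"

text \<open>
 With \<open>g\<^sup>a\<close>, \<open>g\<^sup>b\<close> from the challenge, \<open>w = g\<^sup>a\<^sup>b\<close> and \<open>h\<^sub>i\<^sub>k\<close> with exponent \<open>b Y + a b al\<close> up to known factors, the
 exponents \<open>r\<^sub>i + a t\<^sub>i\<close> of a key can be compensated in the exponent of \<open>w\<close> such that all multiples of
 \<open>a b\<close> cancel.
\<close>

definition comp0 :: "(nat=>nat=>int)=>(nat=>nat=>nat=>int)=>nat=>ident=>nat=>nat=>(kx=>int)=>(kx=>int)=>int" where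
 "comp0 ak Y l0 u j k f0 f1 = - (\<Sum>i = 1..length u. Ax ak u i * f0 (Coef j k i l0)) - (\<Sum>i = 1..length u. Bx Y u l0 i * f1 (Coef j k i l0))
   - (if j = 0 then 0 else ak j k * f0 (Extra j l0))"

text \<open>The coefficient of the challenge exponent a in the exponent of w; \<open>comp0\<close>
  is its constant part.\<close>

definition comp1 :: "(nat=>nat=>int)=>nat=>ident=>nat=>nat=>(kx=>int)=>int" where
 "comp1 ak l0 u j k f1 = - (\<Sum>i = 1..length u. Ax ak u i * f1 (Coef j k i l0))"

definition bdh_rel :: "nat=>nat=>nat=>(nat=>nat=>int)=>(nat=>nat=>nat=>int)=>nat=>int=>ident=>(nat \<times> kx=>int)=>(kx=>int)=>bool" where
 "bdh_rel p d n ak Y l0 x u pl ka <->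
   (ALL z:KI d n (length u). ka z mod int p = (pl (0,z) + x * pl (1,z)) mod int p & (coord z~=l0 --> pl (1,z) = 0)) &
   (ALL j:{length u + 1..d}. pl (1,Extra j l0) = 0) &
   (ALL (j,k):rows d (length u). pl (0,Coef j k 0 l0) mod int p = comp0 ak Y l0 u j k (%z. pl (0,z)) (%z. pl (1,z)) mod int p &
    pl (1,Coef j k 0 l0) mod int p = comp1 ak l0 u j k (%z. pl (1,z)) mod int p)"

definition simf0 :: "(nat=>nat=>int)=>(nat=>nat=>nat=>int)=>nat=>ident=>(rx=>int)=>kx=>int" where
 "simf0 ak Y l0 u rv z = (case z of Coef j k i c=>if c = l0 & i = 0 then comp0 ak Y l0 u j k (%z. rv (RN z)) (%z. rv (RM z)) else rv (RN z)
   | Extra j c=>rv (RN z))"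

definition simf1 :: "(nat=>nat=>int)=>nat=>ident=>(rx=>int)=>kx=>int" where
 "simf1 ak l0 u rv z = (case z of Coef j k i c=>if c = l0 then (if i = 0 then comp1 ak l0 u j k (%z. rv (RM z)) else rv (RM z)) else 0
   | Extra j c=>0)"

text \<open>Although the exponent of w is prescribed, it is uniform: a level \<open>i0\<close> with
  nonzero inner product contributes its \<open>RM\<close> entry to \<open>comp0\<close> with a unit
  as factor, and this entry is otherwise masked by \<open>RN\<close>.\<close>

lemma bdh_key_uniform:
 assumes pr: "prime p" and l: "length u<=d" and l0: "l0:{1..n}" and B: "i0:{1..length u}" "Bx Y u l0 i0 mod int p~=0"
 shows "map_pmf (%rv z. if z:KI d n (length u) then (simf0 ak Y l0 u rv z + x * simf1 ak l0 u rv z) mod int p else 0) (UI p (RS d n)) = UI p (KI d n (length u))"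
proof -
 have p: "0 < p" using pr prime_gt_0_nat by auto
 define l where "l = length u"
 define src where "src z = (case z of Coef j k i c=>if c = l0 & i = 0 then RM (Coef j k i0 l0) else RN z | Extra j c=>RN z)" for z
 let ?pull = "%rv z. if z:KI d n l then rv (src z) else 0"
 have KA: "Coef j k i c:KA d n" if "(j,k):rows d l" "i<=l" "c:{1..n}" for j k i c
  using that l by (intro KI_KA[of _ d n l]) (auto simp: l_def)
 have i0: "i0<=l" using B by (simp add: l_def)
 have pull: "map_pmf ?pull (UI p (RS d n)) = UI p (KI d n l)"
 proof (rule UI_pull[OF finite_RS])
  show "inj_on src (KI d n l)"
  proof (rule inj_onI)
   fix z z' assume "src z = src z'"
   thus "z = z'" by (cases z; cases z') (auto simp: src_def split: if_splits)
  qed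
  show "src ` KI d n l<=RS d n"
  proof
   fix r assume "r:src ` KI d n l"
   then obtain z where z: "z:KI d n l" "r = src z" by auto
   have "z:KA d n" using z(1) l by (intro KI_KA[of _ d n l]) (auto simp: l_def)
   thus "r:RS d n" using z KA i0 l0 by (cases z) (auto simp: src_def)
  qed
 qed
 \<comment> \<open>On \<open>C\<close>, \<open>RN + x * RM\<close> becomes the new
   \<open>RN\<close>. In these variables the exponent of w is free of \<open>x\<close>, and on
   \<open>T\<close> it takes the place of the \<open>RM\<close> entries at level
   \<open>i0\<close>.\<close>
 define C where "C = {RN (Coef j k i l0) | j k i. (j,k):rows d l & i:{1..l}}"
 define T where "T = {RM (Coef j k i0 l0) | j k. (j,k):rows d l}"
 have sub: "C<=RS d n" "T<=RS d n" using KA l0 i0 by (auto simp: C_def T_def)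
 let ?dd1 = "%rv r. case r of RN z=>x * rv (RM z) | _=>0"
 let ?h1 = "%rv r. if r:RS d n - C then rv r else if r:RS d n then (1 * rv r + ?dd1 rv r) mod int p else 0"
 let ?g = "%rv j k. - (\<Sum>i = 1..l. Ax ak u i * rv (RN (Coef j k i l0))) - (\<Sum>i\<in>{1..l} - {i0}. Bx Y u l0 i * rv (RM (Coef j k i l0)))
   - (if j = 0 then 0 else ak j k * rv (RN (Extra j l0)))"
 let ?dd2 = "%rv r. case r of RM (Coef j k i c)=>?g rv j k | _=>0"
 let ?h2 = "%rv r. if r:RS d n - T then rv r else if r:RS d n then ((- Bx Y u l0 i0) * rv r + ?dd2 rv r) mod int p else 0"
 have h1: "map_pmf ?h1 (UI p (RS d n)) = UI p (RS d n)"
 proof (rule UI_triangular[OF finite_RS p])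
  fix rv rv' :: "rx=>int" and r assume eq: "!!j. j:RS d n - C ==> rv j = rv' j" and "r:RS d n - (RS d n - C)"
  then obtain j k i where r: "r = RN (Coef j k i l0)" "(j,k):rows d l" "i:{1..l}" by (auto simp: C_def)
  have "RM (Coef j k i l0):RS d n - C" using KA r l0 by (auto simp: C_def)
  thus "?dd1 rv r = ?dd1 rv' r" using eq r(1) by simp
 qed auto
 have h2: "map_pmf ?h2 (UI p (RS d n)) = UI p (RS d n)"
 proof (rule UI_triangular[OF finite_RS p])
  have "\<not> int p dvd Bx Y u l0 i0" using B(2) by (auto simp: dvd_eq_mod_eq_0)
  hence "coprime (int p) (Bx Y u l0 i0)" using pr by (intro prime_imp_coprime) simp_all
  thus "coprime (- Bx Y u l0 i0) (int p)" by (simp add: coprime_commute)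
 next
  fix rv rv' :: "rx=>int" and r assume eq: "!!j. j:RS d n - T ==> rv j = rv' j" and "r:RS d n - (RS d n - T)"
  then obtain j k where r: "r = RM (Coef j k i0 l0)" "(j,k):rows d l" by (auto simp: T_def)
  have 1: "rv (RN (Coef j k i l0)) = rv' (RN (Coef j k i l0))" if "i:{1..l}" for i
   by (rule eq) (use KA r l0 that in "auto simp: T_def")
  have 2: "rv (RM (Coef j k i l0)) = rv' (RM (Coef j k i l0))" if "i:{1..l} - {i0}" for i
   by (rule eq) (use KA r l0 that in "auto simp: T_def")
  have 3: "rv (RN (Extra j l0)) = rv' (RN (Extra j l0))" if "j~=0"
  proof (rule eq)
   have "Extra j l0:KI d n l" using that r l0 by (auto simp: rows_def)
   thus "RN (Extra j l0):RS d n - T" using l by (auto simp: T_def l_def intro: KI_KA)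
  qed
  have "?g rv j k = ?g rv' j k" using 3
   by (intro arg_cong2[where f = minus] arg_cong[where f = uminus] sum.cong refl arg_cong2[where f = times] 1 2) auto
  thus "?dd2 rv r = ?dd2 rv' r" using r by simp
 qed auto
 have "(%z. if z:KI d n l then (simf0 ak Y l0 u rv z + x * simf1 ak l0 u rv z) mod int p else 0) = ?pull (?h2 (?h1 rv))"
  if rv: "rv:set_pmf (UI p (RS d n))" for rv
 proof
  fix z
  note rng = set_UI_range[OF finite_RS p rv]
  define w1 where "w1 = ?h1 rv"
  show "(if z:KI d n l then (simf0 ak Y l0 u rv z + x * simf1 ak l0 u rv z) mod int p else 0) = ?pull (?h2 (?h1 rv)) z"
  proof (cases "z:KI d n l")
   case zK: True
   hence zR: "RN z:RS d n" using l by (auto simp: l_def intro: KI_KA)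
   have "(simf0 ak Y l0 u rv z + x * simf1 ak l0 u rv z) mod int p = ?h2 w1 (src z)"
   proof (cases "EX j k. z = Coef j k 0 l0")
    case True
    then obtain j k where z: "z = Coef j k 0 l0" by auto
    have jk: "(j,k):rows d l" using zK z by simp
    have m: "RM (Coef j k i0 l0):T" using jk by (auto simp: T_def)
    note m = m subsetD[OF sub(2) m]
    have r1: "w1 (RN (Coef j k i l0)) = (rv (RN (Coef j k i l0)) + x * rv (RM (Coef j k i l0))) mod int p" if "i:{1..l}" for i
    proof -
     have "RN (Coef j k i l0):C" using that jk by (auto simp: C_def)
     hence "RN (Coef j k i l0):C" "RN (Coef j k i l0):RS d n" using sub(1) by auto
     thus ?thesis by (simp add: w1_def)
    qed
    have r2: "w1 (RM (Coef j k i l0)) = rv (RM (Coef j k i l0))" if "i:{1..l}" for i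
    proof -
     have "RM (Coef j k i l0):RS d n - C" using that jk KA l0 by (auto simp: C_def)
     thus ?thesis by (simp add: w1_def)
    qed
    have r3: "w1 (RN (Extra j l0)) = rv (RN (Extra j l0))" if "j~=0"
    proof -
     have "Extra j l0:KI d n l" using that jk l0 by (auto simp: rows_def)
     hence "RN (Extra j l0):RS d n - C" using l by (auto simp: C_def l_def intro: KI_KA)
     thus ?thesis by (simp add: w1_def)
    qed
    define X where "X = (\<Sum>i = 1..l. Ax ak u i * rv (RN (Coef j k i l0)))"
    define X' where "X' = (\<Sum>i = 1..l. Ax ak u i * rv (RM (Coef j k i l0)))"
    define Bs where "Bs = (\<Sum>i = 1..l. Bx Y u l0 i * rv (RM (Coef j k i l0)))"
    define E where "E = (if j = 0 then 0 else ak j k * rv (RN (Extra j l0)))"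
    have b1: "(\<Sum>i = 1..l. Ax ak u i * w1 (RN (Coef j k i l0))) mod int p = (X + x * X') mod int p"
    proof -
     have "(\<Sum>i = 1..l. Ax ak u i * w1 (RN (Coef j k i l0)) mod int p) = (\<Sum>i = 1..l. (Ax ak u i * (rv (RN (Coef j k i l0)) + x * rv (RM (Coef j k i l0)))) mod int p)"
      by (intro sum.cong refl) (simp add: r1 mod_mult_right_eq)
     hence "(\<Sum>i = 1..l. Ax ak u i * w1 (RN (Coef j k i l0))) mod int p = (\<Sum>i = 1..l. Ax ak u i * (rv (RN (Coef j k i l0)) + x * rv (RM (Coef j k i l0)))) mod int p"
      by (subst (1 2) mod_sum_eq[symmetric]) simp
     also have "(\<Sum>i = 1..l. Ax ak u i * (rv (RN (Coef j k i l0)) + x * rv (RM (Coef j k i l0)))) = X + x * X'"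
      by (simp add: X_def X'_def sum.distrib sum_distrib_left algebra_simps)
     finally show ?thesis .
    qed
    have b2: "Bx Y u l0 i0 * rv (RM (Coef j k i0 l0)) + (\<Sum>i\<in>{1..l} - {i0}. Bx Y u l0 i * w1 (RM (Coef j k i l0))) = Bs"
    proof -
     have "(\<Sum>i\<in>{1..l} - {i0}. Bx Y u l0 i * w1 (RM (Coef j k i l0))) = (\<Sum>i\<in>{1..l} - {i0}. Bx Y u l0 i * rv (RM (Coef j k i l0)))"
      by (intro sum.cong refl) (simp add: r2)
     thus ?thesis unfolding Bs_def using B(1) by (subst sum.remove[of "{1..l}" i0]) (auto simp: l_def)
    qed
    have "?h2 w1 (src z) = ((- Bx Y u l0 i0) * w1 (RM (Coef j k i0 l0)) + ?g w1 j k) mod int p" using m z by (simp add: src_def)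
    also have "(- Bx Y u l0 i0) * w1 (RM (Coef j k i0 l0)) + ?g w1 j k = - (\<Sum>i = 1..l. Ax ak u i * w1 (RN (Coef j k i l0))) - Bs - E"
     unfolding b2[symmetric] using r2[of i0] r3 B(1) by (cases "j = 0") (simp_all add: E_def l_def)
    also have "... mod int p = (- (X + x * X') - Bs - E) mod int p"
     by (intro mod_diff_cong mod_minus_cong b1 refl)
    also have "- (X + x * X') - Bs - E = simf0 ak Y l0 u rv z + x * simf1 ak l0 u rv z"
     by (simp add: simf0_def simf1_def z comp0_def comp1_def X_def X'_def Bs_def E_def l_def algebra_simps)
    finally show ?thesis by simp
   next
    case False
    hence s: "src z = RN z" by (cases z) (auto simp: src_def)
    have "RN z:RS d n - T" using zR by (auto simp: T_def)
    hence h: "?h2 w1 (src z) = w1 (RN z)" unfolding s by (rule if_P)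
    show ?thesis
    proof (cases z)
     case (Coef j k i c)
     show ?thesis
     proof (cases "c = l0")
      case True
      hence i: "i:{1..l}" using zK Coef False by (cases "i = 0") auto
      hence "RN z:C" using Coef True zK by (auto simp: C_def)
      thus ?thesis unfolding h using zR i True Coef by (simp add: simf0_def simf1_def w1_def)
     next
      case c: False
      hence "RN z ~: C" using Coef by (auto simp: C_def)
      thus ?thesis unfolding h using zR c Coef rng[of "RN z"] by (simp add: simf0_def simf1_def w1_def)
     qed
    next
     case (Extra j c)
     hence "RN z ~: C" by (auto simp: C_def)
     thus ?thesis unfolding h using zR Extra rng[of "RN z"] by (simp add: simf0_def simf1_def w1_def)
    qed
   qed
   thus ?thesis unfolding w1_def if_P[OF zK] .
  qed simp
 qed
 hence "map_pmf (%rv z. if z:KI d n l then (simf0 ak Y l0 u rv z + x * simf1 ak l0 u rv z) mod int p else 0) (UI p (RS d n)) =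
   map_pmf (%rv. ?pull (?h2 (?h1 rv))) (UI p (RS d n))"
  by (intro map_pmf_cong refl)
 also have "... = map_pmf ?pull (map_pmf ?h2 (map_pmf ?h1 (UI p (RS d n))))" by (simp only: pmf.map_comp o_def)
 finally show ?thesis unfolding h1 h2 pull l_def[symmetric] .
qed

definition linx :: "int=>int=>(nat=>fvar px)=>fvar px" where
 "linx a a' w = PA (PM (PC a) (w 0)) (PM (PC a') (w 1))"

text \<open>\<open>idp i k\<close> is a polynomial for component \<open>k\<close> of level
  \<open>i\<close>. It is abstract because in a delegation the last level is the delegated component
  and not part of the stored identity.\<close>

definition comp0x :: "(nat=>nat=>int)=>(nat=>nat=>nat=>int)=>nat=>nat=>(nat=>nat=>fvar px)=>nat=>nat=>fvar px" where
 "comp0x ak Y l0 l idp j k = PM (PC (-1)) (PA (psum (map (%i.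
   PA (PM (linx (ak i 1) (ak i 2) (idp i)) (PV (VOm (RN (Coef j k i l0)))))
    (PM (linx (Y l0 i 1) (Y l0 i 2) (idp i)) (PV (VOm (RM (Coef j k i l0)))))) [1..<l + 1]))
   (if j = 0 then PC 0 else PM (PC (ak j k)) (PV (VOm (RN (Extra j l0))))))"

definition comp1x :: "(nat=>nat=>int)=>nat=>nat=>(nat=>nat=>fvar px)=>nat=>nat=>fvar px" where
 "comp1x ak l0 l idp j k = PM (PC (-1)) (psum (map (%i.
   PM (linx (ak i 1) (ak i 2) (idp i)) (PV (VOm (RM (Coef j k i l0))))) [1..<l + 1]))"

fun simfx :: "(nat=>nat=>int)=>(nat=>nat=>nat=>int)=>nat=>nat=>(nat=>nat=>fvar px)=>nat=>kx=>fvar px" where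
 "simfx ak Y l0 l idp m (Coef j k i c) = (if c = l0 & i = 0 then (if m = 0 then comp0x ak Y l0 l idp j k else comp1x ak l0 l idp j k)
   else if m = 0 then PV (VOm (RN (Coef j k i c))) else if c = l0 then PV (VOm (RM (Coef j k i c))) else PC 0)"
| "simfx ak Y l0 l idp m (Extra j c) = (if m = 0 then PV (VOm (RN (Extra j c))) else PC 0)"

definition bdh_px :: "nat=>nat=>(nat=>nat=>int)=>(nat=>nat=>nat=>int)=>nat=>nat=>(nat=>nat=>fvar px)=>nat \<times> kx=>fvar px" where
 "bdh_px d n ak Y l0 l idp mz = (case mz of (m,z)=>if z:KI d n l & l<=d then simfx ak Y l0 l idp m z else PC 0)"

lemma pev_simfx:
 assumes idp: "!!i k. i:{1..length u} ==> k < 2 ==> pev (idp i k) et = int (u ! (i - 1) ! k)" and rv: "!!r. et (VOm r) = rv r"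
 shows "pev (simfx ak Y l0 (length u) idp m z) et = (if m = 0 then simf0 ak Y l0 u rv z else simf1 ak l0 u rv z)"
proof -
 have lin: "pev (linx a a' (idp i)) et = a * int (u ! (i - 1) ! 0) + a' * int (u ! (i - 1) ! 1)" if "i:{1..length u}" for a a' i
  using idp[OF that, of 0] idp[OF that, of 1] by (simp add: linx_def)
 have sum: "pev (psum (map F [1..<length u + 1])) et = (\<Sum>i = 1..length u. pev (F i) et)" for F :: "nat=>fvar px"
  unfolding pev_psum list.map_comp o_def map_map
  by (subst interv_sum_list_conv_sum_set_nat) (auto intro!: sum.cong)
 have 0: "pev (comp0x ak Y l0 (length u) idp j k) et = comp0 ak Y l0 u j k (%z. rv (RN z)) (%z. rv (RM z))" for j k
 proof -
  have "(\<Sum>i = 1..length u. pev (PA (PM (linx (ak i 1) (ak i 2) (idp i)) (PV (VOm (RN (Coef j k i l0)))))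
    (PM (linx (Y l0 i 1) (Y l0 i 2) (idp i)) (PV (VOm (RM (Coef j k i l0)))))) et) =
   (\<Sum>i = 1..length u. Ax ak u i * rv (RN (Coef j k i l0)) + Bx Y u l0 i * rv (RM (Coef j k i l0)))"
   by (intro sum.cong refl) (simp only: pev.simps lin rv Ax_def Bx_def)
  thus ?thesis unfolding comp0x_def comp0_def pev.simps sum by (simp add: sum.distrib rv)
 qed
 have 1: "pev (comp1x ak l0 (length u) idp j k) et = comp1 ak l0 u j k (%z. rv (RM z))" for j k
 proof -
  have "(\<Sum>i = 1..length u. pev (PM (linx (ak i 1) (ak i 2) (idp i)) (PV (VOm (RM (Coef j k i l0))))) et) =
   (\<Sum>i = 1..length u. Ax ak u i * rv (RM (Coef j k i l0)))"
   by (intro sum.cong refl) (simp only: pev.simps lin rv Ax_def)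
  thus ?thesis unfolding comp1x_def comp1_def pev.simps sum by simp
 qed
 show ?thesis by (cases z) (simp_all add: 0 1 simf0_def simf1_def rv)
qed

lemma set_px_simfx:
 assumes z: "z:KI d n l" "l<=d" and l0: "l0:{1..n}"
  and idp: "!!i k. i:{1..l} ==> k < 2 ==> set_px (idp i k)<=A" and A: "VOm ` RS d n<=A"
 shows "set_px (simfx ak Y l0 l idp m z)<=A"
proof -
 have lin: "set_px (linx a a' (idp i))<=A" if "i:{1..l}" for a a' i
  using idp[OF that, of 0] idp[OF that, of 1] by (simp add: linx_def)
 have zA: "VOm (RN z):A" "VOm (RM z):A" using KI_KA[OF z] A by auto
 show ?thesis
 proof (cases z)
  case (Coef j k i c)
  have jk: "(j,k):rows d l" using z Coef by simp
  have K: "VOm (RN (Coef j k i' l0)):A" "VOm (RM (Coef j k i' l0)):A" if "i':{1..l}" for i'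
  proof -
   have "Coef j k i' l0:KI d n l" using jk that l0 by simp
   from KI_KA[OF this z(2)] show "VOm (RN (Coef j k i' l0)):A" "VOm (RM (Coef j k i' l0)):A" using A by auto
  qed
  have E: "VOm (RN (Extra j l0)):A" if "j~=0"
  proof -
   have "Extra j l0:KI d n l" using jk that l0 by (auto simp: rows_def)
   from KI_KA[OF this z(2)] show ?thesis using A by auto
  qed
  have set: "set [1..<l + 1] = {1..l}" by auto
  have "set_px (comp0x ak Y l0 l idp j k)<=A" "set_px (comp1x ak l0 l idp j k)<=A"
   unfolding comp0x_def comp1x_def px.set set_px_psum set_map set using lin K E by (auto simp: subset_iff)
  thus ?thesis using Coef zA by auto
 qed (use zA in auto)
qed

lemma psize_simfx:
 assumes l: "l<=d" and idp: "!!i k. psize (idp i k)<=2"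
 shows "psize (simfx ak Y l0 l idp m z)<=300 * (d + 1)"
proof -
 have lin: "psize (linx a a' (idp i))<=15" for a a' i
  using idp[of i 0] idp[of i 1] by (simp add: linx_def)
 have len: "length [1..<l + 1] = l" by simp
 have "psize (comp0x ak Y l0 l idp j k)<=300 * (d + 1)" for j k
 proof -
  define T where "T = psum (map (%i. PA (PM (linx (ak i 1) (ak i 2) (idp i)) (PV (VOm (RN (Coef j k i l0)))))
    (PM (linx (Y l0 i 1) (Y l0 i 2) (idp i)) (PV (VOm (RM (Coef j k i l0)))))) [1..<l + 1])"
  have "psize T<=l * (43 + 3) + 1"
   unfolding T_def
  proof (rule order_trans[OF psize_psum[where K = 43]])
   show "psize z<=43" if z: "z:set (map (%i. PA (PM (linx (ak i 1) (ak i 2) (idp i)) (PV (VOm (RN (Coef j k i l0)))))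
    (PM (linx (Y l0 i 1) (Y l0 i 2) (idp i)) (PV (VOm (RM (Coef j k i l0)))))) [1..<l + 1])" for z
   proof -
    obtain i where i: "z = PA (PM (linx (ak i 1) (ak i 2) (idp i)) (PV (VOm (RN (Coef j k i l0)))))
      (PM (linx (Y l0 i 1) (Y l0 i 2) (idp i)) (PV (VOm (RM (Coef j k i l0)))))" using z by auto
    show ?thesis using lin[of "ak i 1" "ak i 2" i] lin[of "Y l0 i 1" "Y l0 i 2" i] unfolding i by simp
   qed
  qed (simp del: upt_Suc)
  thus ?thesis using l unfolding comp0x_def T_def[symmetric] by simp
 qed
 moreover have "psize (comp1x ak l0 l idp j k)<=300 * (d + 1)" for j k
 proof -
  define T where "T = psum (map (%i. PM (linx (ak i 1) (ak i 2) (idp i)) (PV (VOm (RM (Coef j k i l0)) :: fvar))) [1..<l + 1])"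
  have "psize T<=l * (20 + 3) + 1"
   unfolding T_def by (rule order_trans[OF psize_psum[where K = 20]]) (use lin in "auto simp del: upt_Suc")
  thus ?thesis using l unfolding comp1x_def T_def[symmetric] by simp
 qed
 ultimately show ?thesis by (cases z) auto
qed

lemma bdh_fresh_rel:
 assumes pr: "prime p" and l: "length u<=d" and l0: "l0:{1..n}" and B: "EX i:{1..length u}. Bx Y u l0 i mod int p~=0"
  and F: "!!rv m z. z:KI d n (length u) ==> m < 2 ==> pev (F (m,z)) (E rv) = (if m = 0 then simf0 ak Y l0 u rv z else simf1 ak l0 u rv z)"
 shows "rel_pmf (bdh_rel p d n ak Y l0 x u)
  (map_pmf (%rv i. if i:{..<2} \<times> KA d n then pev (F i) (E rv) mod int p else 0) (UI p (RS d n)))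
  (map_pmf (fresh d n (length u)) (UI p (RS d n)))"
proof -
 obtain i0 where i0: "i0:{1..length u}" "Bx Y u l0 i0 mod int p~=0" using B by auto
 have p: "0 < p" using pr prime_gt_0_nat by auto
 show ?thesis
  unfolding fresh_UI[OF l] bdh_key_uniform[OF pr l l0 i0, symmetric, of ak x]
 proof (rule rel_pmf_map_same)
  fix rv assume rv: "rv:set_pmf (UI p (RS d n))"
  note rng = set_UI_range[OF finite_RS p rv]
  define Q where "Q i = (if i:{..<2} \<times> KA d n then pev (F i) (E rv) mod int p else 0)" for i
  define ka where "ka z = (if z:KI d n (length u) then (simf0 ak Y l0 u rv z + x * simf1 ak l0 u rv z) mod int p else 0)" for z
  have Q: "Q (0,z) = simf0 ak Y l0 u rv z mod int p" "Q (1,z) = simf1 ak l0 u rv z mod int p" if "z:KI d n (length u)" for z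
   using F[OF that, of 0 rv] F[OF that, of 1 rv] KI_KA[OF that l] by (simp_all add: Q_def)
  have "bdh_rel p d n ak Y l0 x u Q ka"
   unfolding bdh_rel_def
  proof (intro conjI ballI impI)
   fix z assume z: "z:KI d n (length u)"
   show "ka z mod int p = (Q (0,z) + x * Q (1,z)) mod int p"
    unfolding ka_def Q[OF z] if_P[OF z] by (intro mod_add_cong[THEN trans[OF mod_mod_trivial]] mod_mult_cong) simp_all
   assume "coord z~=l0"
   thus "Q (1,z) = 0" unfolding Q[OF z] by (cases z) (simp_all add: simf1_def)
  next
   fix j assume "j:{length u + 1..d}"
   hence "Extra j l0:KI d n (length u)" using l0 by simp
   from Q(2)[OF this] show "Q (1,Extra j l0) = 0" by (simp add: simf1_def)
  next
   fix jk assume jk: "jk:rows d (length u)"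
   obtain j k where e: "jk = (j,k)" by (cases jk)
   have K: "Coef j k i l0:KI d n (length u)" if "i<=length u" for i using jk e that l0 by simp
   have q: "Q (0,Coef j k i l0) = rv (RN (Coef j k i l0))" "Q (1,Coef j k i l0) = rv (RM (Coef j k i l0))" if "i:{1..length u}" for i
   proof -
    have i: "i<=length u" "i~=0" using that by auto
    show "Q (0,Coef j k i l0) = rv (RN (Coef j k i l0))" "Q (1,Coef j k i l0) = rv (RM (Coef j k i l0))"
     unfolding Q[OF K[OF i(1)]] using i(2) rng by (simp_all add: simf0_def simf1_def)
   qed
   have q': "Q (0,Extra j l0) = rv (RN (Extra j l0))" if "j~=0"
   proof -
    have "Extra j l0:KI d n (length u)" using jk e that l0 by (auto simp: rows_def)
    thus ?thesis using rng by (simp add: Q simf0_def)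
   qed
   have s: "(\<Sum>i = 1..length u. Ax ak u i * Q (0,Coef j k i l0)) = (\<Sum>i = 1..length u. Ax ak u i * rv (RN (Coef j k i l0)))"
    "(\<Sum>i = 1..length u. Ax ak u i * Q (1,Coef j k i l0)) = (\<Sum>i = 1..length u. Ax ak u i * rv (RM (Coef j k i l0)))"
    "(\<Sum>i = 1..length u. Bx Y u l0 i * Q (1,Coef j k i l0)) = (\<Sum>i = 1..length u. Bx Y u l0 i * rv (RM (Coef j k i l0)))"
    by (intro sum.cong refl, simp only: q)+
   have c0: "comp0 ak Y l0 u j k (%z. Q (0,z)) (%z. Q (1,z)) = comp0 ak Y l0 u j k (%z. rv (RN z)) (%z. rv (RM z))"
    unfolding comp0_def s using q' by simp
   have c1: "comp1 ak l0 u j k (%z. Q (1,z)) = comp1 ak l0 u j k (%z. rv (RM z))"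
    unfolding comp1_def s ..
   show "case jk of (j,k)=>Q (0,Coef j k 0 l0) mod int p = comp0 ak Y l0 u j k (%z. Q (0,z)) (%z. Q (1,z)) mod int p &
    Q (1,Coef j k 0 l0) mod int p = comp1 ak l0 u j k (%z. Q (1,z)) mod int p"
    unfolding e prod.case c0 c1 Q[OF K[OF le0]] by (simp add: simf0_def simf1_def)
  qed
  thus "bdh_rel p d n ak Y l0 x u (%i. if i:{..<2} \<times> KA d n then pev (F i) (E rv) mod int p else 0)
   (%z. if z:KI d n (length u) then (simf0 ak Y l0 u rv z + x * simf1 ak l0 u rv z) mod int p else 0)"
   by (simp only: Q_def[abs_def] ka_def[abs_def])
 qed
qed

definition bdh_re :: "nat=>nat=>secret=>secret=>nat=>(nat \<times> fvar px) list list" where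
 "bdh_re d n sec secY l = (if l<=d then map (%w. [(4,wexpx sec l 0 w),(5,wexpx sec l 1 w),(6,wexpx secY l 0 w)]) (items d n l) else [])"

text \<open>The coefficients of \<open>y\<close> in the master exponents that occur in keys, apart
  from those of x y.\<close>

definition secY :: "(nat=>nat=>nat=>int)=>nat=>secret" where
 "secY Y l0 = (0,%_. 0,%(i,k,c). if c = l0 then Y l0 i k else 0)"

text \<open>The embedding of the challenge at coordinate \<open>l0\<close>. The exponent
  \<open>- y\<close> of h[i,0] cancels the part \<open>y * Y\<close> of h[i,k] in the diagonal entry
  of \<open>C\<close>; otherwise the product y c would be needed, for which there is no challenge
  word. What remains unknown there is the mask times x y c.\<close>

definition shift :: "(nat=>nat=>int)=>(nat=>nat=>nat=>int)=>nat=>int=>int=>int=>sx=>int" where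
 "shift ak Y l0 x y cc s = (case s of SV=>0 | SW l=>if l = l0 then x * y else 0
   | SH i k l=>if l = l0 then (if k = 0 then - y else y * Y l0 i k + x * y * ak i k) else 0
   | SS l=>if l = l0 then cc else 0)"

text \<open>By the choice of the exponent of w, the coefficients of x y and x^2 y vanish modulo p.
  The rest is linear in 1, x and y, that is, computable from the challenge words 4, 5 and 6 of the
  second group.\<close>

lemma bdh_words:
 assumes b: "bilinear_group b" and R: "bdh_rel (bg_p b) d n ak Y l0 x u pl ka" and l: "length u<=d"
  and e: "e 4 = 1" "e 5 = x" "e 6 = y"
 shows "polyW b e (bdh_re d n (sec_of th) (secY Y l0)) u pl = key_words b d n (sec_of (%s. th s + shift ak Y l0 x y cc s)) u ka"
proof -
 interpret H: prime_group "bg_H b" "bg_p b" "bg_h b" by (rule bilinear_groups(2)[OF b])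
 let ?P = "int (bg_p b)"
 define f0 f1 where "f0 z = pl (0,z)" and "f1 z = pl (1,z)" for z
 define sec where "sec = sec_of (%s. th s + shift ak Y l0 x y cc s)"
 have rel: "!!z. z:KI d n (length u) ==> ka z mod ?P = (f0 z + x * f1 z) mod ?P"
  "!!j. j:{length u + 1..d} ==> f1 (Extra j l0) = 0"
  "!!j k. (j,k):rows d (length u) ==> f0 (Coef j k 0 l0) mod ?P = comp0 ak Y l0 u j k f0 f1 mod ?P"
  "!!j k. (j,k):rows d (length u) ==> f1 (Coef j k 0 l0) mod ?P = comp1 ak l0 u j k f1 mod ?P"
  using R unfolding bdh_rel_def f0_def[abs_def] f1_def[abs_def] by blast+
 have "(wexp (sec_of th) u f0 w + x * wexp (sec_of th) u f1 w + y * wexp (secY Y l0) u f0 w) mod ?P = wexp sec u ka w mod ?P"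
  if w: "w:set (items d n (length u))" for w
 proof -
  have "wexp sec u ka w mod ?P = wexp sec u (%z. f0 z + x * f1 z) w mod ?P"
   by (rule wexp_cong[OF _ set_items[OF w]]) (rule rel(1))
  also have "... = (wexp (sec_of th) u f0 w + x * wexp (sec_of th) u f1 w + y * wexp (secY Y l0) u f0 w) mod ?P"
  proof -
   consider z where "w = WL z" | j k c where "w = WRow j k c" "(j,k):rows d (length u)" using set_items[OF w] by auto
   thus ?thesis
   proof cases
    case 1
    thus ?thesis by (simp add: sec_def sec_of_def secY_def shift_def algebra_simps)
   next
    case 2
    note w = 2(1)
    show ?thesis
    proof (cases "c = l0")
     case False
     have "hid (%(i,k,l). th (SH i k l) + shift ak Y l0 x y cc (SH i k l)) u i c = hid (%(i,k,l). th (SH i k l)) u i c" for i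
      using False by (simp add: shift_def)
     moreover have "hid (%(i,k,c). if c = l0 then Y l0 i k else 0) u i c = 0" for i using False by simp
     ultimately show ?thesis unfolding w sec_def sec_of_def secY_def wexp.simps
      using False by (simp add: shift_def sum.distrib sum_distrib_left algebra_simps del: hid.simps)
    next
     case True
     define S where "S F = (\<Sum>i = 1..length u. F i)" for F :: "nat=>int"
     define c0 c1 E where "c0 = f0 (Coef j k 0 l0)" "c1 = f1 (Coef j k 0 l0)" "E = (if j = 0 then 0 else f0 (Extra j l0))"
     define h where "h i = hid (%(i,k,l). th (SH i k l)) u i l0" for i
     define F0 F1 where "F0 i = f0 (Coef j k i l0)" and "F1 i = f1 (Coef j k i l0)" for i
     have hs: "hid (%(i,k,l). th (SH i k l) + shift ak Y l0 x y cc (SH i k l)) u i l0 = h i + y * Bx Y u l0 i + x * y * Ax ak u i" for i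
      by (simp add: shift_def h_def Bx_def Ax_def algebra_simps)
     have hY: "hid (%(i,k,c). if c = l0 then Y l0 i k else 0) u i l0 = Bx Y u l0 i" for i by (simp add: Bx_def)
     have k: "k~=0" "f1 (Extra j l0) = 0" if "j~=0" using 2(2) that rel(2)[of j] by (auto simp: rows_def)
     have 3: "wexp sec u (%z. f0 z + x * f1 z) w =
      S (%i. (h i + y * Bx Y u l0 i + x * y * Ax ak u i) * (F0 i + x * F1 i)) + (th (SW l0) + x * y) * (c0 + x * c1) +
      (th (SH j k l0) + y * Y l0 j k + x * y * ak j k) * E"
      unfolding w sec_def sec_of_def True wexp.simps hs S_def F0_def F1_def c0_c1_E_def
      using k by (cases "j = 0") (simp_all add: shift_def algebra_simps)
     have 4: "wexp (sec_of th) u f0 w = S (%i. h i * F0 i) + th (SW l0) * c0 + th (SH j k l0) * E"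
      "wexp (sec_of th) u f1 w = S (%i. h i * F1 i) + th (SW l0) * c1"
      "wexp (secY Y l0) u f0 w = S (%i. Bx Y u l0 i * F0 i) + Y l0 j k * E"
      unfolding w sec_of_def secY_def True wexp.simps hY h_def[symmetric] S_def F0_def F1_def c0_c1_E_def using k
      by simp_all
     \<comment> \<open>Sorted by monomials, the two sides differ only in the terms with x y and x^2
       y.\<close>
     have "wexp sec u (%z. f0 z + x * f1 z) w - (wexp (sec_of th) u f0 w + x * wexp (sec_of th) u f1 w + y * wexp (secY Y l0) u f0 w) =
      x * y * (c0 - comp0 ak Y l0 u j k f0 f1) + x * x * y * (c1 - comp1 ak l0 u j k f1)"
      unfolding 3 4 comp0_def comp1_def F0_def[symmetric] F1_def[symmetric] c0_c1_E_def(3)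
      by (simp add: S_def sum.distrib sum_distrib_left algebra_simps)
     moreover have "?P dvd c0 - comp0 ak Y l0 u j k f0 f1" "?P dvd c1 - comp1 ak l0 u j k f1"
      using rel(3,4)[OF 2(2)] by (simp_all only: c0_c1_E_def mod_eq_dvd_iff)
     ultimately have "?P dvd wexp sec u (%z. f0 z + x * f1 z) w -
      (wexp (sec_of th) u f0 w + x * wexp (sec_of th) u f1 w + y * wexp (secY Y l0) u f0 w)"
      by (simp only: dvd_add dvd_mult)
     thus ?thesis by (simp only: mod_eq_dvd_iff)
    qed
   qed
  qed
  finally show ?thesis by simp
 qed
 hence "H.ex (\<Sum>(j,q)\<leftarrow>[(4,wexpx (sec_of th) (length u) 0 w),(5,wexpx (sec_of th) (length u) 1 w),(6,wexpx (secY Y l0) (length u) 0 w)].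
   e j * pev q (penv u [] (%_. 0) pl)) = H.ex (wexp sec u ka w)" if "w:set (items d n (length u))" for w
  using that unfolding H.ex_eq_iff by (simp add: pev_wexpx e f0_def[abs_def] f1_def[abs_def] add.assoc)
 thus ?thesis using l by (simp add: polyW_def key_words_def bdh_re_def o_def sec_def)
qed

text \<open>The offset of the exponents in the master public key when \<open>g\<^sup>a\<^sup>b\<^sup>c\<close> is replaced by \<open>g\<^sup>a\<^sup>b\<^sup>c\<^sup>+\<^sup>t\<close>.\<close>

fun offs :: "nat=>(nat=>nat=>int)=>int=>mi=>int" where
 "offs l0 \<beta> t (MCw l2 l1) = (if l2 = l0 & l1 = l0 then t else 0)"
| "offs l0 \<beta> t (MC i k l2 l1) = (if l2 = l0 & l1 = l0 then \<beta> i k else 0)"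
| "offs l0 \<beta> t _ = 0"

section \<open>The master public key computed from the challenge\<close>

definition scale :: "int=>(nat \<times> int) list=>(nat \<times> int) list" where
 "scale s = map (%(j,c). (j,s * c))"

definition mhx :: "(nat=>nat=>int)=>(nat=>nat=>nat=>int)=>nat=>(sx=>int)=>nat=>nat=>nat=>(nat \<times> int) list" where
 "mhx ak Y l0 th i k l = [(0,th (SH i k l)),(1,if l = l0 then (if k = 0 then -1 else Y l0 i k) else 0),(2,if l = l0 & k~=0 then ak i k else 0)]"

definition mwx :: "nat=>(sx=>int)=>nat=>(nat \<times> int) list" where
 "mwx l0 th l = [(0,th (SW l)),(2,if l = l0 then 1 else 0)]"

text \<open>
 The entries of the simulated master public key as products of powers of the words of the challenge, where the
 words \<open>0, 1, 2, 3, 7\<close> are \<open>g, g\<^sup>b, g\<^sup>a\<^sup>b, g\<^sup>c\<close> and \<open>g\<^sup>a\<^sup>b\<^sup>c\<close> or \<open>g\<^sup>z\<close>.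
\<close>

fun bdh_mx :: "(nat=>nat=>int)=>(nat=>nat=>nat=>int)=>nat=>(sx=>int)=>mi=>(nat \<times> int) list" where
 "bdh_mx ak Y l0 th MV = [(0,th SV)]"
| "bdh_mx ak Y l0 th (MW l) = mwx l0 th l"
| "bdh_mx ak Y l0 th (MH i k l) = mhx ak Y l0 th i k l"
| "bdh_mx ak Y l0 th (MJ l) = [(0,th SV * th (SS l)),(3,if l = l0 then th SV else 0)]"
| "bdh_mx ak Y l0 th (MCw l2 l1) = scale (th (SS l2)) (mwx l0 th l1) @
   (if l2 = l0 then [(3,th (SW l1)),(7,if l1 = l0 then 1 else 0)] else [])"
| "bdh_mx ak Y l0 th (MC i k l2 l1) = scale (th (SS l2)) (mhx ak Y l0 th i k l1) @
   (if l2 = l1 then scale (th (SS l2) * Y l1 i k) (mhx ak Y l0 th i 0 l1) else []) @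
   (if l2 = l0 then [(3,th (SH i k l1) + (if l1 = l0 then th (SH i 0 l0) * Y l0 i k else 0)),(7,if l1 = l0 then ak i k else 0)] else [])"

definition evx :: "(nat=>int)=>(nat \<times> int) list=>int" where
 "evx e xs = (\<Sum>(j,c)\<leftarrow>xs. e j * c)"

lemma evx_simps [simp]: "evx e [] = 0" "evx e (jc # xs) = e (fst jc) * snd jc + evx e xs" "evx e (xs @ ys) = evx e xs + evx e ys"
 by (auto simp: evx_def split: prod.split)

lemma evx_scale [simp]: "evx e (scale s xs) = s * evx e xs"
 by (induction xs) (auto simp: scale_def algebra_simps)

lemma set_mitems: "MC i k l2 l1:set (mitems d n) ==> i:{1..d} & k:{1..2} & l2:{1..n} & l1:{1..n}"
 by (auto simp: mitems_def Let_def simp del: upt_Suc)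

lemma evx_bdh_mx:
 assumes m: "m:set (mitems d n)" and e: "e 0 = 1" "e 1 = y" "e 2 = x * y" "e 3 = cc"
 shows "evx e (bdh_mx ak Y l0 th m) = mexp Y (%s. th s + shift ak Y l0 x y cc s) m +
   offs l0 (%i k. (e 7 - x * y * cc) * ak i k) (e 7 - x * y * cc) m"
proof (cases m)
 case (MC i k l2 l1)
 hence "k~=0" using m set_mitems[of i k l2 l1 d n] by auto
 thus ?thesis using e[unfolded One_nat_def] unfolding MC
  by (cases "l2 = l0"; cases "l1 = l0") (simp_all add: mwx_def mhx_def shift_def algebra_simps)
next
 case (MCw l2 l1)
 thus ?thesis using e[unfolded One_nat_def]
  by (cases "l2 = l0"; cases "l1 = l0") (simp_all add: mwx_def mhx_def shift_def algebra_simps)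
qed (use e[unfolded One_nat_def] in "simp_all add: mwx_def mhx_def shift_def algebra_simps")

lemma mwords_cong:
 assumes b: "bilinear_group b" and E: "!!m. m:set (mitems d n) ==> E m mod int (bg_p b) = E' m mod int (bg_p b)"
 shows "mwords b d n E = mwords b d n E'"
proof -
 interpret G: prime_group "bg_G b" "bg_p b" "bg_g b" by (rule bilinear_groups(1)[OF b])
 show ?thesis unfolding mwords_def by (intro map_cong refl) (simp add: G.ex_eq_iff E)
qed

definition bdh_mes :: "bgroup=>nat=>nat=>(nat=>nat=>int)=>(nat=>nat=>nat=>int)=>nat=>(sx=>int)=>nat ex list" where
 "bdh_mes b d n ak Y l0 th = map (%m. wordx b GrpG (%j. j) (map (%(j,c). (j,PC c)) (bdh_mx ak Y l0 th m))) (mitems d n)"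

lemma bdh_mx_words: "(j,c):set (bdh_mx ak Y l0 th m) ==> j:{0,1,2,3,7}" "length (bdh_mx ak Y l0 th m)<=8"
 by (cases m; auto simp: mwx_def mhx_def scale_def split: if_splits)+

lemma eval_bdh_mes:
 assumes b: "bilinear_group b" and e: "e 0 = 1" "e 1 = y" "e 2 = x * y" "e 3 = cc"
  and ws: "!!j. j:{0,1,2,3,7} ==> ws ! j = bg_g b [^]\<^bsub>bg_G b\<^esub> e j"
 shows "map (%z. eval b z (%j. ws ! j)) (bdh_mes b d n ak Y l0 th) =
  mwords b d n (%m. mexp Y (%s. th s + shift ak Y l0 x y cc s) m + offs l0 (%i k. (e 7 - x * y * cc) * ak i k) (e 7 - x * y * cc) m)"
proof -
 note bg = bilinear_groups[OF b]
 have "eval b (wordx b GrpG (%j. j) (map (%(j,c). (j,PC c)) xs)) (%j. ws ! j) = bg_g b [^]\<^bsub>bg_G b\<^esub> evx e xs"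
  if xs: "!!j c. (j,c):set xs ==> j:{0,1,2,3,7}" for xs
 proof -
  have "eval b (wordx b GrpG (%j. j) (map (%(j,c). (j,PC c)) xs)) (%j. ws ! j) =
   bg_g b [^]\<^bsub>the_grp b GrpG\<^esub> (\<Sum>(j,q)\<leftarrow>map (%(j,c). (j,PC c)) xs. e j * pev q (%v. int (ws ! v)))"
  proof (rule eval_wordx)
   show "bg_p b ^ 2<=2 ^ bg_w b" using b by (simp add: bilinear_group_def)
   fix j q assume "(j,q):set (map (%(j,c). (j,PC c :: nat px)) xs)"
   then obtain c where jc: "(j,c):set xs" "q = PC c" by auto
   show "ws ! j = bg_g b [^]\<^bsub>the_grp b GrpG\<^esub> e j" using ws[OF xs[OF jc(1)]] by simp
   show "v:set_px q ==> ws ! v < bg_p b" for v using jc(2) by simp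
  qed (use bg in simp_all)
  also have "(\<Sum>(j,q)\<leftarrow>map (%(j,c). (j,PC c)) xs. e j * pev q (%v. int (ws ! v))) = evx e xs"
   unfolding evx_def by (induction xs) auto
  finally show ?thesis by simp
 qed
 from this[OF bdh_mx_words(1)] have "map (%z. eval b z (%j. ws ! j)) (bdh_mes b d n ak Y l0 th) =
  map (%m. bg_g b [^]\<^bsub>bg_G b\<^esub> evx e (bdh_mx ak Y l0 th m)) (mitems d n)"
  unfolding bdh_mes_def by simp
 also have "... = mwords b d n (%m. mexp Y (%s. th s + shift ak Y l0 x y cc s) m + offs l0 (%i k. (e 7 - x * y * cc) * ak i k) (e 7 - x * y * cc) m)"
  unfolding mwords_def by (intro map_cong refl) (simp only: evx_bdh_mx[OF _ e])
 finally show ?thesis .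
qed

lemma set_ex_bdh_mes: "z:set (bdh_mes b d n ak Y l0 th) ==> set_ex z<={..<8}"
proof -
 assume "z:set (bdh_mes b d n ak Y l0 th)"
 then obtain m where m: "z = wordx b GrpG (%j. j) (map (%(j,c). (j,PC c)) (bdh_mx ak Y l0 th m))" by (auto simp: bdh_mes_def)
 show ?thesis unfolding m by (rule order_trans[OF set_ex_wordx]) (use bdh_mx_words(1) in "force")
qed

lemma esize_bdh_mes: "z:set (bdh_mes b d n ak Y l0 th) ==> esize z<=300 * (d + 1)"
proof -
 assume "z:set (bdh_mes b d n ak Y l0 th)"
 then obtain m where m: "z = wordx b GrpG (%j. j) (map (%(j,c). (j,PC c)) (bdh_mx ak Y l0 th m))" by (auto simp: bdh_mes_def)
 have "esize z<=length (bdh_mx ak Y l0 th m) * (1 + 4) + 1"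
  unfolding m by (rule order_trans[OF esize_wordx[where K = 1]]) auto
 thus ?thesis using bdh_mx_words(2)[of ak Y l0 th m] by simp
qed

section \<open>BDH hops between the hybrids of y\<close>

definition fgame :: "bgroup=>nat=>nat=>ident=>query com=>mem=>reg=>(sx=>int)=>(mi=>int)=>bool pmf" where
 "fgame b d n tg c M a th E = kgame b d tg c M a (mwords b d n E) (freshK (bg_p b) d n) (freshD (bg_p b) d n) (key_words b d n (sec_of th))"

lemma wexp_sec_cong:
 assumes w: "w:set (items d n (length u))" and l: "length u<=d" and th: "!!s. s:SI d n ==> th s mod P = th' s mod P"
 shows "wexp (sec_of th) u ka w mod P = wexp (sec_of th') u ka w mod P"
proof -
 consider j k c where "w = WRow j k c" "(j,k):rows d (length u)" "c:{1..n}" | z where "w = WL z"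
  using set_items[OF w] by auto
 thus ?thesis
 proof cases
  case 1
  have h: "(hid (%(i,k,l). th (SH i k l)) u i c * ka (Coef j k i c)) mod P = (hid (%(i,k,l). th' (SH i k l)) u i c * ka (Coef j k i c)) mod P"
   if i: "i:{1..length u}" for i
  proof -
   have "th (SH i 1 c) mod P = th' (SH i 1 c) mod P" "th (SH i 2 c) mod P = th' (SH i 2 c) mod P"
    using 1 i l by (auto intro!: th)
   thus ?thesis unfolding hid.simps prod.case by (intro mod_mult_cong mod_add_cong refl)
  qed
  have "(\<Sum>i = 1..length u. (hid (%(i,k,l). th (SH i k l)) u i c * ka (Coef j k i c)) mod P) =
   (\<Sum>i = 1..length u. (hid (%(i,k,l). th' (SH i k l)) u i c * ka (Coef j k i c)) mod P)"
   by (intro sum.cong refl h)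
  hence s: "(\<Sum>i = 1..length u. hid (%(i,k,l). th (SH i k l)) u i c * ka (Coef j k i c)) mod P =
   (\<Sum>i = 1..length u. hid (%(i,k,l). th' (SH i k l)) u i c * ka (Coef j k i c)) mod P"
   by (subst (1 2) mod_sum_eq[symmetric]) simp
  have e: "(if j = 0 then 0 else th (SH j k c) * ka (Extra j c)) mod P = (if j = 0 then 0 else th' (SH j k c) * ka (Extra j c)) mod P"
  proof (cases "j = 0")
   case False
   have "th (SH j k c) mod P = th' (SH j k c) mod P" using 1 False by (intro th) (auto simp: rows_def)
   thus ?thesis using False by (simp only: if_False) (intro mod_mult_cong refl)
  qed simp
  have "th (SW c) mod P = th' (SW c) mod P" using 1 by (intro th) auto
  thus ?thesis unfolding 1(1) sec_of_def wexp.simps prod.case by (intro mod_add_cong mod_mult_cong s e refl)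
 next
  case 2
  have "th SV mod P = th' SV mod P" by (intro th) simp
  thus ?thesis unfolding 2 sec_of_def wexp.simps by (intro mod_mult_cong refl)
 qed
qed

lemma fgame_cong:
 assumes b: "bilinear_group b" and th: "!!s. s:SI d n ==> th s mod int (bg_p b) = th' s mod int (bg_p b)"
  and E: "!!m. m:set (mitems d n) ==> E m mod int (bg_p b) = E' m mod int (bg_p b)"
 shows "fgame b d n tg c M a th E = fgame b d n tg c M a th' E'"
proof -
 interpret H: prime_group "bg_H b" "bg_p b" "bg_h b" by (rule bilinear_groups(2)[OF b])
 have k: "key_words b d n (sec_of th) u ka = key_words b d n (sec_of th') u ka" if "valid_id (bg_p b) d u" for u ka
  unfolding key_words_def
  by (intro map_cong refl) (simp only: H.ex_eq_iff, intro wexp_sec_cong th, use that in \<open>auto simp: valid_id_def\<close>)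
 have m: "mwords b d n E = mwords b d n E'" by (rule mwords_cong[OF b E])
 show ?thesis unfolding fgame_def m
  by (rule kgame_rel[where R = "%_. (=)"]) (auto simp: pmf.rel_refl k)
qed

lemma set_mitemsD:
 "m:set (mitems d n) ==> m = MV \<or> (EX l:{1..n}. m = MW l \<or> m = MJ l) \<or> (EX i:{1..d}. EX k:{0..2}. EX l:{1..n}. m = MH i k l) \<or>
   (EX l2:{1..n}. EX l1:{1..n}. m = MCw l2 l1 \<or> (EX i:{1..d}. EX k:{1..2}. m = MC i k l2 l1))"
 by (auto simp: mitems_def Let_def simp del: upt_Suc)

lemma mexp_cong:
 assumes m: "m:set (mitems d n)" and th: "!!s. s:SI d n ==> th s mod P = th' s mod P"
 shows "mexp Y th m mod P = mexp Y th' m mod P"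
 using set_mitemsD[OF m] by (elim disjE bexE conjE; simp only: mexp.simps; intro mod_add_cong mod_mult_cong th refl; simp)

text \<open>Keys of prefixes of the target are stored without any relation to the game; they are
  never transmitted. This is sound only because delegation now yields keys independent of the
  parent, so that a non-prefix inherits nothing from a prefix.\<close>

lemma bdh_sim:
 fixes c :: "query com" and a :: reg
 assumes b: "bilinear_group b" and d: "d + 2 < bg_p b" and tg: "valid_id (bg_p b) d tg" and l0: "l0:{1..n}"
  and B: "!!u. valid_id (bg_p b) d u ==> \<not> prefix u tg ==> EX i:{1..length u}. Bx Y u l0 i mod int (bg_p b)~=0"
  and M0: "!!r. M0 r < 2 ^ bg_w b" "finite {r. M0 r~=0}"
 shows "EX A. cost A<=cost c + card {r. M0 r~=0} + red_bound d n (num_queries c) &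
  (ALL x y cc z. map_pmf out_bit (run_alg b A (store_words 0 [bg_g b,bg_g b [^]\<^bsub>bg_G b\<^esub> (int y),bg_g b [^]\<^bsub>bg_G b\<^esub> (int x * int y),
    bg_g b [^]\<^bsub>bg_G b\<^esub> (int cc),bg_h b,bg_h b [^]\<^bsub>bg_H b\<^esub> (int x),bg_h b [^]\<^bsub>bg_H b\<^esub> (int y),bg_g b [^]\<^bsub>bg_G b\<^esub> (z :: int)] (%_. 0))) =
   fgame b d n tg c M0 a (%s. th s + shift ak Y l0 (int x) (int y) (int cc) s)
    (%m. mexp Y (%s. th s + shift ak Y l0 (int x) (int y) (int cc) s) m +
      offs l0 (%i k. (z - int x * int y * int cc) * ak i k) (z - int x * int y * int cc) m))"
proof -
 let ?p = "bg_p b"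
 note bg = bilinear_groups[OF b]
 interpret G: prime_group "bg_G b" ?p "bg_g b" by (rule bg(1))
 interpret H: prime_group "bg_H b" ?p "bg_h b" by (rule bg(2))
 have p0: "0 < ?p" using bg(4) by simp
 obtain Il where Il: "set Il = {..<2::nat} \<times> KA d n" "distinct Il" "length Il = card ({..<2::nat} \<times> KA d n)"
  using finite_distinct_list_ex[of "{..<2::nat} \<times> KA d n"] by auto
 obtain Rl where Rl: "set Rl = RS d n" "distinct Rl" "length Rl = card (RS d n)"
  using finite_distinct_list_ex[of "RS d n"] by auto
 define ci :: "nat=>nat=>fvar px" where "ci i k = PV (VId (i - 1) k)" for i k
 define di :: "nat=>nat=>nat=>fvar px" where "di l i k = (if i = l + 1 then PV (VX k) else PV (VId (i - 1) k))" for l i k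
 define ce where "ce l = bdh_px d n ak Y l0 l ci" for l
 define de where "de l = bdh_px d n ak Y l0 (l + 1) (di l)" for l
 define re where "re = bdh_re d n (sec_of th) (secY Y l0)"
 define mes where "mes = bdh_mes b d n ak Y l0 th"
 have "EX A. cost A<=cost c + sim_bound d (num_queries c) (length Il + length Rl + 9 * (d + 1) ^ 2 * n) (300 * (d + 1)) +
   card {r. M0 r~=0} + 8 + (8 + length mes) * (300 * (d + 1) + 4) &
  (ALL ws e. length ws = 8 --> (ALL j<8. ws ! j < 2 ^ bg_w b) -->
   (ALL l qs j q. qs:set (re l) --> (j,q):set qs --> ws ! j = H.ex (e j)) -->
   map_pmf out_bit (run_alg b A (store_words 0 ws (%_. 0))) =
   kgame b d tg c M0 a (map (%x. eval b x (%j. ws ! j)) mes) (polyK ?p (set Il) (set Rl) ce)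
    (polyD ?p (set Il) (set Rl) de) (polyW b e re))"
 proof (rule simulate[OF b d tg Il(2) Rl(2)])
  show "set_px (ce l i)<=idvars d Un VOm ` set Rl" for l i
  proof (cases i)
   case (Pair m z)
   show ?thesis
   proof (cases "z:KI d n l & l<=d")
    case True
    hence "set_px (simfx ak Y l0 l ci m z)<=idvars d Un VOm ` set Rl"
     by (intro set_px_simfx[OF _ _ l0]) (auto simp: ci_def Rl)
    thus ?thesis using True Pair by (simp add: ce_def bdh_px_def)
   next
    case False
    thus ?thesis unfolding Pair ce_def bdh_px_def prod.case if_not_P[OF False] by simp
   qed
  qed
  show "set_px (de l i)<=idvars d Un VOm ` set Rl Un VPl ` set Il Un VX ` {..<2}" for l i
  proof (cases i)
   case (Pair m z)
   show ?thesis
   proof (cases "z:KI d n (l + 1) & l + 1<=d")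
    case True
    hence "set_px (simfx ak Y l0 (l + 1) (di l) m z)<=idvars d Un VOm ` set Rl Un VPl ` set Il Un VX ` {..<2}"
     by (intro set_px_simfx[OF _ _ l0]) (auto simp: di_def Rl)
    thus ?thesis using True Pair by (simp add: de_def bdh_px_def)
   next
    case False
    thus ?thesis unfolding Pair de_def bdh_px_def prod.case if_not_P[OF False] by simp
   qed
  qed
  show "j < 8 & set_px q<=idvars d Un VPl ` set Il" if h: "qs:set (re l)" "(j,q):set qs" for l qs j q
  proof -
   obtain w where w: "l<=d" "w:set (items d n l)"
    "j = 4 & q = wexpx (sec_of th) l 0 w \<or> j = 5 & q = wexpx (sec_of th) l 1 w \<or> j = 6 & q = wexpx (secY Y l0) l 0 w"
    using h by (auto simp: re_def bdh_re_def split: if_splits)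
   have "set_px (wexpx sec l m w)<=idvars d Un VPl ` set Il" if "m < 2" for sec m
    using set_px_wexpx[OF w(2,1), of sec m] that by (auto simp: Il)
   from this[of 0] this[of 1] show ?thesis using w(3) by (elim disjE conjE) simp_all
  qed
  show "length (re l)<=9 * (d + 1) ^ 2 * n" for l using length_items[of l d n] by (simp add: re_def bdh_re_def)
  have ci: "psize (ci i k)<=2" and di: "psize (di l i k)<=2" for l i k by (simp_all add: ci_def di_def)
  show "psize (ce l i)<=300 * (d + 1)" for l i using psize_simfx[of l d ci ak Y l0, OF _ ci] by (cases i) (simp add: ce_def bdh_px_def)
  show "psize (de l i)<=300 * (d + 1)" for l i using psize_simfx[of "l + 1" d "di l" ak Y l0, OF _ di] by (cases i) (simp add: de_def bdh_px_def)
  show "esize (wordx b GrpH VCh qs :: fvar ex)<=300 * (d + 1)" if h: "qs:set (re l)" for l qs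
  proof -
   obtain w where w: "l<=d" "qs = [(4,wexpx (sec_of th) l 0 w),(5,wexpx (sec_of th) l 1 w),(6,wexpx (secY Y l0) l 0 w)]"
    using h by (auto simp: re_def bdh_re_def split: if_splits)
   have "esize (wordx b GrpH VCh qs :: fvar ex)<=length qs * (23 * d + 20 + 4) + 1"
    by (rule esize_wordx) (auto simp: w(2) intro!: psize_wexpx[OF w(1)])
   thus ?thesis using w(2) by simp
  qed
  show "set_ex z<={..<8}" "esize z<=300 * (d + 1)" if "z:set mes" for z
   using that set_ex_bdh_mes esize_bdh_mes unfolding mes_def by auto
 qed (use M0 in auto)
 then obtain A where cA: "cost A<=cost c + sim_bound d (num_queries c) (length Il + length Rl + 9 * (d + 1) ^ 2 * n) (300 * (d + 1)) +
   card {r. M0 r~=0} + 8 + (8 + length mes) * (300 * (d + 1) + 4)"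
  and A: "!!ws e. length ws = 8 ==> (ALL j<8. ws ! j < 2 ^ bg_w b) ==>
   (ALL l qs j q. qs:set (re l) --> (j,q):set qs --> ws ! j = H.ex (e j)) ==>
   map_pmf out_bit (run_alg b A (store_words 0 ws (%_. 0))) =
   kgame b d tg c M0 a (map (%x. eval b x (%j. ws ! j)) mes) (polyK ?p (set Il) (set Rl) ce)
    (polyD ?p (set Il) (set Rl) de) (polyW b e re)"
  by blast
 have lmes: "length mes<=size_bound d n"
 proof -
  have "9 * (d + 1) ^ 2 * (n + 1) ^ 2<=size_bound d n" unfolding size_bound_def by (intro mult_right_mono) auto
  thus ?thesis using length_mitems[of d n] by (simp add: mes_def bdh_mes_def)
 qed
 have cost: "cost A<=cost c + card {r. M0 r~=0} + red_bound d n (num_queries c)"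
  by (rule simulate_bound[OF _ lmes _ cA]) (use size_bound_sum[of d n] in "simp_all add: Il Rl card_cartesian_product")
 show ?thesis
 proof (intro exI[of _ A] conjI cost allI)
  fix x y cc :: nat and z :: int
  define ws where "ws = [bg_g b,G.ex (int y),G.ex (int x * int y),G.ex (int cc),bg_h b,H.ex (int x),H.ex (int y),G.ex z]"
  define eG :: "nat=>int" where "eG = (%m. if m = 0 then 1 else if m = 1 then int y else if m = 2 then int x * int y else if m = 3 then int cc else z)"
  define eH :: "nat=>int" where "eH = (%m. if m = 4 then 1 else if m = 5 then int x else int y)"
  have g1: "bg_g b = G.ex 1" "bg_h b = H.ex 1" using G.g G.group H.g H.group by (simp_all add: group.int_pow_1)
  have car: "G.ex i < 2 ^ bg_w b" "H.ex i < 2 ^ bg_w b" for i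
   using b G.ex_closed[of i] H.ex_closed[of i] by (auto simp: bilinear_group_def word_group_def)
  have ws8: "length ws = 8" "ALL j<8. ws ! j < 2 ^ bg_w b"
   using car car[of 1, folded g1] by (auto simp: ws_def less_Suc_eq numeral_eq_Suc)
  have wH: "ALL l qs j q. qs:set (re l) --> (j,q):set qs --> ws ! j = H.ex (eH j)"
  proof (intro allI impI)
   fix l qs j q assume "qs:set (re l)" "(j,q):set qs"
   hence "j = 4 \<or> j = 5 \<or> j = 6" by (auto simp: re_def bdh_re_def split: if_splits)
   thus "ws ! j = H.ex (eH j)" using g1 by (elim disjE) (simp_all add: ws_def eH_def)
  qed
  have wG: "ws ! j = G.ex (eG j)" if "j:{0,1,2,3,7}" for j
   using that g1 by (auto simp: ws_def eG_def)
  have e: "eG 0 = 1" "eG 1 = int y" "eG 2 = int x * int y" "eG 3 = int cc" "eG 7 = z" by (simp_all add: eG_def)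
  define sec where "sec = sec_of (%s. th s + shift ak Y l0 (int x) (int y) (int cc) s)"
  have m: "map (%x. eval b x (%j. ws ! j)) mes = mwords b d n (%m. mexp Y (%s. th s + shift ak Y l0 (int x) (int y) (int cc) s) m +
      offs l0 (%i k. (z - int x * int y * int cc) * ak i k) (z - int x * int y * int cc) m)"
   using eval_bdh_mes[OF b e(1-4) wG, of d n ak Y l0 th] unfolding e mes_def by simp
  show "map_pmf out_bit (run_alg b A (store_words 0 [bg_g b,G.ex (int y),G.ex (int x * int y),G.ex (int cc),bg_h b,H.ex (int x),H.ex (int y),G.ex z] (%_. 0))) =
   fgame b d n tg c M0 a (%s. th s + shift ak Y l0 (int x) (int y) (int cc) s)
    (%m. mexp Y (%s. th s + shift ak Y l0 (int x) (int y) (int cc) s) m +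
      offs l0 (%i k. (z - int x * int y * int cc) * ak i k) (z - int x * int y * int cc) m)"
   unfolding ws_def[symmetric] A[OF ws8 wH] m fgame_def sec_def[symmetric]
  proof (rule kgame_rel[where R = "%u pl ka. \<not> prefix u tg --> bdh_rel ?p d n ak Y l0 (int x) u pl ka"])
   fix u assume u: "valid_id ?p d u"
   hence l: "length u<=d" by (simp add: valid_id_def)
   show "rel_pmf (%pl ka. \<not> prefix u tg --> bdh_rel ?p d n ak Y l0 (int x) u pl ka) (polyK ?p (set Il) (set Rl) ce u) (freshK ?p d n u)"
   proof (cases "prefix u tg")
    case False
    have "rel_pmf (bdh_rel ?p d n ak Y l0 (int x) u) (polyK ?p (set Il) (set Rl) ce u) (freshK ?p d n u)"
     unfolding polyK_def freshK_def Il Rl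
    proof (rule bdh_fresh_rel[OF H.prime_p l l0 B[OF u False]])
     fix rv m z assume "z:KI d n (length u)" "m < (2::nat)"
     thus "pev (ce (length u) (m,z)) (penv u [] rv (%_. 0)) = (if m = 0 then simf0 ak Y l0 u rv z else simf1 ak l0 u rv z)"
      unfolding ce_def bdh_px_def prod.case using l
      by (subst if_P, simp) (rule pev_simfx, auto simp: ci_def)
    qed
    thus ?thesis by (rule pmf.rel_mono_strong) simp
   qed (auto intro: rel_pmf_all)
  next
   fix u v pl ka assume uv: "valid_id ?p d (u @ [v])"
   hence l: "length (u @ [v])<=d" by (simp add: valid_id_def)
   show "rel_pmf (%pl ka. \<not> prefix (u @ [v]) tg --> bdh_rel ?p d n ak Y l0 (int x) (u @ [v]) pl ka) (polyD ?p (set Il) (set Rl) de u pl v) (freshD ?p d n u ka v)"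
   proof (cases "prefix (u @ [v]) tg")
    case False
    have "rel_pmf (bdh_rel ?p d n ak Y l0 (int x) (u @ [v])) (polyD ?p (set Il) (set Rl) de u pl v)
      (map_pmf (fresh d n (length (u @ [v]))) (UI ?p (RS d n)))"
     unfolding polyD_def Il Rl
    proof (rule bdh_fresh_rel[OF H.prime_p l l0 B[OF uv False]])
     fix rv m z assume z: "z:KI d n (length (u @ [v]))" "m < (2::nat)"
     have "de (length u) (m,z) = simfx ak Y l0 (length (u @ [v])) (di (length u)) m z"
      using z l by (simp add: de_def bdh_px_def)
     moreover have "pev (simfx ak Y l0 (length (u @ [v])) (di (length u)) m z) (penv u v rv pl) =
      (if m = 0 then simf0 ak Y l0 (u @ [v]) rv z else simf1 ak l0 (u @ [v]) rv z)"
      by (rule pev_simfx) (auto simp: di_def nth_append)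
     ultimately show "pev (de (length u) (m,z)) (penv u v rv pl) = (if m = 0 then simf0 ak Y l0 (u @ [v]) rv z else simf1 ak l0 (u @ [v]) rv z)" by simp
    qed
    thus ?thesis unfolding freshD_def length_append_singleton Suc_eq_plus1 by (rule pmf.rel_mono_strong) simp
   qed (auto intro: rel_pmf_all)
  next
   fix u pl ka assume u: "valid_id ?p d u" "\<not> prefix u tg" and "\<not> prefix u tg --> bdh_rel ?p d n ak Y l0 (int x) u pl ka"
   thus "polyW b eH re u pl = key_words b d n sec u ka"
    unfolding re_def sec_def by (intro bdh_words[OF b]) (auto simp: valid_id_def eH_def)
  qed
 qed
qed

lemma offs_cong:
 assumes m: "m:set (mitems d n)" and t: "t mod P = t' mod P"
  and \<beta>: "!!i k. i:{1..d} ==> k:{1..2} ==> \<beta> i k mod P = \<beta>' i k mod P"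
 shows "offs l0 \<beta> t m mod P = offs l0 \<beta>' t' m mod P"
 using set_mitemsD[OF m] t \<beta> by (elim disjE bexE conjE) simp_all

definition avg_game :: "bgroup=>nat=>nat=>ident=>query com=>mem=>reg=>((sx=>int)=>mi=>int)=>bool pmf" where
 "avg_game b d n tg c M a E = bind_pmf (UI (bg_p b) (SI d n)) (%th. fgame b d n tg c M a th (E th))"

text \<open>The embedding of the challenge is a shift of master exponents, which uniform master
  exponents absorb.\<close>

lemma shift_avg:
 assumes b: "bilinear_group b"
 shows "bind_pmf (UI (bg_p b) (SI d n)) (%th. fgame b d n tg c M a (%s. th s + sh s) (%m. mexp Y (%s. th s + sh s) m + off m)) =
  avg_game b d n tg c M a (%th m. mexp Y th m + off m)"
proof -
 let ?p = "bg_p b"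
 have p0: "0 < ?p" using bilinear_groups(4)[OF b] by simp
 let ?h = "%th s. if s:SI d n then (1 * th s + sh s) mod int ?p else 0"
 have "fgame b d n tg c M a (%s. th s + sh s) (%m. mexp Y (%s. th s + sh s) m + off m) =
   fgame b d n tg c M a (?h th) (%m. mexp Y (?h th) m + off m)" for th
 proof (rule fgame_cong[OF b])
  show "(mexp Y (%s. th s + sh s) m + off m) mod int ?p = (mexp Y (?h th) m + off m) mod int ?p" if "m:set (mitems d n)" for m
   by (intro mod_add_cong mexp_cong[OF that] refl) simp
 qed simp
 hence "bind_pmf (UI ?p (SI d n)) (%th. fgame b d n tg c M a (%s. th s + sh s) (%m. mexp Y (%s. th s + sh s) m + off m)) =
   bind_pmf (map_pmf ?h (UI ?p (SI d n))) (%th. fgame b d n tg c M a th (%m. mexp Y th m + off m))"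
  by (simp only: bind_map_pmf)
 also have "map_pmf ?h (UI ?p (SI d n)) = UI ?p (SI d n)" by (rule UI_affine[OF finite_SI p0]) simp
 finally show ?thesis by (simp only: avg_game_def)
qed

abbreviation AI :: "nat=>(nat \<times> nat) set" where "AI d \<equiv> {1..d} \<times> {1..2}"

definition rand_game :: "bgroup=>nat=>nat=>ident=>query com=>mem=>reg=>nat=>(nat=>nat=>nat=>int)=>int=>bool pmf" where
 "rand_game b d n tg c M a l0 Y t = bind_pmf (UI (bg_p b) (AI d)) (%A.
   avg_game b d n tg c M a (%th m. mexp Y th m + offs l0 (%i k. t * A (i,k)) t m))"

text \<open>The masks are averaged over as well. On a genuine challenge they occur only inside the
  shift of the master exponents and are absorbed with it; on a random one they also appear
  multiplied by the error \<open>t\<close> of the last challenge word.\<close>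

lemma bdh_hop:
 fixes c :: "query com" and a :: reg
 assumes b: "bilinear_group b" and d: "d + 2 < bg_p b" and tg: "valid_id (bg_p b) d tg" and l0: "l0:{1..n}"
  and B: "!!u. valid_id (bg_p b) d u ==> \<not> prefix u tg ==> EX i:{1..length u}. Bx Y u l0 i mod int (bg_p b)~=0"
  and M0: "!!r. M0 r < 2 ^ bg_w b" "finite {r. M0 r~=0}"
 shows "EX B. cost B<=cost c + card {r. M0 r~=0} + red_bound d n (num_queries c) &
  \<bar>pmf (avg_game b d n tg c M0 a (mexp Y)) True - pmf (bind_pmf (unif (bg_p b)) (%t. rand_game b d n tg c M0 a l0 Y (int t))) True\<bar><=pbdh_adv b B"
proof -
 let ?p = "bg_p b" and ?U = "unif (bg_p b)"
 note bg = bilinear_groups[OF b]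
 interpret G: prime_group "bg_G b" ?p "bg_g b" by (rule bg(1))
 interpret H: prime_group "bg_H b" ?p "bg_h b" by (rule bg(2))
 have p0: "0 < ?p" using bg(4) by simp
 define K where "K A th x y cc z = fgame b d n tg c M0 a (%s. th s + shift (%i k. A (i,k)) Y l0 (int x) (int y) (int cc) s)
    (%m. mexp Y (%s. th s + shift (%i k. A (i,k)) Y l0 (int x) (int y) (int cc) s) m +
      offs l0 (%i k. (z - int x * int y * int cc) * A (i,k)) (z - int x * int y * int cc) m)"
  for A :: "nat \<times> nat=>int" and th and x y cc :: nat and z :: int
 define W where "W g A th = bind_pmf ?U (%x. bind_pmf ?U (%y. bind_pmf ?U (%cc. bind_pmf ?U (%z.
   K A th x y cc (if g then int x * int y * int cc else int z)))))" for g A th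
 let ?A = "UI ?p (AI d)" and ?S = "UI ?p (SI d n)"
 \<comment> \<open>The game after the embedding has been averaged out: only the error
   \<open>t\<close> of the last challenge word remains.\<close>
 define T where "T A t = avg_game b d n tg c M0 a (%th m. mexp Y th m + offs l0 (%i k. t * A (i,k)) t m)" for A :: "nat \<times> nat=>int" and t
 have K: "bind_pmf ?S (%th. K A th x y cc z) = T A (z - int x * int y * int cc)" for A x y cc z
  unfolding K_def T_def by (rule shift_avg[OF b])
 have W: "bind_pmf ?S (W g A) = bind_pmf ?U (%x. bind_pmf ?U (%y. bind_pmf ?U (%cc. bind_pmf ?U (%z.
   T A ((if g then int x * int y * int cc else int z) - int x * int y * int cc)))))" for g A
  unfolding K[symmetric] W_def by (simp only: bind_commute_pmf[of ?S])
 have T0: "T A 0 = avg_game b d n tg c M0 a (mexp Y)" for A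
 proof -
  have "offs l0 (%_ _. 0) 0 m = 0" for m by (cases m) auto
  thus ?thesis by (simp add: T_def)
 qed
 have real: "bind_pmf ?A (%A. bind_pmf ?S (W True A)) = avg_game b d n tg c M0 a (mexp Y)"
  by (simp add: W T0)
 have Tmod: "T A t = T A (t mod int ?p)" for A t
  unfolding T_def avg_game_def by (intro bind_pmf_cong refl fgame_cong[OF b] mod_add_cong offs_cong mod_mult_cong) simp_all
 have rand: "bind_pmf ?A (%A. bind_pmf ?S (W False A)) = bind_pmf ?U (%t. rand_game b d n tg c M0 a l0 Y (int t))"
 proof -
  have "bind_pmf ?S (W False A) = bind_pmf ?U (%t. T A (int t))" for A
  proof -
   have "bind_pmf ?U (%z. T A (int z - int x * int y * int cc)) = bind_pmf ?U (%t. T A (int t))" for x y cc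
   proof -
    have "bind_pmf ?U (%z. T A (int z - int x * int y * int cc)) = bind_pmf (map_pmf (%z. (int z + - (int x * int y * int cc)) mod int ?p) ?U) (T A)"
     by (subst Tmod) (simp add: bind_map_pmf)
    thus ?thesis unfolding unif_shift[OF p0] by (simp add: bind_map_pmf)
   qed
   thus ?thesis unfolding W by simp
  qed
  thus ?thesis unfolding rand_game_def T_def[symmetric] by (simp only: bind_commute_pmf[of ?A])
 qed
 \<comment> \<open>Masks and master exponents are fixed where the difference is at least its
   average, and are hard-wired.\<close>
 obtain A where A: "\<bar>pmf (bind_pmf ?A (%A. bind_pmf ?S (W True A))) True - pmf (bind_pmf ?A (%A. bind_pmf ?S (W False A))) True\<bar>
   <=\<bar>pmf (bind_pmf ?S (W True A)) True - pmf (bind_pmf ?S (W False A)) True\<bar>"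
  using pmf_bind_diff_attained[of ?A "%A. bind_pmf ?S (W True A)" True "%A. bind_pmf ?S (W False A)"] by metis
 obtain th where th: "\<bar>pmf (bind_pmf ?S (W True A)) True - pmf (bind_pmf ?S (W False A)) True\<bar>
   <=\<bar>pmf (W True A th) True - pmf (W False A th) True\<bar>"
  using pmf_bind_diff_attained[of ?S "W True A" True "W False A"] by metis
 obtain D where D: "cost D<=cost c + card {r. M0 r~=0} + red_bound d n (num_queries c)"
  "!!x y cc z. map_pmf out_bit (run_alg b D (store_words 0 [bg_g b,G.ex (int y),G.ex (int x * int y),
    G.ex (int cc),bg_h b,H.ex (int x),H.ex (int y),G.ex z] (%_. 0))) = K A th x y cc z"
  using bdh_sim[OF b d tg l0 B M0, of c a th "%i k. A (i,k)"] unfolding K_def[symmetric] by blast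
 have acc: "accept_prob b D (pbdh_dist b g) = pmf (W g A th) True" for g
 proof -
  have "bind_pmf (pbdh_dist b g) (%ws. map_pmf out_bit (run_alg b D (store_words 0 ws (%_. 0)))) = W g A th"
   unfolding pbdh_dist_def Let_def bind_assoc_pmf bind_return_pmf W_def G.g_pow H.g_pow
   by (intro bind_pmf_cong refl) (cases g; simp only: if_True if_False of_nat_mult D(2))
  thus ?thesis unfolding accept_prob_eq by simp
 qed
 show ?thesis
  using A th D(1) unfolding real rand pbdh_adv_def acc[symmetric] by (intro exI[of _ D] conjI) auto
qed

text \<open>At coordinate \<open>l0\<close>, the vector y occurs in the diagonal entries of
  \<open>C\<close> only. For a unit \<open>t\<close> the uniform masks turn these entries into
  independent uniform values.\<close>

lemma rand_game_unit:
 assumes b: "bilinear_group b" and t: "coprime t (int (bg_p b))" and Y: "!!l. l~=l0 ==> Y l = Y' l"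
 shows "rand_game b d n tg c M a l0 Y t = rand_game b d n tg c M a l0 Y' t"
proof -
 let ?p = "bg_p b"
 have p0: "0 < ?p" using bilinear_groups(4)[OF b] by simp
 \<comment> \<open>The game with its diagonal entries at \<open>l0\<close> replaced by
   \<open>A\<close> itself; the offset \<open>t\<close> of the other diagonal word,
   \<open>MCw\<close>, stays.\<close>
 define X where "X Y th A m = (case m of MC i k l2 l1=>if l2 = l0 & l1 = l0 then A (i,k) else mexp Y th m
   | _=>mexp Y th m + offs l0 (%_ _. 0) t m)" for Y th and A :: "nat \<times> nat=>int" and m
 have X: "rand_game b d n tg c M a l0 Y t = bind_pmf (UI ?p (SI d n)) (%th. bind_pmf (UI ?p (AI d)) (%A. fgame b d n tg c M a th (X Y th A)))" for Y
 proof -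
  have "bind_pmf (UI ?p (AI d)) (%A. fgame b d n tg c M a th (%m. mexp Y th m + offs l0 (%i k. t * A (i,k)) t m)) =
    bind_pmf (UI ?p (AI d)) (%A. fgame b d n tg c M a th (X Y th A))" for th
  proof -
   let ?h = "%A x. if x:AI d then (t * A x + mexp Y th (MC (fst x) (snd x) l0 l0)) mod int ?p else 0"
   have "fgame b d n tg c M a th (%m. mexp Y th m + offs l0 (%i k. t * A (i,k)) t m) = fgame b d n tg c M a th (X Y th (?h A))" for A
   proof (rule fgame_cong[OF b refl])
    fix m assume "m:set (mitems d n)"
    from set_mitemsD[OF this] show "(mexp Y th m + offs l0 (%i k. t * A (i,k)) t m) mod int ?p = X Y th (?h A) m mod int ?p"
     by (elim disjE bexE conjE) (simp_all add: X_def add.commute)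
   qed
   hence "bind_pmf (UI ?p (AI d)) (%A. fgame b d n tg c M a th (%m. mexp Y th m + offs l0 (%i k. t * A (i,k)) t m)) =
     bind_pmf (map_pmf ?h (UI ?p (AI d))) (%A. fgame b d n tg c M a th (X Y th A))" by (simp only: bind_map_pmf)
   also have "map_pmf ?h (UI ?p (AI d)) = UI ?p (AI d)" by (rule UI_affine) (use p0 t in auto)
   finally show ?thesis .
  qed
  thus ?thesis unfolding rand_game_def avg_game_def bind_commute_pmf[of "UI ?p (AI d)"] by simp
 qed
 have "X Y th A = X Y' th A" for th A
  using Y by (auto simp: X_def fun_eq_iff split: mi.splits)
 thus ?thesis unfolding X by simp
qed

lemma pbdh_adv_nonneg: "0<=pbdh_adv b B" by (simp add: pbdh_adv_def)

text \<open>Two hops meet in the random game, which is the same for \<open>Y\<close> and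
  \<open>Y'\<close> as long as \<open>t\<close> is nonzero.\<close>

lemma bdh_step:
 fixes c :: "query com" and a :: reg
 assumes b: "bilinear_group b" and d: "d + 2 < bg_p b" and tg: "valid_id (bg_p b) d tg" and l0: "l0:{1..n}"
  and B: "!!u. valid_id (bg_p b) d u ==> \<not> prefix u tg ==> EX i:{1..length u}. Bx Y u l0 i mod int (bg_p b)~=0"
  and B': "!!u. valid_id (bg_p b) d u ==> \<not> prefix u tg ==> EX i:{1..length u}. Bx Y' u l0 i mod int (bg_p b)~=0"
  and Y: "!!l. l~=l0 ==> Y l = Y' l"
  and M0: "!!r. M0 r < 2 ^ bg_w b" "finite {r. M0 r~=0}"
 shows "EX B. cost B<=cost c + card {r. M0 r~=0} + red_bound d n (num_queries c) &
  \<bar>pmf (avg_game b d n tg c M0 a (mexp Y)) True - pmf (avg_game b d n tg c M0 a (mexp Y')) True\<bar><=2 * pbdh_adv b B + 2 / bg_p b"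
proof -
 let ?p = "bg_p b" and ?C = "cost c + card {r. M0 r~=0} + red_bound d n (num_queries c)"
 note bg = bilinear_groups[OF b]
 interpret G: prime_group "bg_G b" ?p "bg_g b" by (rule bg(1))
 define F where "F Y = pmf (avg_game b d n tg c M0 a (mexp Y)) True" for Y
 define R where "R Y = pmf (bind_pmf (unif ?p) (%t. rand_game b d n tg c M0 a l0 Y (int t))) True" for Y
 define N where "N Y = pmf (bind_pmf (unif_nz ?p) (%t. rand_game b d n tg c M0 a l0 Y (int t))) True" for Y
 obtain D where D: "cost D<=?C" "\<bar>F Y - R Y\<bar><=pbdh_adv b D" using bdh_hop[OF b d tg l0 B M0, of c a] unfolding F_def R_def by blast
 obtain D' where D': "cost D'<=?C" "\<bar>F Y' - R Y'\<bar><=pbdh_adv b D'" using bdh_hop[OF b d tg l0 B' M0, of c a] unfolding F_def R_def by blast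
 have "N Y = N Y'"
 proof -
  have "rand_game b d n tg c M0 a l0 Y (int t) = rand_game b d n tg c M0 a l0 Y' (int t)" if "t:set_pmf (unif_nz ?p)" for t
  proof -
   have "set_pmf (unif_nz ?p) = {1..<?p}" unfolding unif_nz_def by (rule set_pmf_of_set) (use bg(4) in simp_all)
   hence t: "1<=t" "t < ?p" using that by auto
   have "\<not> ?p dvd t" using t by (auto dest: dvd_imp_le)
   hence "coprime (int t) (int ?p)" using prime_imp_coprime[OF G.prime_p] by (simp add: coprime_commute)
   thus ?thesis by (rule rand_game_unit[OF b _ Y])
  qed
  thus ?thesis unfolding N_def by (intro arg_cong[where f = "%P. pmf P True"] bind_pmf_cong refl)
 qed
 moreover have "\<bar>N Y - R Y\<bar><=1 / ?p" for Y
  unfolding N_def R_def by (rule stat_dist_leD[OF stat_dist_le_bind1[OF stat_dist_le_unif_nz[OF bg(4)]]])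
 from this[of Y] this[of Y'] have "\<bar>N Y - R Y\<bar><=1 / ?p" "\<bar>N Y' - R Y'\<bar><=1 / ?p" .
 moreover have "2 / real ?p = 1 / ?p + 1 / ?p" by simp
 ultimately have *: "\<bar>F Y - F Y'\<bar><=pbdh_adv b D + pbdh_adv b D' + 2 / ?p" using D(2) D'(2) by linarith
 show ?thesis
 proof (cases "pbdh_adv b D<=pbdh_adv b D'")
  case True
  thus ?thesis using * D'(1) unfolding F_def by (intro exI[of _ D'] conjI) simp_all
 next
  case False
  thus ?thesis using * D(1) unfolding F_def by (intro exI[of _ D] conjI) simp_all
 qed
qed

lemma bdh_part:
 fixes c :: "query com" and a :: reg
 assumes b: "bilinear_group b" and d: "d + 2 < bg_p b" and tg: "valid_id (bg_p b) d tg"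
  and M0: "!!r. M0 r < 2 ^ bg_w b" "finite {r. M0 r~=0}"
 shows "EX B. cost B<=cost c + card {r. M0 r~=0} + red_bound d n (num_queries c) &
  \<bar>pmf (avg_game b d n tg c M0 a (mexp (real_Y b d n))) True - pmf (avg_game b d n tg c M0 a (mexp (lossy_Y b d n tg))) True\<bar>
  <=n * (2 * pbdh_adv b B + 2 / bg_p b)"
proof -
 let ?p = "bg_p b"
 have p: "1 < ?p" by (rule bilinear_groups(4)[OF b])
 define Z where "Z = {B :: algorithm. cost B<=cost c + card {r. M0 r~=0} + red_bound d n (num_queries c)}"
 \<comment> \<open>Coordinates up to \<open>i\<close> are lossy. Whichever vector a coordinate uses,
   every non-prefix has a nonzero product there, as the simulation of keys requires.\<close>
 define Y where "Y i l = (if l:{1..i} then lossy_Y b d n tg l else real_Y b d n l)" for i l :: nat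
 have Bx: "Bx (Y i) u l j = (if l:{1..i} then Bx (lossy_Y b d n tg) u l j else Bx (real_Y b d n) u l j)" for i u l j
  by (simp add: Bx_def Y_def)
 have B: "EX j:{1..length u}. Bx (Y i) u l j mod int ?p~=0" if u: "valid_id ?p d u" "\<not> prefix u tg" for i u l
 proof (cases "l:{1..i}")
  case True
  thus ?thesis unfolding Bx if_P[OF True] lossy_Y_def by (intro Bx_lossy_not_prefix[OF tg u])
 next
  case False
  have "1:{1..length u}" using u(1) by (auto simp: valid_id_def)
  thus ?thesis unfolding Bx if_not_P[OF False] real_Y_def using Bx_injective[OF u(1)] p by (intro bexI[of _ 1]) auto
 qed
 define G where "G i = pmf (avg_game b d n tg c M0 a (mexp (Y i))) True" for i
 have "EX B:Z. \<bar>G 0 - G n\<bar><=real n * (2 * pbdh_adv b B + 2 / ?p)"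
 proof (rule chain)
  show "Skip:Z" by (simp add: Z_def)
  fix i assume i: "i < n"
  have "EX B. cost B<=cost c + card {r. M0 r~=0} + red_bound d n (num_queries c) &
   \<bar>pmf (avg_game b d n tg c M0 a (mexp (Y i))) True - pmf (avg_game b d n tg c M0 a (mexp (Y (Suc i)))) True\<bar><=2 * pbdh_adv b B + 2 / ?p"
   by (rule bdh_step[OF b d tg, where ?l0.0 = "Suc i"]) (use i M0 B in "auto simp: Y_def le_Suc_eq")
  thus "EX B:Z. \<bar>G i - G (Suc i)\<bar><=2 * pbdh_adv b B + 2 / ?p" unfolding G_def Z_def by blast
 qed simp
 moreover have "Y 0 = real_Y b d n" by (simp add: Y_def fun_eq_iff)
 moreover have "avg_game b d n tg c M0 a (mexp (Y n)) = avg_game b d n tg c M0 a (mexp (lossy_Y b d n tg))"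
 proof -
  have "mexp (Y n) th m = mexp (lossy_Y b d n tg) th m" if "m:set (mitems d n)" for th m
   using set_mitemsD[OF that] by (elim disjE bexE conjE) (simp_all add: Y_def)
  thus ?thesis unfolding avg_game_def by (intro bind_pmf_cong refl fgame_cong[OF b]) simp_all
 qed
 ultimately show ?thesis unfolding G_def Z_def by auto
qed

section \<open>A generic distinguisher\<close>

text \<open>The words 0, 2, 3 and 7 are g, g^(ab), g^c and the last challenge word. As soon as g^c
  is recognized as g^j, that word is compared with the j-th power of g^(ab).\<close>

primrec table_ex :: "nat=>nat ex" where
 "table_ex 0 = EC 0"
| "table_ex (Suc j) = EI (eqx (EV 3) (EP GrpG (EV 0) (EC j))) (notx (eqx (EV 7) (EP GrpG (EV 2) (EC j)))) (table_ex j)"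

lemma esize_table_ex: "esize (table_ex m) = 34 * m + 1"
 by (induction m) (simp_all add: eqx_def notx_def)

lemma set_ex_table_ex: "set_ex (table_ex m)<={..<8}"
 by (induction m) (auto simp: eqx_def notx_def)

text \<open>On a genuine challenge the test accepts iff c < m; on a random one the last exponent
  must in addition hit x y c, which has probability 1 / p.\<close>

lemma table_test:
 assumes b: "bilinear_group b" and m: "m<=bg_p b"
 shows "EX B. cost B<=34 * m + 3 & pbdh_adv b B = real m / bg_p b * (1 - 1 / bg_p b)"
proof -
 let ?p = "bg_p b" and ?U = "unif (bg_p b)"
 note bg = bilinear_groups[OF b]
 interpret G: prime_group "bg_G b" ?p "bg_g b" by (rule bg(1))
 interpret H: prime_group "bg_H b" ?p "bg_h b" by (rule bg(2))
 have p0: "0 < ?p" using bg(4) by simp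
 have car: "G.ex i < 2 ^ bg_w b" for i
  using b G.ex_closed[of i] by (auto simp: bilinear_group_def word_group_def)
 have g1: "bg_g b = G.ex 1" using G.g G.group by (simp add: group.int_pow_1)
 define B :: algorithm where "B = par_assign [(0,table_ex m)] 8"
 have cost: "cost B<=34 * m + 3" by (simp add: B_def cost_par_assign esize_table_ex)
 have ev: "eval b (table_ex j) et~=0 <-> cc < j & int z mod int ?p = int r * int cc mod int ?p"
  if j: "j<=?p" and cc: "cc < ?p" and et: "et 0 = bg_g b" "et 2 = G.ex (int r)" "et 3 = G.ex (int cc)" "et 7 = G.ex (int z)" for et j cc r z
  using j
 proof (induction j)
  case 0
  thus ?case by simp
 next
  case (Suc j)
  have j: "j < ?p" "j < 2 ^ bg_w b" using Suc.prems bg(5) by simp_all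
  have gw: "bg_g b < 2 ^ bg_w b" using car[of 1] unfolding g1[symmetric] .
  have e: "eval b (EV 3 :: nat ex) et = G.ex (int cc)" "eval b (EV 7 :: nat ex) et = G.ex (int z)"
   using car by (simp_all add: et)
  have "eval b (EP GrpG (EV 0) (EC j) :: nat ex) et = bg_g b [^]\<^bsub>bg_G b\<^esub> j"
   using gw j(2) G.g by (simp add: et Let_def)
  moreover have "eval b (EP GrpG (EV 2) (EC j) :: nat ex) et = G.ex (int r) [^]\<^bsub>bg_G b\<^esub> j"
   using car j(2) by (simp add: et Let_def)
  ultimately have e': "eval b (EP GrpG (EV 0) (EC j) :: nat ex) et = G.ex (int j)" "eval b (EP GrpG (EV 2) (EC j) :: nat ex) et = G.ex (int r * int j)"
   unfolding G.g_pow G.ex_pow .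
  have c: "eval b (eqx (EV 3) (EP GrpG (EV 0) (EC j)) :: nat ex) et = 0 <-> cc = j"
   unfolding eval_bool(1)[OF bg(3,6)] e e' using cc j(1) by (simp add: G.ex_eq_iff)
  have t: "eval b (eqx (EV 7) (EP GrpG (EV 2) (EC j)) :: nat ex) et = 0 <-> int z mod int ?p = int r * int j mod int ?p"
   unfolding eval_bool(1)[OF bg(3,6)] e e' by (simp add: G.ex_eq_iff)
  have n: "0 < eval b (notx x) et <-> eval b x et = 0" for x :: "nat ex"
   unfolding neq0_conv[symmetric] eval_bool(2)[OF bg(3,6)] by (rule not_not)
  show ?case
  proof (cases "cc = j")
   case True
   hence "eval b (table_ex (Suc j)) et = eval b (notx (eqx (EV 7) (EP GrpG (EV 2) (EC j)))) et" using c by simp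
   thus ?thesis unfolding neq0_conv using n t True by (simp only: lessI simp_thms)
  next
   case False
   thus ?thesis using c Suc by auto
  qed
 qed
 define W where "W g = bind_pmf ?U (%x. bind_pmf ?U (%y. bind_pmf ?U (%cc. bind_pmf ?U (%z.
   return_pmf (cc < m & (if g then True else z = x * y * cc mod ?p))))))" for g
 have setU: "set_pmf ?U = {0..<?p}" unfolding unif_def by (rule set_pmf_of_set) (use p0 in auto)
 have acc: "accept_prob b B (pbdh_dist b g) = pmf (W g) True" for g
 proof -
  have "map_pmf out_bit (run_alg b B (store_words 0 [bg_g b,bg_g b [^]\<^bsub>bg_G b\<^esub> y,bg_g b [^]\<^bsub>bg_G b\<^esub> (x * y),bg_g b [^]\<^bsub>bg_G b\<^esub> cc,bg_h b,
    bg_h b [^]\<^bsub>bg_H b\<^esub> x,bg_h b [^]\<^bsub>bg_H b\<^esub> y,if g then bg_g b [^]\<^bsub>bg_G b\<^esub> (x * y * cc) else bg_g b [^]\<^bsub>bg_G b\<^esub> z] (%_. 0))) =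
    return_pmf (cc < m & (if g then True else z = x * y * cc mod ?p))"
   if cc: "cc:set_pmf ?U" "z:set_pmf ?U" for x y cc z :: nat
  proof -
   define M where "M = store_words 0 [bg_g b,bg_g b [^]\<^bsub>bg_G b\<^esub> y,bg_g b [^]\<^bsub>bg_G b\<^esub> (x * y),bg_g b [^]\<^bsub>bg_G b\<^esub> cc,bg_h b,
    bg_h b [^]\<^bsub>bg_H b\<^esub> x,bg_h b [^]\<^bsub>bg_H b\<^esub> y,if g then bg_g b [^]\<^bsub>bg_G b\<^esub> (x * y * cc) else bg_g b [^]\<^bsub>bg_G b\<^esub> z] (%_. 0)"
   have M: "M 0 = bg_g b" "M 2 = G.ex (int (x * y))" "M 3 = G.ex (int cc)" "M 7 = G.ex (int (if g then x * y * cc else z))"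
    by (simp_all add: M_def store_words_def G.g_pow)
   have "EX M'. exec b (%_ :: unit. return_pmf) (par_assign [(0,table_ex m)] 8) (M,()) = return_pmf (M',()) &
     (ALL r<8. M' r = (case map_of [(0,table_ex m)] r of Some e=>eval b e M | None=>M r))"
    by (rule exec_par_assign[OF bg(3)]) (use set_ex_table_ex in auto)
   then obtain M' where M': "exec b (%_. return_pmf) B (M,()) = return_pmf (M',())" "M' 0 = eval b (table_ex m) M" by (auto simp: B_def)
   have "out_bit M' <-> cc < m & int (if g then x * y * cc else z) mod int ?p = int (x * y) * int cc mod int ?p"
    unfolding out_bit_def M'(2) by (rule ev[OF m _ M]) (use cc setU in auto)
   also have "... <-> cc < m & (if g then True else z = x * y * cc mod ?p)"
    using cc setU by (auto simp flip: of_nat_mult of_nat_mod)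
   finally show ?thesis unfolding M_def[symmetric] run_alg_def M'(1) by simp
  qed
  hence "bind_pmf (pbdh_dist b g) (%ws. map_pmf out_bit (run_alg b B (store_words 0 ws (%_. 0)))) = W g"
   unfolding pbdh_dist_def Let_def bind_assoc_pmf bind_return_pmf W_def by (intro bind_pmf_cong refl) simp
  thus ?thesis unfolding accept_prob_eq by simp
 qed
 have real: "pmf (W True) True = real m / ?p"
 proof -
  have "W True = map_pmf (%cc. cc < m) ?U" by (simp add: W_def map_pmf_def)
  moreover have "{0..<?p} \<inter> (%cc. cc < m) -` {True} = {0..<m}" using m by (auto simp: vimage_def)
  moreover have ne: "{0..<?p}~={}" using p0 by simp
  ultimately show ?thesis unfolding unif_def by (simp only: pmf_map measure_pmf_of_set[OF ne finite_atLeastLessThan] card_atLeastLessThan diff_zero)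
 qed
 have rand: "pmf (W False) True = real m / (?p * ?p)"
 proof -
  have "pmf (bind_pmf ?U (%cc. bind_pmf ?U (%z. return_pmf (cc < m & z = x * y * cc mod ?p)))) True = real m / (?p * ?p)" for x y
  proof -
   have ne: "{0..<?p} \<times> {0..<?p}~={}" "finite ({0..<?p} \<times> {0..<?p})" using p0 by auto
   let ?f = "%(cc,z). cc < m & z = x * y * cc mod ?p"
   have "bind_pmf ?U (%cc. bind_pmf ?U (%z. return_pmf (cc < m & z = x * y * cc mod ?p))) = map_pmf ?f (pair_pmf ?U ?U)"
    by (simp add: pair_pmf_def map_pmf_def bind_assoc_pmf bind_return_pmf)
   also have "pair_pmf ?U ?U = pmf_of_set ({0..<?p} \<times> {0..<?p})"
   proof (rule pmf_eqI)
    fix w :: "nat \<times> nat"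
    show "pmf (pair_pmf ?U ?U) w = pmf (pmf_of_set ({0..<?p} \<times> {0..<?p})) w"
     using p0 by (cases w) (simp add: unif_def pmf_pair indicator_def)
   qed
   finally have eq: "bind_pmf ?U (%cc. bind_pmf ?U (%z. return_pmf (cc < m & z = x * y * cc mod ?p))) = map_pmf ?f (pmf_of_set ({0..<?p} \<times> {0..<?p}))" .
   have "pmf (bind_pmf ?U (%cc. bind_pmf ?U (%z. return_pmf (cc < m & z = x * y * cc mod ?p)))) True =
     measure (measure_pmf (pmf_of_set ({0..<?p} \<times> {0..<?p}))) (?f -` {True})"
    unfolding eq by (rule pmf_map)
   also have "... = card (({0..<?p} \<times> {0..<?p}) \<inter> ?f -` {True}) / card ({0..<?p} \<times> {0..<?p})"
    by (rule measure_pmf_of_set[OF ne])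
   also have "({0..<?p} \<times> {0..<?p}) \<inter> ?f -` {True} = (%cc. (cc,x * y * cc mod ?p)) ` {0..<m}"
   proof
    show "({0..<?p} \<times> {0..<?p}) \<inter> ?f -` {True}<=(%cc. (cc,x * y * cc mod ?p)) ` {0..<m}" by (force simp: vimage_def)
    have "cc < ?p" if "cc < m" for cc using that m by linarith
    thus "(%cc. (cc,x * y * cc mod ?p)) ` {0..<m}<=({0..<?p} \<times> {0..<?p}) \<inter> ?f -` {True}" using p0 by (simp add: image_subset_iff)
   qed
   also have "card ... = m" by (subst card_image) (auto simp: inj_on_def)
   finally show ?thesis by simp
  qed
  thus ?thesis unfolding W_def if_False by (simp add: pmf_bind)
 qed
 have "pbdh_adv b B = \<bar>real m / ?p - real m / (?p * ?p)\<bar>" unfolding pbdh_adv_def acc real rand ..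
 also have "real m / ?p - real m / (?p * ?p) = real m / ?p * (1 - 1 / ?p)" using p0 by (simp add: field_simps)
 also have "\<bar>...\<bar> = ..." using p0 by (intro abs_of_nonneg mult_nonneg_nonneg) auto
 finally show ?thesis using cost by blast
qed

section \<open>The advantage of a selective adversary\<close>

lemma xgame_nz:
 assumes p: "1 < bg_p b"
 shows "\<bar>pmf (xgame (unif_nz (bg_p b)) b d n tg c M a Y) True - pmf (xgame (unif (bg_p b)) b d n tg c M a Y) True\<bar>
  <=(card (SI d n) + num_queries c * card (RS d n)) / bg_p b"
proof -
 let ?p = "bg_p b"
 have Pi: "finite I ==> stat_dist_le (card I * (1 / ?p)) (Pi_pmf I 0 (%_. unif_nz ?p)) (Pi_pmf I 0 (%_. unif ?p))" for I :: "'i set"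
  by (rule stat_dist_le_Pi_pmf[OF _ _ stat_dist_le_unif_nz[OF p]]) auto
 have "stat_dist_le (card (SI d n) * (1 / ?p) + num_queries c * (card (RS d n) * (1 / ?p)))
   (xgame (unif_nz ?p) b d n tg c M a Y) (xgame (unif ?p) b d n tg c M a Y)"
  unfolding xgame_def
 proof (rule stat_dist_le_bind[OF Pi])
  fix th :: "sx=>nat"
  let ?wm = "mwords b d n (mexp Y (%x. int (th x)))" and ?W = "key_words b d n (sec_of (%x. int (th x)))"
  show "stat_dist_le (num_queries c * (card (RS d n) * (1 / ?p)))
    (kgame b d tg c M a ?wm (genK (unif_nz ?p) d n) (genD (unif_nz ?p) ?p d n) ?W)
    (kgame b d tg c M a ?wm (genK (unif ?p) d n) (genD (unif ?p) ?p d n) ?W)"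
   unfolding kgame_def genK_def genD_def
   by (intro stat_dist_le_map stat_dist_le_kenv_valid Pi) auto
 qed auto
 from stat_dist_leD[OF this] show ?thesis by (simp add: add_divide_distrib)
qed

text \<open>Without reveal queries keys can be exchanged at no cost, which accounts for the factor
  \<open>of_bool\<close>.\<close>

lemma xgame_fresh:
 fixes c :: "query com" and a :: reg
 assumes b: "bilinear_group b" and d: "d + 2 < bg_p b" "1<=d" and tg: "valid_id (bg_p b) d tg"
  and M0: "!!r. M0 r < 2 ^ bg_w b" "finite {r. M0 r~=0}"
 shows "EX B. cost B<=cost c + card {r. M0 r~=0} + red_bound d n (num_queries c) &
  \<bar>pmf (xgame (unif (bg_p b)) b d n tg c M0 a Y) True - pmf (avg_game b d n tg c M0 a (mexp Y)) True\<bar>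
  <=of_bool (num_reveals c~=0) * (4 * real d * (1 + real d) ^ 2) * ddh2_adv b B + real d * (4 * (1 + real d) ^ 2 + 2 * real n * real (num_queries c)) / real (bg_p b)"
proof -
 let ?p = "bg_p b"
 interpret G: prime_group "bg_G b" ?p "bg_g b" by (rule bilinear_groups(1)[OF b])
 define K where "K th = kgame b d tg c M0 a (mwords b d n (mexp Y th)) (genK (unif ?p) d n) (genD (unif ?p) ?p d n) (key_words b d n (sec_of th))" for th
 have x: "xgame (unif ?p) b d n tg c M0 a Y = bind_pmf (UI ?p (SI d n)) K"
  unfolding xgame_def UI_eq_map[OF finite_SI] bind_map_pmf K_def o_def ..
 obtain th where th: "\<bar>pmf (bind_pmf (UI ?p (SI d n)) K) True - pmf (avg_game b d n tg c M0 a (mexp Y)) True\<bar>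
   <=\<bar>pmf (K th) True - pmf (fgame b d n tg c M0 a th (mexp Y th)) True\<bar>"
  unfolding avg_game_def using pmf_bind_diff_attained[of "UI ?p (SI d n)" K True "%th. fgame b d n tg c M0 a th (mexp Y th)"] by metis
 have arith: "real d * (4 * (real d + 1) ^ 2 * y + z / w) = 4 * real d * (1 + real d) ^ 2 * y + real d * z / w" for y z w :: real
  unfolding add.commute[of 1 "real d"] by (simp add: distrib_left)
 show ?thesis
 proof (cases "num_reveals c = 0")
  case True
  have "K th = fgame b d n tg c M0 a th (mexp Y th)" unfolding K_def fgame_def by (rule kgame_no_reveals[OF True])
  thus ?thesis using th True unfolding x by (intro exI[of _ Skip]) simp
 next
  case False
  have car: "y < 2 ^ bg_w b" if "y:carrier (bg_G b)" for y
   using b that by (auto simp: bilinear_group_def word_group_def)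
  have len: "length (mwords b d n (mexp Y th))<=size_bound d n"
  proof -
   have "9 * (d + 1) ^ 2 * (n + 1) ^ 2<=size_bound d n" unfolding size_bound_def by (intro mult_right_mono) auto
   thus ?thesis using length_mitems[of d n] by (simp add: mwords_def)
  qed
  have w: "y < 2 ^ bg_w b" if "y:set (mwords b d n (mexp Y th))" for y
   using that car by (auto simp: mwords_def)
  obtain B where B: "cost B<=cost c + card {r. M0 r~=0} + red_bound d n (num_queries c)"
   "\<bar>pmf (K th) True - pmf (fgame b d n tg c M0 a th (mexp Y th)) True\<bar><=real d * (4 * (real d + 1) ^ 2 * ddh2_adv b B + (4 * (1 + real d) ^ 2 + 2 * real n * real (num_queries c)) / real ?p)"
   using ddh_part[where wm = "mwords b d n (mexp Y th)", OF b d tg M0 w len, of c a "sec_of th"] unfolding K_def fgame_def by auto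
  have "\<bar>pmf (bind_pmf (UI ?p (SI d n)) K) True - pmf (avg_game b d n tg c M0 a (mexp Y)) True\<bar>
   <=real d * (4 * (real d + 1) ^ 2 * ddh2_adv b B + (4 * (1 + real d) ^ 2 + 2 * real n * real (num_queries c)) / real ?p)" using th B(2) by linarith
  also have "... = 4 * real d * (1 + real d) ^ 2 * ddh2_adv b B + real d * (4 * (1 + real d) ^ 2 + 2 * real n * real (num_queries c)) / real ?p"
   by (rule arith)
  finally show ?thesis using B(1) False unfolding x by (intro exI[of _ B] conjI) simp_all
 qed
qed

text \<open>The collected statistical error, times p: for each of the two games the passage to
  uniform exponents and the end of each level of delegation, and 2 for each coordinate of the BDH
  part.\<close>

definition stat :: "nat=>nat=>nat=>nat" where
 "stat d n Q = 2 * (card (SI d n) + Q * card (RS d n)) + 2 * (d * (4 * (d + 1) ^ 2 + 2 * n * Q)) + 2 * n"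

lemma xgame_bound:
 fixes c :: "query com" and a :: reg and n :: nat
 assumes b: "bilinear_group b" and d: "d + 2 < bg_p b" "1<=d" and tg: "valid_id (bg_p b) d tg"
  and M0: "!!r. M0 r < 2 ^ bg_w b" "finite {r. M0 r~=0}"
 defines "C \<equiv> cost c + card {r. M0 r~=0} + red_bound d n (num_queries c)"
 shows "EX B1 B2. cost B1<=C & cost B2<=C &
  \<bar>pmf (xgame (unif_nz (bg_p b)) b d n tg c M0 a (real_Y b d n)) True - pmf (xgame (unif_nz (bg_p b)) b d n tg c M0 a (lossy_Y b d n tg)) True\<bar>
  <=2 * real n * pbdh_adv b B1 + of_bool (num_reveals c~=0) * (8 * real d * (1 + real d) ^ 2) * ddh2_adv b B2 + real (stat d n (num_queries c)) / real (bg_p b)"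
proof -
 let ?p = "bg_p b" and ?r = "of_bool (num_reveals c~=0) :: real" and ?Q = "num_queries c"
 have p: "1 < ?p" by (rule bilinear_groups(4)[OF b])
 define X where "X P Y = pmf (xgame P b d n tg c M0 a Y) True" for P Y
 define F where "F Y = pmf (avg_game b d n tg c M0 a (mexp Y)) True" for Y
 define e1 e2 where "e1 = real (card (SI d n) + ?Q * card (RS d n)) / ?p" and "e2 = real (d * (4 * (d + 1) ^ 2 + 2 * n * ?Q)) / ?p"
 define N where "N = 4 * real d * (1 + real d) ^ 2"
 have nz: "\<bar>X (unif_nz ?p) Y - X (unif ?p) Y\<bar><=e1" for Y unfolding X_def e1_def by (rule xgame_nz[OF p])
 have fr: "EX B. cost B<=C & \<bar>X (unif ?p) Y - F Y\<bar><=?r * N * ddh2_adv b B + e2" for Y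
 proof -
  obtain B where "cost B<=C" "\<bar>X (unif ?p) Y - F Y\<bar><=?r * (4 * real d * (1 + real d) ^ 2) * ddh2_adv b B + real d * (4 * (1 + real d) ^ 2 + 2 * real n * real ?Q) / real ?p"
   using xgame_fresh[OF b d tg M0, of c n a Y] unfolding X_def F_def C_def by (elim exE conjE)
  moreover have "e2 = real d * (4 * (1 + real d) ^ 2 + 2 * real n * real ?Q) / real ?p" by (simp add: e2_def)
  ultimately show ?thesis by (intro exI[of _ B]) (simp add: N_def)
 qed
 obtain D where D: "cost D<=C" "\<bar>X (unif ?p) (real_Y b d n) - F (real_Y b d n)\<bar><=?r * N * ddh2_adv b D + e2" using fr by blast
 obtain D' where D': "cost D'<=C" "\<bar>X (unif ?p) (lossy_Y b d n tg) - F (lossy_Y b d n tg)\<bar><=?r * N * ddh2_adv b D' + e2" using fr by blast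
 define D2 where "D2 = (if ddh2_adv b D<=ddh2_adv b D' then D' else D)"
 have N0: "0<=N" by (simp add: N_def)
 have D2: "cost D2<=C" "?r * N * ddh2_adv b D<=?r * N * ddh2_adv b D2" "?r * N * ddh2_adv b D'<=?r * N * ddh2_adv b D2"
  using D(1) D'(1) by (auto simp: D2_def intro!: mult_left_mono N0)
 obtain B where B: "cost B<=C" "\<bar>F (real_Y b d n) - F (lossy_Y b d n tg)\<bar><=n * (2 * pbdh_adv b B + 2 / ?p)"
  using bdh_part[OF b d(1) tg M0, of c n a] unfolding F_def C_def by blast
 have "\<bar>X (unif_nz ?p) (real_Y b d n) - X (unif_nz ?p) (lossy_Y b d n tg)\<bar> <=
   2 * e1 + 2 * (?r * N * ddh2_adv b D2) + 2 * e2 + n * (2 * pbdh_adv b B + 2 / ?p)"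
  using nz[of "real_Y b d n"] nz[of "lossy_Y b d n tg"] D(2) D'(2) D2(2,3) B(2) by linarith
 also have "... = 2 * real n * pbdh_adv b B + ?r * (8 * real d * (1 + real d) ^ 2) * ddh2_adv b D2 + real (stat d n ?Q) / real ?p"
 proof -
  have "real (stat d n ?Q) / real ?p = 2 * e1 + 2 * e2 + n * (2 / ?p)"
  proof -
   define u w where "u = card (SI d n) + ?Q * card (RS d n)" and "w = d * (4 * (d + 1) ^ 2 + 2 * n * ?Q)"
   show ?thesis unfolding e1_def e2_def stat_def u_def[symmetric] w_def[symmetric] by (simp add: add_divide_distrib)
  qed
  thus ?thesis by (simp add: N_def distrib_left)
 qed
 finally show ?thesis using B(1) D2(1) unfolding X_def by (intro exI[of _ B] exI[of _ D2] conjI)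
qed

section \<open>Polynomial bounds and negligible functions\<close>

text \<open>The base is at least 2, so that constants and sums are absorbed by raising the
  exponent.\<close>

definition poly2 :: "(nat=>nat=>nat)=>bool" where
 "poly2 f <-> (EX c. ALL k Q. f k Q<=(k + Q + 2) ^ c)"

lemma poly2_mono: "poly2 g ==> (!!k Q. f k Q<=g k Q) ==> poly2 f"
 unfolding poly2_def by (meson order_trans)

lemma le_two_power: "c<=(k + Q + 2 :: nat) ^ c"
proof -
 have "c<=2 ^ c" by (simp add: less_imp_le)
 also have "(2 :: nat) ^ c<=(k + Q + 2) ^ c" by (intro power_mono) auto
 finally show ?thesis .
qed

lemma poly2_const: "poly2 (%k Q. c)"
 unfolding poly2_def using le_two_power by blast

lemma poly2_snd: "poly2 (%k Q. Q)"
 unfolding poly2_def by (intro exI[of _ 1]) simp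

lemma poly2_add: "poly2 f ==> poly2 g ==> poly2 (%k Q. f k Q + g k Q)"
proof -
 assume "poly2 f" "poly2 g"
 then obtain c c' where f: "!!k Q. f k Q<=(k + Q + 2) ^ c" and g: "!!k Q. g k Q<=(k + Q + 2) ^ c'" unfolding poly2_def by blast
 have "f k Q + g k Q<=(k + Q + 2) ^ (1 + c + c')" for k Q
 proof -
  have "f k Q + g k Q<=(k + Q + 2) ^ (c + c') + (k + Q + 2) ^ (c + c')"
   by (intro add_mono order_trans[OF f] order_trans[OF g] power_increasing) auto
  also have "...<=(k + Q + 2) * (k + Q + 2) ^ (c + c')" by simp
  finally show ?thesis by simp
 qed
 thus ?thesis unfolding poly2_def by blast
qed

lemma poly2_mult: "poly2 f ==> poly2 g ==> poly2 (%k Q. f k Q * g k Q)"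
proof -
 assume "poly2 f" "poly2 g"
 then obtain c c' where f: "!!k Q. f k Q<=(k + Q + 2) ^ c" and g: "!!k Q. g k Q<=(k + Q + 2) ^ c'" unfolding poly2_def by blast
 have "f k Q * g k Q<=(k + Q + 2) ^ (c + c')" for k Q unfolding power_add by (intro mult_mono f g) auto
 thus ?thesis unfolding poly2_def by blast
qed

lemma poly2_power: "poly2 f ==> poly2 (%k Q. f k Q ^ e)"
 by (induction e) (auto intro: poly2_mult poly2_const)

lemma poly2_poly_bounded: "poly_bounded f ==> poly2 (%k Q. f k)"
proof -
 assume "poly_bounded f"
 then obtain c where f: "!!k. f k<=k ^ c + c" unfolding poly_bounded_def by blast
 have "f k<=(k + Q + 2) ^ (c + 1)" for k Q
 proof -
  have "f k<=(k + Q + 2) ^ c + (k + Q + 2) ^ c"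
   by (intro order_trans[OF f] add_mono power_mono le_two_power) auto
  also have "...<=(k + Q + 2) * (k + Q + 2) ^ c" by simp
  finally show ?thesis by simp
 qed
 thus ?thesis unfolding poly2_def by blast
qed

lemma poly2_bound: "poly2 f ==> EX c. ALL k Q. f k Q<=(k + Q) ^ c + c"
proof -
 assume "poly2 f"
 then obtain c where f: "!!k Q. f k Q<=(k + Q + 2) ^ c" unfolding poly2_def by blast
 have "f k Q<=(k + Q) ^ (2 * c + 3 ^ c) + (2 * c + 3 ^ c)" for k Q
 \<comment> \<open>Powers of \<open>k + Q\<close> do not grow for \<open>k + Q <= 1\<close>, where
   the constant \<open>3 ^ c\<close> takes over. Otherwise \<open>k + Q + 2\<close> is at most the
   square of \<open>k + Q\<close>.\<close>
 proof (cases "k + Q<=1")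
  case True
  hence "(k + Q + 2) ^ c<=3 ^ c" by (intro power_mono) auto
  thus ?thesis using f[of k Q] by linarith
 next
  case False
  hence X: "2<=k + Q" by simp
  have "k + Q + 2<=(k + Q) * 2" using X by simp
  also have "...<=(k + Q) * (k + Q)" using X by (intro mult_left_mono) auto
  finally have "(k + Q + 2) ^ c<=((k + Q) ^ 2) ^ c" by (intro power_mono) (auto simp: power2_eq_square)
  also have "... = (k + Q) ^ (2 * c)" by (simp add: power_mult)
  also have "...<=(k + Q) ^ (2 * c + 3 ^ c)" using X by (intro power_increasing) auto
  finally show ?thesis using f[of k Q] by linarith
 qed
 thus ?thesis by blast
qed

lemma poly_bounded_poly2: "poly2 f ==> poly_bounded g ==> poly_bounded (%k. f k (g k))"
proof -
 assume "poly2 f" and g: "poly_bounded g"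
 then obtain c where f: "!!k Q. f k Q<=(k + Q + 2) ^ c" unfolding poly2_def by blast
 have "poly2 (%k Q. k)" unfolding poly2_def by (intro exI[of _ 1]) simp
 hence "poly2 (%k Q. (k + g k + 2) ^ c)" by (intro poly2_power poly2_add poly2_poly_bounded[OF g] poly2_const)
 from poly2_bound[OF poly2_mono[OF this, of "%k Q. f k (g k)"]] f
 obtain e where "!!k Q :: nat. f k (g k)<=(k + Q) ^ e + e" by blast
 from this[of _ 0] show ?thesis unfolding poly_bounded_def by auto
qed

lemma negligible_poly_bound:
 fixes f g h :: "nat=>real" and u :: "nat=>nat"
 assumes f: "negligible f" and g: "negligible g" and u: "poly_bounded u" and nonneg: "!!k. 0<=h k" and h: "!!k. h k<=real (u k) * (f k + g k)"
 shows "negligible h"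
 unfolding negligible_def
proof
 fix c :: nat
 obtain e where e: "!!k. u k<=k ^ e + e" using u unfolding poly_bounded_def by blast
 \<comment> \<open>\<open>e + 1\<close> pays for the factor \<open>u\<close>, and 1 more for the 2
   that comes from adding two negligible functions.\<close>
 let ?c = "c + e + 2"
 have "\<forall>\<^sub>F k in sequentially. \<bar>f k\<bar> < 1 / real k ^ ?c" "\<forall>\<^sub>F k in sequentially. \<bar>g k\<bar> < 1 / real k ^ ?c"
  using f g unfolding negligible_def by blast+
 thus "\<forall>\<^sub>F k in sequentially. \<bar>h k\<bar> < 1 / real k ^ c"
  using eventually_ge_at_top[of 2]
 proof eventually_elim
  case (elim k)
  have "e<=k ^ e"
  proof -
   have "e<=2 ^ e" by (simp add: less_imp_le)
   also have "(2 :: nat) ^ e<=k ^ e" using elim(3) by (intro power_mono) auto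
   finally show ?thesis .
  qed
  hence "u k<=2 * k ^ e" using e[of k] by linarith
  also have "...<=k * k ^ e" using elim(3) by (intro mult_right_mono) auto
  finally have "u k<=k ^ (e + 1)" by simp
  hence uk: "real (u k)<=real k ^ (e + 1)" by (simp flip: of_nat_power of_nat_mult power_Suc)
  have pos: "0 < real k ^ ?c" "0 < real k ^ (e + 1)" "0 < real k ^ c" using elim(3) by auto
  have "\<bar>h k\<bar><=real (u k) * (\<bar>f k\<bar> + \<bar>g k\<bar>)"
   using nonneg[of k] h[of k] by (smt (verit) mult_left_mono of_nat_0_le_iff)
  also have "...<=real k ^ (e + 1) * (\<bar>f k\<bar> + \<bar>g k\<bar>)" using uk by (intro mult_right_mono) auto
  also have "... < real k ^ (e + 1) * (1 / real k ^ ?c + 1 / real k ^ ?c)" using elim(1,2) pos(2) by (intro mult_strict_left_mono add_strict_mono) auto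
  also have "... = 2 / (real k ^ c * real k)" using elim(3) by (simp add: power_add field_simps power2_eq_square)
  also have "...<=real k / (real k ^ c * real k)" using elim(3) by (intro divide_right_mono) auto
  also have "... = 1 / real k ^ c" using elim(3) by simp
  finally show ?case .
 qed
qed

lemma card_SI: "card (SI d n)<=1 + n + 3 * d * n + n"
proof -
 have eq: "{SH i k l | i k l. i:{1..d} & k:{0..2} & l:{1..n}} = (%(i,k,l). SH i k l) ` ({1..d} \<times> {0..2} \<times> {1..n})"
  by (auto simp: image_iff)
 have "card (SI d n)<=card {SV} + card (SW ` {1..n}) + card ((%(i,k,l). SH i k l) ` ({1..d} \<times> {0..2::nat} \<times> {1..n})) + card (SS ` {1..n})"
  unfolding SI_def eq by (intro order_trans[OF card_Un_le] add_mono order_refl)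
 also have "...<=1 + card {1..n} + card ({1..d} \<times> {0..2::nat} \<times> {1..n}) + card {1..n}"
  by (intro add_mono card_image_le) auto
 also have "... = 1 + n + 3 * d * n + n" by (simp add: card_cartesian_product)
 finally show ?thesis .
qed

lemma poly2_red_bound:
 assumes "poly_bounded n"
 shows "poly2 (%k Q. red_bound d (n k) Q)"
 unfolding red_bound_def sim_bound_def size_bound_def
 by (intro poly2_add poly2_mult poly2_power poly2_const poly2_snd poly2_poly_bounded[OF assms])

lemma poly2_stat:
 assumes "poly_bounded n"
 shows "poly2 (%k Q. stat d (n k) Q)"
proof (rule poly2_mono)
 show "stat d (n k) Q<=2 * ((1 + n k + 3 * d * n k + n k) + Q * (11 * (d + 1) ^ 2 * n k)) + 2 * (d * (4 * (d + 1) ^ 2 + 2 * n k * Q)) + 2 * n k" for k Q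
  unfolding stat_def by (intro add_mono mult_left_mono card_SI card_RS order_refl) auto
 show "poly2 (%k Q. 2 * ((1 + n k + 3 * d * n k + n k) + Q * (11 * (d + 1) ^ 2 * n k)) + 2 * (d * (4 * (d + 1) ^ 2 + 2 * n k * Q)) + 2 * n k)"
  by (intro poly2_add poly2_mult poly2_power poly2_const poly2_snd poly2_poly_bounded[OF assms])
qed

section \<open>Partial lossiness\<close>

text \<open>If \<open>p\<close> is at most this constant, the generic distinguisher has constant size.\<close>

definition small_order :: "nat=>nat" where
 "small_order d = d + 2 + 2 ^ (8 * d * (d + 1) ^ 2)"

text \<open>The last two summands are the cost of the lookup test with the largest table that will
  be used.\<close>

definition cost_bound :: "nat=>nat=>nat=>nat" where
 "cost_bound d n Q = red_bound d n Q + 34 * (small_order d + 2 * stat d n Q) + 3"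

lemma prob_fst_snd:
 "\<P>(x in measure_pmf (map_pmf (%x. (x,True)) R). fst x & snd x) = pmf R True"
 "\<P>(x in measure_pmf (map_pmf (%x. (x,True)) R). fst x) = pmf R True"
 "\<P>(x in measure_pmf (map_pmf (%x. (x,True)) R). snd x) = 1"
proof -
 have "(%x. (x,True)) -` {x. fst x & snd x} = {True}" "(%x. (x,True)) -` {x. fst x} = {True}" "(%x. (x,True)) -` {x :: bool \<times> bool. snd x} = UNIV"
  by auto
 thus "\<P>(x in measure_pmf (map_pmf (%x. (x,True)) R). fst x & snd x) = pmf R True"
  "\<P>(x in measure_pmf (map_pmf (%x. (x,True)) R). fst x) = pmf R True"
  "\<P>(x in measure_pmf (map_pmf (%x. (x,True)) R). snd x) = 1"
  by (simp_all add: measure_pmf_single)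
qed

lemma lossy_adv_bound:
 assumes b: "bilinear_group (bg k)" and d: "1<=d" and n: "real (n k) > log 2 (real (bg_p (bg k)))"
  and rv: "rv = real (n k) - log 2 (real (bg_p (bg k)))" and sel: "selective_adversary (HF bg n d) k A"
 shows "EX B1 B2. lossy_adv (HF bg n d) LHF trivial_pre_output rv k A <=
   real (n k) * ((2 * real d + 1) * pbdh_adv (bg k) B1 + real (num_reveals (adv_attack A)) * ddh2_adv (bg k) B2) &
  cost B1<=adv_cost A + cost_bound d (n k) (num_queries (adv_attack A)) & cost B2<=adv_cost A + cost_bound d (n k) (num_queries (adv_attack A))"
proof -
 define b nn Q q where "b = bg k" "nn = n k" "Q = num_queries (adv_attack A)" "q = num_reveals (adv_attack A)"
 let ?p = "bg_p b" and ?pms = "the_pms b d nn"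
 note b = b[folded b_nn_Q_q_def] and n = n[folded b_nn_Q_q_def]
 note bg = bilinear_groups[OF b]
 define X where "X lossy M = (let tg = target_ident ?pms A M in
   xgame (unif_nz ?p) b d nn tg (adv_attack A) M (adv_mpk A) (if lossy then lossy_Y b d nn tg else real_Y b d nn))" for lossy M
 define L where "L = lossy_adv (HF bg n d) LHF trivial_pre_output rv k A"
 have L: "L = \<bar>pmf (bind_pmf (choose_stage ?pms A) (X False)) True - pmf (bind_pmf (choose_stage ?pms A) (X True)) True\<bar>"
  unfolding L_def lossy_adv_def experiment_eq[OF b[unfolded b_nn_Q_q_def] sel rv, folded b_nn_Q_q_def, folded X_def] prob_fst_snd by (simp add: X_def[abs_def])
 have L1: "L<=1" unfolding L
  using pmf_nonneg[of "bind_pmf (choose_stage ?pms A) (X False)" True] pmf_le_1[of "bind_pmf (choose_stage ?pms A) (X False)" True]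
   pmf_nonneg[of "bind_pmf (choose_stage ?pms A) (X True)" True] pmf_le_1[of "bind_pmf (choose_stage ?pms A) (X True)" True] by linarith
 have p: "1 < real ?p" using bg(4) by simp
 have nn1: "1<=real nn"
 proof -
  have "0 < log 2 (real ?p)" using p by simp
  hence "0 < nn" using n by linarith
  thus ?thesis by simp
 qed
 have d3: "3<=2 * real d + 1" using d by simp
 \<comment> \<open>Twice \<open>stat\<close>, because the advantage of a table of size m is only
   known to be at least half of m / p.\<close>
 define m where "m = min ?p (small_order d + 2 * stat d nn Q)"
 obtain T where T: "cost T<=34 * m + 3" "pbdh_adv b T = real m / ?p * (1 - 1 / ?p)" using table_test[OF b, of m] by (auto simp: m_def)
 have "m<=small_order d + 2 * stat d nn Q" by (simp add: m_def)
 hence "34 * m<=34 * (small_order d + 2 * stat d nn Q)" by (rule mult_left_mono) simp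
 hence "34 * m + 3<=cost_bound d nn Q" unfolding cost_bound_def by (simp del: add_mult_distrib2)
 hence cT: "cost T<=adv_cost A + cost_bound d nn Q" using T(1) by linarith
 have half: "1 / 2<=1 - 1 / real ?p" using bg(4) by (simp add: field_simps)
 show ?thesis
  unfolding L_def[symmetric] b_nn_Q_q_def[symmetric]
 proof (cases "m = ?p")
  \<comment> \<open>The table contains all powers. The test then has advantage at least 1 / 2, and
    the factor \<open>2 * d + 1 >= 3\<close> lifts the bound above 1, the trivial bound on
    \<open>L\<close>.\<close>
  case True
  hence "1 / 2<=pbdh_adv b T" using T(2) half p by simp
  hence "3 * (1 / 2)<=(2 * real d + 1) * pbdh_adv b T" using d3 by (intro mult_mono) auto
  hence "1 * (3 * (1 / 2))<=real nn * ((2 * real d + 1) * pbdh_adv b T + real q * ddh2_adv b Skip)"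
   using nn1 ddh2_adv_nonneg[of b Skip] by (intro mult_mono) (auto intro: add_increasing2)
  hence "L<=real nn * ((2 * real d + 1) * pbdh_adv b T + real q * ddh2_adv b Skip)" using L1 by linarith
  thus "EX B1 B2. L<=real nn * ((2 * real d + 1) * pbdh_adv b B1 + real q * ddh2_adv b B2) &
    cost B1<=adv_cost A + cost_bound d nn Q & cost B2<=adv_cost A + cost_bound d nn Q"
   using cT by (intro exI[of _ T] exI[of _ Skip]) simp
 next
  case False
  hence m: "m = small_order d + 2 * stat d nn Q" "small_order d < ?p" by (auto simp: m_def)
  hence d2: "d + 2 < ?p" and p2: "2 ^ (8 * d * (d + 1) ^ 2) < ?p" by (auto simp: small_order_def)
  \<comment> \<open>The left side is twice the number of DDH steps; since \<open>n\<close> exceeds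
    \<open>log 2 p\<close>, an order above \<open>2 ^ (8 * d * (d + 1) ^ 2)\<close> forces
    \<open>n\<close> above it.\<close>
  have big: "8 * real d * (1 + real d) ^ 2<=real nn"
  proof -
   have "real (8 * d * (d + 1) ^ 2) = log 2 (real (2 ^ (8 * d * (d + 1) ^ 2)))" by simp
   also have "...<=log 2 (real ?p)" using p2 by (intro log_mono) (auto simp del: of_nat_power)
   finally show ?thesis using n by simp
  qed
  obtain M where M: "M:set_pmf (choose_stage ?pms A)" "L<=\<bar>pmf (X False M) True - pmf (X True M) True\<bar>"
   using pmf_bind_diff_attained[of "choose_stage ?pms A" "X False" True "X True"] unfolding L by metis
  define tg where "tg = target_ident ?pms A M"
  have tg: "valid_id ?p d tg"
  proof -
   have "tg:IdSp ?pms"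
    using sel M(1) unfolding selective_adversary_def tg_def by (simp add: HF_def the_params_def b_nn_Q_q_def)
   thus ?thesis by (auto simp: IdSp_def valid_id_def Sigma_ID_def)
  qed
  let ?M0 = "store_words 0 (pms_words ?pms) (%_. 0)"
  have Mr: "M:set_pmf (run_alg b (adv_choose A) ?M0)" using M(1) by (simp add: choose_stage_def)
  have "wordmem b M"
  proof (rule wordmem_run_alg[OF bg(3) _ Mr])
   have "bg_g b < 2 ^ bg_w b" "bg_h b < 2 ^ bg_w b" using b by (auto simp: bilinear_group_def word_group_def)
   thus "wordmem b ?M0" using bg(5) by (auto simp: wordmem_def store_words_def pms_words_def less_Suc_eq)
  qed
  hence Mw: "!!r. M r < 2 ^ bg_w b" by (simp add: wordmem_def)
  have sub: "{r. M r~=0}<={r. M r~=?M0 r} Un {..<3}" by (auto simp: store_words_def pms_words_def)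
  note ch = card_changed_run_alg[OF Mr]
  have fin: "finite {r. M r~=0}" using sub by (rule finite_subset) (use ch in simp)
  have "card {r. M r~=0}<=card ({r. M r~=?M0 r} Un {..<3})" using sub ch by (intro card_mono) auto
  also have "...<=cost (adv_choose A) + 3" using ch by (intro order_trans[OF card_Un_le]) simp
  finally have cM: "cost (adv_attack A) + card {r. M r~=0} + red_bound d nn Q<=adv_cost A + cost_bound d nn Q"
   by (simp add: adv_cost_def cost_bound_def)
  obtain B D where BD: "cost B<=adv_cost A + cost_bound d nn Q" "cost D<=adv_cost A + cost_bound d nn Q"
   and le: "L<=2 * real nn * pbdh_adv b B + of_bool (q~=0) * (8 * real d * (1 + real d) ^ 2) * ddh2_adv b D + real (stat d nn Q) / real ?p"
  proof -
   have "EX B1 B2. cost B1<=cost (adv_attack A) + card {r. M r~=0} + red_bound d nn Q &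
     cost B2<=cost (adv_attack A) + card {r. M r~=0} + red_bound d nn Q &
     \<bar>pmf (X False M) True - pmf (X True M) True\<bar><=2 * real nn * pbdh_adv b B1 + of_bool (q~=0) * (8 * real d * (1 + real d) ^ 2) * ddh2_adv b B2 + real (stat d nn Q) / real ?p"
    unfolding X_def Let_def tg_def[symmetric] if_True if_False b_nn_Q_q_def(3,4)
    by (rule xgame_bound[OF b d2 d tg Mw fin])
   then obtain B1 B2 where B: "cost B1<=cost (adv_attack A) + card {r. M r~=0} + red_bound d nn Q"
     "cost B2<=cost (adv_attack A) + card {r. M r~=0} + red_bound d nn Q"
     "\<bar>pmf (X False M) True - pmf (X True M) True\<bar><=2 * real nn * pbdh_adv b B1 + of_bool (q~=0) * (8 * real d * (1 + real d) ^ 2) * ddh2_adv b B2 + real (stat d nn Q) / real ?p"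
    by (elim exE conjE)
   from that[OF le_trans[OF B(1) cM] le_trans[OF B(2) cM] order_trans[OF M(2) B(3)]] show thesis .
  qed
  define B1 where "B1 = (if pbdh_adv b B<=pbdh_adv b T then T else B)"
  have B1: "pbdh_adv b B<=pbdh_adv b B1" "pbdh_adv b T<=pbdh_adv b B1" "cost B1<=adv_cost A + cost_bound d nn Q"
   using BD(1) cT by (auto simp: B1_def)
  have st: "real (stat d nn Q) / ?p<=real nn * pbdh_adv b B1"
  proof -
   have "real (stat d nn Q) / ?p = 2 * real (stat d nn Q) / ?p * (1 / 2)" by simp
   also have "...<=real m / ?p * (1 - 1 / ?p)" using half by (intro mult_mono divide_right_mono) (auto simp: m)
   also have "...<=pbdh_adv b B1" using B1(2) T(2) by simp
   also have "...<=real nn * pbdh_adv b B1" using nn1 pbdh_adv_nonneg[of b B1] by (simp add: mult_le_cancel_right1)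
   finally show ?thesis .
  qed
  have r: "of_bool (q~=0) * (8 * real d * (1 + real d) ^ 2) * ddh2_adv b D<=real nn * (real q * ddh2_adv b D)"
  proof (cases "q = 0")
   case False
   hence "8 * real d * (1 + real d) ^ 2 * 1<=real nn * real q" using big by (intro mult_mono) auto
   hence "8 * real d * (1 + real d) ^ 2 * 1 * ddh2_adv b D<=real nn * real q * ddh2_adv b D" by (intro mult_right_mono ddh2_adv_nonneg)
   thus ?thesis using False by (simp add: mult.assoc)
  qed simp
  have "2 * real nn * pbdh_adv b B<=2 * real nn * pbdh_adv b B1" using B1(1) by (intro mult_left_mono) auto
  \<comment> \<open>Two of the three multiples stem from the BDH hops, the third from the
    statistical error; \<open>d >= 1\<close> gives \<open>3 <= 2 * d + 1\<close>.\<close>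
  hence "L<=3 * (real nn * pbdh_adv b B1) + real nn * (real q * ddh2_adv b D)" using le st r by linarith
  also have "...<=(2 * real d + 1) * (real nn * pbdh_adv b B1) + real nn * (real q * ddh2_adv b D)"
   using d3 pbdh_adv_nonneg[of b B1] by (intro add_right_mono mult_right_mono) auto
  also have "... = real nn * ((2 * real d + 1) * pbdh_adv b B1 + real q * ddh2_adv b D)" by (simp add: algebra_simps)
  finally show "EX B1 B2. L<=real nn * ((2 * real d + 1) * pbdh_adv b B1 + real q * ddh2_adv b B2) &
    cost B1<=adv_cost A + cost_bound d nn Q & cost B2<=adv_cost A + cost_bound d nn Q"
   using B1(3) BD(2) by (intro exI[of _ B1] exI[of _ D] conjI)
 qed
qed

theorem theorem4:
  fixes bg :: "nat \<Rightarrow> bgroup" and n :: "nat \<Rightarrow> nat" and d :: nat and \<omega> :: "nat \<Rightarrow> real"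
  assumes "bilinear_family bg"
    and "pbdh_assumption bg"
    and "ddh2_assumption bg"
    and "poly_bounded n"
    and "1 \<le> d"
    and "\<And>k. real (n k) > log 2 (real (bg_p (bg k)))"
    and "\<And>k. \<omega> k = real (n k) - log 2 (real (bg_p (bg k)))"
  shows "partially_lossy_with (HF bg n d) LHF (\<lambda>\<zeta>. trivial_pre_output) \<omega> (\<lambda>k. 1) \<and>
    (\<exists>c. \<forall>k A. selective_adversary (HF bg n d) k A \<longrightarrow>
      (\<exists>B1 B2.
        lossy_adv (HF bg n d) LHF trivial_pre_output (\<omega> k) k A
          \<le> real (n k) * ((2 * real d + 1) * pbdh_adv (bg k) B1
               + real (num_reveals (adv_attack A)) * ddh2_adv (bg k) B2) \<and>
        cost B1 \<le> adv_cost A + (k + num_queries (adv_attack A)) ^ c + c \<and>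
        cost B2 \<le> adv_cost A + (k + num_queries (adv_attack A)) ^ c + c))"
proof
 have b: "bilinear_group (bg k)" for k using assms(1) by (simp add: bilinear_family_def)
 have poly: "poly2 (%k Q. cost_bound d (n k) Q)"
  unfolding cost_bound_def by (intro poly2_add poly2_mult poly2_const poly2_red_bound poly2_stat assms(4))
 note bound = lossy_adv_bound[where bg = bg and n = n and k = k and rv = "\<omega> k" for k, OF b assms(5-7)]
 show "EX c. ALL k A. selective_adversary (HF bg n d) k A -->
   (EX B1 B2.
    lossy_adv (HF bg n d) LHF trivial_pre_output (\<omega> k) k A
     <=real (n k) * ((2 * real d + 1) * pbdh_adv (bg k) B1
      + real (num_reveals (adv_attack A)) * ddh2_adv (bg k) B2) &
    cost B1<=adv_cost A + (k + num_queries (adv_attack A)) ^ c + c &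
    cost B2<=adv_cost A + (k + num_queries (adv_attack A)) ^ c + c)"
 proof -
  obtain c where c: "!!k Q. cost_bound d (n k) Q<=(k + Q) ^ c + c" using poly2_bound[OF poly] by blast
  show ?thesis
  proof (intro exI[of _ c] allI impI)
   fix k A assume "selective_adversary (HF bg n d) k A"
   from bound[OF this] obtain B1 B2 where B: "lossy_adv (HF bg n d) LHF trivial_pre_output (\<omega> k) k A
     <=real (n k) * ((2 * real d + 1) * pbdh_adv (bg k) B1 + real (num_reveals (adv_attack A)) * ddh2_adv (bg k) B2)"
    "cost B1<=adv_cost A + cost_bound d (n k) (num_queries (adv_attack A))"
    "cost B2<=adv_cost A + cost_bound d (n k) (num_queries (adv_attack A))" by (elim exE conjE)
   thus "EX B1 B2. lossy_adv (HF bg n d) LHF trivial_pre_output (\<omega> k) k A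
     <=real (n k) * ((2 * real d + 1) * pbdh_adv (bg k) B1 + real (num_reveals (adv_attack A)) * ddh2_adv (bg k) B2) &
    cost B1<=adv_cost A + (k + num_queries (adv_attack A)) ^ c + c & cost B2<=adv_cost A + (k + num_queries (adv_attack A)) ^ c + c"
    using c[of k "num_queries (adv_attack A)"] by (intro exI[of _ B1] exI[of _ B2]) linarith
  qed
 qed
 show "partially_lossy_with (HF bg n d) LHF (%\<zeta>. trivial_pre_output) \<omega> (%k. 1)"
  unfolding partially_lossy_with_def
 proof (intro allI impI)
  fix A and \<zeta> :: "nat=>real"
  assume sel: "ALL k. selective_adversary (HF bg n d) k (A k)" and pb: "poly_bounded (%k. adv_cost (A k))"
  have one: "nonnegligible (%_. 1)" by (auto simp: nonnegligible_def negligible_def intro: exI[of _ 0])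
  have "negligible (%k. lossy_adv (HF bg n d) LHF trivial_pre_output (\<omega> k) k (A k))"
  proof -
   have "ALL k. EX B1 B2. lossy_adv (HF bg n d) LHF trivial_pre_output (\<omega> k) k (A k)
      <=real (n k) * ((2 * real d + 1) * pbdh_adv (bg k) B1 + real (num_reveals (adv_attack (A k))) * ddh2_adv (bg k) B2) &
     cost B1<=adv_cost (A k) + cost_bound d (n k) (num_queries (adv_attack (A k))) &
     cost B2<=adv_cost (A k) + cost_bound d (n k) (num_queries (adv_attack (A k)))"
    using bound sel by blast
   then obtain B1 B2 where B: "!!k. lossy_adv (HF bg n d) LHF trivial_pre_output (\<omega> k) k (A k)
      <=real (n k) * ((2 * real d + 1) * pbdh_adv (bg k) (B1 k) + real (num_reveals (adv_attack (A k))) * ddh2_adv (bg k) (B2 k))"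
     "!!k. cost (B1 k)<=adv_cost (A k) + cost_bound d (n k) (num_queries (adv_attack (A k)))"
     "!!k. cost (B2 k)<=adv_cost (A k) + cost_bound d (n k) (num_queries (adv_attack (A k)))" by metis
   have Qc: "num_queries (adv_attack (A k))<=adv_cost (A k)" for k
    using num_queries_le_cost[of "adv_attack (A k)"] by (simp add: adv_cost_def)
   have pQ: "poly_bounded (%k. num_queries (adv_attack (A k)))"
    using pb Qc unfolding poly_bounded_def by (meson le_trans)
   have pc: "poly_bounded (%k. adv_cost (A k) + cost_bound d (n k) (num_queries (adv_attack (A k))))"
    by (rule poly_bounded_poly2[OF poly2_add[OF poly2_poly_bounded[OF pb] poly] pQ])
   have "poly_bounded (%k. cost (B1 k))" "poly_bounded (%k. cost (B2 k))"
    using pc B(2,3) unfolding poly_bounded_def by (meson le_trans)+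
   hence neg: "negligible (%k. pbdh_adv (bg k) (B1 k))" "negligible (%k. ddh2_adv (bg k) (B2 k))"
    using assms(2,3) unfolding pbdh_assumption_def ddh2_assumption_def by blast+
   have pu: "poly_bounded (%k. n k * (2 * d + 1 + num_queries (adv_attack (A k))))"
    by (rule poly_bounded_poly2[OF _ pQ]) (intro poly2_mult poly2_add poly2_const poly2_snd poly2_poly_bounded[OF assms(4)])
   show ?thesis
   proof (rule negligible_poly_bound[OF neg pu])
    show "0<=lossy_adv (HF bg n d) LHF trivial_pre_output (\<omega> k) k (A k)" for k by (simp add: lossy_adv_def)
    fix k
    let ?f = "pbdh_adv (bg k) (B1 k)" and ?g = "ddh2_adv (bg k) (B2 k)" and ?Q = "num_queries (adv_attack (A k))"
    have fg: "0<=?f" "0<=?g" by (simp_all add: pbdh_adv_nonneg ddh2_adv_nonneg)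
    have "(2 * real d + 1) * ?f + real (num_reveals (adv_attack (A k))) * ?g <=
      (2 * real d + 1 + real ?Q) * ?f + (2 * real d + 1 + real ?Q) * ?g"
    proof (rule add_mono)
     show "(2 * real d + 1) * ?f<=(2 * real d + 1 + real ?Q) * ?f" by (rule mult_right_mono[OF _ fg(1)]) simp
     show "real (num_reveals (adv_attack (A k))) * ?g<=(2 * real d + 1 + real ?Q) * ?g"
      using num_reveals_le_num_queries[of "adv_attack (A k)"] by (intro mult_right_mono[OF _ fg(2)]) simp
    qed
    also have "... = real (2 * d + 1 + ?Q) * (?f + ?g)" by (simp add: algebra_simps)
    finally have "real (n k) * ((2 * real d + 1) * ?f + real (num_reveals (adv_attack (A k))) * ?g)<=real (n k) * (real (2 * d + 1 + ?Q) * (?f + ?g))"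
     by (intro mult_left_mono) auto
    thus "lossy_adv (HF bg n d) LHF trivial_pre_output (\<omega> k) k (A k)<=real (n k * (2 * d + 1 + ?Q)) * (?f + ?g)"
     using B(1)[of k] by (simp only: of_nat_mult mult.assoc)
   qed
  qed
  \<comment> \<open>The non-abort bit is constantly \<open>True\<close>, so that conditioning on it
    changes nothing and both factors can be chosen as 1.\<close>
  moreover have "let REAL = measure_pmf (lossy_experiment (HF bg n d) LHF trivial_pre_output (\<omega> k) k False (A k)) in
      \<P>(x in REAL. snd x) \<ge> 1 & (\<P>(x in REAL. fst x) - 1 / 2 > \<zeta> k --> \<P>(x in REAL. fst x \<bar> snd x) - 1 / 2 > 1 * \<zeta> k)" for k
   unfolding experiment_eq[OF b sel[rule_format] assms(7)] Let_def cond_prob_def prob_fst_snd by simp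
  ultimately show "EX \<epsilon>1 \<epsilon>2. nonnegligible \<epsilon>1 & nonnegligible \<epsilon>2 & (ALL k. 1 = \<epsilon>1 k * \<epsilon>2 k) &
    negligible (%k. lossy_adv (HF bg n d) LHF trivial_pre_output (\<omega> k) k (A k)) &
    (ALL k. let REAL = measure_pmf (lossy_experiment (HF bg n d) LHF trivial_pre_output (\<omega> k) k False (A k)) in
      \<P>(x in REAL. snd x) \<ge> \<epsilon>1 k &
      (\<P>(x in REAL. fst x) - 1 / 2 > \<zeta> k --> \<P>(x in REAL. fst x \<bar> snd x) - 1 / 2 > \<epsilon>2 k * \<zeta> k))"
   using one by (intro exI[of _ "%_. 1"] conjI allI) simp_all
 qed
qed

end
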